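(* Let $u:\operatorname{Sym}(n)\to\mathbb{R}$. Identify $\operatorname{Sym}(n)$ with the vertices of the regular permutahedron $\Pi_n$. Then the following are equivalent: 1. The function $u$ is (the restriction to $\operatorname{Sym}(n)$ of) the compression of a full valuated flag matroid $(w_1,\dots,w_n)$, with $w_d:\binom{[n]}{d}\to\mathbb{R}$, which can be realized by a totally positive flag of linear spaces. 2. All polytopes in the regular subdivision of $\Pi_n$ induced by the height function $u$ are Bruhat interval polytopes. 3. The function $u$ satisfies the following three conditions: - (HXE) for every hexagonal $2$-face of $\Pi_n$ with cyclically labeled vertices $a,b,c,d,e,f$: $u(a)+u(c)+u(e)=u(b)+u(d)+u(f)$; - (SQR) for every square $2$-face of $\Pi_n$ with cyclically labeled vertices $a,b,c,d$: $u(a)+u(c)=u(b)+u(d)$; - (HXM+) for every hexagonal $2$-face of $\Pi_n$ with cyclically labeled vertices $a,b,c,d,e,f$, where $b$ is the lowest permutation among them in the Bruhat order: $u(b)+u(e)=\max\bigl(u(a)+u(d),\,u(c)+u(f)\bigr)$.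
   Context: Permutahedron: $\Pi_n=\operatorname{conv}\{(\sigma(1),\dots,\sigma(n)):\sigma\in\operatorname{Sym}(n)\}\subset\mathbb{R}^n$; the permutation $\sigma$ is identified with the vertex $(\sigma(1),\dots,\sigma(n))$. Every $2$-face of $\Pi_n$ is a hexagon or a square. Regular subdivisions are induced by lower convex hulls of the lifted vertices. Bruhat order: $\operatorname{Sym}(n)$ is generated by $\tau_i=(i,i+1)$, $1\le i\le n-1$; a reduced word of $\sigma$ is a sequence $\tau_{i_1},\dots,\tau_{i_\ell}$ of minimal length with product $\sigma$; $\sigma_1\le\sigma_2$ if some reduced word of $\sigma_2$ contains a (not necessarily consecutive) subsequence which is a reduced word of $\sigma_1$. A Bruhat interval polytope is the convex hull in $\mathbb{R}^n$ of (the points corresponding to) the elements of an interval $[\sigma_1,\sigma_2]$ with $\sigma_1\le\sigma_2$. Valuated matroids (on uniform matroids): $\mu:\binom{[n]}{d}\to\mathbb{R}$ is a valuated matroid if for each $S\in\binom{[n]}{d-2}$ and distinct $i,j,k,l\notin S$ the minimum of $\mu(Sij)+\mu(Skl)$, $\mu(Sik)+\mu(Sjl)$, $\mu(Sil)+\mu(Sjk)$ is attained at least twice (here $Sij=S\cup\{i,j\}$ etc.). For valuated matroids $\mu:\binom{[n]}{r}\to\mathbb{R}$, $\nu:\binom{[n]}{s}\to\mathbb{R}$ with $r<s$, one writes $\mu\twoheadleftarrow\nu$ (a quotient) if for all $I\in\binom{[n]}{r}$, $J\in\binom{[n]}{s}$, $i\in I\setminus J$: $\mu(I)+\nu(J)\ge\min_{j\in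 J\setminus I}\bigl(\mu(I\setminus i\cup j)+\nu(J\setminus j\cup i)\bigr)$; for $s=r+1$ this is equivalent to: for all $S\in\binom{[n]}{r-1}$ and distinct $i,j,k\notin S$ the minimum of $\mu(Si)+\nu(Sjk)$, $\mu(Sj)+\nu(Sik)$, $\mu(Sk)+\nu(Sij)$ is attained at least twice. A full valuated flag matroid (on uniform matroids) is a sequence $(w_1,\dots,w_n)$ of valuated matroids $w_d:\binom{[n]}{d}\to\mathbb{R}$ with $w_i\twoheadleftarrow w_j$ for all $i<j$. Compression: the compression of $(w_1,\dots,w_n)$ is the function on $\Pi_n\cap\mathbb{Z}^n$ given by $x\mapsto\min\{\sum_{d=1}^n w_d(Y_d) : x=\sum_{d=1}^n e_{Y_d},\ Y_d\in\binom{[n]}{d}\}$, where $e_Y=\sum_{i\in Y}e_i$. At the vertex $\sigma$ its value is $\sum_{d=1}^n w_d(F_d)$ with $F_d=\{i:\sigma(i)>n-d\}$. Realization by a totally positive flag: let $K$ be the ordered field of real generalized Puiseux (Hahn) series in $t$ with real exponents, where a nonzero series is positive if its coefficient of lowest order is positive and $\operatorname{val}$ is the lowest exponent. $(w_1,\dots,w_n)$ is realized by a totally positive flag of linear spaces if there are linear subspaces $L_1\subset\dots\subset L_n=K^n$, $\dim L_d=d$, such that, for a suitable scaling of the Plücker coordinates $p_B(L_d)$, $B\in\binom{[n]}{d}$, of each $L_d$, all $p_B(L_d)$ are positive and $\operatorname{val}(p_B(L_d))=w_d(B)$. *)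

theory Defs
  imports
    "HOL-Analysis.Analysis"
    "HOL-Combinatorics.Perm"
    "HOL-Library.Sublist"
    "Jordan_Normal_Form.Determinant"
begin

text \<open>The field of Hahn series over the reals in one variable \<open>t\<close>: formal sums of terms \<open>f e * t powr e\<close>
  whose support is well-ordered.\<close>

typedef hahn = "{f :: real \<Rightarrow> real. wfp_on {e. f e \<noteq> 0} (<)}"
  morphisms hahn_coeff Abs_hahn
  by (rule exI[of _ "\<lambda>_. 0"]) (simp add: wfp_on_def)

lemma hahn_eqI: "(\<And>e. hahn_coeff x e = hahn_coeff y e) \<Longrightarrow> x = y"
  by (simp add: hahn_coeff_inject[symmetric] fun_eq_iff)

lemma hahn_coeff_Abs: "wfp_on {e. f e \<noteq> 0} (<) \<Longrightarrow> hahn_coeff (Abs_hahn f) = f"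
  by (simp add: Abs_hahn_inverse)

lemma hahn_wf: "wfp_on {e. hahn_coeff x e \<noteq> 0} (<)"
  using hahn_coeff[of x] by simp

lemma wfp_on_less_iff:
  "wfp_on A (<) \<longleftrightarrow> (\<forall>B\<subseteq>A. B \<noteq> {} \<longrightarrow> (\<exists>z\<in>B. \<forall>y\<in>B. z \<le> y))" for A :: "real set"
  unfolding wfp_on_iff_ex_minimal by (meson linorder_not_le)

lemma wfp_on_less_least:
  fixes A :: "real set"
  assumes "wfp_on A (<)" "B \<subseteq> A" "B \<noteq> {}"
  shows "\<exists>z\<in>B. \<forall>y\<in>B. z \<le> y"
  using assms unfolding wfp_on_less_iff by simp

lemma wfp_on_less_subset: "wfp_on A (<) \<Longrightarrow> B \<subseteq> A \<Longrightarrow> wfp_on B (<)" for A :: "real set"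
  unfolding wfp_on_less_iff by (meson order_trans)

lemma wfp_on_less_Un:
  fixes A B :: "real set"
  assumes A: "wfp_on A (<)" and B: "wfp_on B (<)"
  shows "wfp_on (A \<union> B) (<)"
  unfolding wfp_on_less_iff
proof (intro allI impI)
  fix C assume C: "C \<subseteq> A \<union> B" "C \<noteq> {}"
  show "\<exists>z\<in>C. \<forall>y\<in>C. z \<le> y"
  proof (cases "C \<inter> A = {} \<or> C \<inter> B = {}")
    case True
    then have "C \<subseteq> B \<or> C \<subseteq> A" using C by blast
    then show ?thesis using wfp_on_less_least[OF A, of C] wfp_on_less_least[OF B, of C] C(2) by blast
  next
    case False
    obtain a where a: "a \<in> C \<inter> A" "\<And>y. y \<in> C \<inter> A \<Longrightarrow> a \<le> y"
      using wfp_on_less_least[OF A, of "C \<inter> A"] False by auto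
    obtain b where b: "b \<in> C \<inter> B" "\<And>y. y \<in> C \<inter> B \<Longrightarrow> b \<le> y"
      using wfp_on_less_least[OF B, of "C \<inter> B"] False by auto
    have "min a b \<in> C" using a b by (auto simp: min_def)
    moreover have "min a b \<le> y" if "y \<in> C" for y
      using a(2)[of y] b(2)[of y] that C(1) by (auto simp: min_le_iff_disj)
    ultimately show ?thesis by blast
  qed
qed

lemma wfp_on_less_finite:
  fixes A B :: "real set"
  assumes A: "wfp_on A (<)" and B: "wfp_on B (<)"
  shows "finite {a \<in> A. g - a \<in> B}"
proof -
  define T where "T = {a \<in> A. g - a \<in> B}"
  have mx: "\<exists>z\<in>C. \<forall>y\<in>C. y \<le> z" if C: "C \<subseteq> T" "C \<noteq> {}" for C
  proof -
    have "(\<lambda>a. g - a) ` C \<subseteq> B" "(\<lambda>a. g - a) ` C \<noteq> {}" using C by (auto simp: T_def)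
    then obtain z where "z \<in> C" "\<forall>y\<in>C. g - z \<le> g - y"
      using wfp_on_less_least[OF B, of "(\<lambda>a. g - a) ` C"] by auto
    then show ?thesis by auto
  qed
  have wT: "wfp_on T (<)" by (rule wfp_on_less_subset[OF A]) (auto simp: T_def)
  have step: "finite C" if C: "C \<subseteq> T" and fin: "\<And>z. z \<in> C \<Longrightarrow> finite {x \<in> C. x < z}" for C
  proof (cases "C = {}")
    case False
    then obtain z where z: "z \<in> C" "\<forall>y\<in>C. y \<le> z" using mx[OF C] by blast
    then have "C = insert z {x \<in> C. x < z}" by force
    then show ?thesis using fin[OF z(1)] by (metis finite_insert)
  qed simp
  have "finite {x \<in> T. x < a}" if "a \<in> T" for a
    using wT that
  proof (induction a rule: wfp_on_induct)
    case in_set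
    then show ?case using that by simp
  next
    case (less a)
    have *: "finite {x \<in> {x \<in> T. x < a}. x < z}" if "z \<in> {x \<in> T. x < a}" for z
      by (rule finite_subset[OF _ less.IH[of z]]) (use that in auto)
    show ?case by (rule step) (use * in auto)
  qed
  then have "finite T" by (rule step[OF order_refl]) auto
  then show ?thesis by (simp add: T_def)
qed

lemma wfp_on_less_plus:
  fixes A B :: "real set"
  assumes A: "wfp_on A (<)" and B: "wfp_on B (<)"
  shows "wfp_on {a + b | a b. a \<in> A \<and> b \<in> B} (<)"
proof -
  have main: "\<exists>z\<in>S. \<forall>y\<in>S. z \<le> y"
    if "b \<in> B" "S \<subseteq> {a + b | a b. a \<in> A \<and> b \<in> B}" "a + b \<in> S"
      "\<And>a' b'. a' \<in> A \<Longrightarrow> b' \<in> B \<Longrightarrow> a' + b' \<in> S \<Longrightarrow> a \<le> a'" for b S a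
    using B that
  proof (induction b arbitrary: S a rule: wfp_on_induct)
    case in_set
    then show ?case using that by simp
  next
    case (less b)
    show ?case
    proof (cases "\<forall>c\<in>S. a + b \<le> c")
      case True
      then show ?thesis using less by blast
    next
      case False
      define S' where "S' = {c \<in> S. c < a + b}"
      define A' where "A' = {a' \<in> A. \<exists>b'\<in>B. a' + b' \<in> S'}"
      have A'_sub: "A' \<subseteq> A" by (auto simp: A'_def)
      obtain c where c: "c \<in> S" "c < a + b" using False by (auto simp: not_le)
      obtain a1 b1 where "c = a1 + b1" "a1 \<in> A" "b1 \<in> B" using subsetD[OF less.prems(2) c(1)] by blast
      then have "a1 \<in> A'" using c by (auto simp: S'_def A'_def)
      then have "A' \<noteq> {}" by blast
      then obtain a' where a': "a' \<in> A'" "\<And>y. y \<in> A' \<Longrightarrow> a' \<le> y"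
        using wfp_on_less_least[OF A A'_sub] by auto
      then obtain b' where b': "b' \<in> B" "a' + b' \<in> S'" by (auto simp: A'_def)
      have "a \<le> a'" using less.prems(4) a' b' by (auto simp: A'_def S'_def)
      then have "b' < b" using b' by (auto simp: S'_def)
      have "\<exists>z\<in>S'. \<forall>y\<in>S'. z \<le> y"
      proof (rule less.IH[OF b'(1) \<open>b' < b\<close> b'(1) _ b'(2)])
        show "S' \<subseteq> {a + b | a b. a \<in> A \<and> b \<in> B}"
          using less.prems(2) by (auto simp: S'_def)
        show "a' \<le> x" if "x \<in> A" "y \<in> B" "x + y \<in> S'" for x y
          by (rule a'(2)) (use that in \<open>auto simp: A'_def\<close>)
      qed
      then obtain z where z: "z \<in> S'" "\<And>y. y \<in> S' \<Longrightarrow> z \<le> y" by blast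
      have "z \<le> y" if "y \<in> S" for y
        using z(1) z(2)[of y] that by (cases "y < a + b") (auto simp: S'_def)
      then show ?thesis using z(1) by (auto simp: S'_def)
    qed
  qed
  show ?thesis
    unfolding wfp_on_less_iff
  proof (intro allI impI)
    fix S assume S: "S \<subseteq> {a + b | a b. a \<in> A \<and> b \<in> B}" "S \<noteq> {}"
    define A' where "A' = {a' \<in> A. \<exists>b'\<in>B. a' + b' \<in> S}"
    have A'_sub: "A' \<subseteq> A" by (auto simp: A'_def)
    obtain c where c: "c \<in> S" using S(2) by blast
    obtain a1 b1 where "c = a1 + b1" "a1 \<in> A" "b1 \<in> B" using subsetD[OF S(1) c] by blast
    then have "a1 \<in> A'" using c by (auto simp: A'_def)
    then have "A' \<noteq> {}" by blast
    then obtain a' where a': "a' \<in> A'" "\<And>y. y \<in> A' \<Longrightarrow> a' \<le> y"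
      using wfp_on_less_least[OF A A'_sub] by auto
    then obtain b' where b': "b' \<in> B" "a' + b' \<in> S" by (auto simp: A'_def)
    show "\<exists>z\<in>S. \<forall>y\<in>S. z \<le> y"
    proof (rule main[OF b'(1) S(1) b'(2)])
      show "a' \<le> x" if "x \<in> A" "y \<in> B" "x + y \<in> S" for x y
        by (rule a'(2)) (use that in \<open>auto simp: A'_def\<close>)
    qed
  qed
qed

definition hahn_monom :: "real \<Rightarrow> real \<Rightarrow> hahn" where
  "hahn_monom c v = Abs_hahn (\<lambda>e. if e = v then c else 0)"

instantiation hahn :: "{zero, one, plus, minus, uminus, times}"
begin

definition zero_hahn :: hahn where
  "0 = Abs_hahn (\<lambda>_. 0)"

definition one_hahn :: hahn where
  "1 = hahn_monom 1 0"

definition plus_hahn :: "hahn \<Rightarrow> hahn \<Rightarrow> hahn" where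
  "x + y = Abs_hahn (\<lambda>e. hahn_coeff x e + hahn_coeff y e)"

definition minus_hahn :: "hahn \<Rightarrow> hahn \<Rightarrow> hahn" where
  "x - y = Abs_hahn (\<lambda>e. hahn_coeff x e - hahn_coeff y e)"

definition uminus_hahn :: "hahn \<Rightarrow> hahn" where
  "- x = Abs_hahn (\<lambda>e. - hahn_coeff x e)"

definition times_hahn :: "hahn \<Rightarrow> hahn \<Rightarrow> hahn" where
  "x * y = Abs_hahn (\<lambda>e.
     \<Sum>a | hahn_coeff x a \<noteq> 0 \<and> hahn_coeff y (e - a) \<noteq> 0. hahn_coeff x a * hahn_coeff y (e - a))"

instance ..

end

lemma hahn_coeff_monom: "hahn_coeff (hahn_monom c v) e = (if e = v then c else 0)"
proof -
  have "wfp_on {e. (if e = v then c else 0) \<noteq> 0} (<)"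
    by (auto simp: wfp_on_less_iff)
  then show ?thesis by (simp add: hahn_monom_def hahn_coeff_Abs)
qed

lemma hahn_coeff_0 [simp]: "hahn_coeff 0 e = 0"
  by (simp add: zero_hahn_def hahn_coeff_Abs wfp_on_def)

lemma hahn_coeff_1: "hahn_coeff 1 e = (if e = 0 then 1 else 0)"
  by (simp add: one_hahn_def hahn_coeff_monom)

lemma hahn_coeff_add [simp]: "hahn_coeff (x + y) e = hahn_coeff x e + hahn_coeff y e"
  unfolding plus_hahn_def
  by (subst hahn_coeff_Abs)
    (auto intro: wfp_on_less_subset[OF wfp_on_less_Un[OF hahn_wf[of x] hahn_wf[of y]]])

lemma hahn_coeff_diff [simp]: "hahn_coeff (x - y) e = hahn_coeff x e - hahn_coeff y e"
  unfolding minus_hahn_def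
  by (subst hahn_coeff_Abs)
    (auto intro: wfp_on_less_subset[OF wfp_on_less_Un[OF hahn_wf[of x] hahn_wf[of y]]])

lemma hahn_coeff_uminus [simp]: "hahn_coeff (- x) e = - hahn_coeff x e"
  unfolding uminus_hahn_def by (subst hahn_coeff_Abs) (auto simp: hahn_wf)

lemma hahn_coeff_mult:
  "hahn_coeff (x * y) e =
     (\<Sum>a | hahn_coeff x a \<noteq> 0 \<and> hahn_coeff y (e - a) \<noteq> 0. hahn_coeff x a * hahn_coeff y (e - a))"
proof -
  have "wfp_on {e. (\<Sum>a | hahn_coeff x a \<noteq> 0 \<and> hahn_coeff y (e - a) \<noteq> 0.
          hahn_coeff x a * hahn_coeff y (e - a)) \<noteq> 0} (<)"
  proof (rule wfp_on_less_subset[OF wfp_on_less_plus[OF hahn_wf[of x] hahn_wf[of y]]], rule subsetI)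
    fix e
    assume "e \<in> {e. (\<Sum>a | hahn_coeff x a \<noteq> 0 \<and> hahn_coeff y (e - a) \<noteq> 0.
          hahn_coeff x a * hahn_coeff y (e - a)) \<noteq> 0}"
    then have "(\<Sum>a | hahn_coeff x a \<noteq> 0 \<and> hahn_coeff y (e - a) \<noteq> 0.
          hahn_coeff x a * hahn_coeff y (e - a)) \<noteq> 0" by simp
    then obtain a where "a \<in> {a. hahn_coeff x a \<noteq> 0 \<and> hahn_coeff y (e - a) \<noteq> 0}"
      by (rule sum.not_neutral_contains_not_neutral)
    then have "e = a + (e - a) \<and> a \<in> {e. hahn_coeff x e \<noteq> 0} \<and> e - a \<in> {e. hahn_coeff y e \<noteq> 0}"
      by simp
    then show "e \<in> {a + b | a b. a \<in> {e. hahn_coeff x e \<noteq> 0} \<and> b \<in> {e. hahn_coeff y e \<noteq> 0}}"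
      by blast
  qed
  then show ?thesis by (simp add: times_hahn_def hahn_coeff_Abs)
qed

lemma hahn_mult_finite: "finite {a. hahn_coeff x a \<noteq> 0 \<and> hahn_coeff y (e - a) \<noteq> 0}"
  using wfp_on_less_finite[OF hahn_wf[of x] hahn_wf[of y], of e] by simp

lemma hahn_coeff_mult_superset:
  assumes "finite F" "\<And>a. hahn_coeff x a \<noteq> 0 \<Longrightarrow> hahn_coeff y (e - a) \<noteq> 0 \<Longrightarrow> a \<in> F"
  shows "hahn_coeff (x * y) e = (\<Sum>a\<in>F. hahn_coeff x a * hahn_coeff y (e - a))"
  unfolding hahn_coeff_mult using assms by (intro sum.mono_neutral_left) auto

lemma hahn_coeff_mult_nonzeroE:
  assumes "hahn_coeff (x * y) e \<noteq> 0"
  obtains a b where "hahn_coeff x a \<noteq> 0" "hahn_coeff y b \<noteq> 0" "e = a + b"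
proof -
  obtain a where "a \<in> {a. hahn_coeff x a \<noteq> 0 \<and> hahn_coeff y (e - a) \<noteq> 0}"
    using assms unfolding hahn_coeff_mult by (rule sum.not_neutral_contains_not_neutral)
  then show ?thesis by (intro that[of a "e - a"]) auto
qed

lemma hahn_mult_comm: "x * y = y * x" for x y :: hahn
proof (rule hahn_eqI)
  fix e
  show "hahn_coeff (x * y) e = hahn_coeff (y * x) e"
    unfolding hahn_coeff_mult
    by (rule sum.reindex_bij_witness[of _ "\<lambda>a. e - a" "\<lambda>a. e - a"]) auto
qed

lemma hahn_mult_assoc: "(x * y) * z = x * (y * z)" for x y z :: hahn
proof (rule hahn_eqI)
  fix g
  let ?x = "hahn_coeff x" and ?y = "hahn_coeff y" and ?z = "hahn_coeff z"
  define S where "S = {a + b | a b. a \<in> {e. ?x e \<noteq> 0} \<and> b \<in> {e. ?y e \<noteq> 0}}"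
  define C where "C = {c \<in> S. g - c \<in> {e. ?z e \<noteq> 0}}"
  have finC: "finite C"
    unfolding C_def S_def by (intro wfp_on_less_finite wfp_on_less_plus hahn_wf)
  define A where "A = (\<Union>c\<in>C. {a. ?x a \<noteq> 0 \<and> ?y (c - a) \<noteq> 0})"
  have finA: "finite A" unfolding A_def using finC hahn_mult_finite by auto
  have C: "a + b \<in> C" if "?x a \<noteq> 0" "?y b \<noteq> 0" "?z (g - a - b) \<noteq> 0" for a b
    using that by (auto simp: C_def S_def diff_diff_eq)
  have A: "a \<in> A" if "?x a \<noteq> 0" "?y b \<noteq> 0" "?z (g - a - b) \<noteq> 0" for a b
    using C[OF that] that by (force simp: A_def)
  have "hahn_coeff (x * y * z) g = (\<Sum>c\<in>C. hahn_coeff (x * y) c * ?z (g - c))"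
    by (rule hahn_coeff_mult_superset[OF finC])
      (auto elim!: hahn_coeff_mult_nonzeroE intro!: C simp: diff_diff_eq)
  also have "\<dots> = (\<Sum>c\<in>C. \<Sum>a\<in>A. ?x a * ?y (c - a) * ?z (g - c))"
  proof (rule sum.cong[OF refl])
    fix c assume c: "c \<in> C"
    have "hahn_coeff (x * y) c = (\<Sum>a\<in>A. ?x a * ?y (c - a))"
      by (rule hahn_coeff_mult_superset[OF finA]) (use c in \<open>auto simp: A_def\<close>)
    then show "hahn_coeff (x * y) c * ?z (g - c) = (\<Sum>a\<in>A. ?x a * ?y (c - a) * ?z (g - c))"
      by (simp add: sum_distrib_right)
  qed
  also have "\<dots> = (\<Sum>a\<in>A. \<Sum>c\<in>C. ?x a * ?y (c - a) * ?z (g - c))"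
    by (rule sum.swap)
  also have "\<dots> = (\<Sum>a\<in>A. ?x a * hahn_coeff (y * z) (g - a))"
  proof (rule sum.cong[OF refl])
    fix a assume "a \<in> A"
    then have xa: "?x a \<noteq> 0" by (auto simp: A_def)
    have "hahn_coeff (y * z) (g - a) = (\<Sum>b\<in>(\<lambda>c. c - a) ` C. ?y b * ?z (g - a - b))"
    proof (rule hahn_coeff_mult_superset)
      fix b assume "?y b \<noteq> 0" "?z (g - a - b) \<noteq> 0"
      then have "a + b \<in> C" using C xa by blast
      then show "b \<in> (\<lambda>c. c - a) ` C" by force
    qed (use finC in auto)
    also have "\<dots> = (\<Sum>c\<in>C. ?y (c - a) * ?z (g - c))"
      by (subst sum.reindex) (auto simp: inj_on_def)
    finally show "(\<Sum>c\<in>C. ?x a * ?y (c - a) * ?z (g - c)) = ?x a * hahn_coeff (y * z) (g - a)"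
      by (simp add: sum_distrib_left mult.assoc)
  qed
  also have "\<dots> = hahn_coeff (x * (y * z)) g"
  proof (rule hahn_coeff_mult_superset[OF finA, symmetric])
    fix a assume a: "?x a \<noteq> 0" "hahn_coeff (y * z) (g - a) \<noteq> 0"
    then obtain b c where "?y b \<noteq> 0" "?z c \<noteq> 0" "g - a = b + c"
      by (auto elim: hahn_coeff_mult_nonzeroE)
    then show "a \<in> A" using A[of a b] a by (simp add: algebra_simps)
  qed
  finally show "hahn_coeff (x * y * z) g = hahn_coeff (x * (y * z)) g" .
qed

lemma hahn_distrib: "(x + y) * z = x * z + y * z" for x y z :: hahn
proof (rule hahn_eqI)
  fix e
  define F where "F = {a. hahn_coeff x a \<noteq> 0 \<and> hahn_coeff z (e - a) \<noteq> 0}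
     \<union> {a. hahn_coeff y a \<noteq> 0 \<and> hahn_coeff z (e - a) \<noteq> 0}"
  have F: "finite F" unfolding F_def by (simp add: hahn_mult_finite)
  show "hahn_coeff ((x + y) * z) e = hahn_coeff (x * z + y * z) e"
    by (simp add: hahn_coeff_mult_superset[OF F] F_def sum.distrib[symmetric] distrib_right
        hahn_coeff_mult_superset[OF F, of "x + y"])
       (subst hahn_coeff_mult_superset[OF F]; auto simp: F_def distrib_right)
qed

lemma hahn_coeff_monom_mult:
  "hahn_coeff (hahn_monom c v * x) e = c * hahn_coeff x (e - v)"
  by (subst hahn_coeff_mult_superset[of "{v}"]) (auto simp: hahn_coeff_monom split: if_splits)

instance hahn :: comm_ring_1
proof
  fix a b c :: hahn
  show "a * b * c = a * (b * c)" by (rule hahn_mult_assoc)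
  show "a * b = b * a" by (rule hahn_mult_comm)
  show "1 * a = a" by (rule hahn_eqI) (simp add: one_hahn_def hahn_coeff_monom_mult)
  show "(a + b) * c = a * c + b * c" by (rule hahn_distrib)
  show "(0::hahn) \<noteq> 1" by (metis hahn_coeff_0 hahn_coeff_1 zero_neq_one)
qed (auto intro: hahn_eqI)

definition hahn_val :: "hahn \<Rightarrow> real" where
  "hahn_val x = (LEAST e. hahn_coeff x e \<noteq> 0)"

lemma hahn_val:
  assumes "x \<noteq> 0"
  shows "hahn_coeff x (hahn_val x) \<noteq> 0" "\<And>e. hahn_coeff x e \<noteq> 0 \<Longrightarrow> hahn_val x \<le> e"
proof -
  have "{e. hahn_coeff x e \<noteq> 0} \<noteq> {}" using assms hahn_eqI[of x 0] by auto
  then obtain m where m: "hahn_coeff x m \<noteq> 0" "\<And>e. hahn_coeff x e \<noteq> 0 \<Longrightarrow> m \<le> e"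
    using wfp_on_less_least[OF hahn_wf[of x] order_refl] by auto
  then have "hahn_val x = m" unfolding hahn_val_def by (intro Least_equality) auto
  then show "hahn_coeff x (hahn_val x) \<noteq> 0" "\<And>e. hahn_coeff x e \<noteq> 0 \<Longrightarrow> hahn_val x \<le> e"
    using m by auto
qed

lemma hahn_val_eqI:
  assumes "hahn_coeff x m \<noteq> 0" "\<And>e. e < m \<Longrightarrow> hahn_coeff x e = 0"
  shows "hahn_val x = m"
  unfolding hahn_val_def using assms by (intro Least_equality) (auto simp: not_less[symmetric])

lemma hahn_coeff_power_eq_0:
  assumes "\<And>e. e < m \<Longrightarrow> hahn_coeff x e = 0" "e < real k * m"
  shows "hahn_coeff (x ^ k) e = 0"
  using assms(2)
proof (induction k arbitrary: e)
  case 0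
  then show ?case by (simp add: hahn_coeff_1)
next
  case (Suc k)
  show ?case
  proof (rule ccontr)
    assume "hahn_coeff (x ^ Suc k) e \<noteq> 0"
    then obtain a b where ab: "hahn_coeff x a \<noteq> 0" "hahn_coeff (x ^ k) b \<noteq> 0" "e = a + b"
      by (auto elim: hahn_coeff_mult_nonzeroE)
    then have "m \<le> a" "real k * m \<le> b" using assms(1) Suc.IH by (meson not_le)+
    then show False using Suc.prems ab(3) by (simp add: algebra_simps)
  qed
qed

text \<open>As the exponent group is Archimedean, the coefficients of \<open>\<Sum>k. x ^ k\<close> are finite sums
  once all exponents of \<open>x\<close> are positive.\<close>

lemma hahn_geometric:
  assumes m: "0 < m" and x: "\<And>e. e < m \<Longrightarrow> hahn_coeff x e = 0"
  shows "\<exists>z. (1 - x) * z = 1"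
proof -
  define N where "N = (\<lambda>e. nat \<lceil>e / m\<rceil>)"
  define s where "s = (\<lambda>n. \<Sum>k\<le>n. x ^ k)"
  have N: "e < real (Suc n) * m" if "N e \<le> n" for e n
  proof -
    have "e / m \<le> real (N e)" unfolding N_def by (simp add: real_nat_ceiling_ge)
    also have "\<dots> < real (Suc n)" using that by simp
    finally show ?thesis using m by (simp add: pos_divide_less_eq)
  qed
  have s_Suc: "hahn_coeff (s (Suc n)) e = hahn_coeff (s n) e" if "N e \<le> n" for e n
    using hahn_coeff_power_eq_0[OF x N[OF that]] unfolding s_def by simp
  have s_eq: "hahn_coeff (s n) e = hahn_coeff (s (N e)) e" if "N e \<le> n" for e n
    using that by (induction n rule: dec_induct) (auto simp: s_Suc)
  have N_mono: "N e \<le> N e'" if "e \<le> e'" for e e'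
    unfolding N_def using that m by (intro nat_mono ceiling_mono divide_right_mono) auto
  define f where "f = (\<lambda>e. hahn_coeff (s (N e)) e)"
  have f: "f e = hahn_coeff (s (N g)) e" if "e \<le> g" for e g
    unfolding f_def using s_eq[OF N_mono[OF that]] by simp
  have "wfp_on {e. f e \<noteq> 0} (<)"
    unfolding wfp_on_less_iff
  proof (intro allI impI)
    fix B assume B: "B \<subseteq> {e. f e \<noteq> 0}" "B \<noteq> {}"
    then obtain g where g: "g \<in> B" by blast
    have "{e \<in> B. e \<le> g} \<subseteq> {e. hahn_coeff (s (N g)) e \<noteq> 0}" using B f by auto
    then obtain z where "z \<in> {e \<in> B. e \<le> g}" "\<And>y. y \<in> {e \<in> B. e \<le> g} \<Longrightarrow> z \<le> y"
      using wfp_on_less_least[OF hahn_wf[of "s (N g)"], of "{e \<in> B. e \<le> g}"] g by fast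
    then show "\<exists>z\<in>B. \<forall>y\<in>B. z \<le> y"
      by (metis (mono_tags, lifting) linorder_le_cases mem_Collect_eq order_trans)
  qed
  then have coeff: "hahn_coeff (Abs_hahn f) = f" by (rule hahn_coeff_Abs)
  have "(1 - x) * Abs_hahn f = 1"
  proof (rule hahn_eqI)
    fix g
    have tel: "(1 - x) * s n = 1 - x ^ Suc n" for n
      unfolding s_def by (rule sum_gp_basic)
    have z: "hahn_coeff (1 - x) a = 0" if "a < 0" for a
      using x[of a] that m by (simp add: hahn_coeff_1)
    have "hahn_coeff ((1 - x) * (Abs_hahn f - s (N g))) g = 0"
    proof (rule ccontr)
      assume "\<not> ?thesis"
      then obtain a b where ab: "hahn_coeff (1 - x) a \<noteq> 0"
        "hahn_coeff (Abs_hahn f - s (N g)) b \<noteq> 0" "g = a + b"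
        by (auto elim: hahn_coeff_mult_nonzeroE)
      have "0 \<le> a" using ab(1) z by (meson not_le)
      then show False using ab f[of b g] by (simp add: coeff)
    qed
    then have "hahn_coeff ((1 - x) * Abs_hahn f) g = hahn_coeff ((1 - x) * s (N g)) g"
      by (simp add: right_diff_distrib)
    also have "\<dots> = hahn_coeff 1 g"
      using hahn_coeff_power_eq_0[OF x N[OF order_refl, of g]] by (simp add: tel del: power_Suc)
    finally show "hahn_coeff ((1 - x) * Abs_hahn f) g = hahn_coeff 1 g" .
  qed
  then show ?thesis by blast
qed

lemma hahn_ex_inverse:
  assumes "x \<noteq> 0"
  shows "\<exists>z. x * z = (1::hahn)"
proof -
  define v where "v = hahn_val x"
  define c where "c = hahn_coeff x v"
  define y where "y = 1 - hahn_monom (1 / c) (- v) * x"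
  have c: "c \<noteq> 0" using hahn_val[OF assms] by (simp add: c_def v_def)
  have coeff_y: "hahn_coeff y e = (if e = 0 then 1 else 0) - (1 / c) * hahn_coeff x (e + v)" for e
    by (simp add: y_def hahn_coeff_1 hahn_coeff_monom_mult)
  have pos: "0 < e" if "hahn_coeff y e \<noteq> 0" for e
  proof (rule ccontr)
    assume "\<not> 0 < e"
    then consider "e = 0" | "e < 0" by linarith
    then show False
    proof cases
      case 1
      then show False using that c by (simp add: coeff_y c_def)
    next
      case 2
      then have "hahn_coeff x (e + v) = 0"
        using hahn_val(2)[OF assms, of "e + v"] by (auto simp: v_def)
      then show False using that 2 by (simp add: coeff_y)
    qed
  qed
  obtain m where "0 < m" "\<And>e. e < m \<Longrightarrow> hahn_coeff y e = 0"
  proof (cases "y = 0")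
    case True
    then show ?thesis using that[of 1] by simp
  next
    case False
    then show ?thesis using that[of "hahn_val y"] pos hahn_val[OF False] by (meson not_le)
  qed
  then obtain z where "(1 - y) * z = 1" using hahn_geometric by blast
  then have "x * (hahn_monom (1 / c) (- v) * z) = 1" by (simp add: y_def mult_ac)
  then show ?thesis by blast
qed

instantiation hahn :: field
begin

definition inverse_hahn :: "hahn \<Rightarrow> hahn" where
  "inverse x = (if x = 0 then 0 else SOME z. x * z = 1)" for x :: hahn

definition divide_hahn :: "hahn \<Rightarrow> hahn \<Rightarrow> hahn" where
  "x div y = x * inverse y" for x y :: hahn

instance
proof
  fix a b :: hahn
  show "inverse a * a = 1" if "a \<noteq> 0"
    using someI_ex[OF hahn_ex_inverse[OF that]] that by (simp add: inverse_hahn_def mult.commute)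
  show "a div b = a * inverse b" by (simp add: divide_hahn_def)
  show "inverse (0::hahn) = 0" by (simp add: inverse_hahn_def)
qed

end

definition hahn_pos :: "hahn \<Rightarrow> bool" where
  "hahn_pos x \<longleftrightarrow> x \<noteq> 0 \<and> 0 < hahn_coeff x (hahn_val x)"

lemma hahn_pos_iff:
  "hahn_pos x \<longleftrightarrow> (\<exists>m. 0 < hahn_coeff x m \<and> (\<forall>e<m. hahn_coeff x e = 0))"
proof
  assume "hahn_pos x"
  then show "\<exists>m. 0 < hahn_coeff x m \<and> (\<forall>e<m. hahn_coeff x e = 0)"
    using hahn_val(2)[of x] by (intro exI[of _ "hahn_val x"]) (auto simp: hahn_pos_def not_le[symmetric])
next
  assume "\<exists>m. 0 < hahn_coeff x m \<and> (\<forall>e<m. hahn_coeff x e = 0)"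
  then obtain m where m: "0 < hahn_coeff x m" "\<forall>e<m. hahn_coeff x e = 0" by blast
  then have "hahn_val x = m" by (intro hahn_val_eqI) auto
  then show "hahn_pos x" using m by (auto simp: hahn_pos_def)
qed

lemma hahn_pos_add:
  assumes "hahn_pos x" "hahn_pos y"
  shows "hahn_pos (x + y)"
proof -
  obtain m n where m: "0 < hahn_coeff x m" "\<forall>e<m. hahn_coeff x e = 0"
    and n: "0 < hahn_coeff y n" "\<forall>e<n. hahn_coeff y e = 0"
    using assms unfolding hahn_pos_iff by blast
  have "0 \<le> hahn_coeff x e" if "e \<le> m" for e using m that by (cases "e = m") auto
  moreover have "0 \<le> hahn_coeff y e" if "e \<le> n" for e using n that by (cases "e = n") auto
  ultimately show ?thesis
    unfolding hahn_pos_iff using m n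
    by (intro exI[of _ "min m n"]) (auto simp: min_def intro: add_pos_nonneg add_nonneg_pos)
qed

lemma hahn_pos_mult:
  assumes "hahn_pos x" "hahn_pos y"
  shows "hahn_pos (x * y)"
proof -
  obtain m n where m: "0 < hahn_coeff x m" "\<forall>e<m. hahn_coeff x e = 0"
    and n: "0 < hahn_coeff y n" "\<forall>e<n. hahn_coeff y e = 0"
    using assms unfolding hahn_pos_iff by blast
  have le: "m \<le> a" if "hahn_coeff x a \<noteq> 0" for a using m that by (meson not_le)
  have le': "n \<le> b" if "hahn_coeff y b \<noteq> 0" for b using n that by (meson not_le)
  have "hahn_coeff (x * y) (m + n) = hahn_coeff x m * hahn_coeff y n"
    by (subst hahn_coeff_mult_superset[of "{m}"]) (auto dest!: le le')
  moreover have "hahn_coeff (x * y) e = 0" if "e < m + n" for e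
  proof (rule ccontr)
    assume "hahn_coeff (x * y) e \<noteq> 0"
    then show False using that by (auto elim!: hahn_coeff_mult_nonzeroE dest!: le le')
  qed
  ultimately show ?thesis
    unfolding hahn_pos_iff using m(1) n(1) by (intro exI[of _ "m + n"]) auto
qed

lemma hahn_pos_uminus: "x \<noteq> 0 \<Longrightarrow> hahn_pos x \<or> hahn_pos (- x)"
proof -
  assume x: "x \<noteq> 0"
  have "hahn_coeff x e = 0" if "e < hahn_val x" for e
    using hahn_val(2)[OF x, of e] that by linarith
  then show ?thesis unfolding hahn_pos_iff
    using hahn_val(1)[OF x] by (metis hahn_coeff_uminus linorder_neqE_linordered_idom neg_0_less_iff_less neg_equal_0_iff_equal)
qed

lemma not_hahn_pos_0: "\<not> hahn_pos 0"
  by (simp add: hahn_pos_def)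

instantiation hahn :: linordered_field
begin

definition less_hahn :: "hahn \<Rightarrow> hahn \<Rightarrow> bool" where
  "x < y \<longleftrightarrow> hahn_pos (y - x)"

definition less_eq_hahn :: "hahn \<Rightarrow> hahn \<Rightarrow> bool" where
  "x \<le> y \<longleftrightarrow> x < y \<or> x = y" for x y :: hahn

definition abs_hahn :: "hahn \<Rightarrow> hahn" where
  "\<bar>x\<bar> = (if x < 0 then - x else x)" for x :: hahn

definition sgn_hahn :: "hahn \<Rightarrow> hahn" where
  "sgn x = (if x = 0 then 0 else if 0 < x then 1 else - 1)" for x :: hahn

instance
proof
  fix x y z :: hahn
  have asym: "\<not> (x < y \<and> y < x)" for x y :: hahn
    using hahn_pos_add[of "x - y" "y - x"] by (auto simp: less_hahn_def not_hahn_pos_0)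
  have trans: "x < y \<Longrightarrow> y < z \<Longrightarrow> x < z" for x y z :: hahn
    using hahn_pos_add[of "z - y" "y - x"] by (simp add: less_hahn_def)
  show "(x < y) = (x \<le> y \<and> \<not> y \<le> x)" using asym less_eq_hahn_def by metis
  show "x \<le> x" by (simp add: less_eq_hahn_def)
  show "x \<le> y \<Longrightarrow> y \<le> z \<Longrightarrow> x \<le> z" using trans less_eq_hahn_def by metis
  show "x \<le> y \<Longrightarrow> y \<le> x \<Longrightarrow> x = y" using asym less_eq_hahn_def by metis
  show "x \<le> y \<or> y \<le> x"
    using hahn_pos_uminus[of "y - x"] by (auto simp: less_eq_hahn_def less_hahn_def)
  show "x \<le> y \<Longrightarrow> z + x \<le> z + y" by (auto simp: less_eq_hahn_def less_hahn_def)
  show "x < y \<Longrightarrow> 0 < z \<Longrightarrow> z * x < z * y"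
    using hahn_pos_mult[of z "y - x"] by (simp add: less_hahn_def right_diff_distrib)
  show "\<bar>x\<bar> = (if x < 0 then - x else x)" by (rule abs_hahn_def)
  show "sgn x = (if x = 0 then 0 else if 0 < x then 1 else - 1)" by (rule sgn_hahn_def)
qed

end

text \<open>The ground set \<open>[n]\<close> is an arbitrary finite linearly ordered type \<open>'n\<close>, with \<open>n = CARD('n)\<close>;
  \<open>idx\<close> is its unique order isomorphism onto \<open>{1..n}\<close>. Since \<open>'n\<close> is finite, \<open>'n perm\<close> is the full
  symmetric group.\<close>

definition idx :: "'n::{finite,linorder} \<Rightarrow> nat" where
  "idx i = card {..i}"

definition perm_point :: "'n::{finite,linorder} perm \<Rightarrow> real ^ 'n::{finite,linorder}" where
  "perm_point \<sigma> = (\<chi> i. real (idx (Perm.apply \<sigma> i)))"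

definition permutahedron :: "(real ^ 'n::{finite,linorder}) set" where
  "permutahedron = convex hull (range perm_point)"

text \<open>\<open>vs\<close> lists the vertices of a 2-face in cyclic order. The 2-faces of the permutahedron with four
  vertices are exactly the square ones.\<close>

definition face_cycle :: "'n::{finite,linorder} perm list \<Rightarrow> bool" where
  "face_cycle vs \<longleftrightarrow> distinct vs \<and>
     (\<exists>F. F face_of permutahedron \<and> aff_dim F = 2 \<and>
        {x. x extreme_point_of F} = perm_point ` set vs \<and>
        (\<forall>k<length vs. closed_segment (perm_point (vs ! k))
           (perm_point (vs ! (Suc k mod length vs))) edge_of F))"

definition hexagon :: "'n::{finite,linorder} perm \<Rightarrow> 'n perm \<Rightarrow> 'n perm \<Rightarrow> 'n perm \<Rightarrow> 'n perm \<Rightarrow> 'n perm \<Rightarrow> bool"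
  where "hexagon a b c d e f \<longleftrightarrow> face_cycle [a, b, c, d, e, f]"

definition square :: "'n::{finite,linorder} perm \<Rightarrow> 'n perm \<Rightarrow> 'n perm \<Rightarrow> 'n perm \<Rightarrow> bool"
  where "square a b c d \<longleftrightarrow> face_cycle [a, b, c, d]"

definition simple_transpositions :: "'n::{finite,linorder} perm set" where
  "simple_transpositions = {Perm.swap i j | i j. idx j = Suc (idx i)}"

definition reduced_word :: "'n::{finite,linorder} perm list \<Rightarrow> 'n perm \<Rightarrow> bool" where
  "reduced_word ws \<sigma> \<longleftrightarrow>
     is_arg_min length (\<lambda>vs. set vs \<subseteq> simple_transpositions \<and> prod_list vs = \<sigma>) ws"

text \<open>The product of permutations is composition; composing in the opposite order would give the same
  relation up to inverting both permutations, and the Bruhat order is invariant under inversion.\<close>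

definition bruhat_le :: "'n::{finite,linorder} perm \<Rightarrow> 'n perm \<Rightarrow> bool" where
  "bruhat_le \<sigma>\<^sub>1 \<sigma>\<^sub>2 \<longleftrightarrow> (\<exists>ws vs. reduced_word ws \<sigma>\<^sub>2 \<and> subseq vs ws \<and> reduced_word vs \<sigma>\<^sub>1)"

definition bruhat_interval_polytope :: "(real ^ 'n::{finite,linorder}) set \<Rightarrow> bool" where
  "bruhat_interval_polytope P \<longleftrightarrow>
     (\<exists>\<sigma>\<^sub>1 \<sigma>\<^sub>2. bruhat_le \<sigma>\<^sub>1 \<sigma>\<^sub>2 \<and>
        P = convex hull (perm_point ` {\<sigma>. bruhat_le \<sigma>\<^sub>1 \<sigma> \<and> bruhat_le \<sigma> \<sigma>\<^sub>2}))"

definition lifted_permutahedron :: "('n::{finite,linorder} perm \<Rightarrow> real) \<Rightarrow> ((real ^ 'n::{finite,linorder}) \<times> real) set" where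
  "lifted_permutahedron u = convex hull (range (\<lambda>\<sigma>. (perm_point \<sigma>, u \<sigma>)))"

text \<open>A lower face is the nonempty set of minimizers of a linear functional whose coefficient on the
  height coordinate is positive, here normalized to 1.\<close>

definition lower_face :: "('a::real_inner \<times> real) set \<Rightarrow> ('a \<times> real) set \<Rightarrow> bool" where
  "lower_face P F \<longleftrightarrow> F \<noteq> {} \<and>
     (\<exists>c b. (\<forall>(x, h)\<in>P. b \<le> c \<bullet> x + h) \<and> F = {(x, h) \<in> P. c \<bullet> x + h = b})"

definition regular_subdivision :: "('n::{finite,linorder} perm \<Rightarrow> real) \<Rightarrow> (real ^ 'n::{finite,linorder}) set set" where
  "regular_subdivision u = {fst ` F | F. lower_face (lifted_permutahedron u) F}"

definition min_attained_twice :: "real \<Rightarrow> real \<Rightarrow> real \<Rightarrow> bool" where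
  "min_attained_twice x y z \<longleftrightarrow> (x = y \<and> x \<le> z) \<or> (x = z \<and> x \<le> y) \<or> (y = z \<and> y \<le> x)"

text \<open>A function on the \<open>d\<close>-subsets of \<open>'n\<close> is represented by a function on all subsets, of which only
  the values on sets of cardinality \<open>d\<close> are used.\<close>

definition valuated_matroid :: "nat \<Rightarrow> ('n::finite set \<Rightarrow> real) \<Rightarrow> bool" where
  "valuated_matroid d \<mu> \<longleftrightarrow>
     (\<forall>S i j k l. card S + 2 = d \<and> distinct [i, j, k, l] \<and> {i, j, k, l} \<inter> S = {} \<longrightarrow>
        min_attained_twice (\<mu> (S \<union> {i, j}) + \<mu> (S \<union> {k, l}))
                           (\<mu> (S \<union> {i, k}) + \<mu> (S \<union> {j, l}))
                           (\<mu> (S \<union> {i, l}) + \<mu> (S \<union> {j, k})))"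

definition valuated_quotient ::
    "nat \<Rightarrow> nat \<Rightarrow> ('n::finite set \<Rightarrow> real) \<Rightarrow> ('n set \<Rightarrow> real) \<Rightarrow> bool" where
  "valuated_quotient r s \<mu> \<nu> \<longleftrightarrow>
     (\<forall>I J i. card I = r \<and> card J = s \<and> i \<in> I - J \<longrightarrow>
        \<mu> I + \<nu> J \<ge> (MIN j\<in>J - I. \<mu> (I - {i} \<union> {j}) + \<nu> (J - {j} \<union> {i})))"

definition full_valuated_flag_matroid :: "(nat \<Rightarrow> 'n::finite set \<Rightarrow> real) \<Rightarrow> bool" where
  "full_valuated_flag_matroid w \<longleftrightarrow>
     (\<forall>d\<in>{1..CARD('n)}. valuated_matroid d (w d)) \<and>
     (\<forall>i j. 1 \<le> i \<and> i < j \<and> j \<le> CARD('n) \<longrightarrow> valuated_quotient i j (w i) (w j))"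

definition indicator_vec :: "'n::finite set \<Rightarrow> real ^ 'n" where
  "indicator_vec Y = (\<Sum>i\<in>Y. axis i 1)"

definition compression :: "(nat \<Rightarrow> 'n::finite set \<Rightarrow> real) \<Rightarrow> real ^ 'n \<Rightarrow> real" where
  "compression w x =
     Min {\<Sum>d=1..CARD('n). w d (Y d) | Y.
            (\<forall>d\<in>{1..CARD('n)}. card (Y d) = d) \<and> x = (\<Sum>d=1..CARD('n). indicator_vec (Y d))}"

text \<open>\<open>p\<close> is a vector of Pluecker coordinates of the \<open>d\<close>-dimensional subspace \<open>L\<close>, up to a common
  nonzero factor: the maximal minors of the matrix whose rows are the basis \<open>v 0, \<dots>, v (d - 1)\<close>, with
  the columns indexed by \<open>B\<close> taken in increasing order.\<close>

definition pluecker_coordinates ::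
    "nat \<Rightarrow> ('k::field ^ 'n::{finite,linorder}) set \<Rightarrow> ('n set \<Rightarrow> 'k) \<Rightarrow> bool" where
  "pluecker_coordinates d L p \<longleftrightarrow>
     (\<exists>v c. inj_on v {..<d} \<and> vec.independent (v ` {..<d}) \<and> vec.span (v ` {..<d}) = L \<and> c \<noteq> 0 \<and>
        (\<forall>B. card B = d \<longrightarrow>
           p B = c * Determinant.det
             (Matrix.mat d d (\<lambda>(i, j). vec_nth (v i) (sorted_list_of_set B ! j)))))"

definition realized_by_totally_positive_flag ::
    "(nat \<Rightarrow> 'n::{finite,linorder} set \<Rightarrow> real) \<Rightarrow> bool" where
  "realized_by_totally_positive_flag w \<longleftrightarrow>
     (\<exists>L :: nat \<Rightarrow> (hahn ^ 'n::{finite,linorder}) set.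
        (\<forall>d\<in>{1..CARD('n)}. vec.subspace (L d) \<and> vec.dim (L d) = d) \<and>
        (\<forall>i j. 1 \<le> i \<and> i < j \<and> j \<le> CARD('n) \<longrightarrow> L i \<subset> L j) \<and>
        L CARD('n) = UNIV \<and>
        (\<forall>d\<in>{1..CARD('n)}. \<exists>p. pluecker_coordinates d (L d) p \<and>
           (\<forall>B. card B = d \<longrightarrow> 0 < p B \<and> hahn_val (p B) = w d B)))"

definition HXE :: "('n::{finite,linorder} perm \<Rightarrow> real) \<Rightarrow> bool" where
  "HXE u \<longleftrightarrow> (\<forall>a b c d e f. hexagon a b c d e f \<longrightarrow> u a + u c + u e = u b + u d + u f)"

definition SQR :: "('n::{finite,linorder} perm \<Rightarrow> real) \<Rightarrow> bool" where
  "SQR u \<longleftrightarrow> (\<forall>a b c d. square a b c d \<longrightarrow> u a + u c = u b + u d)"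

definition HXM_plus :: "('n::{finite,linorder} perm \<Rightarrow> real) \<Rightarrow> bool" where
  "HXM_plus u \<longleftrightarrow>
     (\<forall>a b c d e f. hexagon a b c d e f \<and> (\<forall>x\<in>{a, b, c, d, e, f}. bruhat_le b x) \<longrightarrow>
        u b + u e = max (u a + u d) (u c + u f))"

end

theory Submission
  imports Defs
begin

text \<open>
  Writing \<open>u \<sigma> = \<Sum>d. w (F\<^sub>d \<sigma>)\<close> for a single function \<open>w\<close> on the subsets of \<open>'n\<close>, where \<open>F\<^sub>d \<sigma>\<close> is the set
  of positions of the \<open>d\<close> largest values of \<open>\<sigma>\<close>, the three conditions meet in the positive tropical three-term
  relations \<open>w(Sj) + w(Sik) = min (w(Si) + w(Sjk)) (w(Sk) + w(Sij))\<close> for \<open>i < j < k\<close>. The balancing conditions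
  on squares and hexagons say that such a \<open>w\<close> exists, because the cycles of Johnson graphs are generated by their
  triangles, and then the maximum condition on hexagons is the three-term relation. Such a \<open>w\<close> lifts to a totally
  positive flag over the Hahn series: a matrix can be chosen with prescribed minors in the first rows and consecutive
  columns, and the three-term relations determine the valuations of the other minors by subtraction-free expressions.

  For a cell of the subdivision, a linear change of \<open>w\<close> turns the cell into the set of minimizers of \<open>u\<close>, and the
  initial form of the lift is a real totally nonnegative flag with nonzero Pluecker coordinates exactly at
  these minimizers. The support of such a flag is a Bruhat interval. Conversely, tilting \<open>u\<close> so that only the
  vertices of one 2-face compete, the requirement that all sets of minimizers be Bruhat intervals forces the local
  conditions, by a case distinction on the real heights over that face.
\<close>

no_notation Matrix.scalar_prod (infix "\<bullet>" 70)

section \<open>Permutations as flags of subsets\<close>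

text \<open>Only relations between consecutive cardinalities are imposed on \<open>w\<close>; those
  within one cardinality, and those between distant ones, are recovered from the lift, because the
  leading rows of one matrix carry all members of the flag. The hardest point is that a real totally
  nonnegative flag is supported on an interval. No parametrization of cells is used: the induction
  is on the Bruhat-largest vertex, the member of dimension \<open>d + 1\<close> slides inside its
  pencil until one minor vanishes, and the slopes of the functionals on the pencil, which are
  monotone in the Gale order, tell which coordinates survive. In the converse only two properties of
  an interval enter: it is convex, and two distinct elements of equal length are neither its least
  nor its greatest element. Over a hexagon the five combinations of heights belong to the minimal
  sets of vertices with the centre in their hull (two triangles, three diagonals); the least
  combination tells which of them spans the lower hull there, and a tilt that makes it horizontal
  forces the remaining heights.\<close>

lemma idx_strict_mono: "i < j \<Longrightarrow> idx i < idx j" for i j :: "'n::{finite,linorder}"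
  unfolding idx_def by (intro psubset_card_mono) auto

lemma idx_less_iff: "idx i < idx j \<longleftrightarrow> i < j" for i j :: "'n::{finite,linorder}"
  using idx_strict_mono[of i j] idx_strict_mono[of j i] by (cases i j rule: linorder_cases) auto

lemma idx_le_iff: "idx i \<le> idx j \<longleftrightarrow> i \<le> j" for i j :: "'n::{finite,linorder}"
  using idx_less_iff[of j i] by (auto simp: not_less[symmetric])

lemma idx_eq_iff: "idx i = idx j \<longleftrightarrow> i = j" for i j :: "'n::{finite,linorder}"
  using idx_le_iff[of i j] idx_le_iff[of j i] by (auto simp: eq_iff)

lemma idx_ge_1: "1 \<le> idx (i :: 'n::{finite,linorder})"
  unfolding idx_def by (simp add: Suc_le_eq card_gt_0_iff)

lemma idx_le_card: "idx (i :: 'n::{finite,linorder}) \<le> CARD('n)"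
  unfolding idx_def by (simp add: card_mono)

lemma idx_range: "range (idx :: 'n::{finite,linorder} \<Rightarrow> nat) = {1..CARD('n)}"
proof (rule card_subset_eq)
  show "range (idx :: 'n \<Rightarrow> nat) \<subseteq> {1..CARD('n)}"
    using idx_ge_1 idx_le_card by fastforce
  have "inj (idx :: 'n \<Rightarrow> nat)" by (rule injI) (simp add: idx_eq_iff)
  then show "card (range (idx :: 'n \<Rightarrow> nat)) = card {1..CARD('n)}"
    by (simp add: card_image)
qed simp

definition el :: "nat \<Rightarrow> 'n::{finite,linorder}" where
  "el m = inv_into UNIV idx m"

lemma idx_el: "1 \<le> m \<Longrightarrow> m \<le> CARD('n) \<Longrightarrow> idx (el m :: 'n::{finite,linorder}) = m"
  unfolding el_def by (rule f_inv_into_f) (simp add: idx_range)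

lemma el_idx [simp]: "el (idx i) = (i :: 'n::{finite,linorder})"
  by (metis idx_eq_iff idx_el idx_ge_1 idx_le_card)

lemma card_ge_1: "1 \<le> CARD('n::finite)"
  by (simp add: Suc_le_eq card_gt_0_iff)

text \<open>\<open>pos \<sigma> d\<close> is the position of the \<open>d\<close>-th largest value of \<open>\<sigma>\<close>, counting from \<open>0\<close>, and \<open>lev \<sigma> d\<close> is
  the set \<open>F\<^sub>d\<close> of the positions of the \<open>d\<close> largest values.\<close>

definition pos :: "'n::{finite,linorder} perm \<Rightarrow> nat \<Rightarrow> 'n" where
  "pos \<sigma> d = Perm.apply (inverse \<sigma>) (el (CARD('n) - d))"

definition lev :: "'n::{finite,linorder} perm \<Rightarrow> nat \<Rightarrow> 'n set" where
  "lev \<sigma> d = {i. CARD('n) < idx (Perm.apply \<sigma> i) + d}"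

text \<open>Left multiplication acts on values, so it changes a flag in the single level
  \<open>Suc d\<close>; ranks are counted from the top, so \<open>adj 0\<close> exchanges the two
  largest values.\<close>

definition adj :: "nat \<Rightarrow> 'n::{finite,linorder} perm" where
  "adj d = Perm.swap (el (CARD('n) - d)) (el (CARD('n) - Suc d))"

lemma apply_inverse_perm [simp]:
  "Perm.apply (inverse \<sigma>) (Perm.apply \<sigma> i) = i" "Perm.apply \<sigma> (Perm.apply (inverse \<sigma>) i) = i"
  by (simp_all add: apply_sequence)

lemma idx_apply_pos:
  assumes "d < CARD('n)"
  shows "idx (Perm.apply \<sigma> (pos \<sigma> d :: 'n::{finite,linorder})) = CARD('n) - d"
  using assms by (simp add: pos_def idx_el)

lemma pos_eq_iff:
  fixes \<sigma> :: "'n::{finite,linorder} perm"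
  assumes "d < CARD('n)"
  shows "pos \<sigma> d = i \<longleftrightarrow> idx (Perm.apply \<sigma> i) = CARD('n) - d"
  using idx_apply_pos[OF assms, of \<sigma>] by (metis apply_inj idx_eq_iff)

lemma pos_inj:
  fixes \<sigma> :: "'n::{finite,linorder} perm"
  assumes "d < CARD('n)" "e < CARD('n)"
  shows "pos \<sigma> d = pos \<sigma> e \<longleftrightarrow> d = e"
  using pos_eq_iff[OF assms(1), of \<sigma> "pos \<sigma> e"] idx_apply_pos[OF assms(2), of \<sigma>] assms by auto

lemma ex_pos:
  fixes \<sigma> :: "'n::{finite,linorder} perm"
  shows "\<exists>d<CARD('n). i = pos \<sigma> d"
  using idx_ge_1[of "Perm.apply \<sigma> i"] idx_le_card[of "Perm.apply \<sigma> i"]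
  by (intro exI[of _ "CARD('n) - idx (Perm.apply \<sigma> i)"])
    (auto simp: pos_eq_iff eq_commute[of i])

lemma perm_eqI_pos:
  fixes \<sigma> \<tau> :: "'n::{finite,linorder} perm"
  assumes "\<And>d. d < CARD('n) \<Longrightarrow> pos \<sigma> d = pos \<tau> d"
  shows "\<sigma> = \<tau>"
proof (rule perm_eqI)
  fix i
  obtain d where d: "d < CARD('n)" "i = pos \<sigma> d" using ex_pos by blast
  then show "Perm.apply \<sigma> i = Perm.apply \<tau> i"
    using idx_apply_pos[of d \<sigma>] idx_apply_pos[of d \<tau>] assms[of d] by (metis idx_eq_iff)
qed

lemma ex_perm_pos:
  fixes x :: "nat \<Rightarrow> 'n::{finite,linorder}"
  assumes "inj_on x {..<CARD('n)}"
  shows "\<exists>\<sigma>. \<forall>d<CARD('n). pos \<sigma> d = x d"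
proof -
  have im: "x ` {..<CARD('n)} = UNIV"
    by (rule card_subset_eq) (simp_all add: card_image[OF assms])
  define g where "g = (\<lambda>i. el (CARD('n) - inv_into {..<CARD('n)} x i) :: 'n)"
  have gx: "idx (g (x d)) = CARD('n) - d" if "d < CARD('n)" for d
    using that by (simp add: g_def inv_into_f_f[OF assms] idx_el)
  have "inj g"
  proof (rule injI)
    fix i j assume "g i = g j"
    moreover obtain d e where "d < CARD('n)" "i = x d" "e < CARD('n)" "j = x e" using im by blast
    ultimately show "i = j" using gx[of d] gx[of e] by (metis diff_less_mono2 less_irrefl linorder_neqE_nat)
  qed
  then have "bij g" by (simp add: finite_UNIV_inj_surj bij_def)
  then have "Perm.apply (Perm g) = g" by (intro Perm_inverse) simp
  then show ?thesis using gx by (intro exI[of _ "Perm g"]) (simp add: pos_eq_iff)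
qed

lemma lev_0 [simp]: "lev (\<sigma> :: 'n::{finite,linorder} perm) 0 = {}"
  using idx_le_card by (auto simp: lev_def not_less)

lemma lev_card: "CARD('n) \<le> d \<Longrightarrow> lev (\<sigma> :: 'n::{finite,linorder} perm) d = UNIV"
  using idx_ge_1[of "Perm.apply \<sigma> _"] by (auto simp: lev_def) (metis Suc_le_lessD add_strict_increasing)

lemma lev_Suc:
  fixes \<sigma> :: "'n::{finite,linorder} perm"
  assumes "d < CARD('n)"
  shows "lev \<sigma> (Suc d) = insert (pos \<sigma> d) (lev \<sigma> d)" "pos \<sigma> d \<notin> lev \<sigma> d"
proof -
  have "CARD('n) < idx (Perm.apply \<sigma> i) + Suc d \<longleftrightarrow> pos \<sigma> d = i \<or> CARD('n) < idx (Perm.apply \<sigma> i) + d" for i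
    using assms by (auto simp: pos_eq_iff)
  then show "lev \<sigma> (Suc d) = insert (pos \<sigma> d) (lev \<sigma> d)" by (auto simp: lev_def)
  show "pos \<sigma> d \<notin> lev \<sigma> d" using assms by (simp add: lev_def idx_apply_pos)
qed

lemma lev_Suc2:
  fixes \<sigma> :: "'n::{finite,linorder} perm"
  assumes "Suc d < CARD('n)"
  shows "lev \<sigma> (Suc (Suc d)) = insert (pos \<sigma> (Suc d)) (insert (pos \<sigma> d) (lev \<sigma> d))"
    "pos \<sigma> (Suc d) \<notin> lev \<sigma> d" "pos \<sigma> (Suc d) \<noteq> pos \<sigma> d"
  using lev_Suc[of d \<sigma>] lev_Suc[of "Suc d" \<sigma>] assms pos_inj[of "Suc d" d \<sigma>] by auto

lemma lev_image: "d \<le> CARD('n) \<Longrightarrow> lev (\<sigma> :: 'n::{finite,linorder} perm) d = pos \<sigma> ` {..<d}"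
  by (induction d) (auto simp: lev_Suc lessThan_Suc)

lemma card_lev: "d \<le> CARD('n) \<Longrightarrow> card (lev (\<sigma> :: 'n::{finite,linorder} perm) d) = d"
  by (induction d) (auto simp: lev_Suc)

lemma perm_eqI_lev:
  fixes \<sigma> \<tau> :: "'n::{finite,linorder} perm"
  assumes "\<And>d. d \<le> CARD('n) \<Longrightarrow> lev \<sigma> d = lev \<tau> d"
  shows "\<sigma> = \<tau>"
proof (rule perm_eqI_pos)
  fix d assume "d < CARD('n)"
  then show "pos \<sigma> d = pos \<tau> d"
    using lev_Suc[of d \<sigma>] lev_Suc[of d \<tau>] assms[of d] assms[of "Suc d"] by auto
qed

lemma adj_adj [simp]: "adj d * adj d = 1" "adj d * (adj d * \<sigma>) = \<sigma>"
  by (simp_all add: adj_def mult.assoc[symmetric])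

lemma adj_cancel [simp]: "adj d * \<sigma> = adj d * \<tau> \<longleftrightarrow> \<sigma> = \<tau>"
  by (metis adj_adj(2))

lemma inverse_adj: "inverse (adj d) = adj d"
  by (simp add: adj_def)

lemma pos_adj:
  fixes \<sigma> :: "'n::{finite,linorder} perm"
  assumes "Suc d < CARD('n)" "e < CARD('n)"
  shows "pos (adj d * \<sigma>) e = pos \<sigma> (Transposition.transpose d (Suc d) e)"
proof -
  have e: "Transposition.transpose d (Suc d) e < CARD('n)"
    using assms by (auto simp: Transposition.transpose_def)
  have *: "a - b = a - c \<longleftrightarrow> b = c" if "b < a" "c < a" for a b c :: nat using that by auto
  have neq: "(el (CARD('n) - x) :: 'n) = el (CARD('n) - y) \<longleftrightarrow> x = y"
    if "x < CARD('n)" "y < CARD('n)" for x y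
    using that idx_el[of "CARD('n) - x", where 'n='n] idx_el[of "CARD('n) - y", where 'n='n] *[of x "CARD('n)" y]
    by (metis diff_le_self less_one not_le zero_less_diff)
  have "Perm.apply (adj d) (el (CARD('n) - e)) = (el (CARD('n) - Transposition.transpose d (Suc d) e) :: 'n)"
  proof -
    consider "e = d" | "e = Suc d" | "e \<noteq> d" "e \<noteq> Suc d" by blast
    then show ?thesis
    proof cases
      case 3
      then show ?thesis using assms neq unfolding adj_def
        by (subst apply_swap_same) (auto simp: Transposition.transpose_def)
    qed (auto simp: adj_def)
  qed
  moreover have "Perm.apply (inverse (adj d * \<sigma>)) i = Perm.apply (inverse \<sigma>) (Perm.apply (adj d) i)" for i :: 'n
    by (simp add: inverse_adj apply_times)
  ultimately show ?thesis by (simp add: pos_def)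
qed

lemma pos_adj_simps:
  fixes \<sigma> :: "'n::{finite,linorder} perm"
  assumes "Suc d < CARD('n)"
  shows "pos (adj d * \<sigma>) d = pos \<sigma> (Suc d)" "pos (adj d * \<sigma>) (Suc d) = pos \<sigma> d"
    "e < CARD('n) \<Longrightarrow> e \<noteq> d \<Longrightarrow> e \<noteq> Suc d \<Longrightarrow> pos (adj d * \<sigma>) e = pos \<sigma> e"
  using assms by (simp_all add: pos_adj)

lemma lev_adj:
  fixes \<sigma> :: "'n::{finite,linorder} perm"
  assumes "Suc d < CARD('n)" "e \<noteq> Suc d"
  shows "lev (adj d * \<sigma>) e = lev \<sigma> e"
proof (cases "e \<le> CARD('n)")
  case True
  have "Transposition.transpose d (Suc d) ` {..<e} = {..<e}"
  proof (cases "e \<le> d")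
    case True
    then show ?thesis by (force simp: Transposition.transpose_def image_iff)
  next
    case False
    then show ?thesis using assms(2) by (intro transpose_image_eq) auto
  qed
  moreover have "pos (adj d * \<sigma>) ` {..<e} = pos \<sigma> ` (Transposition.transpose d (Suc d) ` {..<e})"
    unfolding image_image using assms(1) True by (intro image_cong) (auto simp: pos_adj)
  ultimately show ?thesis using True by (simp add: lev_image)
next
  case False
  then show ?thesis by (simp add: lev_card)
qed

lemma lev_adj_Suc:
  fixes \<sigma> :: "'n::{finite,linorder} perm"
  assumes "Suc d < CARD('n)"
  shows "lev (adj d * \<sigma>) (Suc d) = insert (pos \<sigma> (Suc d)) (lev \<sigma> d)"
  using assms by (simp add: lev_Suc lev_adj pos_adj_simps)

lemma adj_neq: "Suc d < CARD('n) \<Longrightarrow> adj d * \<sigma> \<noteq> (\<sigma> :: 'n::{finite,linorder} perm)"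
  by (metis pos_adj_simps(1) pos_inj n_not_Suc_n Suc_lessD)

text \<open>Two elements are added between the levels \<open>d\<close> and
  \<open>Suc (Suc d)\<close>, so only two sets fit in between.\<close>

lemma lev_eq_outside:
  fixes \<sigma> \<tau> :: "'n::{finite,linorder} perm"
  assumes d: "Suc d < CARD('n)" and eq: "\<And>e. e \<noteq> Suc d \<Longrightarrow> lev \<sigma> e = lev \<tau> e"
  shows "\<tau> = \<sigma> \<or> \<tau> = adj d * \<sigma>"
proof -
  have "insert (pos \<tau> (Suc d)) (insert (pos \<tau> d) (lev \<sigma> d)) = insert (pos \<sigma> (Suc d)) (insert (pos \<sigma> d) (lev \<sigma> d))"
    using lev_Suc2(1)[OF d, of \<sigma>] lev_Suc2(1)[OF d, of \<tau>] eq[of "Suc (Suc d)"] eq[of d] by simp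
  moreover have "pos \<tau> d \<notin> lev \<sigma> d" "pos \<sigma> d \<notin> lev \<sigma> d"
    using lev_Suc(2)[of d \<tau>] lev_Suc(2)[of d \<sigma>] d eq[of d] by auto
  ultimately have "pos \<tau> d = pos \<sigma> d \<or> pos \<tau> d = pos \<sigma> (Suc d)" by blast
  then show ?thesis
  proof
    assume "pos \<tau> d = pos \<sigma> d"
    then have "lev \<tau> e = lev \<sigma> e" for e using eq[of e] eq[of d] lev_Suc(1)[of d \<sigma>] lev_Suc(1)[of d \<tau>] d
      by (cases "e = Suc d") auto
    then show ?thesis by (intro disjI1 perm_eqI_lev) auto
  next
    assume "pos \<tau> d = pos \<sigma> (Suc d)"
    then have "lev \<tau> e = lev (adj d * \<sigma>) e" for e
      using eq[of e] eq[of d] lev_adj_Suc[OF d, of \<sigma>] lev_Suc(1)[of d \<tau>] d lev_adj[OF d, of e \<sigma>]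
      by (cases "e = Suc d") auto
    then show ?thesis by (intro disjI2 perm_eqI_lev) auto
  qed
qed

text \<open>The usual inversions, indexed by ranks of values from the largest down instead of by
  positions, so that left multiplication by \<open>adj d\<close> acts on the index pairs through the
  transposition of \<open>d\<close> and \<open>Suc d\<close>.\<close>

definition inversions :: "'n::{finite,linorder} perm \<Rightarrow> (nat \<times> nat) set" where
  "inversions \<sigma> = {(d, e). d < e \<and> e < CARD('n) \<and> pos \<sigma> d < pos \<sigma> e}"

lemma finite_inversions [simp]: "finite (inversions \<sigma>)"
  by (rule finite_subset[of _ "{..<CARD('a)} \<times> {..<CARD('a)}"]) (auto simp: inversions_def)

text \<open>Transposing \<open>d\<close> and \<open>Suc d\<close> in the index pairs keeps the order
  of every pair except \<open>(d, Suc d)\<close>, which becomes the one new inversion.\<close>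

lemma card_inversions_adj:
  fixes \<sigma> :: "'n::{finite,linorder} perm"
  assumes d: "Suc d < CARD('n)" and desc: "pos \<sigma> (Suc d) < pos \<sigma> d"
  shows "card (inversions (adj d * \<sigma>)) = Suc (card (inversions \<sigma>))"
proof -
  let ?t = "Transposition.transpose d (Suc d)"
  have lt: "?t a < ?t b \<longleftrightarrow> a < b" if "(a, b) \<noteq> (d, Suc d)" "(a, b) \<noteq> (Suc d, d)" for a b
    using that by (auto simp: Transposition.transpose_def)
  have n: "?t a < CARD('n) \<longleftrightarrow> a < CARD('n)" for a
    using d by (auto simp: Transposition.transpose_def)
  have "inversions (adj d * \<sigma>) = insert (d, Suc d) (map_prod ?t ?t ` inversions \<sigma>)"
  proof (intro Set.set_eqI)
    fix ab :: "nat \<times> nat"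
    obtain a b where ab: "ab = (a, b)" by (cases ab)
    show "ab \<in> inversions (adj d * \<sigma>) \<longleftrightarrow> ab \<in> insert (d, Suc d) (map_prod ?t ?t ` inversions \<sigma>)"
      unfolding ab
    proof -
    show "(a, b) \<in> inversions (adj d * \<sigma>) \<longleftrightarrow> (a, b) \<in> insert (d, Suc d) (map_prod ?t ?t ` inversions \<sigma>)"
    proof -
      have im: "(a, b) \<in> map_prod ?t ?t ` inversions \<sigma> \<longleftrightarrow> (?t a, ?t b) \<in> inversions \<sigma>"
        by (force simp: image_iff)
      consider "(a, b) = (d, Suc d)" | "(a, b) = (Suc d, d)" | "(a, b) \<noteq> (d, Suc d)" "(a, b) \<noteq> (Suc d, d)" by blast
      then show ?thesis
      proof cases
        case 1
        then show ?thesis using d desc by (auto simp: inversions_def pos_adj_simps)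
      next
        case 2
        then have "(?t a, ?t b) \<notin> inversions \<sigma>" using desc by (auto simp: inversions_def)
        then show ?thesis using 2 im by (auto simp: inversions_def)
      next
        case 3
        then show ?thesis unfolding im insert_iff
          using lt[OF 3] n[of b] d by (auto simp: inversions_def pos_adj)
      qed
    qed
    qed
  qed
  moreover have "(d, Suc d) \<notin> map_prod ?t ?t ` inversions \<sigma>"
    using desc by (auto simp: image_iff inversions_def Transposition.transpose_def split: if_splits)
  moreover have "inj_on (map_prod ?t ?t) (inversions \<sigma>)"
    by (rule inj_onI) (auto simp: map_prod_def dest: injD[OF inj_transpose])
  ultimately show ?thesis by (simp add: card_image)
qed

lemma pos_Suc_cases:
  fixes \<sigma> :: "'n::{finite,linorder} perm"
  assumes "Suc d < CARD('n)"
  obtains "pos \<sigma> (Suc d) < pos \<sigma> d" | "pos \<sigma> d < pos \<sigma> (Suc d)"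
  using lev_Suc2(3)[OF assms, of \<sigma>] by (meson linorder_neqE)

lemma card_inversions_adj':
  fixes \<sigma> :: "'n::{finite,linorder} perm"
  assumes d: "Suc d < CARD('n)" and asc: "pos \<sigma> d < pos \<sigma> (Suc d)"
  shows "card (inversions \<sigma>) = Suc (card (inversions (adj d * \<sigma>)))"
  using card_inversions_adj[OF d, of "adj d * \<sigma>"] asc d by (simp add: pos_adj_simps)

lemma pos_one: "d < CARD('n) \<Longrightarrow> pos (1 :: 'n::{finite,linorder} perm) d = el (CARD('n) - d)"
  by (simp add: pos_def)

lemma inversions_one [simp]: "inversions (1 :: 'n::{finite,linorder} perm) = {}"
proof -
  have "\<not> el (CARD('n) - d) < (el (CARD('n) - e) :: 'n)" if "d < e" "e < CARD('n)" for d e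
    using that idx_el[of "CARD('n) - d", where 'n='n] idx_el[of "CARD('n) - e", where 'n='n]
    by (simp add: idx_less_iff[symmetric])
  then show ?thesis by (auto simp: inversions_def pos_one)
qed

text \<open>The positions decrease strictly along the ranks; bounds obtained from both ends of the
  chain leave the identity only.\<close>

lemma perm_eq_one:
  fixes \<sigma> :: "'n::{finite,linorder} perm"
  assumes "\<And>d. Suc d < CARD('n) \<Longrightarrow> pos \<sigma> (Suc d) < pos \<sigma> d"
  shows "\<sigma> = 1"
proof (rule perm_eqI_pos)
  have le: "idx (pos \<sigma> d) + d \<le> CARD('n)" if "d < CARD('n)" for d
    using that
  proof (induction d)
    case 0
    then show ?case by (simp add: idx_le_card)
  next
    case (Suc d)
    then show ?case using idx_strict_mono[OF assms[of d]] by simp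
  qed
  have ge: "CARD('n) \<le> idx (pos \<sigma> (CARD('n) - Suc k)) + (CARD('n) - Suc k)" if "k < CARD('n)" for k
    using that
  proof (induction k)
    case 0
    then show ?case using idx_ge_1[of "pos \<sigma> (CARD('n) - Suc 0)"] by linarith
  next
    case (Suc k)
    then have "pos \<sigma> (Suc (CARD('n) - Suc (Suc k))) < pos \<sigma> (CARD('n) - Suc (Suc k))"
      by (intro assms) simp
    moreover have "Suc (CARD('n) - Suc (Suc k)) = CARD('n) - Suc k" using Suc.prems by simp
    ultimately show ?case using Suc idx_strict_mono by fastforce
  qed
  fix d assume d: "d < CARD('n)"
  then have "idx (pos \<sigma> d) = CARD('n) - d"
    using le[of d] ge[of "CARD('n) - Suc d"] by simp
  then show "pos \<sigma> d = pos 1 d" using d by (metis el_idx pos_one)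
qed

text \<open>Induction on the length: \<open>pos \<sigma> d < pos \<sigma> (Suc d)\<close> says that
  \<open>adj d\<close> removes an inversion. Later inductions also apply it to the quotient of two
  permutations.\<close>

lemma perm_descent_induct [case_names one step]:
  fixes \<sigma> :: "'n::{finite,linorder} perm"
  assumes one: "P 1"
    and step: "\<And>\<sigma> d. Suc d < CARD('n) \<Longrightarrow> pos \<sigma> d < pos \<sigma> (Suc d) \<Longrightarrow> P (adj d * \<sigma>) \<Longrightarrow> P \<sigma>"
  shows "P \<sigma>"
proof (induction "card (inversions \<sigma>)" arbitrary: \<sigma> rule: less_induct)
  case less
  show ?case
  proof (cases "\<exists>d. Suc d < CARD('n) \<and> pos \<sigma> d < pos \<sigma> (Suc d)")
    case True
    then obtain d where d: "Suc d < CARD('n)" "pos \<sigma> d < pos \<sigma> (Suc d)" by blast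
    then show ?thesis using less[of "adj d * \<sigma>"] card_inversions_adj'[OF d] step by simp
  next
    case False
    then have "\<sigma> = 1" by (intro perm_eq_one) (meson pos_Suc_cases)
    then show ?thesis using one by simp
  qed
qed

section \<open>The Bruhat order\<close>

lemma simple_transpositions_eq:
  "(simple_transpositions :: 'n::{finite,linorder} perm set) = adj ` {d. Suc d < CARD('n)}"
proof (intro equalityI subsetI)
  fix s :: "'n perm" assume "s \<in> simple_transpositions"
  then obtain i j :: 'n where ij: "s = Perm.swap i j" "idx j = Suc (idx i)"
    by (auto simp: simple_transpositions_def)
  have "s = adj (CARD('n) - idx j)"
    using ij idx_le_card[of j] idx_ge_1[of i]
    unfolding adj_def
    by (metis (no_types, lifting) Suc_diff_le diff_diff_cancel diff_Suc_Suc el_idx idx_le_card swap_sym)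
  then show "s \<in> adj ` {d. Suc d < CARD('n)}"
    using ij idx_le_card[of j] idx_ge_1[of i] by (intro image_eqI) auto
next
  fix s :: "'n perm" assume "s \<in> adj ` {d. Suc d < CARD('n)}"
  then obtain d where d: "Suc d < CARD('n)" "s = adj d" by blast
  then show "s \<in> simple_transpositions"
    unfolding simple_transpositions_def adj_def
    using idx_el[of "CARD('n) - d", where 'n='n] idx_el[of "CARD('n) - Suc d", where 'n='n]
    by (force simp: swap_sym)
qed

lemma card_inversions_adj_le:
  "Suc d < CARD('n) \<Longrightarrow> card (inversions (adj d * \<sigma>)) \<le> Suc (card (inversions (\<sigma> :: 'n::{finite,linorder} perm)))"
  using card_inversions_adj card_inversions_adj' pos_Suc_cases
  by (metis Suc_n_not_le_n le_refl nat_le_linear le_SucI)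

lemma card_inversions_prod_list:
  fixes ws :: "'n::{finite,linorder} perm list"
  shows "set ws \<subseteq> simple_transpositions \<Longrightarrow> card (inversions (prod_list ws)) \<le> length ws"
proof (induction ws)
  case (Cons s ws)
  then obtain d where d: "Suc d < CARD('n)" "s = adj d" by (auto simp: simple_transpositions_eq)
  then show ?case using Cons card_inversions_adj_le[OF d(1), of "prod_list ws"] by simp
qed simp

lemma ex_word:
  fixes \<sigma> :: "'n::{finite,linorder} perm"
  shows "\<exists>ws. set ws \<subseteq> simple_transpositions \<and> prod_list ws = \<sigma> \<and> length ws = card (inversions \<sigma>)"
proof (induction \<sigma> rule: perm_descent_induct)
  case one
  then show ?case by (intro exI[of _ "[]"]) simp
next
  case (step \<sigma> d)
  then obtain ws where "set ws \<subseteq> simple_transpositions" "prod_list ws = adj d * \<sigma>"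
    "length ws = card (inversions (adj d * \<sigma>))" by blast
  then show ?case using step card_inversions_adj'[OF step(1,2)]
    by (intro exI[of _ "adj d # ws"]) (auto simp: simple_transpositions_eq)
qed

text \<open>A simple transposition changes the number of inversions by at most one, and removing
  inversions one by one gives a word of exactly that length.\<close>

lemma reduced_word_iff:
  "reduced_word ws \<sigma> \<longleftrightarrow>
     set ws \<subseteq> simple_transpositions \<and> prod_list ws = \<sigma> \<and> length ws = card (inversions \<sigma>)"
  using ex_word[of \<sigma>] card_inversions_prod_list
  unfolding reduced_word_def is_arg_min_def by (metis le_neq_implies_less not_le)

lemma reduced_word_ConsD:
  fixes \<sigma> :: "'n::{finite,linorder} perm"
  assumes "reduced_word (s # ws) \<sigma>"
  obtains d where "Suc d < CARD('n)" "s = adj d" "reduced_word ws (adj d * \<sigma>)" "pos \<sigma> d < pos \<sigma> (Suc d)"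
proof -
  have s: "s \<in> simple_transpositions" "set ws \<subseteq> simple_transpositions" "s * prod_list ws = \<sigma>"
    "Suc (length ws) = card (inversions \<sigma>)"
    using assms by (auto simp: reduced_word_iff)
  then obtain d where d: "Suc d < CARD('n)" "s = adj d" by (auto simp: simple_transpositions_eq)
  have eq: "prod_list ws = adj d * \<sigma>" using s(3) d by auto
  have le: "card (inversions (adj d * \<sigma>)) \<le> length ws"
    using card_inversions_prod_list[OF s(2)] eq by simp
  have asc: "pos \<sigma> d < pos \<sigma> (Suc d)"
  proof (rule ccontr)
    assume "\<not> ?thesis"
    then have "pos \<sigma> (Suc d) < pos \<sigma> d" using pos_Suc_cases[OF d(1)] by metis
    then show False using card_inversions_adj[OF d(1), of \<sigma>] le s(4) by simp
  qed
  then have "card (inversions (adj d * \<sigma>)) = length ws"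
    using card_inversions_adj'[OF d(1) asc] s(4) by simp
  then show ?thesis using that d asc s(2) eq by (simp add: reduced_word_iff)
qed

lemma reduced_word_ConsI:
  fixes \<sigma> :: "'n::{finite,linorder} perm"
  assumes "Suc d < CARD('n)" "reduced_word ws (adj d * \<sigma>)" "pos \<sigma> d < pos \<sigma> (Suc d)"
  shows "reduced_word (adj d # ws) \<sigma>"
  using assms card_inversions_adj'[OF assms(1,3)] by (auto simp: reduced_word_iff simple_transpositions_eq)

section \<open>The Gale order and the tableau criterion\<close>

definition cnt :: "'n::{finite,linorder} set \<Rightarrow> 'n \<Rightarrow> nat" where
  "cnt I t = card {x\<in>I. t \<le> x}"

text \<open>For sets of equal cardinality this is the Gale order, the componentwise comparison of
  the sorted elements. Counting above thresholds makes the insertion of an element an arithmetic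
  change.\<close>

definition gale_le :: "'n::{finite,linorder} set \<Rightarrow> 'n set \<Rightarrow> bool" where
  "gale_le I J \<longleftrightarrow> (\<forall>t. cnt I t \<le> cnt J t)"

lemma gale_le_refl [simp]: "gale_le I I"
  by (simp add: gale_le_def)

lemma gale_le_trans: "gale_le I J \<Longrightarrow> gale_le J K \<Longrightarrow> gale_le I K"
  unfolding gale_le_def using le_trans by blast

lemma cnt_insert: "x \<notin> I \<Longrightarrow> cnt (insert x I) t = cnt I t + (if t \<le> x then 1 else 0)"
proof -
  assume x: "x \<notin> I"
  have "{y \<in> insert x I. t \<le> y} = (if t \<le> x then insert x {y\<in>I. t \<le> y} else {y\<in>I. t \<le> y})" by auto
  then show ?thesis using x by (simp add: cnt_def)
qed

lemma gale_le_antisym: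
  fixes I J :: "'n::{finite,linorder} set"
  assumes "gale_le I J" "gale_le J I"
  shows "I = J"
proof (rule ccontr)
  assume neq: "I \<noteq> J"
  have eq: "cnt I t = cnt J t" for t using assms by (simp add: gale_le_def eq_iff)
  define m where "m = Max (I - J \<union> (J - I))"
  have m: "m \<in> I - J \<union> (J - I)" "\<And>x. x \<in> I - J \<union> (J - I) \<Longrightarrow> x \<le> m"
  proof -
    have "I - J \<union> (J - I) \<noteq> {}" using neq by blast
    then show "m \<in> I - J \<union> (J - I)" unfolding m_def by (intro Max_in) auto
    show "x \<le> m" if "x \<in> I - J \<union> (J - I)" for x
      unfolding m_def using that by (intro Max_ge) auto
  qed
  let ?K = "{x. x \<in> I \<and> m < x}"
  have K: "{x\<in>J. m < x} = ?K" using m(2) by fastforce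
  have "{x\<in>I. m \<le> x} = (if m \<in> I then insert m ?K else ?K)"
    "{x\<in>J. m \<le> x} = (if m \<in> J then insert m ?K else ?K)"
    using K by (auto simp: order_le_less)
  then show False using eq[of m] m(1) by (auto simp: cnt_def)
qed

text \<open>The tableau criterion for the Bruhat order. The sides are exchanged because a longer
  permutation has its large values further to the left, hence Gale-smaller levels.\<close>

definition flag_le :: "'n::{finite,linorder} perm \<Rightarrow> 'n perm \<Rightarrow> bool" where
  "flag_le v w \<longleftrightarrow> (\<forall>d. gale_le (lev w d) (lev v d))"

lemma flag_le_refl [simp]: "flag_le v v"
  by (simp add: flag_le_def)

lemma flag_le_trans: "flag_le u v \<Longrightarrow> flag_le v w \<Longrightarrow> flag_le u w"
  unfolding flag_le_def using gale_le_trans by blast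

lemma flag_le_antisym: "flag_le v w \<Longrightarrow> flag_le w v \<Longrightarrow> v = w"
  unfolding flag_le_def by (intro perm_eqI_lev gale_le_antisym) auto

text \<open>If \<open>w\<close> adds the smaller of its two new elements first, then at each
  threshold its middle count is its lower count or its upper count minus one, and the middle count
  of \<open>v\<close> dominates both. The case that \<open>v\<close> adds its larger element first
  is dual.\<close>

lemma gale_le_lift:
  fixes v w :: "'n::{finite,linorder} perm"
  assumes d: "Suc d < CARD('n)"
    and le: "gale_le (lev w d) (lev v d)" "gale_le (lev w (Suc (Suc d))) (lev v (Suc (Suc d)))"
    and c: "pos w d < pos w (Suc d) \<or> pos v (Suc d) < pos v d"
  shows "gale_le (lev w (Suc d)) (lev v (Suc d))"
  unfolding gale_le_def
proof
  fix t
  have "cnt (lev w d) t \<le> cnt (lev v d) t"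
    "cnt (lev w (Suc (Suc d))) t \<le> cnt (lev v (Suc (Suc d))) t"
    using le by (auto simp: gale_le_def)
  then show "cnt (lev w (Suc d)) t \<le> cnt (lev v (Suc d)) t"
    using c lev_Suc[of d v] lev_Suc[of d w] lev_Suc2[OF d, of v] lev_Suc2[OF d, of w] d
    by (auto simp: cnt_insert split: if_splits)
qed

lemma flag_le_lift:
  fixes v w :: "'n::{finite,linorder} perm"
  assumes d: "Suc d < CARD('n)"
    and le: "\<And>e. e \<noteq> Suc d \<Longrightarrow> gale_le (lev w e) (lev v e)"
    and c: "pos w d < pos w (Suc d) \<or> pos v (Suc d) < pos v d"
  shows "flag_le v w"
  unfolding flag_le_def using gale_le_lift[OF d le[of d] le[of "Suc (Suc d)"] c] le
  by (metis n_not_Suc_n)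

text \<open>The shorter element of the coset \<open>{\<sigma>, adj d * \<sigma>}\<close>.\<close>

definition lower :: "nat \<Rightarrow> 'n::{finite,linorder} perm \<Rightarrow> 'n perm" where
  "lower d \<sigma> = (if pos \<sigma> d < pos \<sigma> (Suc d) then adj d * \<sigma> else \<sigma>)"

lemma lev_lower: "Suc d < CARD('n) \<Longrightarrow> e \<noteq> Suc d \<Longrightarrow> lev (lower d \<sigma>) e = lev (\<sigma> :: 'n::{finite,linorder} perm) e"
  by (simp add: lower_def lev_adj)

lemma pos_lower: "Suc d < CARD('n) \<Longrightarrow> pos (lower d \<sigma>) (Suc d) < pos (lower d (\<sigma> :: 'n::{finite,linorder} perm)) d"
  by (rule pos_Suc_cases[of d \<sigma>]) (auto simp: lower_def pos_adj_simps)

text \<open>The lifting property of the Bruhat order. Outside level \<open>Suc d\<close> nothing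
  changes under \<open>lower d\<close>, and \<open>flag_le_lift\<close> supplies the missing level
  on either side.\<close>

lemma flag_le_lower_iff:
  fixes v w :: "'n::{finite,linorder} perm"
  assumes d: "Suc d < CARD('n)" and asc: "pos w d < pos w (Suc d)"
  shows "flag_le v w \<longleftrightarrow> flag_le (lower d v) (lower d w)"
proof
  assume "flag_le v w"
  then show "flag_le (lower d v) (lower d w)"
    using pos_lower[OF d] by (intro flag_le_lift[OF d]) (auto simp: lev_lower[OF d] flag_le_def)
next
  assume *: "flag_le (lower d v) (lower d w)"
  have "gale_le (lev w e) (lev v e)" if "e \<noteq> Suc d" for e
    using * lev_lower[OF d that, of v] lev_lower[OF d that, of w] unfolding flag_le_def by metis
  then show "flag_le v w" by (intro flag_le_lift[OF d]) (simp_all add: asc)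
qed

lemma flag_le_lower:
  fixes w :: "'n::{finite,linorder} perm"
  shows "Suc d < CARD('n) \<Longrightarrow> flag_le (lower d w) w"
  using pos_lower[of d] by (intro flag_le_lift[of d]) (auto simp: lev_lower)

text \<open>The levels of the identity are final segments of \<open>'n\<close>, the Gale-largest
  sets of their size.\<close>

lemma flag_le_one:
  assumes "flag_le v (1 :: 'n::{finite,linorder} perm)"
  shows "v = 1"
proof (rule perm_eqI_lev)
  fix d assume d: "d \<le> CARD('n)"
  show "lev v d = lev 1 d"
  proof (cases "d = 0")
    case False
    let ?t = "el (Suc (CARD('n)) - d) :: 'n"
    have "idx ?t = Suc (CARD('n)) - d" using d False by (intro idx_el) auto
    then have L: "lev (1 :: 'n perm) d = {?t..}"
      using d False by (auto simp: lev_def idx_le_iff[symmetric])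
    have "d = cnt (lev 1 d) ?t" using card_lev[OF d, of 1] L by (simp add: cnt_def atLeast_def)
    also have "\<dots> \<le> cnt (lev v d) ?t" using assms by (simp add: flag_le_def gale_le_def)
    finally have "lev v d = {x\<in>lev v d. ?t \<le> x}"
      using card_lev[OF d, of v] by (intro sym[OF card_seteq]) (auto simp: cnt_def)
    then have "lev v d \<subseteq> lev 1 d" using L by auto
    then show ?thesis using card_lev[OF d] by (metis card_subset_eq finite)
  qed simp
qed

text \<open>Induction along the word of \<open>w\<close>. If the subword skips the first letter,
  only \<open>w\<close> is shortened; if it uses the letter, both permutations lose it and the
  lifting property restores the comparison.\<close>

lemma bruhat_imp_flag_le:
  fixes v w :: "'n::{finite,linorder} perm"
  shows "reduced_word ws w \<Longrightarrow> subseq vs ws \<Longrightarrow> reduced_word vs v \<Longrightarrow> flag_le v w"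
proof (induction ws arbitrary: vs v w)
  case (Nil vs v w)
  have "vs = []" using list_emb_Nil2[OF Nil.prems(2)] .
  then have "v = 1" "w = 1" using Nil.prems(1,3) unfolding reduced_word_iff by (metis prod_list.Nil)+
  then show ?case by simp
next
  case (Cons s ws vs v w)
  obtain d where d: "Suc d < CARD('n)" "s = adj d" "reduced_word ws (adj d * w)" "pos w d < pos w (Suc d)"
    using reduced_word_ConsD[OF Cons.prems(1)] by blast
  then have w: "lower d w = adj d * w" by (simp add: lower_def)
  show ?case
  proof (cases "subseq vs ws")
    case True
    then have "flag_le v (lower d w)" using Cons.IH[OF d(3) _ Cons.prems(3)] w by simp
    then show ?thesis using flag_le_trans flag_le_lower[OF d(1)] by blast
  next
    case False
    then obtain vs' where vs: "vs = s # vs'" "subseq vs' ws"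
      using Cons.prems(2) by (cases vs) (auto split: if_splits)
    have "reduced_word (s # vs') v" using Cons.prems(3) vs by simp
    then obtain d' where d': "Suc d' < CARD('n)" "s = adj d'" "reduced_word vs' (adj d' * v)"
      "pos v d' < pos v (Suc d')"
      using reduced_word_ConsD by blast
    \<comment> \<open>Distinct \<open>adj d\<close> change distinct levels, so the common first
      letter determines its index.\<close>
    have "lev (adj d * v) (Suc d) \<noteq> lev v (Suc d)"
      using lev_adj_Suc[OF d(1), of v] lev_Suc[of d v] lev_Suc2[OF d(1), of v] d(1) by auto
    then have "d' = d" using d'(1,2) d(2) lev_adj[OF d'(1), of "Suc d" v] by auto
    then have "flag_le (lower d v) (lower d w)"
      using Cons.IH[OF d(3) vs(2)] d' w by (simp add: lower_def)
    then show ?thesis using flag_le_lower_iff[OF d(1,4)] by simp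
  qed
qed

lemma flag_le_imp_bruhat: "flag_le v w \<Longrightarrow> bruhat_le v w" for v w :: "'n::{finite,linorder} perm"
proof (induction w arbitrary: v rule: perm_descent_induct)
  case one
  then have "v = 1" by (rule flag_le_one)
  then show ?case unfolding bruhat_le_def by (intro exI[of _ "[]"]) (simp add: reduced_word_iff)
next
  case (step w d)
  have "flag_le (lower d v) (adj d * w)"
    using step flag_le_lower_iff[of d w v] by (simp add: lower_def[of d w])
  then obtain ws vs where r: "reduced_word ws (adj d * w)" "subseq vs ws" "reduced_word vs (lower d v)"
    using step.IH unfolding bruhat_le_def by blast
  have ws: "reduced_word (adj d # ws) w" using reduced_word_ConsI[OF step(1) r(1) step(2)] .
  show ?case
  proof (cases "pos v d < pos v (Suc d)")
    case True
    then have "reduced_word (adj d # vs) v"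
      using reduced_word_ConsI[OF step(1) _ True] r(3) by (simp add: lower_def)
    then show ?thesis unfolding bruhat_le_def
      using ws r(2) by (intro exI[of _ "adj d # ws"] exI[of _ "adj d # vs"]) auto
  next
    case False
    then show ?thesis unfolding bruhat_le_def
      using ws r(2,3) by (intro exI[of _ "adj d # ws"] exI[of _ vs]) (auto simp: lower_def)
  qed
qed

lemma bruhat_le_iff: "bruhat_le v w \<longleftrightarrow> flag_le v w" for v w :: "'n::{finite,linorder} perm"
  using bruhat_imp_flag_le flag_le_imp_bruhat unfolding bruhat_le_def by blast

lemma bruhat_le_inversions:
  fixes v w :: "'n::{finite,linorder} perm"
  assumes "bruhat_le v w"
  shows "card (inversions v) \<le> card (inversions w)" "card (inversions v) = card (inversions w) \<Longrightarrow> v = w"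
proof -
  obtain ws vs where r: "reduced_word ws w" "subseq vs ws" "reduced_word vs v"
    using assms by (auto simp: bruhat_le_def)
  then show "card (inversions v) \<le> card (inversions w)"
    using list_emb_length[OF r(2)] by (simp add: reduced_word_iff)
  assume "card (inversions v) = card (inversions w)"
  then have "vs = ws" using r subseq_same_length[OF r(2)] by (simp add: reduced_word_iff)
  then show "v = w" using r by (simp add: reduced_word_iff)
qed

lemma bruhat_le_refl [simp]: "bruhat_le v v"
  by (simp add: bruhat_le_iff)

section \<open>Flag minors and their relations\<close>

definition minor_mat :: "(nat \<Rightarrow> 'c \<Rightarrow> 'k) \<Rightarrow> 'c list \<Rightarrow> 'k Matrix.mat" where
  "minor_mat f xs = Matrix.mat (length xs) (length xs) (\<lambda>(i, j). f i (xs ! j))"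

text \<open>The rows are always the first \<open>length xs\<close>, so one matrix \<open>f\<close>
  encodes a whole flag whose member of dimension \<open>d\<close> is spanned by the first
  \<open>d\<close> rows. Columns form a list over any type, which allows repeated and adjoined
  columns.\<close>

definition minor :: "(nat \<Rightarrow> 'c \<Rightarrow> 'k::comm_ring_1) \<Rightarrow> 'c list \<Rightarrow> 'k" where
  "minor f xs = Determinant.det (minor_mat f xs)"

lemma minor_mat_carrier [simp]: "minor_mat f xs \<in> carrier_mat (length xs) (length xs)"
  by (simp add: minor_mat_def)

lemma minor_mat_dim [simp]: "dim_row (minor_mat f xs) = length xs" "dim_col (minor_mat f xs) = length xs"
  by (simp_all add: minor_mat_def)

lemma minor_mat_index [simp]:
  "i < length xs \<Longrightarrow> j < length xs \<Longrightarrow> minor_mat f xs $$ (i, j) = f i (xs ! j)"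
  by (simp add: minor_mat_def)

lemma minor_cong:
  assumes "xs = ys" "\<And>i c. i < length ys \<Longrightarrow> c \<in> set ys \<Longrightarrow> f i c = g i c"
  shows "minor f xs = minor g ys"
  using assms unfolding minor_def by (intro arg_cong[of _ _ Determinant.det]) (auto simp: minor_mat_def)

lemma minor_Nil [simp]: "minor f [] = 1"
  by (simp add: minor_def minor_mat_def)

lemma minor_map: "minor f (map h xs) = minor (\<lambda>i c. f i (h c)) xs"
  unfolding minor_def by (intro arg_cong[of _ _ Determinant.det]) (auto simp: minor_mat_def)

lemma minor_column_expansion:
  assumes "p < length xs"
  shows "minor f (xs[p := x]) = (\<Sum>l<length xs. f l x * cofactor (minor_mat f xs) l p)"
proof -
  have "cofactor (minor_mat f (xs[p := x])) l p = cofactor (minor_mat f xs) l p" if "l < length xs" for l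
    unfolding cofactor_def mat_delete_def
    by (intro arg_cong2[of _ _ _ _ "(*)"] arg_cong[of _ _ Determinant.det] refl eq_matI)
      (use assms that in auto)
  then show ?thesis unfolding minor_def
    using assms by (subst laplace_expansion_column[of _ "length xs" p]) (auto intro!: sum.cong)
qed

lemma minor_snoc:
  "minor f (xs @ [x]) = (\<Sum>l\<le>length xs. f l x *
     ((-1) ^ (l + length xs) * minor (\<lambda>i. f (if i < l then i else Suc i)) xs))"
proof -
  have "cofactor (minor_mat f (xs @ [x])) l (length xs) =
      (-1) ^ (l + length xs) * minor (\<lambda>i. f (if i < l then i else Suc i)) xs" if "l \<le> length xs" for l
    unfolding cofactor_def mat_delete_def minor_def
    by (intro arg_cong2[of _ _ _ _ "(*)"] arg_cong[of _ _ Determinant.det] refl eq_matI)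
      (use that in \<open>auto simp: nth_append\<close>)
  moreover have "minor f (xs @ [x]) = (\<Sum>l<Suc (length xs). f l x * cofactor (minor_mat f (xs @ [x])) l (length xs))"
    unfolding minor_def
    by (subst laplace_expansion_column[of _ "Suc (length xs)" "length xs"])
      (auto intro!: sum.cong simp: carrier_matI nth_append)
  ultimately show ?thesis by (simp add: lessThan_Suc_atMost)
qed

lemma minor_snoc_last_coeff:
  "(-1) ^ (length xs + length xs) * minor (\<lambda>i. f (if i < length xs then i else Suc i)) xs = minor f xs"
  by (auto intro!: minor_cong)

lemma minor_row_expansion:
  assumes "i < length xs"
  shows "minor (f(i := r)) xs = (\<Sum>j<length xs. r (xs ! j) * cofactor (minor_mat f xs) i j)"
proof -
  have "cofactor (minor_mat (f(i := r)) xs) i j = cofactor (minor_mat f xs) i j" if "j < length xs" for j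
    unfolding cofactor_def mat_delete_def
    by (intro arg_cong2[of _ _ _ _ "(*)"] arg_cong[of _ _ Determinant.det] refl eq_matI)
      (use assms that in auto)
  then show ?thesis unfolding minor_def
    using assms by (subst laplace_expansion_row[of _ "length xs" i]) (auto intro!: sum.cong)
qed

lemma minor_row_linear:
  assumes "i < length xs"
  shows "minor (f(i := \<lambda>c. a * r c + b * r' c)) xs = a * minor (f(i := r)) xs + b * minor (f(i := r')) xs"
  unfolding minor_row_expansion[OF assms]
  by (simp add: sum_distrib_left sum.distrib algebra_simps)

lemma minor_same_rows:
  assumes "i \<noteq> j" "i < length xs" "j < length xs" "f i = f j"
  shows "minor f xs = 0"
  unfolding minor_def
  by (rule det_identical_rows[OF minor_mat_carrier assms(1-3)]) (use assms in \<open>auto simp: minor_mat_def\<close>)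

lemma minor_not_distinct:
  assumes "\<not> distinct xs"
  shows "minor f xs = 0"
proof -
  obtain i j where "i < length xs" "j < length xs" "i \<noteq> j" "xs ! i = xs ! j"
    using assms by (auto simp: distinct_conv_nth)
  then show ?thesis unfolding minor_def
    by (intro det_identical_columns[OF minor_mat_carrier, of i j]) (auto simp: minor_mat_def)
qed

lemma minor_swap: "minor f (as @ x # y # bs) = - minor f (as @ y # x # bs)"
proof -
  let ?k = "length as" and ?xs = "as @ y # x # bs"
  have "minor_mat f (as @ x # y # bs) = swapcols ?k (Suc ?k) (minor_mat f ?xs)"
    by (rule eq_matI) (auto simp: nth_append nth_Cons split: nat.split)
  then show ?thesis unfolding minor_def
    by (simp add: det_swapcols[OF _ _ _ minor_mat_carrier])
qed

lemma minor_move: "minor f (as @ x # bs @ cs) = (-1) ^ length bs * minor f (as @ bs @ x # cs)"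
proof (induction bs arbitrary: as)
  case (Cons b bs)
  show ?case using minor_swap[of f as x b "bs @ cs"] Cons[of "as @ [b]"] by simp
qed simp

lemma minor_two_rows:
  assumes ij: "i \<noteq> j" "i < length xs" "j < length xs"
  shows "minor (f(i := \<lambda>c. a * f i c + b * f j c, j := \<lambda>c. a' * f i c + b' * f j c)) xs
    = (a * b' - b * a') * minor f xs"
proof -
  define D where "D = (\<lambda>u v. minor (f(i := u, j := v)) xs)"
  have l1: "D (\<lambda>c. a * u c + b * u' c) v = a * D u v + b * D u' v" for a b u u' v
    unfolding D_def using minor_row_linear[OF ij(2), of "f(j := v)"] ij(1) by (simp add: fun_upd_twist)
  have l2: "D v (\<lambda>c. a * u c + b * u' c) = a * D v u + b * D v u'" for a b u u' v
    unfolding D_def using minor_row_linear[OF ij(3), of "f(i := v)"] by simp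
  have d0: "D u u = 0" for u
    unfolding D_def by (rule minor_same_rows[OF ij]) (use ij(1) in simp)
  have alt: "D v u = - D u v" for u v
  proof -
    have "0 = D (\<lambda>c. 1 * u c + 1 * v c) (\<lambda>c. 1 * u c + 1 * v c)" by (rule d0[symmetric])
    also have "\<dots> = 1 * D u (\<lambda>c. 1 * u c + 1 * v c) + 1 * D v (\<lambda>c. 1 * u c + 1 * v c)" by (rule l1)
    also have "\<dots> = 1 * (1 * D u u + 1 * D u v) + 1 * (1 * D v u + 1 * D v v)" by (simp only: l2)
    finally show ?thesis using d0[of u] d0[of v] by (simp add: add_eq_0_iff)
  qed
  let ?v = "\<lambda>c. a' * f i c + b' * f j c"
  have "D (\<lambda>c. a * f i c + b * f j c) ?v = a * D (f i) ?v + b * D (f j) ?v" by (rule l1)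
  also have "\<dots> = a * (a' * D (f i) (f i) + b' * D (f i) (f j)) + b * (a' * D (f j) (f i) + b' * D (f j) (f j))"
    by (simp only: l2)
  also have "\<dots> = (a * b' - b * a') * D (f i) (f j)"
    using d0[of "f i"] d0[of "f j"] alt[of "f j" "f i"] by (simp add: algebra_simps)
  finally have "D (\<lambda>c. a * f i c + b * f j c) ?v = (a * b' - b * a') * D (f i) (f j)" .
  then show ?thesis using ij(1) by (simp add: D_def)
qed

text \<open>A lower triangular change of rows respects each initial block of rows, so it only
  rescales the minors by diagonal entries.\<close>

lemma minor_triangular:
  assumes "\<And>i c. i < length xs \<Longrightarrow> c \<in> set xs \<Longrightarrow> g i c = (\<Sum>l\<le>i. T i l * h l c)"
  shows "minor g xs = (\<Prod>i<length xs. T i i) * minor h xs"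
proof -
  let ?n = "length xs"
  define A where "A = Matrix.mat ?n ?n (\<lambda>(i, l). if l \<le> i then T i l else 0)"
  have A: "A \<in> carrier_mat ?n ?n" by (simp add: A_def)
  have "minor_mat g xs = A * minor_mat h xs"
  proof (rule eq_matI)
    fix i j assume ij: "i < dim_row (A * minor_mat h xs)" "j < dim_col (A * minor_mat h xs)"
    then have ij: "i < ?n" "j < ?n" by (auto simp: A_def)
    have "(A * minor_mat h xs) $$ (i, j) = (\<Sum>l<?n. (if l \<le> i then T i l else 0) * h l (xs ! j))"
      using ij A by (simp add: scalar_prod_def A_def atLeast0LessThan)
    also have "\<dots> = (\<Sum>l\<le>i. T i l * h l (xs ! j))"
      using ij by (intro sum.mono_neutral_cong_right) auto
    finally show "minor_mat g xs $$ (i, j) = (A * minor_mat h xs) $$ (i, j)"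
      using ij assms[of i "xs ! j"] by simp
  qed (auto simp: A_def)
  moreover have "Determinant.det A = (\<Prod>i<?n. T i i)"
    by (subst det_lower_triangular[OF _ A])
      (auto simp: A_def prod_list_diag_prod atLeast0LessThan intro!: prod.cong)
  ultimately show ?thesis unfolding minor_def
    by (simp add: det_mult[OF A minor_mat_carrier])
qed

text \<open>Cramer's rule: the identity \<open>A \<cdot> adj A = det A\<close> applied to the column \<open>x\<close>.\<close>

lemma minor_cramer:
  assumes "l < length ys"
  shows "minor h ys * h l x = (\<Sum>j<length ys. minor h (ys[j := x]) * h l (ys ! j))"
proof -
  let ?s = "length ys" and ?A = "minor_mat h ys"
  have "(\<Sum>j<?s. minor h (ys[j := x]) * h l (ys ! j))
      = (\<Sum>j<?s. \<Sum>m<?s. h m x * (h l (ys ! j) * cofactor ?A m j))"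
    by (intro sum.cong) (auto simp: minor_column_expansion sum_distrib_right sum_distrib_left mult_ac)
  also have "\<dots> = (\<Sum>m<?s. h m x * (\<Sum>j<?s. h l (ys ! j) * cofactor ?A m j))"
    by (subst sum.swap) (simp add: sum_distrib_left)
  also have "\<dots> = (\<Sum>m<?s. h m x * (if m = l then minor h ys else 0))"
  proof (intro sum.cong refl arg_cong2[of _ _ _ _ "(*)"])
    fix m assume "m \<in> {..<?s}"
    then have m: "m < ?s" by simp
    have "(\<Sum>j<?s. h l (ys ! j) * cofactor ?A m j) = (?A * adj_mat ?A) $$ (l, m)"
      using assms m by (simp add: adj_mat_def scalar_prod_def atLeast0LessThan)
    also have "\<dots> = (if m = l then minor h ys else 0)"
      unfolding adj_mat(2)[OF minor_mat_carrier] minor_def using assms m by simp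
    finally show "(\<Sum>j<?s. h l (ys ! j) * cofactor ?A m j) = (if m = l then minor h ys else 0)" .
  qed
  also have "\<dots> = minor h ys * h l x"
    using assms by (simp add: if_distrib mult.commute cong: if_cong)
  finally show ?thesis by simp
qed

text \<open>The incidence Pluecker relations. The rows of \<open>f\<close> are combinations of those
  of \<open>h\<close>, so the expression of column \<open>x\<close> through the columns
  \<open>ys\<close> by Cramer's rule carries over from \<open>h\<close> to \<open>f\<close>; then
  one expands along column \<open>p\<close>.\<close>

lemma minor_exchange:
  assumes span: "\<And>i c. i < length xs \<Longrightarrow> f i c = (\<Sum>l<length ys. T i l * h l c)"
    and p: "p < length xs"
  shows "minor h ys * minor f (xs[p := x])
    = (\<Sum>j<length ys. minor h (ys[j := x]) * minor f (xs[p := ys ! j]))"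
proof -
  let ?s = "length ys" and ?C = "\<lambda>i. cofactor (minor_mat f xs) i p"
  have f: "minor h ys * f i x = (\<Sum>j<?s. minor h (ys[j := x]) * f i (ys ! j))" if "i < length xs" for i
  proof -
    have "minor h ys * f i x = (\<Sum>l<?s. T i l * (minor h ys * h l x))"
      using span[OF that] by (simp add: sum_distrib_left mult_ac)
    also have "\<dots> = (\<Sum>l<?s. \<Sum>j<?s. T i l * (minor h (ys[j := x]) * h l (ys ! j)))"
      unfolding sum_distrib_left[symmetric]
      by (intro sum.cong refl arg_cong2[of _ _ _ _ "(*)"] minor_cramer) simp
    also have "\<dots> = (\<Sum>j<?s. minor h (ys[j := x]) * f i (ys ! j))"
      by (subst sum.swap) (simp add: span[OF that] sum_distrib_left mult_ac)
    finally show ?thesis .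
  qed
  have "minor h ys * minor f (xs[p := x]) = (\<Sum>i<length xs. (minor h ys * f i x) * ?C i)"
    by (simp add: minor_column_expansion[OF p] sum_distrib_left mult_ac)
  also have "\<dots> = (\<Sum>i<length xs. \<Sum>j<?s. minor h (ys[j := x]) * (f i (ys ! j) * ?C i))"
    by (intro sum.cong refl) (simp add: f sum_distrib_right mult.assoc)
  also have "\<dots> = (\<Sum>j<?s. minor h (ys[j := x]) * minor f (xs[p := ys ! j]))"
    by (subst sum.swap) (simp add: minor_column_expansion[OF p] sum_distrib_left)
  finally show ?thesis .
qed

lemma minor_three_term:
  assumes span: "\<And>l c. l \<le> length xs \<Longrightarrow> f l c = (\<Sum>m<Suc (Suc (length xs)). T l m * h m c)"
  shows "minor f (xs @ [j]) * minor h (xs @ [i, k])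
    = minor f (xs @ [i]) * minor h (xs @ [j, k]) + minor f (xs @ [k]) * minor h (xs @ [i, j])"
proof -
  let ?m = "length xs" and ?ys = "xs @ [i, k]"
  have len: "length ?ys = Suc (Suc ?m)" by simp
  have "minor h ?ys * minor f ((xs @ [j])[?m := j])
    = (\<Sum>l<length ?ys. minor h (?ys[l := j]) * minor f ((xs @ [j])[?m := ?ys ! l]))"
    by (rule minor_exchange) (use span in auto)
  \<comment> \<open>Exchanging with an element of \<open>xs\<close> repeats a column, so only the
    summands of \<open>i\<close> and \<open>k\<close> survive.\<close>
  moreover have "minor f ((xs @ [j])[?m := ?ys ! l]) = 0" if "l < ?m" for l
    by (rule minor_not_distinct) (use that in \<open>auto simp: nth_append\<close>)
  ultimately show ?thesis unfolding len
    by (simp add: nth_append list_update_append lessThan_Suc mult.commute)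
qed

text \<open>The next identity is the Pluecker relation after adjoining two unit vectors as extra columns.\<close>

lemma minor_pencil:
  fixes f :: "nat \<Rightarrow> 'c \<Rightarrow> 'k::comm_ring_1"
  defines "g \<equiv> \<lambda>m. f(m := f (Suc m))"
  shows "minor f (xs @ [a]) * minor (g (length xs)) (xs @ [b]) - minor f (xs @ [b]) * minor (g (length xs)) (xs @ [a])
    = minor f xs * minor f (xs @ [a, b])"
proof -
  let ?m = "length xs"
  \<comment> \<open>\<open>Inr False\<close> and \<open>Inr True\<close> are the unit vectors of the
    rows \<open>?m\<close> and \<open>Suc ?m\<close>. Expanding along one of them deletes its row:
    without row \<open>Suc ?m\<close> a minor of \<open>f\<close> remains, without row
    \<open>?m\<close> one of \<open>g ?m\<close>.\<close>
  define F :: "nat \<Rightarrow> 'c + bool \<Rightarrow> 'k" where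
    "F = (\<lambda>i c. case c of Inl c \<Rightarrow> f i c | Inr e \<Rightarrow> if i = (if e then Suc ?m else ?m) then 1 else 0)"
  let ?X = "map Inl xs" and ?N = "Inr False :: 'c + bool" and ?L = "Inr True :: 'c + bool"
  have Inl: "minor F (map Inl ys) = minor f ys" for ys
    by (simp add: minor_map F_def)
  have unit: "minor F (ys @ [c]) = (-1) ^ (r + length ys) * minor (\<lambda>i. F (if i < r then i else Suc i)) ys"
    if "r \<le> length ys" "\<And>l. F l c = (if l = r then 1 else 0)" for ys c r
    unfolding minor_snoc that(2) using that(1) by (simp add: if_distrib[of "\<lambda>y. y * _"] cong: if_cong)
  have L: "minor F (?X @ [Inl c, ?L]) = minor f (xs @ [c])" for c
  proof -
    have "minor F (?X @ [Inl c, ?L]) = minor (\<lambda>i. F (if i < Suc ?m then i else Suc i)) (?X @ [Inl c])"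
      using unit[of "Suc ?m" "?X @ [Inl c]" ?L] by (simp add: F_def)
    also have "\<dots> = minor F (?X @ [Inl c])" by (intro minor_cong) auto
    finally show ?thesis using Inl[of "xs @ [c]"] by simp
  qed
  have N: "minor F (?X @ [Inl c, ?N]) = - minor (g ?m) (xs @ [c])" for c
  proof -
    have "minor F (?X @ [Inl c, ?N]) = - minor (\<lambda>i. F (if i < ?m then i else Suc i)) (map Inl (xs @ [c]))"
      using unit[of ?m "?X @ [Inl c]" ?N] by (simp add: F_def)
    also have "\<dots> = - minor (g ?m) (xs @ [c])"
      unfolding minor_map by (auto intro!: minor_cong simp: F_def g_def less_Suc_eq)
    finally show ?thesis .
  qed
  have NL: "minor F (?X @ [?N, ?L]) = minor f xs"
  proof -
    have "minor F (?X @ [?N, ?L]) = minor (\<lambda>i. F (if i < Suc ?m then i else Suc i)) (?X @ [?N])"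
      using unit[of "Suc ?m" "?X @ [?N]" ?L] by (simp add: F_def)
    also have "\<dots> = minor F (?X @ [?N])" by (auto intro!: minor_cong)
    also have "\<dots> = minor F ?X" using unit[of ?m ?X ?N] by (auto intro!: minor_cong simp: F_def)
    finally show ?thesis using Inl by simp
  qed
  let ?ys = "?X @ [Inl a, Inl b]"
  have len: "length ?ys = Suc (Suc ?m)" by simp
  have "minor F ?ys * minor F ((?X @ [?N, ?L])[?m := ?N])
    = (\<Sum>l<length ?ys. minor F (?ys[l := ?N]) * minor F ((?X @ [?N, ?L])[?m := ?ys ! l]))"
    using minor_exchange[of "?X @ [?N, ?L]" F "\<lambda>i l. if i = l then 1 else 0" F ?ys ?m ?N]
    by (simp add: if_distrib[of "\<lambda>y. y * _"] cong: if_cong)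
  moreover have "minor F ((?X @ [?N, ?L])[?m := ?ys ! l]) = 0" if "l < ?m" for l
    by (rule minor_not_distinct) (use that in \<open>auto simp: nth_append list_update_append\<close>)
  ultimately have "minor F ?ys * minor F (?X @ [?N, ?L])
    = minor F (?X @ [?N, Inl b]) * minor F (?X @ [Inl a, ?L]) + minor F (?X @ [Inl a, ?N]) * minor F (?X @ [Inl b, ?L])"
    unfolding len by (simp add: nth_append list_update_append lessThan_Suc add.commute)
  moreover have "minor F (?X @ [?N, Inl b]) = - minor F (?X @ [Inl b, ?N])"
    using minor_swap[of F ?X ?N "Inl b" "[]"] by simp
  ultimately show ?thesis using Inl[of "xs @ [a, b]"] by (simp add: L N NL algebra_simps)
qed

text \<open>If every extension vanished, expansion along the last column would be a linear relation
  among the rows up to \<open>length xs\<close>, with nonzero coefficient \<open>minor h xs\<close>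
  at the last of them, and every larger minor would vanish.\<close>

lemma ex_minor_snoc_nonzero:
  fixes h :: "nat \<Rightarrow> 'c \<Rightarrow> 'k::idom"
  assumes xs: "minor h xs \<noteq> 0" and ys: "minor h ys \<noteq> 0" and len: "length xs < length ys"
  shows "\<exists>c. minor h (xs @ [c]) \<noteq> 0"
proof (rule ccontr)
  assume *: "\<not> ?thesis"
  let ?m = "length xs"
  let ?c = "\<lambda>l. (-1) ^ (l + ?m) * minor (\<lambda>i. h (if i < l then i else Suc i)) xs"
  define T where "T = (\<lambda>i l. if i = ?m then ?c l else if l = i then 1 else 0)"
  \<comment> \<open>Row \<open>?m\<close> is replaced by this relation, that is by zero, written as
    a combination with zero coefficients to match \<open>minor_row_linear\<close>.\<close>
  define g where "g = h(?m := (\<lambda>c. 0 * h 0 c + 0 * h 0 c))"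
  have "minor g ys = (\<Prod>i<length ys. T i i) * minor h ys"
  proof (rule minor_triangular[where T = T])
    fix i c
    show "g i c = (\<Sum>l\<le>i. T i l * h l c)"
    proof (cases "i = ?m")
      case True
      have "(\<Sum>l\<le>?m. ?c l * h l c) = 0"
        using * minor_snoc[of h xs c] by (simp add: mult.commute)
      then show ?thesis using True by (simp add: g_def T_def)
    next
      case False
      then show ?thesis by (simp add: g_def T_def if_distrib[of "\<lambda>y. y * _"] cong: if_cong)
    qed
  qed
  moreover have "(\<Prod>i<length ys. T i i) = minor h xs"
  proof -
    have "(\<Prod>i<length ys. T i i) = (\<Prod>i<length ys. if i = ?m then minor h xs else 1)"
      using minor_snoc_last_coeff[of xs h] by (intro prod.cong) (auto simp: T_def)
    then show ?thesis using len by simp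
  qed
  moreover have "minor g ys = 0" unfolding g_def by (subst minor_row_linear[OF len]) simp
  ultimately show False using xs ys by simp
qed

text \<open>Row \<open>d\<close> becomes the functional taking a column \<open>c\<close> to the
  minor of the first \<open>d\<close> pivots and \<open>c\<close>. By expansion it is a combination
  of the rows up to \<open>d\<close>, with coefficient \<open>a d * minor h (take d js)\<close> at
  row \<open>d\<close>, so the change of rows is triangular.\<close>

lemma minor_normal_rows:
  fixes h :: "nat \<Rightarrow> 'c \<Rightarrow> 'k::comm_ring_1"
  assumes "length xs \<le> length js"
  shows "minor (\<lambda>d c. a d * minor h (take d js @ [c])) xs
    = (\<Prod>k<length xs. a k * minor h (take k js)) * minor h xs"
proof -
  let ?T = "\<lambda>k l. a k * ((-1) ^ (l + k) * minor (\<lambda>i. h (if i < l then i else Suc i)) (take k js))"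
  have "minor (\<lambda>d c. a d * minor h (take d js @ [c])) xs = (\<Prod>k<length xs. ?T k k) * minor h xs"
    by (rule minor_triangular[where T = ?T])
      (use assms in \<open>auto simp: minor_snoc min_absorb2 sum_distrib_left mult_ac\<close>)
  moreover have "?T k k = a k * minor h (take k js)" if "k < length xs" for k
    using minor_snoc_last_coeff[of "take k js" h] assms that by (simp add: min_absorb2)
  ultimately show ?thesis by simp
qed

text \<open>A greedy choice. The cost may depend on the columns already chosen: it will be a fixed
  weight for Gale-extremal bases and the valuation of the enlarged set for initial forms.\<close>

lemma ex_pivots:
  fixes h :: "nat \<Rightarrow> 'c::finite \<Rightarrow> 'k::idom" and cost :: "'c list \<Rightarrow> 'c \<Rightarrow> real"
  assumes ys: "minor h ys \<noteq> 0"
  shows "\<exists>js. length js = length ys \<and> distinct js \<and> (\<forall>d\<le>length ys. minor h (take d js) \<noteq> 0) \<and>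
    (\<forall>d<length ys. \<forall>c. minor h (take d js @ [c]) \<noteq> 0 \<longrightarrow> cost (take d js) (js ! d) \<le> cost (take d js) c)"
proof -
  have "\<exists>js. length js = m \<and> (\<forall>d\<le>m. minor h (take d js) \<noteq> 0) \<and>
    (\<forall>d<m. \<forall>c. minor h (take d js @ [c]) \<noteq> 0 \<longrightarrow> cost (take d js) (js ! d) \<le> cost (take d js) c)"
    if "m \<le> length ys" for m
    using that
  proof (induction m)
    case (Suc m)
    then obtain js where js: "length js = m" "\<And>d. d \<le> m \<Longrightarrow> minor h (take d js) \<noteq> 0"
      "\<And>d c. d < m \<Longrightarrow> minor h (take d js @ [c]) \<noteq> 0 \<Longrightarrow> cost (take d js) (js ! d) \<le> cost (take d js) c"
      by force
    define C where "C = {c. minor h (js @ [c]) \<noteq> 0}"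
    have "C \<noteq> {}" using ex_minor_snoc_nonzero[of h js ys] js(2)[of m] js(1) ys Suc.prems
      by (auto simp: C_def)
    then obtain j where j: "j \<in> C" "\<And>c. c \<in> C \<Longrightarrow> cost js j \<le> cost js c"
      using arg_min_if_finite[of C "cost js"] by (meson finite leI)
    show ?case
    proof (intro exI[of _ "js @ [j]"] conjI allI impI)
      show "length (js @ [j]) = Suc m" using js by simp
      show "minor h (take d (js @ [j])) \<noteq> 0" if "d \<le> Suc m" for d
        using that js(1) js(2)[of d] j(1) by (cases "d = Suc m") (auto simp: C_def)
      show "cost (take d (js @ [j])) ((js @ [j]) ! d) \<le> cost (take d (js @ [j])) c"
        if "d < Suc m" "minor h (take d (js @ [j]) @ [c]) \<noteq> 0" for d c
        using that js(1) js(3)[of d c] j(2)[of c] by (cases "d = m") (auto simp: C_def nth_append)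
    qed
  qed (auto intro!: exI[of _ "[]"])
  from this[OF order_refl] obtain js where js: "length js = length ys"
    "\<forall>d\<le>length ys. minor h (take d js) \<noteq> 0"
    "\<forall>d<length ys. \<forall>c. minor h (take d js @ [c]) \<noteq> 0 \<longrightarrow> cost (take d js) (js ! d) \<le> cost (take d js) c"
    by blast
  moreover have "minor h js \<noteq> 0" using js(1) js(2)[rule_format, of "length ys"] by simp
  then have "distinct js" using minor_not_distinct by blast
  ultimately show ?thesis by blast
qed

section \<open>Minors indexed by sets of columns\<close>

definition pl :: "(nat \<Rightarrow> 'c::linorder \<Rightarrow> 'k::comm_ring_1) \<Rightarrow> 'c set \<Rightarrow> 'k" where
  "pl f B = minor f (sorted_list_of_set B)"

lemma pl_empty [simp]: "pl f {} = 1"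
  by (simp add: pl_def)

lemma sorted_list_of_set_eqI:
  assumes "finite S" "sorted_wrt (<) xs" "set xs = S"
  shows "sorted_list_of_set S = (xs :: 'c::linorder list)"
  using sorted_list_of_set_unique[OF assms(1), of xs] assms(2,3)
  by (metis distinct_card strict_sorted_iff)

lemma sorted_list_of_set_split:
  fixes S :: "'c::linorder set"
  assumes "finite S" "x \<notin> S"
  shows "sorted_list_of_set S = sorted_list_of_set {y\<in>S. y < x} @ sorted_list_of_set {y\<in>S. x < y}"
    "sorted_list_of_set (insert x S) = sorted_list_of_set {y\<in>S. y < x} @ x # sorted_list_of_set {y\<in>S. x < y}"
proof -
  have cases: "y < x \<or> x < y" if "y \<in> S" for y
    using assms(2) that by (metis neq_iff)
  then have S: "{y\<in>S. y < x} \<union> {y\<in>S. x < y} = S" by blast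
  have *: "sorted_list_of_set S = sorted_list_of_set {y\<in>S. y < x} @ sorted_list_of_set {y\<in>S. x < y}"
  proof (rule sorted_list_of_set_eqI)
    show "set (sorted_list_of_set {y\<in>S. y < x} @ sorted_list_of_set {y\<in>S. x < y}) = S"
      using S assms(1) by simp
  qed (use assms in \<open>auto simp: sorted_wrt_append\<close>)
  have **: "sorted_list_of_set (insert x S) = sorted_list_of_set {y\<in>S. y < x} @ x # sorted_list_of_set {y\<in>S. x < y}"
  proof (rule sorted_list_of_set_eqI)
    show "set (sorted_list_of_set {y\<in>S. y < x} @ x # sorted_list_of_set {y\<in>S. x < y}) = insert x S"
      using S assms(1) by simp
  qed (use assms in \<open>auto simp: sorted_wrt_append\<close>)
  show "sorted_list_of_set S = sorted_list_of_set {y\<in>S. y < x} @ sorted_list_of_set {y\<in>S. x < y}"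
    "sorted_list_of_set (insert x S) = sorted_list_of_set {y\<in>S. y < x} @ x # sorted_list_of_set {y\<in>S. x < y}"
    by (rule *, rule **)
qed

lemma pl_insert:
  assumes "finite S" "x \<notin> S"
  shows "pl f (insert x S) = (-1) ^ card {y\<in>S. x < y} * minor f (sorted_list_of_set S @ [x])"
  unfolding pl_def sorted_list_of_set_split[OF assms]
  using minor_move[of f "sorted_list_of_set {y\<in>S. y < x}" x "sorted_list_of_set {y\<in>S. x < y}" "[]"] by simp

lemma pl_insert2:
  assumes S: "finite S" "i \<notin> S" "k \<notin> S" and ik: "i < k"
  shows "pl f (insert i (insert k S)) =
    (-1) ^ (card {y\<in>S. i < y} + card {y\<in>S. k < y}) * minor f (sorted_list_of_set S @ [i, k])"
proof -
  let ?l = "sorted_list_of_set {y\<in>S. y < i}" and ?r = "sorted_list_of_set {y\<in>S. i < y}"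
  have "pl f (insert k (insert i S)) = (-1) ^ card {y\<in>insert i S. k < y} * minor f (sorted_list_of_set (insert i S) @ [k])"
    using assms by (intro pl_insert) auto
  moreover have "{y\<in>insert i S. k < y} = {y\<in>S. k < y}" using ik by auto
  moreover have "minor f (sorted_list_of_set (insert i S) @ [k]) =
      (-1) ^ card {y\<in>S. i < y} * minor f (sorted_list_of_set S @ [i, k])"
    unfolding sorted_list_of_set_split[OF S(1,2)] using minor_move[of f ?l i ?r "[k]"] by simp
  ultimately show ?thesis by (simp add: insert_commute power_add)
qed

text \<open>Sorting the columns multiplies all three products by the same sign, given by the
  elements of \<open>S\<close> above \<open>i\<close>, \<open>j\<close> and \<open>k\<close>. With
  \<open>i < j < k\<close> no minus sign is left, which is what positivity and tropicalization rely
  on.\<close>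

lemma pl_three_term:
  fixes f h :: "nat \<Rightarrow> 'c::linorder \<Rightarrow> 'k::comm_ring_1"
  assumes S: "finite S" "i \<notin> S" "j \<notin> S" "k \<notin> S" and ijk: "i < j" "j < k"
    and span: "\<And>l c. l \<le> card S \<Longrightarrow> f l c = (\<Sum>m<Suc (Suc (card S)). T l m * h m c)"
  shows "pl f (insert j S) * pl h (insert i (insert k S))
    = pl f (insert i S) * pl h (insert j (insert k S)) + pl f (insert k S) * pl h (insert i (insert j S))"
proof -
  let ?xs = "sorted_list_of_set S" and ?c = "\<lambda>x. card {y\<in>S. x < y}"
  have "minor f (?xs @ [j]) * minor h (?xs @ [i, k])
    = minor f (?xs @ [i]) * minor h (?xs @ [j, k]) + minor f (?xs @ [k]) * minor h (?xs @ [i, j])"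
    by (rule minor_three_term) (use span in simp)
  then have "(-1) ^ (?c i + ?c j + ?c k) * (minor f (?xs @ [j]) * minor h (?xs @ [i, k]))
    = (-1) ^ (?c i + ?c j + ?c k) * (minor f (?xs @ [i]) * minor h (?xs @ [j, k]) + minor f (?xs @ [k]) * minor h (?xs @ [i, j]))"
    by simp
  moreover note pl_insert[OF S(1,2), of f] pl_insert[OF S(1,3), of f] pl_insert[OF S(1,4), of f]
    pl_insert2[OF S(1,2,4), of h] pl_insert2[OF S(1,3,4), of h] pl_insert2[OF S(1,2,3), of h]
  ultimately show ?thesis using ijk by (simp add: power_add algebra_simps)
qed

lemma pl_pencil:
  fixes f :: "nat \<Rightarrow> 'c::linorder \<Rightarrow> 'k::comm_ring_1"
  assumes S: "finite S" "a \<notin> S" "b \<notin> S" and ab: "a < b"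
  shows "pl f (insert a S) * pl (f(card S := f (Suc (card S)))) (insert b S)
      - pl f (insert b S) * pl (f(card S := f (Suc (card S)))) (insert a S)
    = pl f S * pl f (insert a (insert b S))"
proof -
  let ?xs = "sorted_list_of_set S" and ?c = "\<lambda>x. card {y\<in>S. x < y}" and ?g = "f(card S := f (Suc (card S)))"
  have "(-1) ^ (?c a + ?c b) * (minor f (?xs @ [a]) * minor ?g (?xs @ [b]) - minor f (?xs @ [b]) * minor ?g (?xs @ [a]))
    = (-1) ^ (?c a + ?c b) * (minor f ?xs * minor f (?xs @ [a, b]))"
    using minor_pencil[of f ?xs a b] by simp
  moreover note pl_insert[OF S(1,2), of f] pl_insert[OF S(1,3), of f] pl_insert[OF S(1,2), of ?g]
    pl_insert[OF S(1,3), of ?g] pl_insert2[OF S(1,2,3) ab, of f] pl_def[of f S]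
  ultimately show ?thesis by (simp add: power_add algebra_simps)
qed

text \<open>Each new column moves past the larger ones, so the sign depends on the order of the
  columns alone; hence it is chosen before \<open>f\<close>.\<close>

lemma minor_eq_sign_pl:
  "distinct xs \<Longrightarrow> \<exists>e\<in>{1, -1 :: 'k::comm_ring_1}. \<forall>f. minor f xs = e * pl f (set (xs :: 'c::linorder list))"
proof (induction xs rule: rev_induct)
  case (snoc x xs)
  then obtain e :: 'k where e: "e \<in> {1, -1}" "\<And>f. minor f xs = e * pl f (set xs)"
    by (metis (no_types, lifting) butlast_snoc distinct_butlast)
  have "minor f (xs @ [x]) = e * minor f (sorted_list_of_set (set xs) @ [x])" for f :: "nat \<Rightarrow> 'c \<Rightarrow> 'k"
    unfolding minor_snoc e(2) using snoc.prems
    by (simp add: pl_def distinct_card sum_distrib_left mult_ac)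
  moreover have "minor f (sorted_list_of_set (set xs) @ [x]) = (-1) ^ card {y\<in>set xs. x < y} * pl f (set (xs @ [x]))"
    for f :: "nat \<Rightarrow> 'c \<Rightarrow> 'k"
    using snoc.prems pl_insert[of "set xs" x f] by (simp add: mult.assoc[symmetric] power_mult_distrib[symmetric])
  ultimately have "minor f (xs @ [x]) = (e * (-1) ^ card {y\<in>set xs. x < y}) * pl f (set (xs @ [x]))"
    for f :: "nat \<Rightarrow> 'c \<Rightarrow> 'k"
    by (simp add: mult.assoc)
  moreover have "e * (-1) ^ card {y\<in>set xs. x < y} \<in> {1, -1}"
    using e(1) by (cases "even (card {y\<in>set xs. x < y})") auto
  ultimately show ?case by blast
qed auto

section \<open>Supports of totally nonnegative flags\<close>

text \<open>The bases of the flag matroid of \<open>h\<close>, seen as vertices of the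
  permutahedron.\<close>

definition supp :: "(nat \<Rightarrow> 'n::{finite,linorder} \<Rightarrow> 'k::comm_ring_1) \<Rightarrow> 'n perm set" where
  "supp h = {\<sigma>. \<forall>d. pl h (lev \<sigma> d) \<noteq> 0}"

text \<open>Gale-smallest in every level means Bruhat-largest, since \<open>flag_le\<close> reverses
  the Gale order: \<open>gale_min\<close> describes the top of the support and
  \<open>gale_max\<close> the bottom.\<close>

definition gale_min :: "(nat \<Rightarrow> 'n::{finite,linorder} \<Rightarrow> 'k::comm_ring_1) \<Rightarrow> 'n perm \<Rightarrow> bool" where
  "gale_min h w \<longleftrightarrow> w \<in> supp h \<and> (\<forall>I. pl h I \<noteq> 0 \<longrightarrow> gale_le (lev w (card I)) I)"

definition gale_max :: "(nat \<Rightarrow> 'n::{finite,linorder} \<Rightarrow> 'k::comm_ring_1) \<Rightarrow> 'n perm \<Rightarrow> bool" where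
  "gale_max h v \<longleftrightarrow> v \<in> supp h \<and> (\<forall>I. pl h I \<noteq> 0 \<longrightarrow> gale_le I (lev v (card I)))"

section \<open>Gale-extremal bases from greedy pivots\<close>

lemma det_nonzero_imp_perm:
  assumes "A \<in> carrier_mat m m" "Determinant.det A \<noteq> (0 :: 'k::idom)"
  shows "\<exists>p. p permutes {0..<m} \<and> (\<forall>i<m. A $$ (i, p i) \<noteq> 0)"
proof (rule ccontr)
  assume *: "\<not> ?thesis"
  have "(\<Prod>i = 0..<m. A $$ (i, p i)) = 0" if "p permutes {0..<m}" for p
    using * that by (intro prod_zero) force+
  then have "Determinant.det A = 0" unfolding det_def'[OF assms(1)] by (intro sum.neutral) simp
  then show False using assms(2) by simp
qed

lemma ex_perm_list:
  fixes js :: "'n::{finite,linorder} list"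
  assumes "distinct js" "length js = CARD('n)"
  shows "\<exists>\<sigma>. \<forall>d\<le>CARD('n). lev \<sigma> d = set (take d js)"
proof -
  obtain \<sigma> where \<sigma>: "\<forall>d<CARD('n). pos \<sigma> d = js ! d"
    using ex_perm_pos[of "(!) js"] assms by (auto simp: inj_on_nth)
  have "lev \<sigma> d = set (take d js)" if "d \<le> CARD('n)" for d
    unfolding lev_image[OF that] using \<sigma> assms(2) that
    by (force simp: set_conv_nth image_iff)
  then show ?thesis by blast
qed

lemma pl_set_nonzero_iff:
  fixes h :: "nat \<Rightarrow> 'c::linorder \<Rightarrow> 'k::idom"
  shows "distinct xs \<Longrightarrow> pl h (set xs) \<noteq> 0 \<longleftrightarrow> minor h xs \<noteq> 0"
  using minor_eq_sign_pl[of xs, where 'k='k] by auto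

text \<open>Pivots of least weight are taken greedily. In the normalized matrix, row
  \<open>i\<close> is nonzero only at columns of weight at least that of pivot \<open>i\<close>, so
  a nonzero term of the determinant on \<open>I\<close> matches the first pivots injectively with
  elements of \<open>I\<close> of no smaller weight. One flag thus serves all cardinalities.\<close>

lemma ex_pivot_flag:
  fixes h :: "nat \<Rightarrow> 'n::{finite,linorder} \<Rightarrow> 'k::idom" and \<kappa> :: "'n \<Rightarrow> real"
  assumes "pl h UNIV \<noteq> 0"
  shows "\<exists>\<sigma>\<in>supp h. \<forall>I t. pl h I \<noteq> 0 \<longrightarrow> card {x\<in>lev \<sigma> (card I). t \<le> \<kappa> x} \<le> card {x\<in>I. t \<le> \<kappa> x}"
proof -
  let ?ys = "sorted_list_of_set (UNIV :: 'n set)"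
  obtain js where len: "length js = CARD('n)" and dist: "distinct js"
    and nz: "\<And>d. d \<le> CARD('n) \<Longrightarrow> minor h (take d js) \<noteq> 0"
    and min: "\<And>d c. d < CARD('n) \<Longrightarrow> minor h (take d js @ [c]) \<noteq> 0 \<Longrightarrow> \<kappa> (js ! d) \<le> \<kappa> c"
    using ex_pivots[of h ?ys "\<lambda>_. \<kappa>"] assms by (auto simp: pl_def)
  obtain \<sigma> where \<sigma>: "\<And>d. d \<le> CARD('n) \<Longrightarrow> lev \<sigma> d = set (take d js)"
    using ex_perm_list[OF dist len] by blast
  have "\<sigma> \<in> supp h"
    unfolding supp_def
  proof safe
    fix d assume "pl h (lev \<sigma> d) = 0"
    then show False
      using nz[of d] \<sigma>[of d] dist pl_set_nonzero_iff[of "take d js" h] lev_card[of d \<sigma>] assms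
      by (cases "d \<le> CARD('n)") auto
  qed
  moreover have "card {x\<in>lev \<sigma> (card I). t \<le> \<kappa> x} \<le> card {x\<in>I. t \<le> \<kappa> x}" if I: "pl h I \<noteq> 0" for I t
  proof -
    let ?xs = "sorted_list_of_set I" and ?m = "card I"
    have m: "?m \<le> CARD('n)" by (simp add: card_mono)
    let ?g = "\<lambda>d c. 1 * minor h (take d js @ [c])"
    have "minor ?g ?xs = (\<Prod>k<length ?xs. 1 * minor h (take k js)) * minor h ?xs"
      by (rule minor_normal_rows) (use m len in simp)
    moreover have "(\<Prod>k<?m. minor h (take k js)) \<noteq> 0" using nz m by auto
    ultimately have "minor ?g ?xs \<noteq> 0" using I by (simp add: pl_def)
    then obtain p where p: "p permutes {0..<?m}" "\<And>i. i < ?m \<Longrightarrow> minor_mat ?g ?xs $$ (i, p i) \<noteq> 0"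
      using det_nonzero_imp_perm[OF minor_mat_carrier, of ?g ?xs] unfolding minor_def[of ?g] by auto
    have pm: "p i < ?m" if "i < ?m" for i using permutes_in_image[OF p(1), of i] that by simp
    have le: "\<kappa> (js ! i) \<le> \<kappa> (?xs ! p i)" if "i < ?m" for i
      using min[of i "?xs ! p i"] p(2)[OF that] pm[OF that] that m by simp
    have "{x\<in>lev \<sigma> ?m. t \<le> \<kappa> x} = (!) js ` {i. i < ?m \<and> t \<le> \<kappa> (js ! i)}"
      unfolding \<sigma>[OF m] nth_image[symmetric, of ?m js, OF m[folded len]] by auto
    then have "card {x\<in>lev \<sigma> ?m. t \<le> \<kappa> x} \<le> card {i. i < ?m \<and> t \<le> \<kappa> (js ! i)}"
      by (simp add: card_image_le)
    also have "\<dots> = card ((\<lambda>i. ?xs ! p i) ` {i. i < ?m \<and> t \<le> \<kappa> (js ! i)})"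
    proof (rule sym, rule card_image, rule inj_onI)
      fix i j assume "i \<in> {i. i < ?m \<and> t \<le> \<kappa> (js ! i)}" "j \<in> {i. i < ?m \<and> t \<le> \<kappa> (js ! i)}" "?xs ! p i = ?xs ! p j"
      then have "p i = p j" using pm[of i] pm[of j] by (simp add: nth_eq_iff_index_eq)
      then show "i = j" using permutes_inj[OF p(1)] by (simp add: inj_eq)
    qed
    also have "\<dots> \<le> card {x\<in>I. t \<le> \<kappa> x}"
    proof (rule card_mono)
      show "(\<lambda>i. ?xs ! p i) ` {i. i < ?m \<and> t \<le> \<kappa> (js ! i)} \<subseteq> {x\<in>I. t \<le> \<kappa> x}"
      proof clarsimp
        fix i assume i: "i < ?m" "t \<le> \<kappa> (js ! i)"
        then have "?xs ! p i \<in> set ?xs" using pm[of i] by (intro nth_mem) simp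
        then show "?xs ! p i \<in> I \<and> t \<le> \<kappa> (?xs ! p i)" using i le[of i] by simp
      qed
    qed simp
    finally show ?thesis .
  qed
  ultimately show ?thesis by blast
qed

lemma ex_gale_min:
  fixes h :: "nat \<Rightarrow> 'n::{finite,linorder} \<Rightarrow> 'k::idom"
  assumes "pl h UNIV \<noteq> 0"
  shows "\<exists>w. gale_min h w"
proof -
  obtain w where w: "w \<in> supp h" "\<And>I t. pl h I \<noteq> 0 \<Longrightarrow>
      card {x\<in>lev w (card I). t \<le> real (idx x)} \<le> card {x\<in>I. t \<le> real (idx x)}"
    using ex_pivot_flag[OF assms, of "\<lambda>x. real (idx x)"] by blast
  have "gale_le (lev w (card I)) I" if "pl h I \<noteq> 0" for I
    unfolding gale_le_def cnt_def
  proof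
    show "card {x\<in>lev w (card I). t \<le> x} \<le> card {x\<in>I. t \<le> x}" for t
      using w(2)[OF that, of "real (idx t)"] by (simp add: idx_le_iff)
  qed
  then show ?thesis using w(1) by (auto simp: gale_min_def)
qed

lemma ex_gale_max:
  fixes h :: "nat \<Rightarrow> 'n::{finite,linorder} \<Rightarrow> 'k::idom"
  assumes "pl h UNIV \<noteq> 0"
  shows "\<exists>v. gale_max h v"
proof -
  obtain v where v: "v \<in> supp h" "\<And>I t. pl h I \<noteq> 0 \<Longrightarrow>
      card {x\<in>lev v (card I). t \<le> - real (idx x)} \<le> card {x\<in>I. t \<le> - real (idx x)}"
    using ex_pivot_flag[OF assms, of "\<lambda>x. - real (idx x)"] by blast
  have cnt: "cnt I t = card I - card {x\<in>I. x < t}" for I and t :: 'n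
  proof -
    have "card I = cnt I t + card {x\<in>I. x < t}" unfolding cnt_def
      by (subst card_Un_disjoint[symmetric]) (auto intro!: arg_cong[of _ _ card])
    then show ?thesis by simp
  qed
  have "gale_le I (lev v (card I))" if "pl h I \<noteq> 0" for I
    unfolding gale_le_def
  proof
    fix t :: 'n
    \<comment> \<open>Indices are integers, so \<open>x < t\<close> is a weak bound on the negated
      weight; the counts then bound the complement of \<open>cnt\<close>.\<close>
    have *: "1 - real (idx t) \<le> - real (idx x) \<longleftrightarrow> x < t" for x :: 'n
      using idx_less_iff[of x t] by linarith
    have "card (lev v (card I)) = card I" by (intro card_lev card_mono) auto
    then show "cnt I t \<le> cnt (lev v (card I)) t"
      using v(2)[OF that, of "1 - real (idx t)"] unfolding * cnt by simp
  qed
  then show ?thesis using v(1) by (auto simp: gale_max_def)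
qed

lemma card_lev': "card (lev (\<sigma> :: 'n::{finite,linorder} perm) d) = min d (CARD('n))"
  by (cases "d \<le> CARD('n)") (simp_all add: card_lev lev_card)

lemma lev_min: "lev \<sigma> (min d (CARD('n))) = lev (\<sigma> :: 'n::{finite,linorder} perm) d"
  by (cases "d \<le> CARD('n)") (simp_all add: lev_card min_def)

lemma gale_min_supp:
  fixes h :: "nat \<Rightarrow> 'n::{finite,linorder} \<Rightarrow> 'k::idom"
  assumes "gale_min h w" "pl h (lev \<sigma> d) \<noteq> 0"
  shows "gale_le (lev w d) (lev \<sigma> d)"
  using assms unfolding gale_min_def by (metis card_lev' lev_min)

lemma gale_max_supp:
  fixes h :: "nat \<Rightarrow> 'n::{finite,linorder} \<Rightarrow> 'k::idom"
  assumes "gale_max h v" "pl h (lev \<sigma> d) \<noteq> 0"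
  shows "gale_le (lev \<sigma> d) (lev v d)"
  using assms unfolding gale_max_def by (metis card_lev' lev_min)

text \<open>The extremal basis is determined level by level, so levels with the same vanishing
  coordinates agree and \<open>lev_eq_outside\<close> leaves two choices.\<close>

lemma gale_min_outside:
  fixes h h' :: "nat \<Rightarrow> 'n::{finite,linorder} \<Rightarrow> 'k::idom"
  assumes d: "Suc d < CARD('n)" and w: "gale_min h w" "gale_min h' w'"
    and eq: "\<And>I. card I \<noteq> Suc d \<Longrightarrow> pl h' I = 0 \<longleftrightarrow> pl h I = 0"
  shows "w' = w \<or> w' = adj d * w"
proof (rule lev_eq_outside[OF d])
  fix e assume "e \<noteq> Suc d"
  then have "card (lev \<sigma> e) \<noteq> Suc d" for \<sigma> :: "'n perm" using d by (simp add: card_lev')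
  then show "lev w e = lev w' e"
    using gale_min_supp[OF w(1), of w' e] gale_min_supp[OF w(2), of w e] w eq[of "lev w e"] eq[of "lev w' e"]
    by (intro gale_le_antisym) (auto simp: gale_min_def supp_def)
qed

lemma gale_max_outside:
  fixes h h' :: "nat \<Rightarrow> 'n::{finite,linorder} \<Rightarrow> 'k::idom"
  assumes d: "Suc d < CARD('n)" and v: "gale_max h v" "gale_max h' v'"
    and eq: "\<And>I. card I \<noteq> Suc d \<Longrightarrow> pl h' I = 0 \<longleftrightarrow> pl h I = 0"
  shows "v' = v \<or> v' = adj d * v"
proof (rule lev_eq_outside[OF d])
  fix e assume "e \<noteq> Suc d"
  then have "card (lev \<sigma> e) \<noteq> Suc d" for \<sigma> :: "'n perm" using d by (simp add: card_lev')
  then show "lev v e = lev v' e"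
    using gale_max_supp[OF v(1), of v' e] gale_max_supp[OF v(2), of v e] v eq[of "lev v e"] eq[of "lev v' e"]
    by (intro gale_le_antisym) (auto simp: gale_max_def supp_def)
qed

text \<open>The lines between \<open>V\<^sub>d\<close> and \<open>V\<^sub>d\<^sub>+\<^sub>2\<close> form a pencil; on its two-dimensional space of directions every
  \<open>(d + 1)\<close>-set \<open>I\<close> defines a linear functional, and \<open>wedge h d J I\<close> is the determinant of two of them.\<close>

definition wedge :: "(nat \<Rightarrow> 'n::linorder \<Rightarrow> 'k::comm_ring_1) \<Rightarrow> nat \<Rightarrow> 'n set \<Rightarrow> 'n set \<Rightarrow> 'k" where
  "wedge h d J I = pl h J * pl (h(d := h (Suc d))) I - pl h I * pl (h(d := h (Suc d))) J"

lemma wedge_pencil: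
  fixes h :: "nat \<Rightarrow> 'n::{finite,linorder} \<Rightarrow> 'k::comm_ring_1"
  assumes "a \<notin> S" "b \<notin> S" "a < b" "card S = d"
  shows "wedge h d (insert a S) (insert b S) = pl h S * pl h (insert a (insert b S))"
  using pl_pencil[of S a b h] assms by (simp add: wedge_def)

text \<open>Slopes of the functionals are monotone in the Gale order. Exchanging the largest element
  of \<open>I - J\<close> for the largest of \<open>J - I\<close> gives a set between
  \<open>J\<close> and \<open>I\<close>; this one exchange has positive wedge by the relation of the
  pencil, and comparison of slopes is transitive.\<close>

lemma wedge_pos:
  fixes h :: "nat \<Rightarrow> 'n::{finite,linorder} \<Rightarrow> real"
  assumes h: "\<And>I. 0 < pl h I"
  shows "card I = Suc d \<Longrightarrow> card J = Suc d \<Longrightarrow> gale_le J I \<Longrightarrow> 0 \<le> wedge h d J I"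
proof (induction "card (I - J)" arbitrary: I rule: less_induct)
  case less
  show ?case
  proof (cases "I = J")
    case False
    have card_eq: "card (I - J) = card (J - I)" using less.prems
      by (simp add: card_Diff_subset_Int inf_commute)
    then have ne: "I - J \<noteq> {}" "J - I \<noteq> {}" using False by (metis Diff_eq_empty_iff card_0_eq finite subset_antisym)+
    define t where "t = Max (I - J)"
    define b where "b = Max (J - I)"
    have t: "t \<in> I" "t \<notin> J" "\<And>x. x \<in> I \<Longrightarrow> x \<notin> J \<Longrightarrow> x \<le> t"
      using Max_in[OF _ ne(1)] Max_ge[of "I - J"] by (auto simp: t_def)
    have b: "b \<in> J" "b \<notin> I" "\<And>x. x \<in> J \<Longrightarrow> x \<notin> I \<Longrightarrow> x \<le> b"
      using Max_in[OF _ ne(2)] Max_ge[of "J - I"] by (auto simp: b_def)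
    have bt: "b < t"
    proof (rule ccontr)
      assume "\<not> b < t"
      then have "t < b" using t b by (metis neq_iff)
      then have "{x\<in>I. b \<le> x} \<subset> {x\<in>J. b \<le> x}" using t b by fastforce
      then have "cnt I b < cnt J b" unfolding cnt_def by (intro psubset_card_mono) auto
      then show False using less.prems(3) by (simp add: gale_le_def not_less[symmetric])
    qed
    define S where "S = I - {t}"
    have S: "t \<notin> S" "b \<notin> S" "I = insert t S" "card S = d" using t b less.prems(1) by (auto simp: S_def)
    let ?I' = "insert b S"
    have "gale_le J ?I'" unfolding gale_le_def
    proof
      fix x
      have le: "cnt J x \<le> cnt I x" using less.prems(3) by (simp add: gale_le_def)
      show "cnt J x \<le> cnt ?I' x"
      proof (cases "b < x \<and> x \<le> t")
        case True
        then have "{y\<in>J. x \<le> y} \<subseteq> {y\<in>S. x \<le> y}" using b t unfolding S_def by fastforce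
        then have "cnt J x \<le> cnt S x" unfolding cnt_def by (intro card_mono) auto
        then show ?thesis using S by (simp add: cnt_insert)
      next
        case False
        then have "x \<le> t \<longleftrightarrow> x \<le> b" using bt by auto
        then show ?thesis using le S by (simp add: cnt_insert)
      qed
    qed
    moreover have "?I' - J = I - J - {t}" using b t by (auto simp: S_def)
    then have "card (?I' - J) < card (I - J)" using t by (metis DiffI card_Diff1_less finite)
    ultimately have ih: "0 \<le> wedge h d J ?I'" using less.hyps[of ?I'] less.prems S by simp
    have "0 < wedge h d ?I' I" using wedge_pencil[of b S t d h] S bt h[of S] h[of "insert b (insert t S)"] by simp
    \<comment> \<open>The Pluecker relation of three vectors in a plane; with positive factors it is
      transitivity of the order by slope.\<close>
    moreover have "pl h ?I' * wedge h d J I = pl h I * wedge h d J ?I' + pl h J * wedge h d ?I' I"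
      by (simp add: wedge_def algebra_simps)
    ultimately have "0 \<le> pl h ?I' * wedge h d J I" using ih h[of I] h[of J] by simp
    then show ?thesis using h[of ?I'] by (simp add: zero_le_mult_iff)
  qed (simp add: wedge_def)
qed

definition adjacent :: "'n::linorder \<Rightarrow> 'n \<Rightarrow> bool" where
  "adjacent i j \<longleftrightarrow> i \<noteq> j \<and> (\<forall>x. x \<noteq> i \<longrightarrow> x \<noteq> j \<longrightarrow> (x < i \<longleftrightarrow> x < j))"

text \<open>The operation acts on all rows, hence on every member of the flag at once; for
  neighbouring columns and positive \<open>e\<close> it is an elementary totally nonnegative
  matrix.\<close>

definition add_column :: "'k \<Rightarrow> 'n \<Rightarrow> 'n \<Rightarrow> (nat \<Rightarrow> 'n \<Rightarrow> 'k::comm_ring_1) \<Rightarrow> nat \<Rightarrow> 'n \<Rightarrow> 'k" where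
  "add_column e i j h = (\<lambda>l c. if c = j then h l j + e * h l i else h l c)"

text \<open>No element lies between \<open>i\<close> and \<open>j\<close>, so replacing
  \<open>j\<close> by \<open>i\<close> keeps the columns sorted and creates no sign; for a set
  containing both, the correction has a repeated column.\<close>

lemma pl_add_column:
  fixes h :: "nat \<Rightarrow> 'n::{finite,linorder} \<Rightarrow> 'k::comm_ring_1"
  assumes ij: "adjacent i j"
  shows "pl (add_column e i j h) I = pl h I + (if j \<in> I \<and> i \<notin> I then e * pl h (insert i (I - {j})) else 0)"
proof (cases "j \<in> I")
  case False
  then show ?thesis unfolding pl_def by (auto intro!: minor_cong simp: add_column_def)
next
  case True
  define S where "S = I - {j}"
  have S: "I = insert j S" "j \<notin> S" using True by (auto simp: S_def)
  define as where "as = sorted_list_of_set {y\<in>S. y < j}"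
  define bs where "bs = sorted_list_of_set {y\<in>S. j < y}"
  let ?xs = "as @ j # bs" and ?p = "length as"
  have xs: "sorted_list_of_set I = ?xs"
    using sorted_list_of_set_split(2)[of S j] S by (simp add: as_def bs_def)
  \<comment> \<open>\<open>None\<close> stands for the altered column, so that linearity is applied
    in a single position.\<close>
  define F :: "nat \<Rightarrow> 'n option \<Rightarrow> 'k" where
    "F = (\<lambda>l c. case c of Some c \<Rightarrow> h l c | None \<Rightarrow> h l j + e * h l i)"
  have p: "?p < length (map Some ?xs)" by simp
  have F: "minor F (map Some ys) = minor h ys" for ys by (simp add: minor_map F_def)
  have "minor (add_column e i j h) ?xs = minor F ((map Some ?xs)[?p := None])"
  proof -
    have "(map Some ?xs)[?p := None] = map (\<lambda>c. if c = j then None else Some c) ?xs"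
      by (simp add: list_update_append) (auto simp: as_def bs_def)
    then show ?thesis by (simp only: minor_map) (auto intro!: minor_cong simp: F_def add_column_def)
  qed
  also have "\<dots> = minor F ((map Some ?xs)[?p := Some j]) + e * minor F ((map Some ?xs)[?p := Some i])"
    unfolding minor_column_expansion[OF p]
    by (simp add: F_def sum.distrib sum_distrib_left algebra_simps)
  also have "\<dots> = minor h ?xs + e * minor h (as @ i # bs)"
    using F[of ?xs] F[of "as @ i # bs"] by (simp add: list_update_append)
  finally have eq: "pl (add_column e i j h) I = pl h I + e * minor h (as @ i # bs)"
    by (simp add: pl_def xs)
  show ?thesis
  proof (cases "i \<in> I")
    case True
    then have "i \<in> S" using ij S by (auto simp: adjacent_def)
    then have "i \<in> set as \<union> set bs" using S by (simp add: as_def bs_def) (metis neq_iff)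
    then have "minor h (as @ i # bs) = 0" by (intro minor_not_distinct) auto
    then show ?thesis using eq True by simp
  next
    case False
    have "sorted_list_of_set (insert i S) = as @ i # bs"
    proof (rule sorted_list_of_set_eqI)
      have lt: "x < i" if "x \<in> S" "x < j" for x
        using that ij False S by (auto simp: adjacent_def)
      have gt: "i < x" if "x \<in> S" "j < x" for x
        using that ij False S by (metis adjacent_def insert_iff linorder_less_linear order_less_asym)
      have "y < j \<or> j < y" if "y \<in> S" for y using S(2) that by (metis neq_iff)
      then have "{y\<in>S. y < j} \<union> {y\<in>S. j < y} = S" by blast
      then show "set (as @ i # bs) = insert i S" by (simp add: as_def bs_def)
      show "sorted_wrt (<) (as @ i # bs)"
        using lt gt by (fastforce simp: sorted_wrt_append as_def bs_def)
    qed simp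
    then show ?thesis using eq True False by (simp add: pl_def S_def)
  qed
qed

lemma add_column_pencil: "(add_column e i j h)(d := add_column e i j h (Suc d)) = add_column e i j (h(d := h (Suc d)))"
  by (auto simp: add_column_def fun_eq_iff)

definition tnn :: "(nat \<Rightarrow> 'n::{finite,linorder} \<Rightarrow> real) \<Rightarrow> bool" where
  "tnn h \<longleftrightarrow> pl h UNIV \<noteq> 0 \<and> (\<forall>I. 0 \<le> pl h I)"

lemma initial_segment_eq:
  fixes I :: "'n::{finite,linorder} set"
  assumes "\<And>x y. x \<in> I \<Longrightarrow> idx x = Suc (idx y) \<Longrightarrow> y \<in> I"
  shows "I = {x. idx x \<le> card I}"
proof (cases "I = {}")
  case True
  then show ?thesis using idx_ge_1 by (auto simp: not_le Suc_le_eq)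
next
  case False
  define m where "m = Max I"
  have m: "m \<in> I" "\<And>x. x \<in> I \<Longrightarrow> x \<le> m" using False by (auto simp: m_def)
  have "x \<in> I" if "x \<le> m" for x
    using that
  proof (induction "idx m - idx x" arbitrary: x)
    case 0
    then show ?case using m by (metis diff_is_0_eq idx_le_iff order_antisym)
  next
    case (Suc k)
    then have lt: "idx x < idx m" by simp
    define y where "y = (el (Suc (idx x)) :: 'n)"
    have y: "idx y = Suc (idx x)" unfolding y_def using lt idx_le_card[of m] by (intro idx_el) auto
    then have "y \<in> I" using Suc(1)[of y] Suc(2) lt by (simp add: idx_le_iff[symmetric])
    then show ?case using assms y by blast
  qed
  then have I: "I = {..m}" using m by auto
  have "idx m = card I" by (simp add: I idx_def)
  then show ?thesis using I by (auto simp: idx_le_iff[symmetric])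
qed

text \<open>Neighbour exchanges bring every set down to the initial segment of its size, the sum of
  indices decreasing. If none of them could leave \<open>P\<close>, then, being reversible, they
  would preserve \<open>P\<close>, which would depend on the cardinality alone.\<close>

lemma ex_adjacent_exchange:
  fixes P :: "'n::{finite,linorder} set \<Rightarrow> bool"
  assumes "P I" "\<not> P J" "card I = card J"
  shows "\<exists>I i j. adjacent i j \<and> j \<in> I \<and> i \<notin> I \<and> P I \<and> \<not> P (insert i (I - {j}))"
proof (rule ccontr)
  assume "\<not> ?thesis"
  then have step: "P (insert i (I - {j}))" if "adjacent i j" "j \<in> I" "i \<notin> I" "P I" for I i j
    using that by blast
  have iff: "P I \<longleftrightarrow> P {x. idx x \<le> card I}" for I
  proof (induction "sum idx I" arbitrary: I rule: less_induct)
    case less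
    show ?case
    proof (cases "\<exists>x y. x \<in> I \<and> idx x = Suc (idx y) \<and> y \<notin> I")
      case True
      then obtain x y where xy: "x \<in> I" "idx x = Suc (idx y)" "y \<notin> I" by blast
      then have a: "adjacent x y" "adjacent y x"
        by (auto simp: adjacent_def idx_less_iff[symmetric] less_Suc_eq idx_eq_iff)
      let ?I = "insert y (I - {x})"
      have "P I \<longleftrightarrow> P ?I"
        using step[OF a(2), of I] step[OF a(1), of ?I] xy by (auto simp: insert_absorb)
      moreover have "sum idx ?I < sum idx I" "card ?I = card I"
        using xy sum.remove[of I x idx] card_Suc_Diff1[of I x] by auto
      ultimately show ?thesis using less[of ?I] by simp
    next
      case False
      then show ?thesis using initial_segment_eq[of I] by metis
    qed
  qed
  show False using iff[of I] iff[of J] assms by simp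
qed

lemma nonneg_of_quadratic:
  fixes a b c :: real
  assumes "\<And>e. 0 < e \<Longrightarrow> 0 \<le> a + b * e + c * e\<^sup>2"
  shows "0 \<le> a"
proof -
  have "((\<lambda>e. a + b * e + c * e\<^sup>2) \<longlongrightarrow> a + b * 0 + c * 0\<^sup>2) (at_right 0)"
    by (intro tendsto_intros)
  moreover have "\<forall>\<^sub>F e in at_right 0. 0 \<le> a + b * e + c * e\<^sup>2"
    using assms by (auto simp: eventually_at_filter)
  ultimately show ?thesis using tendsto_lowerbound by fastforce
qed

text \<open>Adding a small positive multiple of a column to a neighbouring one keeps the minors nonnegative and
  makes more of them positive, which reduces the claim to the case of positive minors.\<close>

lemma wedge_nonneg:
  fixes h :: "nat \<Rightarrow> 'n::{finite,linorder} \<Rightarrow> real"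
  assumes "tnn h" "card I = Suc d" "card J = Suc d" "gale_le J I"
  shows "0 \<le> wedge h d J I"
  using assms(1)
proof (induction "card {I. pl h I = 0}" arbitrary: h rule: less_induct)
  case less
  show ?case
  proof (cases "\<exists>I. pl h I = 0")
    case False
    then have "0 < pl h I" for I using less.prems by (metis tnn_def order_le_less)
    then show ?thesis using assms by (intro wedge_pos) auto
  next
    case True
    then obtain I0 where I0: "pl h I0 = 0" by blast
    obtain w where "gale_min h w" using ex_gale_min less.prems by (auto simp: tnn_def)
    then have "pl h (lev w (card I0)) \<noteq> 0" by (auto simp: gale_min_def supp_def)
    moreover have "card (lev w (card I0)) = card I0" by (intro card_lev card_mono) auto
    \<comment> \<open>The zero minor of \<open>K\<close> becomes positive after the column operation
      while no positive minor is lost, so the number of zero minors drops.\<close>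
    ultimately obtain K i j where K: "adjacent i j" "j \<in> K" "i \<notin> K" "pl h K = 0" "pl h (insert i (K - {j})) \<noteq> 0"
      using ex_adjacent_exchange[of "\<lambda>I. pl h I = 0" I0 "lev w (card I0)"] I0 by auto
    let ?b = "\<lambda>h I. if j \<in> I \<and> i \<notin> I then pl h (insert i (I - {j})) else 0"
    have pl: "pl (add_column e i j h) I = pl h I + e * ?b h I" for e and h :: "nat \<Rightarrow> 'n \<Rightarrow> real" and I
      by (simp add: pl_add_column[OF K(1)])
    have wedge_e: "0 \<le> wedge (add_column e i j h) d J I" if e: "0 < e" for e :: real
    proof (rule less.hyps)
      have nn: "0 \<le> pl h I" for I using less.prems by (simp add: tnn_def)
      then have b: "0 \<le> e * ?b h I" for I using e by simp
      show "tnn (add_column e i j h)"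
        using less.prems nn b by (simp add: tnn_def pl)
      have "{I. pl (add_column e i j h) I = 0} \<subseteq> {I. pl h I = 0}"
        unfolding pl using add_nonneg_eq_0_iff[OF nn b] by blast
      moreover have "K \<in> {I. pl h I = 0} - {I. pl (add_column e i j h) I = 0}"
        unfolding pl using K e by simp
      ultimately show "card {I. pl (add_column e i j h) I = 0} < card {I. pl h I = 0}"
        by (intro psubset_card_mono) auto
    qed
    let ?q = "h(d := h (Suc d))"
    \<comment> \<open>Every minor involved is affine in \<open>e\<close>, so the wedge is quadratic
      in \<open>e\<close>, with the wedge of \<open>h\<close> as its constant term.\<close>
    define B where "B = pl h J * ?b ?q I + ?b h J * pl ?q I - pl h I * ?b ?q J - ?b h I * pl ?q J"
    define C where "C = ?b h J * ?b ?q I - ?b h I * ?b ?q J"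
    have "wedge (add_column e i j h) d J I = wedge h d J I + B * e + C * e\<^sup>2" for e :: real
      unfolding wedge_def add_column_pencil pl B_def C_def by (simp add: algebra_simps power2_eq_square)
    then show ?thesis
      using nonneg_of_quadratic[of "wedge h d J I" B C] wedge_e by simp
  qed
qed

lemma flag_le_lower_mono:
  fixes v z :: "'n::{finite,linorder} perm"
  assumes "Suc d < CARD('n)" "flag_le v z"
  shows "flag_le (lower d v) (lower d z)"
  using assms pos_lower[of d v] by (intro flag_le_lift[of d]) (auto simp: lev_lower flag_le_def)

text \<open>The step from \<open>w\<close> to \<open>adj d * w\<close> moves \<open>V\<^sub>d\<^sub>+\<^sub>1\<close> to the end of the nonnegative part of its pencil at
  which the minor of \<open>lev w (d + 1)\<close> vanishes.\<close>

lemma tnn_interval: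
  fixes h :: "nat \<Rightarrow> 'n::{finite,linorder} \<Rightarrow> real"
  shows "tnn h \<Longrightarrow> gale_max h v \<Longrightarrow> gale_min h w \<Longrightarrow> flag_le v z \<Longrightarrow> flag_le z w \<Longrightarrow> z \<in> supp h"
proof (induction w arbitrary: h v z rule: perm_descent_induct)
  case (one h v z)
  then have "z = 1" by (intro flag_le_one)
  then show ?case using one by (simp add: gale_min_def)
next
  case (step w d h v z)
  note d = step.hyps(1) and asc = step.hyps(2) and tnn = step.prems(1)
  have nn: "0 \<le> pl h I" for I using tnn by (simp add: tnn_def)
  let ?q = "h(d := h (Suc d))" and ?n = "CARD('n)"
  define J where "J = lev w (Suc d)"
  have cJ: "card J = Suc d" using d by (simp add: J_def card_lev)
  have pJ: "0 < pl h J" using step.prems(3) nn[of J] by (auto simp: gale_min_def supp_def J_def order_le_less)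
  \<comment> \<open>Recombining the rows \<open>d\<close> and \<open>Suc d\<close> affects minors of
    size \<open>Suc d\<close> linearly; smaller minors do not see these rows and larger ones are
    multiplied by the determinant of the recombination.\<close>
  have swap: "pl (h(d := \<lambda>c. a * h d c + b * h (Suc d) c, Suc d := \<lambda>c. a' * h d c + b' * h (Suc d) c)) I
      = (if card I \<le> d then pl h I else if card I = Suc d then a * pl h I + b * pl ?q I else (a * b' - b * a') * pl h I)"
    for a b a' b' I
  proof -
    have l: "length (sorted_list_of_set I) = card I" by simp
    consider "card I \<le> d" | "card I = Suc d" | "Suc d < card I" by linarith
    then show ?thesis
    proof cases
      case 1
      then show ?thesis unfolding pl_def by (auto intro!: minor_cong)
    next
      case 2
      have "pl (h(d := \<lambda>c. a * h d c + b * h (Suc d) c, Suc d := \<lambda>c. a' * h d c + b' * h (Suc d) c)) I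
        = minor (h(d := \<lambda>c. a * h d c + b * h (Suc d) c)) (sorted_list_of_set I)"
        unfolding pl_def using 2 by (auto intro!: minor_cong)
      then show ?thesis using 2 minor_row_linear[of d "sorted_list_of_set I" h a "h d" b "h (Suc d)"]
        by (simp add: pl_def)
    next
      case 3
      then show ?thesis unfolding pl_def using minor_two_rows[of d "Suc d" "sorted_list_of_set I" h a b a' b'] by simp
    qed
  qed
  \<comment> \<open>A set whose functional is nonzero only in the second direction is compared with
    \<open>J\<close> through the flag with both rows exchanged: its Gale-smallest basis is
    \<open>w\<close> or \<open>adj d * w\<close>, and both have level \<open>Suc d\<close> at or
    above \<open>J\<close>.\<close>
  have geJ: "gale_le J I" if cI: "card I = Suc d" and nz: "pl h I \<noteq> 0 \<or> pl ?q I \<noteq> 0" for I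
  proof (cases "pl h I \<noteq> 0")
    case True
    then show ?thesis using step.prems(3) cI by (metis gale_min_def J_def)
  next
    case False
    define h2 where "h2 = h(d := \<lambda>c. 0 * h d c + 1 * h (Suc d) c, Suc d := \<lambda>c. 1 * h d c + 0 * h (Suc d) c)"
    have h2: "pl h2 K = (if card K \<le> d then pl h K else if card K = Suc d then pl ?q K else - pl h K)" for K
      unfolding h2_def swap by simp
    obtain w2 where w2: "gale_min h2 w2"
      using ex_gale_min[of h2] tnn d unfolding h2 tnn_def by auto
    have "w2 = w \<or> w2 = adj d * w"
      using h2 by (intro gale_min_outside[OF d step.prems(3) w2]) auto
    then have "flag_le w2 w"
      using flag_le_lower[OF d, of w] asc by (auto simp: lower_def)
    then have "gale_le J (lev w2 (Suc d))" by (simp add: flag_le_def J_def)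
    moreover have "gale_le (lev w2 (Suc d)) I"
      using w2 nz False cI h2[of I] unfolding gale_min_def by (metis Suc_n_not_le_n)
    ultimately show ?thesis by (rule gale_le_trans)
  qed
  \<comment> \<open>The new row \<open>d\<close> turns the minors of size \<open>Suc d\<close> into
    wedges with \<open>J\<close>, so that of \<open>J\<close> vanishes; the new row
    \<open>Suc d\<close> gives the recombination the positive determinant
    \<open>pl h J\<close>.\<close>
  define h1 where "h1 = h(d := \<lambda>c. (- pl ?q J) * h d c + pl h J * h (Suc d) c, Suc d := \<lambda>c. (-1) * h d c + 0 * h (Suc d) c)"
  have h1: "pl h1 I = (if card I \<le> d then pl h I else if card I = Suc d then wedge h d J I else pl h J * pl h I)" for I
    unfolding h1_def swap by (simp add: wedge_def)
  have h1_out: "pl h1 I = 0 \<longleftrightarrow> pl h I = 0" if "card I \<noteq> Suc d" for I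
    using that pJ by (simp add: h1)
  have tnn1: "tnn h1"
    unfolding tnn_def
  proof (intro conjI allI)
    show "pl h1 UNIV \<noteq> 0" using tnn d h1_out[of UNIV] by (simp add: tnn_def)
    fix I
    show "0 \<le> pl h1 I"
    proof (cases "card I = Suc d \<and> (pl h I \<noteq> 0 \<or> pl ?q I \<noteq> 0)")
      case True
      then show ?thesis using wedge_nonneg[OF tnn _ cJ geJ, of I] by (simp add: h1)
    next
      case False
      then show ?thesis using nn[of I] pJ by (auto simp: h1 wedge_def)
    qed
  qed
  obtain w1 where w1: "gale_min h1 w1" using ex_gale_min tnn1 by (auto simp: tnn_def)
  have "pl h1 (lev w (Suc d)) = 0" using cJ by (simp add: h1 J_def[symmetric] wedge_def)
  then have "w \<notin> supp h1" by (auto simp: supp_def)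
  then have w1_eq: "w1 = adj d * w"
    using gale_min_outside[OF d step.prems(3) w1 h1_out] w1 by (auto simp: gale_min_def)
  obtain v1 where v1: "gale_max h1 v1" using ex_gale_max tnn1 by (auto simp: tnn_def)
  have cases: "v1 = v \<or> v1 = adj d * v" by (rule gale_max_outside[OF d step.prems(2) v1 h1_out])
  \<comment> \<open>Otherwise \<open>?H\<close>, the Gale-larger of the two candidates, would have
    zero wedge with \<open>J\<close>, although in the order of slopes \<open>?L\<close> comes
    strictly after \<open>J\<close> and \<open>?H\<close> strictly after \<open>?L\<close>; the
    relation among the three wedges excludes this.\<close>
  have v1_eq: "v1 = lower d v"
  proof (rule ccontr)
    assume neq: "v1 \<noteq> lower d v"
    define vl where "vl = lower d v"
    have eq: "v1 = adj d * vl" using neq cases by (auto simp: vl_def lower_def)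
    have vl_pos: "pos vl (Suc d) < pos vl d" unfolding vl_def by (rule pos_lower[OF d])
    let ?H = "lev vl (Suc d)" and ?L = "lev v1 (Suc d)" and ?A = "lev vl d"
    have H: "?H = insert (pos vl d) ?A" "pos vl d \<notin> ?A" using lev_Suc[of d vl] d by auto
    have L: "?L = insert (pos vl (Suc d)) ?A" "pos vl (Suc d) \<notin> ?A"
      using lev_adj_Suc[OF d, of vl] lev_Suc2[OF d, of vl] by (auto simp: eq)
    have cH: "card ?H = Suc d" "card ?L = Suc d" "card ?A = d" using d by (auto simp: card_lev)
    have "pl h1 ?H = 0"
    proof (rule ccontr)
      assume "pl h1 ?H \<noteq> 0"
      then have "gale_le ?H ?L" using v1 cH by (metis gale_max_def)
      moreover have "lev vl e = lev v1 e" if "e \<noteq> Suc d" for e using lev_adj[OF d that, of vl] eq by simp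
      ultimately have "flag_le v1 vl" unfolding flag_le_def by (metis gale_le_refl)
      moreover have "flag_le vl v1"
        using flag_le_lower[OF d, of v1] vl_pos by (simp add: eq lower_def pos_adj_simps[OF d])
      ultimately show False using neq flag_le_antisym by (auto simp: vl_def)
    qed
    then have wH: "wedge h d J ?H = 0" using cH by (simp add: h1)
    have "pl h1 ?L \<noteq> 0" using v1 by (auto simp: gale_max_def supp_def)
    moreover have "0 \<le> pl h1 ?L" using tnn1 by (simp add: tnn_def)
    ultimately have wL: "0 < wedge h d J ?L" using cH by (simp add: h1)
    have "wedge h d ?L ?H = pl h ?A * pl h (lev vl (Suc (Suc d)))"
      unfolding L H lev_Suc2(1)[OF d] using L H vl_pos cH(3) by (intro wedge_pencil) auto
    moreover have "pl h (lev vl e) \<noteq> 0" if "e \<noteq> Suc d" for e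
      using step.prems(2) lev_lower[OF d that, of v] by (auto simp: gale_max_def supp_def vl_def)
    ultimately have wLH: "0 < wedge h d ?L ?H" using nn[of ?A] nn[of "lev vl (Suc (Suc d))"]
      by (simp add: order_le_less)
    have "pl h J * wedge h d ?L ?H = pl h ?L * wedge h d J ?H - pl h ?H * wedge h d J ?L"
      by (simp add: wedge_def algebra_simps)
    moreover have "0 \<le> pl h ?H * wedge h d J ?L" using nn[of ?H] wL by simp
    moreover have "0 < pl h J * wedge h d ?L ?H" using pJ wLH by simp
    ultimately show False using wH by simp
  qed
  have zl: "lower d z \<in> supp h1"
  proof (rule step.IH[OF tnn1 v1])
    show "gale_min h1 (adj d * w)" using w1 w1_eq by simp
    show "flag_le v1 (lower d z)" unfolding v1_eq by (rule flag_le_lower_mono[OF d step.prems(4)])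
    show "flag_le (lower d z) (adj d * w)"
      using flag_le_lower_iff[OF d asc, of z] step.prems(5) asc by (simp add: lower_def[of d w])
  qed
  have out: "pl h (lev z e) \<noteq> 0" if "e \<noteq> Suc d" for e
  proof -
    have "card (lev z e) \<noteq> Suc d" using that d by (simp add: card_lev')
    moreover have "pl h1 (lev z e) \<noteq> 0" using zl lev_lower[OF d that, of z] unfolding supp_def by (metis (mono_tags) mem_Collect_eq)
    ultimately show ?thesis using h1_out by blast
  qed
  \<comment> \<open>If this coordinate vanished, its functional would be nonzero in the second
    direction, because the neighbouring set in the pencil is independent of it. Comparison with
    \<open>J\<close> and with the level of \<open>v\<close> would give that value both
    signs.\<close>
  have "pl h (lev z (Suc d)) \<noteq> 0"
  proof
    let ?C = "lev z (Suc d)" and ?A = "lev z d" and ?a = "pos z d" and ?b = "pos z (Suc d)" and ?V = "lev v (Suc d)"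
    assume C0: "pl h ?C = 0"
    have C: "?C = insert ?a ?A" "?a \<notin> ?A" "?b \<notin> ?A" "?a \<noteq> ?b" "card ?A = d" "card ?C = Suc d" "card ?V = Suc d"
      using lev_Suc[of d z] lev_Suc2[OF d, of z] d by (auto simp: card_lev)
    have nz: "pl h ?A * pl h (insert ?a (insert ?b ?A)) \<noteq> 0"
      using out[of d] out[of "Suc (Suc d)"] lev_Suc2(1)[OF d, of z] by (simp add: insert_commute)
    have "wedge h d ?C (insert ?b ?A) \<noteq> 0"
    proof (cases "?a < ?b")
      case True
      then show ?thesis using wedge_pencil[of ?a ?A ?b d h] C nz by simp
    next
      case False
      then have "wedge h d (insert ?b ?A) ?C \<noteq> 0"
        using wedge_pencil[of ?b ?A ?a d h] C nz by (simp add: insert_commute)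
      then show ?thesis by (simp add: wedge_def)
    qed
    then have qC: "pl ?q ?C \<noteq> 0" using C0 by (auto simp: wedge_def)
    have "0 \<le> wedge h d J ?C"
      using step.prems(5) by (intro wedge_nonneg[OF tnn C(6) cJ]) (auto simp: flag_le_def J_def)
    then have "0 \<le> pl ?q ?C" using C0 pJ by (simp add: wedge_def zero_le_mult_iff)
    moreover have "0 \<le> wedge h d ?C ?V"
      using step.prems(4) by (intro wedge_nonneg[OF tnn C(7,6)]) (auto simp: flag_le_def)
    then have "pl h ?V * pl ?q ?C \<le> 0" using C0 by (simp add: wedge_def)
    moreover have "0 < pl h ?V" using step.prems(2) nn[of ?V] by (auto simp: gale_max_def supp_def order_le_less)
    ultimately show False using qC by (simp add: mult_le_0_iff)
  qed
  then have "pl h (lev z e) \<noteq> 0" for e using out[of e] by (cases "e = Suc d") auto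
  then show ?case by (simp add: supp_def)
qed

theorem tnn_supp_interval:
  fixes h :: "nat \<Rightarrow> 'n::{finite,linorder} \<Rightarrow> real"
  assumes "tnn h"
  shows "\<exists>v w. bruhat_le v w \<and> supp h = {z. bruhat_le v z \<and> bruhat_le z w}"
proof -
  obtain v w where vw: "gale_max h v" "gale_min h w"
    using ex_gale_max[of h] ex_gale_min[of h] assms by (auto simp: tnn_def)
  have "flag_le v z \<and> flag_le z w" if "z \<in> supp h" for z
    using that gale_max_supp[OF vw(1), of z] gale_min_supp[OF vw(2), of z] by (auto simp: flag_le_def supp_def)
  moreover have "v \<in> supp h" using vw(1) by (simp add: gale_max_def)
  moreover have "z \<in> supp h" if "flag_le v z" "flag_le z w" for z
    using tnn_interval[OF assms vw that] .
  ultimately have "supp h = {z. flag_le v z \<and> flag_le z w}" "flag_le v w" by blast+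
  then show ?thesis unfolding bruhat_le_iff by blast
qed

section \<open>Modular functions on the vertices of the permutahedron\<close>

lemma adj_commute:
  fixes \<sigma> :: "'n::{finite,linorder} perm"
  assumes "Suc d < e" "Suc e < CARD('n)"
  shows "adj d * (adj e * \<sigma>) = adj e * (adj d * \<sigma>)"
proof (rule perm_eqI_pos)
  fix x assume x: "x < CARD('n)"
  consider "x = d" | "x = Suc d" | "x = e" | "x = Suc e" | "x \<noteq> d \<and> x \<noteq> Suc d \<and> x \<noteq> e \<and> x \<noteq> Suc e" by blast
  then show "pos (adj d * (adj e * \<sigma>)) x = pos (adj e * (adj d * \<sigma>)) x"
    using assms x by cases (simp_all add: pos_adj_simps)
qed

lemma pos_adj_triple:
  fixes \<sigma> :: "'n::{finite,linorder} perm"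
  assumes "Suc (Suc d) < CARD('n)"
  shows "pos (adj d * \<sigma>) d = pos \<sigma> (Suc d)" "pos (adj d * \<sigma>) (Suc d) = pos \<sigma> d"
    "pos (adj d * \<sigma>) (Suc (Suc d)) = pos \<sigma> (Suc (Suc d))"
    "pos (adj (Suc d) * \<sigma>) d = pos \<sigma> d" "pos (adj (Suc d) * \<sigma>) (Suc d) = pos \<sigma> (Suc (Suc d))"
    "pos (adj (Suc d) * \<sigma>) (Suc (Suc d)) = pos \<sigma> (Suc d)"
  using assms by (simp_all add: pos_adj_simps)

lemma adj_braid:
  fixes \<sigma> :: "'n::{finite,linorder} perm"
  assumes "Suc (Suc d) < CARD('n)"
  shows "adj d * (adj (Suc d) * (adj d * \<sigma>)) = adj (Suc d) * (adj d * (adj (Suc d) * \<sigma>))"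
proof (rule perm_eqI_pos)
  fix x assume x: "x < CARD('n)"
  consider "x = d" | "x = Suc d" | "x = Suc (Suc d)" | "x \<noteq> d \<and> x \<noteq> Suc d \<and> x \<noteq> Suc (Suc d)" by blast
  then show "pos (adj d * (adj (Suc d) * (adj d * \<sigma>))) x = pos (adj (Suc d) * (adj d * (adj (Suc d) * \<sigma>))) x"
    using assms x by cases (simp_all add: pos_adj_simps)
qed

lemma ex_perm_at:
  fixes A :: "'n::{finite,linorder} set"
  assumes "distinct ys" "set ys \<inter> A = {}"
  shows "\<exists>\<sigma>. lev \<sigma> (card A) = A \<and> (\<forall>k<length ys. pos \<sigma> (card A + k) = ys ! k)"
proof -
  define js where "js = sorted_list_of_set A @ ys @ sorted_list_of_set (- A - set ys)"
  have dist: "distinct js" using assms by (auto simp: js_def)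
  have "set js = UNIV" by (auto simp: js_def)
  then have len: "length js = CARD('n)" using distinct_card[OF dist] by simp
  have lenA: "card A + length ys \<le> CARD('n)" using len by (simp add: js_def)
  obtain \<sigma> where \<sigma>: "\<And>d. d < CARD('n) \<Longrightarrow> pos \<sigma> d = js ! d"
    using ex_perm_pos[of "(!) js"] dist len by (auto simp: inj_on_nth)
  have "lev \<sigma> (card A) = (!) js ` {..<card A}"
    using lenA \<sigma> by (subst lev_image) (auto intro!: image_cong)
  also have "\<dots> = set (take (card A) js)" using nth_image[of "card A" js] lenA len by (simp add: lessThan_atLeast0)
  finally have "lev \<sigma> (card A) = A" by (simp add: js_def)
  moreover have "pos \<sigma> (card A + k) = ys ! k" if "k < length ys" for k
    using \<sigma>[of "card A + k"] lenA that by (simp add: js_def nth_append)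
  ultimately show ?thesis by blast
qed

text \<open>The conditions of part 3, written with the adjacent transpositions that generate the 2-faces.\<close>

definition hexagons_balanced :: "('n::{finite,linorder} perm \<Rightarrow> real) \<Rightarrow> bool" where
  "hexagons_balanced u \<longleftrightarrow> (\<forall>\<sigma> d. Suc (Suc d) < CARD('n) \<longrightarrow>
     u (adj d * \<sigma>) + u (adj (Suc d) * \<sigma>) + u (adj d * (adj (Suc d) * (adj d * \<sigma>)))
     = u \<sigma> + u (adj d * (adj (Suc d) * \<sigma>)) + u (adj (Suc d) * (adj d * \<sigma>)))"

definition squares_balanced :: "('n::{finite,linorder} perm \<Rightarrow> real) \<Rightarrow> bool" where
  "squares_balanced u \<longleftrightarrow> (\<forall>\<sigma> d e. Suc d < e \<and> Suc e < CARD('n) \<longrightarrow>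
     u (adj d * \<sigma>) + u (adj e * \<sigma>) = u \<sigma> + u (adj d * (adj e * \<sigma>)))"

definition hexagons_max :: "('n::{finite,linorder} perm \<Rightarrow> real) \<Rightarrow> bool" where
  "hexagons_max u \<longleftrightarrow> (\<forall>\<sigma> d. Suc (Suc d) < CARD('n) \<and> pos \<sigma> (Suc d) < pos \<sigma> d \<and> pos \<sigma> (Suc (Suc d)) < pos \<sigma> (Suc d) \<longrightarrow>
     u \<sigma> + u (adj d * (adj (Suc d) * (adj d * \<sigma>)))
     = max (u (adj d * \<sigma>) + u (adj d * (adj (Suc d) * \<sigma>))) (u (adj (Suc d) * \<sigma>) + u (adj (Suc d) * (adj d * \<sigma>))))"

text \<open>Two flags that agree in the levels \<open>E\<close> are connected by adjacent transpositions that fix these levels.\<close>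

lemma level_connected:
  fixes \<sigma> \<tau> :: "'n::{finite,linorder} perm"
  assumes base: "R \<tau>"
    and step: "\<And>\<sigma> k. Suc k < CARD('n) \<Longrightarrow> Suc k \<notin> E \<Longrightarrow> R (adj k * \<sigma>) \<Longrightarrow> R \<sigma>"
    and eq: "\<And>e. e \<in> E \<Longrightarrow> lev \<sigma> e = lev \<tau> e"
  shows "R \<sigma>"
proof -
  have pos: "pos \<rho> d = Perm.apply \<tau> (pos (\<rho> * \<tau>) d)" for \<rho> d
    by (simp add: pos_def apply_times apply_inverse[symmetric])
  have "(\<forall>e\<in>E. lev (\<rho> * \<tau>) e = lev \<tau> e) \<longrightarrow> R (\<rho> * \<tau>)" for \<rho>
  proof (induction \<rho> rule: perm_descent_induct)
    case one
    then show ?case using base by simp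
  next
    case (step \<rho> k)
    show ?case
    proof
      assume *: "\<forall>e\<in>E. lev (\<rho> * \<tau>) e = lev \<tau> e"
      \<comment> \<open>If the level \<open>Suc k\<close> agreed with that of \<tau>, the position
        of rank \<open>k\<close> would have the larger value under \<tau>, and \<open>adj k\<close>
        would lengthen \<rho> instead of shortening it.\<close>
      have k: "Suc k \<notin> E"
      proof
        assume "Suc k \<in> E"
        then have "lev (\<rho> * \<tau>) (Suc k) = lev \<tau> (Suc k)" using * by blast
        moreover have "pos (\<rho> * \<tau>) k \<in> lev (\<rho> * \<tau>) (Suc k)" "pos (\<rho> * \<tau>) (Suc k) \<notin> lev (\<rho> * \<tau>) (Suc k)"
          using lev_Suc[of k "\<rho> * \<tau>"] lev_Suc[of "Suc k" "\<rho> * \<tau>"] step(1) by auto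
        ultimately have "idx (pos \<rho> (Suc k)) < idx (pos \<rho> k)"
          unfolding pos[of \<rho>] by (simp add: lev_def)
        then show False using step(2) by (simp add: idx_less_iff)
      qed
      have "\<forall>e\<in>E. lev (adj k * \<rho> * \<tau>) e = lev \<tau> e"
        using * k lev_adj[OF step(1)] by (metis mult.assoc)
      then have "R (adj k * (\<rho> * \<tau>))" using step(3) by (simp add: mult.assoc)
      then show "R (\<rho> * \<tau>)" using assms(2)[OF step(1) k] by blast
    qed
  qed
  from this[of "\<sigma> * inverse \<tau>"] show ?thesis using eq by (simp add: mult.assoc)
qed

text \<open>Squares transport the difference along commuting moves. Flags sharing the three levels
  are connected by moves \<open>adj k\<close> with \<open>k\<close> at distance at least two from
  \<open>d\<close>, exactly those that span a square with \<open>adj d\<close>.\<close>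

lemma edge_difference_cong:
  fixes \<sigma> \<tau> :: "'n::{finite,linorder} perm"
  assumes u: "squares_balanced u" and d: "Suc d < CARD('n)"
    and eq: "lev \<sigma> d = lev \<tau> d" "lev \<sigma> (Suc d) = lev \<tau> (Suc d)" "lev \<sigma> (Suc (Suc d)) = lev \<tau> (Suc (Suc d))"
  shows "u \<sigma> - u (adj d * \<sigma>) = u \<tau> - u (adj d * \<tau>)"
proof (rule level_connected[where R = "\<lambda>\<sigma>. u \<sigma> - u (adj d * \<sigma>) = u \<tau> - u (adj d * \<tau>)" and E = "{d, Suc d, Suc (Suc d)}" and \<tau> = \<tau>])
  fix \<sigma> :: "'n perm" and k
  assume k: "Suc k < CARD('n)" "Suc k \<notin> {d, Suc d, Suc (Suc d)}"
    and *: "u (adj k * \<sigma>) - u (adj d * (adj k * \<sigma>)) = u \<tau> - u (adj d * \<tau>)"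
  have "u (adj d * \<sigma>) + u (adj k * \<sigma>) = u \<sigma> + u (adj d * (adj k * \<sigma>))"
  proof (cases "Suc d < k")
    case True
    then show ?thesis using u k unfolding squares_balanced_def by blast
  next
    case False
    then have kd: "Suc k < d" using k(2) by auto
    then have "u (adj k * \<sigma>) + u (adj d * \<sigma>) = u \<sigma> + u (adj k * (adj d * \<sigma>))"
      using u d unfolding squares_balanced_def by blast
    then show ?thesis using adj_commute[OF kd d, of \<sigma>] by simp
  qed
  then show "u \<sigma> - u (adj d * \<sigma>) = u \<tau> - u (adj d * \<tau>)" using * by simp
qed (use eq in auto)

subsection \<open>Potentials on Johnson graphs\<close>

definition johnson_adj :: "'a set \<Rightarrow> 'a set \<Rightarrow> bool" where
  "johnson_adj I K \<longleftrightarrow> (\<exists>x y. x \<in> I \<and> y \<notin> I \<and> K = insert y (I - {x}))"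

lemma johnson_adjI: "x \<notin> S \<Longrightarrow> y \<notin> S \<Longrightarrow> x \<noteq> y \<Longrightarrow> johnson_adj (insert x S) (insert y S)"
  unfolding johnson_adj_def by (rule exI[of _ x], rule exI[of _ y]) auto

lemma johnson_adj_card: "johnson_adj I K \<Longrightarrow> card (K :: 'a::finite set) = card I"
proof -
  assume "johnson_adj I K"
  then obtain x y where "x \<in> I" "y \<notin> I" "K = insert y (I - {x})" by (auto simp: johnson_adj_def)
  then show ?thesis using card_Suc_Diff1[of I x] by simp
qed

lemma johnson_adj_sym: "johnson_adj I K \<Longrightarrow> johnson_adj K I"
proof -
  assume "johnson_adj I K"
  then obtain x y where xy: "x \<in> I" "y \<notin> I" "K = insert y (I - {x})" by (auto simp: johnson_adj_def)
  then have "johnson_adj (insert y (I - {x})) (insert x (I - {x}))" by (intro johnson_adjI) auto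
  then show ?thesis using xy by (simp add: insert_absorb)
qed

text \<open>All cycles of a Johnson graph are generated by its triangles: squares are filled by a fifth vertex,
  and each set of distance \<open>k + 1\<close> from \<open>I0\<close> has a neighbour at distance \<open>k\<close>.\<close>

lemma johnson_potential:
  fixes D :: "'a::finite set \<Rightarrow> 'a set \<Rightarrow> real"
  assumes anti: "\<And>I K. card I = m \<Longrightarrow> johnson_adj I K \<Longrightarrow> D K I = - D I K"
    and low: "\<And>A a b c. Suc (card A) = m \<Longrightarrow> a \<notin> A \<Longrightarrow> b \<notin> A \<Longrightarrow> c \<notin> A \<Longrightarrow> distinct [a, b, c] \<Longrightarrow>
      D (insert a A) (insert b A) + D (insert b A) (insert c A) + D (insert c A) (insert a A) = 0"
    and up: "\<And>A a b c. Suc (Suc (card A)) = m \<Longrightarrow> a \<notin> A \<Longrightarrow> b \<notin> A \<Longrightarrow> c \<notin> A \<Longrightarrow> distinct [a, b, c] \<Longrightarrow>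
      D (insert a (insert b A)) (insert a (insert c A)) + D (insert a (insert c A)) (insert b (insert c A))
      + D (insert b (insert c A)) (insert a (insert b A)) = 0"
  shows "\<exists>W. \<forall>I K. card I = m \<longrightarrow> johnson_adj I K \<longrightarrow> W I - W K = D I K"
proof -
  \<comment> \<open>The three sets of a triangle either contain a common set with one element less
    or lie in a common set with one element more; these are the cases \<open>low\<close> and
    \<open>up\<close>.\<close>
  have tri: "D I K + D K L = D I L"
    if m: "card I = m" and adj: "johnson_adj I K" "johnson_adj K L" "johnson_adj I L" for I K L
  proof -
    obtain x y where K: "x \<in> I" "y \<notin> I" "K = insert y (I - {x})" using adj(1) by (auto simp: johnson_adj_def)
    obtain p q where L: "p \<in> I" "q \<notin> I" "L = insert q (I - {p})" using adj(3) by (auto simp: johnson_adj_def)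
    obtain p' q' where L': "p' \<in> K" "q' \<notin> K" "L = insert q' (K - {p'})" using adj(2) by (auto simp: johnson_adj_def)
    have LI: "D L I = - D I L" using anti[OF m adj(3)] .
    show ?thesis
    proof (cases "x = p")
      case True
      let ?S = "I - {x}"
      have "y \<noteq> q" using K L L' True by auto
      moreover have "Suc (card ?S) = m" using m K(1) by (metis card_Suc_Diff1 finite)
      ultimately have "D (insert x ?S) (insert y ?S) + D (insert y ?S) (insert q ?S) + D (insert q ?S) (insert x ?S) = 0"
        using K L by (intro low) auto
      then show ?thesis using K L LI True by (simp add: insert_absorb)
    next
      case False
      have yq: "y = q"
      proof (rule ccontr)
        assume "y \<noteq> q"
        then have "y \<in> K - L" "p \<in> K - L" "y \<noteq> p" using K L False by auto
        then show False using L' by auto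
      qed
      let ?A = "I - {x, p}"
      have I: "I = insert x (insert p ?A)" "K = insert y (insert p ?A)" "L = insert x (insert y ?A)"
        using K L False yq by auto
      have "card ?A = card I - 2" using K(1) L(1) False by (subst card_Diff_subset) auto
      moreover have "2 \<le> card I" using K(1) L(1) False card_mono[of I "{x, p}"] by simp
      ultimately have "Suc (Suc (card ?A)) = m" using m by simp
      then have "D (insert p (insert x ?A)) (insert p (insert y ?A)) + D (insert p (insert y ?A)) (insert x (insert y ?A))
        + D (insert x (insert y ?A)) (insert p (insert x ?A)) = 0"
        using K L False yq by (intro up) auto
      then show ?thesis using I LI by (simp add: insert_commute)
    qed
  qed
  show ?thesis
  proof (cases "\<exists>I0 :: 'a set. card I0 = m")
    case False
    then show ?thesis by blast
  next
    case True
    then obtain I0 :: "'a set" where I0: "card I0 = m" by blast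
    have ne: "I0 - I \<noteq> {}" if "card I = m" "card (I - I0) = Suc k" for I k
      using that I0 by (metis Diff_eq_empty_iff card.empty card_subset_eq finite nat.distinct(1))
    have dist: "card (insert y (I - {x}) - I0) = (if y \<in> I0 then 0 else 1) + (card (I - I0) - (if x \<in> I0 then 0 else 1))"
      if "x \<in> I" "y \<notin> I" for x y I
    proof -
      have "insert y (I - {x}) - I0 = (if y \<in> I0 then {} else {y}) \<union> (I - I0 - {x})" by auto
      moreover have "card (I - I0 - {x}) = card (I - I0) - (if x \<in> I0 then 0 else 1)"
        using that by (auto simp: card_Diff_singleton_if)
      ultimately show ?thesis using that by auto
    qed
    have "\<exists>W. \<forall>I K. card I = m \<longrightarrow> johnson_adj I K \<longrightarrow> card (I - I0) \<le> k \<longrightarrow> card (K - I0) \<le> k \<longrightarrow> W I - W K = D I K" for k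
    proof (induction k)
      case 0
      have "\<not> johnson_adj I K" if "card I = m" "card (I - I0) \<le> 0" "card (K - I0) \<le> 0" for I K
      proof
        assume adj: "johnson_adj I K"
        then have "I \<subseteq> I0" "K \<subseteq> I0" "card K = m" using that johnson_adj_card by auto
        then have "I = I0" "K = I0" using I0 that card_subset_eq[of I0 I] card_subset_eq[of I0 K] by auto
        then show False using adj by (auto simp: johnson_adj_def)
      qed
      then show ?case by blast
    next
      case (Suc k)
      then obtain W where W: "\<And>I K. card I = m \<Longrightarrow> johnson_adj I K \<Longrightarrow> card (I - I0) \<le> k \<Longrightarrow> card (K - I0) \<le> k \<Longrightarrow> W I - W K = D I K"
        by blast
      \<comment> \<open>Steps towards \<open>I0\<close>: each lowers the distance
        \<open>card (I - I0)\<close> by one.\<close>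
      define c where "c = (\<lambda>I K. \<exists>t b. t \<in> I - I0 \<and> b \<in> I0 - I \<and> K = insert b (I - {t}))"
      have c_adj: "johnson_adj I K" if "c I K" for I K using that by (auto simp: c_def johnson_adj_def)
      have c_dist: "card (K - I0) = k" if cIK: "c I K" and I: "card (I - I0) = Suc k" for I K
      proof -
        obtain t b where "t \<in> I - I0" "b \<in> I0 - I" "K = insert b (I - {t})" using cIK by (auto simp: c_def)
        then show ?thesis using dist[of t I b] I by simp
      qed
      have indep: "D I K + W K = D I K' + W K'"
        if m: "card I = m" and I: "card (I - I0) = Suc k" and cK: "c I K" "c I K'" for I K K'
      proof -
        obtain t b where K: "t \<in> I - I0" "b \<in> I0 - I" "K = insert b (I - {t})" using cK(1) by (auto simp: c_def)
        obtain t' b' where K': "t' \<in> I - I0" "b' \<in> I0 - I" "K' = insert b' (I - {t'})" using cK(2) by (auto simp: c_def)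
        have cards: "card K = m" "card K' = m" using cK c_adj johnson_adj_card m by metis+
        show ?thesis
        proof (cases "K = K'")
          case False
          show ?thesis
          proof (cases "t = t' \<or> b = b'")
            case True
            have "johnson_adj K K'"
            proof (cases "t = t'")
              case True
              then have "b \<noteq> b'" using K(3) K'(3) \<open>K \<noteq> K'\<close> by auto
              then show ?thesis using johnson_adjI[of b "I - {t}" b'] K K' True by simp
            next
              case False
              then have eq: "K = insert t' (insert b (I - {t, t'}))" "K' = insert t (insert b (I - {t, t'}))"
                using K K' True by auto
              show ?thesis unfolding eq by (rule johnson_adjI) (use False K K' True in auto)
            qed
            then show ?thesis using tri[OF m c_adj[OF cK(1)] _ c_adj[OF cK(2)]] W[of K K'] cards c_dist[OF cK(1) I] c_dist[OF cK(2) I]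
              by simp
          next
            case neq: False
            define A where "A = I - {t, t'}"
            \<comment> \<open>\<open>L\<close> closes the square through \<open>K\<close>,
              \<open>I\<close>, \<open>K'\<close> on the side nearer to \<open>I0\<close>, and the
              fifth set \<open>M\<close> is adjacent to all four, so that four triangles fill the
              square.\<close>
            define L where "L = insert b (insert b' A)"
            define M where "M = insert t (insert b A)"
            have sets: "I = insert t (insert t' A)" "K = insert t' (insert b A)" "K' = insert t (insert b' A)"
              using K K' neq by (auto simp: A_def)
            have tt: "t \<noteq> t'" "b \<noteq> b'" "t \<noteq> b" "t \<noteq> b'" "t' \<noteq> b" "t' \<noteq> b'" "t \<notin> A" "t' \<notin> A" "b \<notin> A" "b' \<notin> A"
              using K K' neq by (auto simp: A_def)
            have "johnson_adj (insert t' (insert t A)) (insert b (insert t A))"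
              "johnson_adj (insert t (insert b A)) (insert t' (insert b A))"
              "johnson_adj (insert t' (insert b A)) (insert b' (insert b A))"
              "johnson_adj (insert t (insert b A)) (insert b' (insert b A))"
              "johnson_adj (insert b (insert t A)) (insert b' (insert t A))"
              "johnson_adj (insert t (insert b' A)) (insert b (insert b' A))"
              by (rule johnson_adjI; use tt in simp)+
            then have a: "johnson_adj I M" "johnson_adj M K" "johnson_adj K L" "johnson_adj M L" "johnson_adj M K'" "johnson_adj K' L"
              unfolding sets L_def M_def by (simp_all only: insert_commute[of t' t] insert_commute[of b t] insert_commute[of b' t] insert_commute[of b' b])
            have "card M = m" using a(1) johnson_adj_card m by metis
            then have "D I M + D M K = D I K" "D M K + D K L = D M L" "D I M + D M K' = D I K'" "D M K' + D K' L = D M L"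
              using a c_adj cK m by (auto intro!: tri)
            moreover have "L - I0 \<subseteq> K - I0" using sets K K' by (auto simp: L_def)
            then have "card (L - I0) \<le> k" using c_dist[OF cK(1) I] card_mono[of "K - I0" "L - I0"] by simp
            then have "W K - W L = D K L" "W K' - W L = D K' L"
              using W[of K L] W[of K' L] a cards c_dist[OF cK(1) I] c_dist[OF cK(2) I] by auto
            ultimately show ?thesis by simp
          qed
        qed simp
      qed
      have ex_c: "\<exists>K. c I K" if m: "card I = m" and I: "card (I - I0) = Suc k" for I
      proof -
        obtain b where "b \<in> I0 - I" using ne[OF m I] by blast
        moreover obtain t where "t \<in> I - I0" using I by (metis card.empty ex_in_conv nat.distinct(1))
        ultimately show ?thesis unfolding c_def by blast
      qed
      define W' where "W' = (\<lambda>I. if card (I - I0) = Suc k then D I (SOME K. c I K) + W (SOME K. c I K) else W I)"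
      have W'_eq: "W' I = D I K + W K" if "card I = m" "card (I - I0) = Suc k" "c I K" for I K
        using indep[OF that(1,2) someI_ex[OF ex_c[OF that(1,2)]] that(3)] that(2) by (simp add: W'_def)
      have W'_old: "W' I = W I" if "card (I - I0) \<le> k" for I using that by (simp add: W'_def)
      have cI: "c I K" if adj: "johnson_adj I K" and "card (I - I0) = Suc k" "card (K - I0) \<le> k" for I K
      proof -
        obtain x y where xy: "x \<in> I" "y \<notin> I" "K = insert y (I - {x})" using adj by (auto simp: johnson_adj_def)
        then have "x \<notin> I0 \<and> y \<in> I0" using dist[of x I y] that by (auto split: if_splits)
        then show ?thesis using xy by (auto simp: c_def)
      qed
      have main: "W' I - W' K = D I K" if m: "card I = m" and adj: "johnson_adj I K"
        and I: "card (I - I0) = Suc k" and K: "card (K - I0) \<le> Suc k" for I K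
      proof (cases "card (K - I0) = Suc k")
        case False
        then have Kk: "card (K - I0) \<le> k" using K by simp
        then show ?thesis using W'_eq[OF m I cI[OF adj I Kk]] W'_old[OF Kk] by simp
      next
        case True
        obtain x y where xy: "x \<in> I" "y \<notin> I" "K = insert y (I - {x})" using adj by (auto simp: johnson_adj_def)
        have iff: "x \<in> I0 \<longleftrightarrow> y \<in> I0" using dist[OF xy(1,2)] I True xy(3) by (auto split: if_splits)
        \<comment> \<open>An edge between sets at equal distance is the base of a triangle whose
          apex is nearer to \<open>I0\<close>.\<close>
        obtain M where M: "c I M" "c K M"
        proof (cases "x \<in> I0")
          case True
          obtain t where t: "t \<in> I - I0" using I by (metis card.empty ex_in_conv nat.distinct(1))
          have "c I (insert y (I - {t}))" unfolding c_def
            by (rule exI[of _ t], rule exI[of _ y]) (use t True iff xy in auto)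
          moreover have "insert y (I - {t}) = insert x (K - {t})" using xy t True iff by auto
          then have "c K (insert y (I - {t}))" unfolding c_def
            by (intro exI[of _ t] exI[of _ x]) (use t True iff xy in auto)
          ultimately show ?thesis by (rule that)
        next
          case False
          obtain b where b: "b \<in> I0 - I" using ne[OF m I] by blast
          have "c I (insert b (I - {x}))" unfolding c_def
            by (rule exI[of _ x], rule exI[of _ b]) (use b False xy in auto)
          moreover have "insert b (I - {x}) = insert b (K - {y})" using xy by auto
          then have "c K (insert b (I - {x}))" unfolding c_def
            by (intro exI[of _ y] exI[of _ b]) (use b False iff xy in auto)
          ultimately show ?thesis by (rule that)
        qed
        have Km: "card K = m" using adj johnson_adj_card m by metis
        have "D I K + D K M = D I M" using tri[OF m adj c_adj[OF M(2)] c_adj[OF M(1)]] .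
        then show ?thesis using W'_eq[OF m I M(1)] W'_eq[OF Km True M(2)] by simp
      qed
      show ?case
      proof (intro exI[of _ W'] allI impI)
        fix I K assume *: "card I = m" "johnson_adj I K" "card (I - I0) \<le> Suc k" "card (K - I0) \<le> Suc k"
        have Km: "card K = m" using * johnson_adj_card by metis
        consider "card (I - I0) = Suc k" | "card (K - I0) = Suc k" | "card (I - I0) \<le> k" "card (K - I0) \<le> k"
          using * by linarith
        then show "W' I - W' K = D I K"
        proof cases
          case 1
          show ?thesis using main[OF *(1,2) 1 *(4)] .
        next
          case 2
          then show ?thesis using main[OF Km johnson_adj_sym[OF *(2)] 2 *(3)] anti[OF *(1,2)] by simp
        next
          case 3
          then show ?thesis using W * W'_old by simp
        qed
      qed
    qed
    from this[of m] obtain W where W: "\<And>I K. card I = m \<Longrightarrow> johnson_adj I K \<Longrightarrow> card (I - I0) \<le> m \<Longrightarrow> card (K - I0) \<le> m \<Longrightarrow> W I - W K = D I K"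
      by blast
    have "card (I - I0) \<le> card I" for I by (intro card_mono) auto
    then show ?thesis using W johnson_adj_card by metis
  qed
qed

subsection \<open>Decomposition into functions of the flag members\<close>

definition flag_sum :: "('n::{finite,linorder} set \<Rightarrow> real) \<Rightarrow> 'n perm \<Rightarrow> real" where
  "flag_sum w \<sigma> = (\<Sum>d=1..CARD('n). w (lev \<sigma> d))"

lemma flag_sum_adj:
  fixes \<sigma> :: "'n::{finite,linorder} perm"
  assumes "Suc d < CARD('n)"
  shows "flag_sum w \<sigma> - flag_sum w (adj d * \<sigma>) = w (lev \<sigma> (Suc d)) - w (lev (adj d * \<sigma>) (Suc d))"
proof -
  have "flag_sum w \<sigma> = w (lev \<sigma> (Suc d)) + (\<Sum>e\<in>{1..CARD('n)} - {Suc d}. w (lev \<sigma> e))" for \<sigma> :: "'n perm"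
    unfolding flag_sum_def using assms by (intro sum.remove) auto
  moreover have "(\<Sum>e\<in>{1..CARD('n)} - {Suc d}. w (lev (adj d * \<sigma>) e)) = (\<Sum>e\<in>{1..CARD('n)} - {Suc d}. w (lev \<sigma> e))"
    using lev_adj[OF assms] by (intro sum.cong) auto
  ultimately show ?thesis by simp
qed

lemma johnson_edge:
  fixes I K :: "'n::{finite,linorder} set"
  assumes "card I = Suc d" "johnson_adj I K"
  obtains \<sigma> where "Suc d < CARD('n)" "lev \<sigma> (Suc d) = I" "lev (adj d * \<sigma>) (Suc d) = K"
proof -
  obtain x y where xy: "x \<in> I" "y \<notin> I" "K = insert y (I - {x})" using assms by (auto simp: johnson_adj_def)
  let ?A = "I - {x}"
  have cA: "card ?A = d" using assms(1) xy(1) by simp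
  have "card (insert y I) \<le> CARD('n)" by (intro card_mono) auto
  then have d: "Suc d < CARD('n)" using assms(1) xy(2) by simp
  obtain \<sigma> where \<sigma>: "lev \<sigma> (card ?A) = ?A" "\<And>k. k < length [x, y] \<Longrightarrow> pos \<sigma> (card ?A + k) = [x, y] ! k"
    using ex_perm_at[of "[x, y]" ?A] xy by auto
  have p: "lev \<sigma> d = ?A" "pos \<sigma> d = x" "pos \<sigma> (Suc d) = y" using \<sigma>(1) \<sigma>(2)[of 0] \<sigma>(2)[of 1] cA by auto
  have "lev \<sigma> (Suc d) = I" using lev_Suc[of d \<sigma>] d p xy by auto
  moreover have "lev (adj d * \<sigma>) (Suc d) = K" using lev_adj_Suc[OF d, of \<sigma>] p xy by auto
  ultimately show ?thesis using that d by blast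
qed

lemma lev_adj_Int_Un:
  fixes \<sigma> :: "'n::{finite,linorder} perm"
  assumes "Suc d < CARD('n)"
  shows "lev \<sigma> (Suc d) \<inter> lev (adj d * \<sigma>) (Suc d) = lev \<sigma> d"
    "lev \<sigma> (Suc d) \<union> lev (adj d * \<sigma>) (Suc d) = lev \<sigma> (Suc (Suc d))"
    "johnson_adj (lev \<sigma> (Suc d)) (lev (adj d * \<sigma>) (Suc d))"
  using lev_adj_Suc[OF assms, of \<sigma>] lev_Suc[of d \<sigma>] lev_Suc2[OF assms, of \<sigma>] assms
  by (auto intro!: johnson_adjI)

lemma lev_triple:
  fixes \<sigma> :: "'n::{finite,linorder} perm"
  assumes "Suc (Suc d) < CARD('n)"
  shows "lev \<sigma> (Suc d) = insert (pos \<sigma> d) (lev \<sigma> d)"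
    "lev \<sigma> (Suc (Suc d)) = insert (pos \<sigma> d) (insert (pos \<sigma> (Suc d)) (lev \<sigma> d))"
    "lev (adj d * \<sigma>) d = lev \<sigma> d" "lev (adj (Suc d) * \<sigma>) d = lev \<sigma> d"
  using assms by (auto simp: lev_Suc lev_adj)

text \<open>Two neighbouring sets of size \<open>Suc d\<close> determine the levels \<open>d\<close>
  and \<open>Suc (Suc d)\<close> as their intersection and union, so by the squares the difference
  of \<open>u\<close> across an edge is a function of this pair. The hexagons make it additive on
  both kinds of triangles, and each level gets a potential.\<close>

lemma modular_imp_flag_sum:
  fixes u :: "'n::{finite,linorder} perm \<Rightarrow> real"
  assumes hx: "hexagons_balanced u" and sq: "squares_balanced u"
  shows "\<exists>w. \<forall>\<sigma>. u \<sigma> = flag_sum w \<sigma>"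
proof -
  define D where "D = (\<lambda>d I K. let \<sigma> = SOME \<sigma>. lev \<sigma> (Suc d) = I \<and> lev (adj d * \<sigma>) (Suc d) = K in u \<sigma> - u (adj d * \<sigma>))"
  have D: "D d (lev \<sigma> (Suc d)) (lev (adj d * \<sigma>) (Suc d)) = u \<sigma> - u (adj d * \<sigma>)" if d: "Suc d < CARD('n)" for d \<sigma>
  proof -
    define \<tau> where "\<tau> = (SOME \<tau>. lev \<tau> (Suc d) = lev \<sigma> (Suc d) \<and> lev (adj d * \<tau>) (Suc d) = lev (adj d * \<sigma>) (Suc d))"
    have \<tau>: "lev \<tau> (Suc d) = lev \<sigma> (Suc d)" "lev (adj d * \<tau>) (Suc d) = lev (adj d * \<sigma>) (Suc d)"
      using someI[of "\<lambda>\<tau>. lev \<tau> (Suc d) = lev \<sigma> (Suc d) \<and> lev (adj d * \<tau>) (Suc d) = lev (adj d * \<sigma>) (Suc d)" \<sigma>]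
      by (auto simp: \<tau>_def)
    have "u \<tau> - u (adj d * \<tau>) = u \<sigma> - u (adj d * \<sigma>)"
      using \<tau> lev_adj_Int_Un[OF d, of \<sigma>] lev_adj_Int_Un[OF d, of \<tau>] by (intro edge_difference_cong[OF sq d]) auto
    then show ?thesis by (simp add: D_def \<tau>_def[symmetric] Let_def)
  qed
  have D_pos: "D d (insert (pos \<sigma> d) (lev \<sigma> d)) (insert (pos \<sigma> (Suc d)) (lev \<sigma> d)) = u \<sigma> - u (adj d * \<sigma>)"
    if "Suc d < CARD('n)" for d \<sigma>
    using D[OF that, of \<sigma>] lev_adj_Suc[OF that, of \<sigma>] lev_Suc[of d \<sigma>] that by simp
  have "\<exists>W. \<forall>I K. card I = Suc d \<longrightarrow> johnson_adj I K \<longrightarrow> W I - W K = D d I K" for d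
  proof (rule johnson_potential)
    fix I K :: "'n set" assume IK: "card I = Suc d" "johnson_adj I K"
    then obtain \<sigma> where \<sigma>: "Suc d < CARD('n)" "lev \<sigma> (Suc d) = I" "lev (adj d * \<sigma>) (Suc d) = K"
      using johnson_edge by blast
    then show "D d K I = - D d I K" using D[OF \<sigma>(1), of \<sigma>] D[OF \<sigma>(1), of "adj d * \<sigma>"] by simp
  next
    fix A :: "'n set" and a b c
    assume A: "Suc (card A) = Suc d" "a \<notin> A" "b \<notin> A" "c \<notin> A" "distinct [a, b, c]"
    have "card (A \<union> {a, b, c}) \<le> CARD('n)" by (intro card_mono) auto
    moreover have "card (A \<union> {a, b, c}) = card A + 3" using A by (subst card_Un_disjoint) auto
    ultimately have d: "Suc (Suc d) < CARD('n)" using A(1) by simp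
    obtain \<sigma> where \<sigma>: "lev \<sigma> (card A) = A" "\<And>k. k < length [a, b, c] \<Longrightarrow> pos \<sigma> (card A + k) = [a, b, c] ! k"
      using ex_perm_at[of "[a, b, c]" A] A by auto
    have p: "lev \<sigma> d = A" "pos \<sigma> d = a" "pos \<sigma> (Suc d) = b" "pos \<sigma> (Suc (Suc d)) = c"
      using \<sigma>(1) \<sigma>(2)[of 0] \<sigma>(2)[of 1] \<sigma>(2)[of 2] A(1) by auto
    let ?s = "\<lambda>\<sigma>. adj d * \<sigma>" and ?t = "\<lambda>\<sigma>. adj (Suc d) * \<sigma>"
    have d': "Suc d < CARD('n)" using d by simp
    note simps = p pos_adj_triple[OF d] lev_triple(3,4)[OF d]
    \<comment> \<open>The three hexagon edges with the smaller label give this kind of triangle;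
      those with the larger label give the other kind below.\<close>
    have "D d (insert a A) (insert b A) = u \<sigma> - u (?s \<sigma>)" using D_pos[OF d', of \<sigma>] by (simp add: simps)
    moreover have "D d (insert b A) (insert c A) = u (?t (?s \<sigma>)) - u (?s (?t (?s \<sigma>)))"
      using D_pos[OF d', of "?t (?s \<sigma>)"] by (simp add: simps)
    moreover have "D d (insert c A) (insert a A) = u (?s (?t \<sigma>)) - u (?t \<sigma>)"
      using D_pos[OF d', of "?s (?t \<sigma>)"] by (simp add: simps)
    ultimately show "D d (insert a A) (insert b A) + D d (insert b A) (insert c A) + D d (insert c A) (insert a A) = 0"
      using hx[unfolded hexagons_balanced_def, rule_format, OF d, of \<sigma>] by simp
  next
    fix A :: "'n set" and a b c
    assume A: "Suc (Suc (card A)) = Suc d" "a \<notin> A" "b \<notin> A" "c \<notin> A" "distinct [a, b, c]"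
    have "card (A \<union> {a, b, c}) \<le> CARD('n)" by (intro card_mono) auto
    moreover have "card (A \<union> {a, b, c}) = card A + 3" using A by (subst card_Un_disjoint) auto
    moreover obtain e where e: "d = Suc e" "card A = e" using A(1) by simp
    ultimately have d: "Suc (Suc e) < CARD('n)" by simp
    obtain \<sigma> where \<sigma>: "lev \<sigma> (card A) = A" "\<And>k. k < length [a, b, c] \<Longrightarrow> pos \<sigma> (card A + k) = [a, b, c] ! k"
      using ex_perm_at[of "[a, b, c]" A] A by auto
    have p: "lev \<sigma> e = A" "pos \<sigma> e = a" "pos \<sigma> (Suc e) = b" "pos \<sigma> (Suc (Suc e)) = c"
      using \<sigma>(1) \<sigma>(2)[of 0] \<sigma>(2)[of 1] \<sigma>(2)[of 2] e(2) by auto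
    let ?s = "\<lambda>\<sigma>. adj e * \<sigma>" and ?t = "\<lambda>\<sigma>. adj (Suc e) * \<sigma>"
    have D2: "D d (insert (pos \<tau> e) (insert (pos \<tau> (Suc e)) (lev \<tau> e))) (insert (pos \<tau> e) (insert (pos \<tau> (Suc (Suc e))) (lev \<tau> e)))
      = u \<tau> - u (?t \<tau>)" for \<tau>
      using D[OF d, of \<tau>] lev_triple(2)[OF d, of \<tau>] lev_triple(2,4)[OF d, of "?t \<tau>"] e(1) by (simp add: pos_adj_triple[OF d])
    note simps = p pos_adj_triple[OF d] lev_triple(3,4)[OF d]
    have "D d (insert a (insert b A)) (insert a (insert c A)) = u \<sigma> - u (?t \<sigma>)" using D2[of \<sigma>] by (simp add: simps)
    moreover have "D d (insert a (insert c A)) (insert b (insert c A)) = u (?s (?t \<sigma>)) - u (?t (?s (?t \<sigma>)))"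
      using D2[of "?s (?t \<sigma>)"] by (simp add: simps insert_commute)
    moreover have "D d (insert b (insert c A)) (insert a (insert b A)) = u (?t (?s \<sigma>)) - u (?s \<sigma>)"
      using D2[of "?t (?s \<sigma>)"] by (simp add: simps insert_commute)
    ultimately show "D d (insert a (insert b A)) (insert a (insert c A)) + D d (insert a (insert c A)) (insert b (insert c A))
      + D d (insert b (insert c A)) (insert a (insert b A)) = 0"
      using hx[unfolded hexagons_balanced_def, rule_format, OF d, of \<sigma>] adj_braid[OF d, of \<sigma>] by simp
  qed
  then obtain W where W: "\<And>d I K. card I = Suc d \<Longrightarrow> johnson_adj I K \<Longrightarrow> W d I - W d K = D d I K" by metis
  \<comment> \<open>The value at \<open>UNIV\<close>, a member of every flag, is kept free to absorb
    the additive constant at the end.\<close>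
  define w where "w = (\<lambda>I. if I = UNIV then 0 else W (card I - 1) I)"
  have "u \<sigma> - flag_sum w \<sigma> = u 1 - flag_sum w 1" for \<sigma>
  proof (induction \<sigma> rule: perm_descent_induct)
    case (step \<sigma> d)
    have wl: "w (lev \<tau> (Suc d)) = W d (lev \<tau> (Suc d))" for \<tau> :: "'n perm"
    proof -
      have "card (lev \<tau> (Suc d)) = Suc d" using step(1) by (simp add: card_lev)
      then show ?thesis using step(1) by (auto simp: w_def)
    qed
    have "W d (lev \<sigma> (Suc d)) - W d (lev (adj d * \<sigma>) (Suc d)) = u \<sigma> - u (adj d * \<sigma>)"
      using W[of "lev \<sigma> (Suc d)" d "lev (adj d * \<sigma>) (Suc d)"] lev_adj_Int_Un(3)[OF step(1), of \<sigma>] D[OF step(1), of \<sigma>] step(1)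
      by (simp add: card_lev)
    then show ?case using step flag_sum_adj[OF step(1), of w \<sigma>] wl by simp
  qed simp
  then have u: "u \<sigma> = flag_sum w \<sigma> + (u 1 - flag_sum w 1)" for \<sigma> by (metis add.commute diff_add_cancel)
  define w' where "w' = (\<lambda>I. if I = UNIV then u 1 - flag_sum w 1 else w I)"
  have w': "flag_sum w' \<sigma> = flag_sum w \<sigma> + (u 1 - flag_sum w 1)" for \<sigma>
  proof -
    have split: "{1..CARD('n)} = insert (CARD('n)) {1..<CARD('n)}" using card_ge_1[where 'n='n] by auto
    have "lev \<sigma> d \<noteq> UNIV" if "d < CARD('n)" for d using that card_lev[of d \<sigma>] by auto
    then have "(\<Sum>d=1..<CARD('n). w' (lev \<sigma> d)) = (\<Sum>d=1..<CARD('n). w (lev \<sigma> d))"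
      by (intro sum.cong) (auto simp: w'_def)
    then show ?thesis unfolding flag_sum_def[of w' \<sigma>] flag_sum_def[of w \<sigma>] split
      by (simp add: lev_card w'_def w_def)
  qed
  have "u \<sigma> = flag_sum w' \<sigma>" for \<sigma> using u[of \<sigma>] w'[of \<sigma>] by linarith
  then show ?thesis by blast
qed

text \<open>The tropical shadow of \<open>pl_three_term\<close> for positive series, whose terms
  cannot cancel; hence a minimum on the right instead of a minimum attained twice. No term involves
  \<open>w {}\<close>, which explains the restriction to nonempty sets below.\<close>

definition tropical_positive :: "('n::linorder set \<Rightarrow> real) \<Rightarrow> bool" where
  "tropical_positive w \<longleftrightarrow> (\<forall>S i j k. i < j \<and> j < k \<and> i \<notin> S \<and> j \<notin> S \<and> k \<notin> S \<longrightarrow>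
     w (insert j S) + w (insert i (insert k S))
     = min (w (insert i S) + w (insert j (insert k S))) (w (insert k S) + w (insert i (insert j S))))"

text \<open>Around a hexagon only two levels vary; each takes three sets, and every vertex selects
  an incident pair of them.\<close>

lemma flag_sum_triple:
  fixes \<sigma> :: "'n::{finite,linorder} perm" and w :: "'n set \<Rightarrow> real"
  assumes d: "Suc (Suc d) < CARD('n)"
  defines "c \<equiv> flag_sum w \<sigma> - w (lev \<sigma> (Suc d)) - w (lev \<sigma> (Suc (Suc d)))"
    and "A \<equiv> lev \<sigma> d" and "x \<equiv> pos \<sigma> d" and "y \<equiv> pos \<sigma> (Suc d)" and "z \<equiv> pos \<sigma> (Suc (Suc d))"
  shows "flag_sum w \<sigma> = c + w (insert x A) + w (insert x (insert y A))"
    "flag_sum w (adj d * \<sigma>) = c + w (insert y A) + w (insert x (insert y A))"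
    "flag_sum w (adj (Suc d) * \<sigma>) = c + w (insert x A) + w (insert x (insert z A))"
    "flag_sum w (adj d * (adj (Suc d) * \<sigma>)) = c + w (insert z A) + w (insert x (insert z A))"
    "flag_sum w (adj (Suc d) * (adj d * \<sigma>)) = c + w (insert y A) + w (insert y (insert z A))"
    "flag_sum w (adj d * (adj (Suc d) * (adj d * \<sigma>))) = c + w (insert z A) + w (insert y (insert z A))"
proof -
  let ?s = "\<lambda>\<sigma>. adj d * \<sigma>" and ?t = "\<lambda>\<sigma>. adj (Suc d) * \<sigma>"
  have d': "Suc d < CARD('n)" using d by simp
  have s: "flag_sum w (?s \<tau>) = flag_sum w \<tau> - w (insert (pos \<tau> d) (lev \<tau> d)) + w (insert (pos \<tau> (Suc d)) (lev \<tau> d))" for \<tau>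
    using flag_sum_adj[OF d', of w \<tau>] lev_triple(1)[OF d, of \<tau>] lev_triple(1,3)[OF d, of "?s \<tau>"]
    by (simp add: pos_adj_triple[OF d] lev_triple(3)[OF d])
  have t: "flag_sum w (?t \<tau>) = flag_sum w \<tau> - w (insert (pos \<tau> d) (insert (pos \<tau> (Suc d)) (lev \<tau> d)))
      + w (insert (pos \<tau> d) (insert (pos \<tau> (Suc (Suc d))) (lev \<tau> d)))" for \<tau>
    using flag_sum_adj[OF d, of w \<tau>] lev_triple(2)[OF d, of \<tau>] lev_triple(2)[OF d, of "?t \<tau>"]
    by (simp add: pos_adj_triple[OF d] lev_triple(4)[OF d])
  note simps = pos_adj_triple[OF d] lev_triple(3,4)[OF d]
  show 0: "flag_sum w \<sigma> = c + w (insert x A) + w (insert x (insert y A))"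
    unfolding c_def A_def x_def y_def using lev_triple(1,2)[OF d, of \<sigma>] by simp
  show 1: "flag_sum w (?s \<sigma>) = c + w (insert y A) + w (insert x (insert y A))"
    using s[of \<sigma>] 0 by (simp add: A_def x_def y_def)
  show 2: "flag_sum w (?t \<sigma>) = c + w (insert x A) + w (insert x (insert z A))"
    using t[of \<sigma>] 0 by (simp add: A_def x_def y_def z_def)
  show "flag_sum w (?s (?t \<sigma>)) = c + w (insert z A) + w (insert x (insert z A))"
    using s[of "?t \<sigma>"] 2 by (simp add: simps A_def x_def y_def z_def)
  show 4: "flag_sum w (?t (?s \<sigma>)) = c + w (insert y A) + w (insert y (insert z A))"
    using t[of "?s \<sigma>"] 1 by (simp add: simps A_def x_def y_def z_def insert_commute)
  show "flag_sum w (?s (?t (?s \<sigma>))) = c + w (insert z A) + w (insert y (insert z A))"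
    using s[of "?t (?s \<sigma>)"] 4 by (simp add: simps A_def x_def y_def z_def)
qed

lemma hexagons_balanced_flag_sum: "hexagons_balanced (flag_sum w)"
  unfolding hexagons_balanced_def
proof (intro allI impI)
  fix \<sigma> :: "'a perm" and d assume d: "Suc (Suc d) < CARD('a)"
  show "flag_sum w (adj d * \<sigma>) + flag_sum w (adj (Suc d) * \<sigma>) + flag_sum w (adj d * (adj (Suc d) * (adj d * \<sigma>)))
     = flag_sum w \<sigma> + flag_sum w (adj d * (adj (Suc d) * \<sigma>)) + flag_sum w (adj (Suc d) * (adj d * \<sigma>))"
    using flag_sum_triple[OF d, of w \<sigma>] by linarith
qed

lemma squares_balanced_flag_sum: "squares_balanced (flag_sum (w :: 'n::{finite,linorder} set \<Rightarrow> real))"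
  unfolding squares_balanced_def
proof (intro allI impI)
  fix \<sigma> :: "'n perm" and d e assume de: "Suc d < e \<and> Suc e < CARD('n)"
  then have d: "Suc d < CARD('n)" by simp
  have "flag_sum w \<sigma> - flag_sum w (adj d * \<sigma>) = flag_sum w (adj e * \<sigma>) - flag_sum w (adj d * (adj e * \<sigma>))"
    unfolding flag_sum_adj[OF d]
    using de adj_commute[of d e \<sigma>] lev_adj[of e "Suc d" \<sigma>] lev_adj[of e "Suc d" "adj d * \<sigma>"] by simp
  then show "flag_sum w (adj d * \<sigma>) + flag_sum w (adj e * \<sigma>) = flag_sum w \<sigma> + flag_sum w (adj d * (adj e * \<sigma>))"
    by simp
qed

text \<open>Up to a constant, the sum over two opposite vertices is the total of the six set values
  minus one of the three tropical products, so a maximum of vertex sums is a minimum of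
  products.\<close>

lemma hexagons_max_flag_sum_iff:
  "hexagons_max (flag_sum w) \<longleftrightarrow> tropical_positive (w :: 'n::{finite,linorder} set \<Rightarrow> real)"
proof
  assume *: "hexagons_max (flag_sum w)"
  show "tropical_positive w"
    unfolding tropical_positive_def
  proof (intro allI impI, elim conjE)
    fix S :: "'n set" and i j k
    assume S: "i < j" "j < k" "i \<notin> S" "j \<notin> S" "k \<notin> S"
    let ?d = "card S"
    have "card (S \<union> {i, j, k}) \<le> CARD('n)" by (intro card_mono) auto
    moreover have "card (S \<union> {i, j, k}) = ?d + 3" using S by (subst card_Un_disjoint) (auto simp: card_insert_if)
    ultimately have d: "Suc (Suc ?d) < CARD('n)" by simp
    obtain \<sigma> where \<sigma>: "lev \<sigma> ?d = S" "\<And>l. l < length [k, j, i] \<Longrightarrow> pos \<sigma> (?d + l) = [k, j, i] ! l"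
      using ex_perm_at[of "[k, j, i]" S] S less_trans[OF S(1,2)] by auto
    have p: "lev \<sigma> ?d = S" "pos \<sigma> ?d = k" "pos \<sigma> (Suc ?d) = j" "pos \<sigma> (Suc (Suc ?d)) = i"
      using \<sigma>(1) \<sigma>(2)[of 0] \<sigma>(2)[of 1] \<sigma>(2)[of 2] by auto
    show "w (insert j S) + w (insert i (insert k S))
     = min (w (insert i S) + w (insert j (insert k S))) (w (insert k S) + w (insert i (insert j S)))"
      using *[unfolded hexagons_max_def, rule_format, of ?d \<sigma>, unfolded p, OF conjI[OF d conjI[OF S(2,1)]]]
        flag_sum_triple[OF d, of w \<sigma>] unfolding p
      by (simp only: insert_commute[of k i] insert_commute[of k j] insert_commute[of j i]; linarith)
  qed
next
  assume *: "tropical_positive w"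
  show "hexagons_max (flag_sum w)"
    unfolding hexagons_max_def
  proof (intro allI impI, elim conjE)
    fix \<sigma> :: "'n perm" and d
    assume d: "Suc (Suc d) < CARD('n)" and p: "pos \<sigma> (Suc d) < pos \<sigma> d" "pos \<sigma> (Suc (Suc d)) < pos \<sigma> (Suc d)"
    have "pos \<sigma> (Suc (Suc d)) < pos \<sigma> (Suc d) \<and> pos \<sigma> (Suc d) < pos \<sigma> d \<and>
        pos \<sigma> (Suc (Suc d)) \<notin> lev \<sigma> d \<and> pos \<sigma> (Suc d) \<notin> lev \<sigma> d \<and> pos \<sigma> d \<notin> lev \<sigma> d"
      using lev_Suc[of d \<sigma>] lev_Suc2[of d \<sigma>] lev_Suc2[of "Suc d" \<sigma>] d p by auto
    from *[unfolded tropical_positive_def, rule_format, OF this] show "flag_sum w \<sigma> + flag_sum w (adj d * (adj (Suc d) * (adj d * \<sigma>)))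
     = max (flag_sum w (adj d * \<sigma>) + flag_sum w (adj d * (adj (Suc d) * \<sigma>)))
         (flag_sum w (adj (Suc d) * \<sigma>) + flag_sum w (adj (Suc d) * (adj d * \<sigma>)))"
      using flag_sum_triple[OF d, of w \<sigma>]
      by (simp only: insert_commute[of "pos \<sigma> (Suc (Suc d))"] insert_commute[of "pos \<sigma> (Suc d)" "pos \<sigma> d"]; linarith)
  qed
qed

theorem local_conditions_iff:
  fixes u :: "'n::{finite,linorder} perm \<Rightarrow> real"
  shows "hexagons_balanced u \<and> squares_balanced u \<and> hexagons_max u
    \<longleftrightarrow> (\<exists>w. tropical_positive w \<and> (\<forall>\<sigma>. u \<sigma> = flag_sum w \<sigma>))"
proof
  assume *: "hexagons_balanced u \<and> squares_balanced u \<and> hexagons_max u"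
  then obtain w where "\<And>\<sigma>. u \<sigma> = flag_sum w \<sigma>" using modular_imp_flag_sum by blast
  then have "u = flag_sum w" by blast
  then show "\<exists>w. tropical_positive w \<and> (\<forall>\<sigma>. u \<sigma> = flag_sum w \<sigma>)"
    using * hexagons_max_flag_sum_iff by blast
next
  assume "\<exists>w. tropical_positive w \<and> (\<forall>\<sigma>. u \<sigma> = flag_sum w \<sigma>)"
  then obtain w where "tropical_positive w" "u = flag_sum w" by blast
  then show "hexagons_balanced u \<and> squares_balanced u \<and> hexagons_max u"
    using hexagons_balanced_flag_sum squares_balanced_flag_sum hexagons_max_flag_sum_iff by blast
qed

section \<open>Tropically positive functions as valuations of totally positive flags\<close>

lemma hahn_less_iff: "0 < x \<longleftrightarrow> hahn_pos x"
  by (simp add: less_hahn_def)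

lemma hahn_val_mult:
  assumes "x \<noteq> 0" "y \<noteq> 0"
  shows "hahn_val (x * y) = hahn_val x + hahn_val y"
proof (rule hahn_val_eqI)
  have le: "hahn_val x \<le> a" if "hahn_coeff x a \<noteq> 0" for a using hahn_val(2)[OF assms(1) that] .
  have le': "hahn_val y \<le> a" if "hahn_coeff y a \<noteq> 0" for a using hahn_val(2)[OF assms(2) that] .
  have "hahn_coeff (x * y) (hahn_val x + hahn_val y) = hahn_coeff x (hahn_val x) * hahn_coeff y (hahn_val y)"
    by (subst hahn_coeff_mult_superset[of "{hahn_val x}"]) (auto dest!: le le')
  then show "hahn_coeff (x * y) (hahn_val x + hahn_val y) \<noteq> 0"
    using hahn_val(1)[OF assms(1)] hahn_val(1)[OF assms(2)] by simp
  show "hahn_coeff (x * y) e = 0" if "e < hahn_val x + hahn_val y" for e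
    using that by (auto elim!: hahn_coeff_mult_nonzeroE dest!: le le' intro: ccontr)
qed

lemma hahn_coeff_less_val: "x \<noteq> 0 \<Longrightarrow> e < hahn_val x \<Longrightarrow> hahn_coeff x e = 0"
  using hahn_val(2)[of x e] by auto

text \<open>Positive leading coefficients cannot cancel, even at equal valuations.\<close>

lemma hahn_val_add:
  assumes "0 < x" "0 < y"
  shows "hahn_val (x + y) = min (hahn_val x) (hahn_val y)"
proof (rule hahn_val_eqI)
  have pos: "x \<noteq> 0" "0 < hahn_coeff x (hahn_val x)" "y \<noteq> 0" "0 < hahn_coeff y (hahn_val y)"
    using assms by (auto simp: hahn_less_iff hahn_pos_def)
  have nn: "0 \<le> hahn_coeff x e" if "e \<le> hahn_val x" for e
    using that pos hahn_coeff_less_val[of x e] by (cases "e = hahn_val x") auto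
  have nn': "0 \<le> hahn_coeff y e" if "e \<le> hahn_val y" for e
    using that pos hahn_coeff_less_val[of y e] by (cases "e = hahn_val y") auto
  show "hahn_coeff (x + y) (min (hahn_val x) (hahn_val y)) \<noteq> 0"
    using pos nn[of "hahn_val y"] nn'[of "hahn_val x"] by (cases "hahn_val x \<le> hahn_val y") (auto simp: min_def)
  show "hahn_coeff (x + y) e = 0" if "e < min (hahn_val x) (hahn_val y)" for e
    using that pos by (simp add: hahn_coeff_less_val)
qed

lemma hahn_val_uminus: "hahn_val (- x) = hahn_val x"
  by (simp add: hahn_val_def)

lemma hahn_monom_pos: "0 < c \<Longrightarrow> 0 < hahn_monom c v"
  unfolding hahn_less_iff hahn_pos_iff by (intro exI[of _ v]) (simp add: hahn_coeff_monom)

lemma hahn_val_monom: "c \<noteq> 0 \<Longrightarrow> hahn_val (hahn_monom c v) = v"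
  by (rule hahn_val_eqI) (simp_all add: hahn_coeff_monom)

lemma hahn_val_divide:
  assumes "x \<noteq> 0" "y \<noteq> 0"
  shows "hahn_val (x / y) = hahn_val x - hahn_val y"
  using hahn_val_mult[of "x / y" y] assms by simp

lemma hahn_coeff_sum: "hahn_coeff (sum f A) e = (\<Sum>a\<in>A. hahn_coeff (f a) e)"
  by (induction A rule: infinite_finite_induct) auto

lemma hahn_val_sum_ge:
  assumes "sum f A \<noteq> 0"
  shows "\<exists>a\<in>A. f a \<noteq> 0 \<and> hahn_val (f a) \<le> hahn_val (sum f A)"
proof -
  have "(\<Sum>a\<in>A. hahn_coeff (f a) (hahn_val (sum f A))) \<noteq> 0"
    using hahn_val(1)[OF assms] by (simp add: hahn_coeff_sum)
  then obtain a where a: "a \<in> A" "hahn_coeff (f a) (hahn_val (sum f A)) \<noteq> 0"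
    by (rule sum.not_neutral_contains_not_neutral)
  then have "f a \<noteq> 0" by auto
  then show ?thesis using a hahn_val(2) by blast
qed

text \<open>A term of strictly least valuation would survive in the sum.\<close>

lemma min_attained_twice_of_sum_zero:
  assumes "x + y + z = 0" "x \<noteq> 0" "y \<noteq> 0" "z \<noteq> 0"
  shows "min_attained_twice (hahn_val x) (hahn_val y) (hahn_val z)"
proof -
  have *: "\<not> (hahn_val x < hahn_val y \<and> hahn_val x < hahn_val z)" if "x + y + z = 0" "x \<noteq> 0" "y \<noteq> 0" "z \<noteq> 0" for x y z
  proof
    assume lt: "hahn_val x < hahn_val y \<and> hahn_val x < hahn_val z"
    have "hahn_coeff x (hahn_val x) + hahn_coeff y (hahn_val x) + hahn_coeff z (hahn_val x) = 0"
      using that(1) by (metis hahn_coeff_0 hahn_coeff_add)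
    then show False using lt that hahn_val(1)[of x] by (simp add: hahn_coeff_less_val)
  qed
  have "\<not> (hahn_val x < hahn_val y \<and> hahn_val x < hahn_val z)" "\<not> (hahn_val y < hahn_val x \<and> hahn_val y < hahn_val z)"
    "\<not> (hahn_val z < hahn_val x \<and> hahn_val z < hahn_val y)"
    using *[of x y z] *[of y x z] *[of z x y] assms by (auto simp: add_ac)
  then show ?thesis unfolding min_attained_twice_def by linarith
qed

subsection \<open>The valuation ring and its residue map\<close>

definition integral_hahn :: "hahn \<Rightarrow> bool" where
  "integral_hahn x \<longleftrightarrow> (\<forall>e<0. hahn_coeff x e = 0)"

abbreviation residue :: "hahn \<Rightarrow> real" where
  "residue x \<equiv> hahn_coeff x 0"

lemma integral_hahn_iff: "x \<noteq> 0 \<Longrightarrow> integral_hahn x \<longleftrightarrow> 0 \<le> hahn_val x"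
  unfolding integral_hahn_def using hahn_val(1)[of x] hahn_coeff_less_val[of x] by (meson less_le_trans not_le)

lemma integral_hahn_0 [simp]: "integral_hahn 0" and integral_hahn_1 [simp]: "integral_hahn 1"
  by (simp_all add: integral_hahn_def hahn_coeff_1)

lemma integral_hahn_mult:
  assumes "integral_hahn x" "integral_hahn y"
  shows "integral_hahn (x * y)" "residue (x * y) = residue x * residue y"
proof -
  have x: "0 \<le> a" if "hahn_coeff x a \<noteq> 0" for a using assms that by (auto simp: integral_hahn_def intro: leI)
  have y: "0 \<le> a" if "hahn_coeff y a \<noteq> 0" for a using assms that by (auto simp: integral_hahn_def intro: leI)
  show "integral_hahn (x * y)"
    unfolding integral_hahn_def
  proof (intro allI impI)
    fix e :: real assume e: "e < 0"
    show "hahn_coeff (x * y) e = 0"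
    proof (rule ccontr)
      assume "hahn_coeff (x * y) e \<noteq> 0"
      then obtain a b where "hahn_coeff x a \<noteq> 0" "hahn_coeff y b \<noteq> 0" "e = a + b"
        by (rule hahn_coeff_mult_nonzeroE)
      then show False using x[of a] y[of b] e by simp
    qed
  qed
  show "residue (x * y) = residue x * residue y"
    by (subst hahn_coeff_mult_superset[of "{0}"]) (auto dest!: x y)
qed

lemma integral_hahn_uminus: "integral_hahn x \<Longrightarrow> integral_hahn (- x)"
  by (simp add: integral_hahn_def)

lemma integral_hahn_sum: "(\<And>a. a \<in> A \<Longrightarrow> integral_hahn (f a)) \<Longrightarrow> integral_hahn (sum f A)"
  by (simp add: integral_hahn_def hahn_coeff_sum)

lemma integral_hahn_prod:
  "(\<And>a. a \<in> A \<Longrightarrow> integral_hahn (f a)) \<Longrightarrow> integral_hahn (prod f A) \<and> residue (prod f A) = (\<Prod>a\<in>A. residue (f a))"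
  by (induction A rule: infinite_finite_induct) (auto simp: integral_hahn_mult hahn_coeff_1)

lemma minor_residue:
  assumes "\<And>i c. i < length xs \<Longrightarrow> c \<in> set xs \<Longrightarrow> integral_hahn (g i c)"
  shows "integral_hahn (minor g xs)" "residue (minor g xs) = minor (\<lambda>i c. residue (g i c)) xs"
proof -
  let ?n = "length xs"
  have p: "integral_hahn (signof p * (\<Prod>i = 0..<?n. minor_mat g xs $$ (i, p i))) \<and>
      residue (signof p * (\<Prod>i = 0..<?n. minor_mat g xs $$ (i, p i)))
      = signof p * (\<Prod>i = 0..<?n. minor_mat (\<lambda>i c. residue (g i c)) xs $$ (i, p i))"
    if "p permutes {0..<?n}" for p
  proof -
    have in_n: "p i < ?n" if "i < ?n" for i
      using permutes_in_image[OF \<open>p permutes {0..<?n}\<close>, of i] that by simp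
    have "integral_hahn (\<Prod>i = 0..<?n. minor_mat g xs $$ (i, p i)) \<and>
      residue (\<Prod>i = 0..<?n. minor_mat g xs $$ (i, p i)) = (\<Prod>i = 0..<?n. residue (minor_mat g xs $$ (i, p i)))"
      using in_n assms by (intro integral_hahn_prod) auto
    moreover have "(\<Prod>i = 0..<?n. residue (minor_mat g xs $$ (i, p i))) = (\<Prod>i = 0..<?n. minor_mat (\<lambda>i c. residue (g i c)) xs $$ (i, p i))"
      using in_n by (intro prod.cong) auto
    ultimately show ?thesis by (cases "sign p = 1") (auto simp: sign_def integral_hahn_uminus split: if_splits)
  qed
  show "integral_hahn (minor g xs)"
    unfolding minor_def det_def'[OF minor_mat_carrier] using p by (intro integral_hahn_sum) auto
  show "residue (minor g xs) = minor (\<lambda>i c. residue (g i c)) xs"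
    unfolding minor_def det_def'[OF minor_mat_carrier] hahn_coeff_sum using p by (intro sum.cong) auto
qed

subsection \<open>Matrices with prescribed interval minors\<close>

text \<open>The matrix is filled row by row, each row from left to right. The entry of row
  \<open>d\<close> in column \<open>a + d\<close> enters the minor on \<open>[a..<a + Suc d]\<close>
  with the minor on \<open>[a..<a + d]\<close> as coefficient, which is nonzero by the preceding
  rows, and no minor prescribed earlier contains this entry.\<close>

lemma ex_interval_minors:
  fixes x :: "nat \<Rightarrow> nat \<Rightarrow> 'k::field"
  assumes x: "\<And>d a. x d a \<noteq> 0"
  shows "\<exists>g. \<forall>d<m. \<forall>a<N. minor g [a..<a + Suc d] = x d a"
proof (induction m)
  case (Suc m)
  then obtain g where g: "\<And>d a. d < m \<Longrightarrow> a < N \<Longrightarrow> minor g [a..<a + Suc d] = x d a" by blast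
  have "\<exists>r. \<forall>a<N'. minor (g(m := r)) [a..<a + Suc m] = x m a" if "N' \<le> N" for N'
    using that
  proof (induction N')
    case (Suc N')
    then obtain r where r: "\<And>a. a < N' \<Longrightarrow> minor (g(m := r)) [a..<a + Suc m] = x m a"
      by (meson Suc_leD)
    define h where "h = (\<lambda>v. g(m := r(N' + m := v)))"
    let ?xs = "[N'..<N' + m]" and ?c = "N' + m"
    define c where "c = (\<lambda>l. (-1) ^ (l + m) * minor (\<lambda>i. (g(m := r)) (if i < l then i else Suc i)) ?xs)"
    have old: "minor (h v) [a..<a + Suc m] = x m a" if "a < N'" for v a
      unfolding r[OF that, symmetric] by (rule minor_cong) (use that in \<open>auto simp: h_def\<close>)
    have "c m = minor (g(m := r)) ?xs" using minor_snoc_last_coeff[of ?xs "g(m := r)"] by (simp add: c_def)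
    also have "\<dots> = minor g ?xs" by (rule minor_cong) auto
    also have "\<dots> \<noteq> 0"
    proof (cases m)
      case (Suc m')
      then show ?thesis using g[of m' N'] Suc.prems x[of m' N'] by simp
    qed simp
    finally have cm: "c m \<noteq> 0" .
    have new: "minor (h v) [N'..<N' + Suc m] = (\<Sum>l<m. g l ?c * c l) + v * c m" for v
    proof -
      have "minor (h v) (?xs @ [?c]) = (\<Sum>l\<le>length ?xs. h v l ?c *
          ((-1) ^ (l + length ?xs) * minor (\<lambda>i. h v (if i < l then i else Suc i)) ?xs))"
        by (rule minor_snoc)
      also have "\<dots> = (\<Sum>l\<le>m. h v l ?c * c l)"
        unfolding c_def by (intro sum.cong arg_cong2[of _ _ _ _ "(*)"] minor_cong) (auto simp: h_def)
      also have "\<dots> = (\<Sum>l<m. h v l ?c * c l) + h v m ?c * c m"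
        by (simp add: lessThan_Suc_atMost[symmetric])
      finally show ?thesis by (simp add: h_def)
    qed
    define v where "v = (x m N' - (\<Sum>l<m. g l ?c * c l)) / c m"
    have "minor (h v) [N'..<N' + Suc m] = x m N'" unfolding new v_def using cm by simp
    then show ?case using old[of _ v] unfolding h_def by (metis less_Suc_eq)
  qed auto
  then obtain r where r: "\<And>a. a < N \<Longrightarrow> minor (g(m := r)) [a..<a + Suc m] = x m a" by blast
  have "minor (g(m := r)) [a..<a + Suc d] = x d a" if "d < Suc m" "a < N" for d a
  proof (cases "d = m")
    case False
    then show ?thesis using that g[of d a, symmetric] by (auto intro!: minor_cong)
  qed (use r that in simp)
  then show ?case by blast
qed simp

lemma sorted_list_of_interval:
  assumes "a + d \<le> CARD('n)"
  shows "sorted_list_of_set {c :: 'n::{finite,linorder}. a < idx c \<and> idx c \<le> a + d} = map (\<lambda>m. el (Suc m)) [a..<a + d]"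
proof (rule sorted_list_of_set_eqI)
  have e: "idx (el (Suc m) :: 'n) = Suc m" if "m < a + d" for m using that assms by (intro idx_el) auto
  show "sorted_wrt (<) (map (\<lambda>m. el (Suc m) :: 'n) [a..<a + d])"
    unfolding sorted_wrt_map by (rule sorted_wrt_mono_rel[OF _ sorted_wrt_upt]) (auto simp: idx_less_iff[symmetric] e)
  show "set (map (\<lambda>m. el (Suc m)) [a..<a + d]) = {c :: 'n. a < idx c \<and> idx c \<le> a + d}"
  proof (intro equalityI subsetI)
    fix c :: 'n assume c: "c \<in> {c. a < idx c \<and> idx c \<le> a + d}"
    then have "c = el (Suc (idx c - 1))" by simp
    moreover have "idx c - 1 \<in> {a..<a + d}" using c by auto
    ultimately show "c \<in> set (map (\<lambda>m. el (Suc m)) [a..<a + d])" by (metis image_eqI list.set_map set_upt)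
  qed (auto simp: e)
qed simp

text \<open>By the three-term relations, the interval minors determine all others through subtraction-free
  rational expressions.\<close>

theorem ex_totally_positive_lift:
  fixes w :: "'n::{finite,linorder} set \<Rightarrow> real"
  assumes w: "tropical_positive w"
  shows "\<exists>f :: nat \<Rightarrow> 'n \<Rightarrow> hahn. \<forall>I. I \<noteq> {} \<longrightarrow> 0 < pl f I \<and> hahn_val (pl f I) = w I"
proof -
  let ?iv = "\<lambda>a d. {c :: 'n. a < idx c \<and> idx c \<le> a + d}"
  have nz: "hahn_monom 1 e \<noteq> 0" for e using hahn_monom_pos[of 1 e] by auto
  have "\<exists>g. \<forall>d<CARD('n). \<forall>a<CARD('n). minor g [a..<a + Suc d] = hahn_monom 1 (w (?iv a (Suc d)))"
    by (rule ex_interval_minors) (rule nz)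
  then obtain g :: "nat \<Rightarrow> nat \<Rightarrow> hahn" where g: "\<And>d a. d < CARD('n) \<Longrightarrow> a < CARD('n) \<Longrightarrow>
      minor g [a..<a + Suc d] = hahn_monom 1 (w (?iv a (Suc d)))"
    by blast
  define f where "f = (\<lambda>i (c :: 'n). g i (idx c - 1))"
  have iv: "pl f (?iv a (Suc d)) = hahn_monom 1 (w (?iv a (Suc d)))" if "a + Suc d \<le> CARD('n)" for a d
  proof -
    have "pl f (?iv a (Suc d)) = minor (\<lambda>i m. f i (el (Suc m))) [a..<a + Suc d]"
      unfolding pl_def sorted_list_of_interval[OF that] by (rule minor_map)
    also have "\<dots> = minor g [a..<a + Suc d]"
      using that by (intro minor_cong) (auto simp: f_def idx_el)
    finally show ?thesis using g[of d a] that by simp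
  qed
  have "0 < pl f I \<and> hahn_val (pl f I) = w I" if "I \<noteq> {}" for I
    using that
  proof (induction "idx (Max I) - idx (Min I)" arbitrary: I rule: less_induct)
    case less
    define i where "i = Min I"
    define k where "k = Max I"
    have ik: "i \<in> I" "k \<in> I" "\<And>c. c \<in> I \<Longrightarrow> i \<le> c \<and> c \<le> k" using less.prems by (auto simp: i_def k_def)
    show ?case
    proof (cases "I = {i..k}")
      case True
      define a where "a = idx i - 1"
      define d where "d = idx k - idx i"
      have le: "1 \<le> idx i" "idx i \<le> idx k" "idx k \<le> CARD('n)"
        using ik idx_ge_1[of i] idx_le_card[of k] by (auto simp: idx_le_iff)
      have "I = ?iv a (Suc d)"
        unfolding True using le by (auto simp: a_def d_def idx_le_iff[symmetric])
      then show ?thesis using iv[of a d] le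
        by (auto simp: a_def d_def hahn_monom_pos hahn_val_monom)
    next
      case False
      \<comment> \<open>With a gap \<open>j\<close> of \<open>I\<close>, each of the other five sets
        in the relation omits the least or the greatest element of \<open>I\<close>, so it spans a
        shorter range and the induction hypothesis applies.\<close>
      then obtain j where j: "j \<notin> I" "i \<le> j" "j \<le> k" using ik by force
      then have ijk: "i < j" "j < k" using ik by (auto simp: order_le_less)
      define S where "S = I - {i, k}"
      have S: "i \<notin> S" "j \<notin> S" "k \<notin> S" "I = insert i (insert k S)" using ik j by (auto simp: S_def)
      have ih: "0 < pl f K \<and> hahn_val (pl f K) = w K" if K: "K \<noteq> {}" "K \<subseteq> {i..k}" "i \<notin> K \<or> k \<notin> K" for K
      proof (rule less.hyps[OF _ K(1)])
        have m: "Min K \<in> K" "Max K \<in> K" using K by auto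
        then have le: "i \<le> Min K" "Max K \<le> k" "Min K \<le> Max K" using K(2) by (auto intro: Max_ge)
        moreover have "i \<noteq> Min K \<or> Max K \<noteq> k" using K(3) m by metis
        ultimately have "i \<le> Min K" "Max K \<le> k" "Min K \<le> Max K" "i < Min K \<or> Max K < k"
          by (simp_all add: order_le_less) blast
        then have "idx i \<le> idx (Min K)" "idx (Max K) \<le> idx k" "idx (Min K) \<le> idx (Max K)"
          "idx i < idx (Min K) \<or> idx (Max K) < idx k" by (auto simp: idx_le_iff idx_less_iff)
        then show "idx (Max K) - idx (Min K) < idx (Max I) - idx (Min I)"
          unfolding i_def[symmetric] k_def[symmetric] by linarith
      qed
      have Sik: "S \<subseteq> {i..k}" using ik by (auto simp: S_def)
      have ihs: "0 < pl f (insert j S) \<and> hahn_val (pl f (insert j S)) = w (insert j S)"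
        "0 < pl f (insert i S) \<and> hahn_val (pl f (insert i S)) = w (insert i S)"
        "0 < pl f (insert k S) \<and> hahn_val (pl f (insert k S)) = w (insert k S)"
        "0 < pl f (insert j (insert k S)) \<and> hahn_val (pl f (insert j (insert k S))) = w (insert j (insert k S))"
        "0 < pl f (insert i (insert j S)) \<and> hahn_val (pl f (insert i (insert j S))) = w (insert i (insert j S))"
        by (rule ih; use Sik S ijk less_trans[OF ijk] in \<open>auto simp: less_imp_le\<close>)+
      have rel: "pl f (insert j S) * pl f I
        = pl f (insert i S) * pl f (insert j (insert k S)) + pl f (insert k S) * pl f (insert i (insert j S))"
        unfolding S(4) using S ijk
        by (intro pl_three_term[where T = "\<lambda>l m. if l = m then 1 else 0"])
          (auto simp: if_distrib[of "\<lambda>y. y * _"] cong: if_cong)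
      let ?x = "pl f (insert i S) * pl f (insert j (insert k S))" and ?y = "pl f (insert k S) * pl f (insert i (insert j S))"
      have pos: "0 < ?x" "0 < ?y" using ihs by (auto intro: mult_pos_pos)
      then have "0 < pl f (insert j S) * pl f I" using rel by simp
      then have I: "0 < pl f I" using ihs(1) by (simp add: zero_less_mult_iff)
      have "w (insert j S) + hahn_val (pl f I) = hahn_val (pl f (insert j S) * pl f I)"
        using ihs(1) I by (subst hahn_val_mult) auto
      also have "\<dots> = min (hahn_val ?x) (hahn_val ?y)" unfolding rel by (rule hahn_val_add[OF pos])
      also have "\<dots> = min (w (insert i S) + w (insert j (insert k S))) (w (insert k S) + w (insert i (insert j S)))"
        using ihs by (subst (1 2) hahn_val_mult) auto
      also have "\<dots> = w (insert j S) + w I"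
        using w[unfolded tropical_positive_def, rule_format, of i j k S] S ijk by simp
      finally show ?thesis using I by simp
    qed
  qed
  then show ?thesis by blast
qed

subsection \<open>Initial degenerations\<close>

text \<open>Choosing pivots of minimal valuation makes all entries integral; the residue matrix is then totally
  nonnegative and its nonzero minors are those of minimal valuation.\<close>

lemma ex_initial_flag:
  fixes w :: "'n::{finite,linorder} set \<Rightarrow> real"
  assumes w: "tropical_positive w"
  shows "\<exists>h m. tnn h \<and> (\<forall>I. I \<noteq> {} \<longrightarrow> m (card I) \<le> w I \<and> (pl h I \<noteq> 0 \<longleftrightarrow> w I = m (card I)))"
proof -
  obtain f :: "nat \<Rightarrow> 'n \<Rightarrow> hahn" where f: "\<And>I. I \<noteq> {} \<Longrightarrow> 0 < pl f I" "\<And>I. I \<noteq> {} \<Longrightarrow> hahn_val (pl f I) = w I"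
    using ex_totally_positive_lift[OF w] by blast
  have fpos: "0 < pl f I" for I using f(1)[of I] by (cases "I = {}") auto
  define v where "v = (\<lambda>I. hahn_val (pl f I))"
  have "minor f (sorted_list_of_set UNIV) \<noteq> 0" using fpos[of UNIV] by (simp add: pl_def)
  from ex_pivots[OF this, of "\<lambda>xs j. v (insert j (set xs))"] obtain js where
    len: "length js = CARD('n)" and dist: "distinct js" and nz: "\<And>d. d \<le> CARD('n) \<Longrightarrow> minor f (take d js) \<noteq> 0"
    and cost: "\<And>d c. d < CARD('n) \<Longrightarrow> minor f (take d js @ [c]) \<noteq> 0 \<Longrightarrow>
      v (insert (js ! d) (set (take d js))) \<le> v (insert c (set (take d js)))"
    by auto
  define P where "P = (\<lambda>d. pl f (set (take d js)))"
  have P: "0 < P d" for d using fpos by (simp add: P_def)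
  have P0: "P 0 = 1" by (simp add: P_def)
  have sgn: "\<exists>e\<in>{1, -1 :: hahn}. minor f xs = e * pl f (set xs)" if "distinct xs" for xs
    using minor_eq_sign_pl[OF that] by blast
  \<comment> \<open>These factors telescope: a minor of size \<open>d\<close> gets divided by
    \<open>P d\<close>, the coordinate of the first \<open>d\<close> pivots.\<close>
  define a where "a = (\<lambda>k. P k / (P (Suc k) * minor f (take k js)))"
  define g where "g = (\<lambda>d c. a d * minor f (take d js @ [c]))"
  have g: "minor g xs = minor f xs / P (length xs)" if "length xs \<le> CARD('n)" for xs
  proof -
    have "minor g xs = (\<Prod>k<length xs. a k * minor f (take k js)) * minor f xs"
      unfolding g_def by (rule minor_normal_rows) (use that len in simp)
    also have "(\<Prod>k<length xs. a k * minor f (take k js)) = (\<Prod>k<length xs. P k / P (Suc k))"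
      using that nz by (intro prod.cong) (auto simp: a_def)
    also have "\<dots> = 1 / P (length xs)"
    proof (induction "length xs")
      case 0
      then show ?case by (simp add: P0)
    next
      case (Suc m)
      show ?case
        unfolding Suc.hyps(2)[symmetric]
      proof -
        have "(\<Prod>k<l. P k / P (Suc k)) = 1 / P l" for l
          by (induction l) (use P in \<open>auto simp: P0 less_imp_neq[THEN not_sym]\<close>)
        then show "(\<Prod>k<Suc m. P k / P (Suc k)) = 1 / P (Suc m)" .
      qed
    qed
    finally show ?thesis by simp
  qed
  \<comment> \<open>Up to sign the entry is the coordinate of the first \<open>d\<close> pivots
    together with \<open>c\<close>, divided by \<open>P (Suc d)\<close>; the pivot was chosen with
    least valuation, so the quotient is integral.\<close>
  have int: "integral_hahn (g d c)" if d: "d < CARD('n)" for d c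
  proof (cases "minor f (take d js @ [c]) = 0")
    case False
    then have dc: "distinct (take d js @ [c])" using minor_not_distinct by blast
    obtain e where e: "e \<in> {1, -1 :: hahn}" "minor f (take d js @ [c]) = e * pl f (set (take d js @ [c]))"
      using sgn[OF dc] by blast
    obtain e' where e': "e' \<in> {1, -1 :: hahn}" "minor f (take d js) = e' * P d"
      using sgn[OF distinct_take[OF dist]] unfolding P_def by blast
    let ?I = "insert c (set (take d js))"
    have "g d c = e' * e * (pl f ?I / P (Suc d))"
      using e e' P[of d] by (auto simp: g_def a_def)
    moreover have "integral_hahn (pl f ?I / P (Suc d))"
    proof -
      have "set (take (Suc d) js) = insert (js ! d) (set (take d js))"
        using d len by (simp add: take_Suc_conv_app_nth)
      then have "hahn_val (P (Suc d)) \<le> hahn_val (pl f ?I)"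
        using cost[OF d False] by (simp add: v_def P_def)
      then show ?thesis using fpos[of ?I] P[of "Suc d"]
        by (subst integral_hahn_iff) (auto simp: hahn_val_divide less_imp_neq[THEN not_sym])
    qed
    ultimately show ?thesis using e(1) e'(1) by (auto simp: integral_hahn_uminus)
  qed (simp add: g_def)
  define h where "h = (\<lambda>d c. residue (g d c))"
  have card_le: "card I \<le> CARD('n)" for I :: "'n set" by (simp add: card_mono)
  have pl_g: "pl g I = pl f I / P (card I)" for I
    using g[of "sorted_list_of_set I"] card_le by (simp add: pl_def)
  have h: "integral_hahn (pl f I / P (card I))" "pl h I = residue (pl f I / P (card I))" for I
  proof -
    have i: "integral_hahn (g i c)" if "i < length (sorted_list_of_set I)" for i c
      using that card_le[of I] by (intro int) simp
    have "integral_hahn (pl g I)" "pl h I = residue (pl g I)"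
      unfolding pl_def h_def by (rule minor_residue[OF i] minor_residue(2)[OF i, symmetric], assumption)+
    then show "integral_hahn (pl f I / P (card I))" "pl h I = residue (pl f I / P (card I))"
      unfolding pl_g by simp_all
  qed
  define m where "m = (\<lambda>d. hahn_val (P d))"
  have quot: "0 < pl f I / P (card I)" "hahn_val (pl f I / P (card I)) = v I - m (card I)" for I
    using fpos[of I] P[of "card I"] by (auto simp: hahn_val_divide v_def m_def)
  \<comment> \<open>Integral entries have integral minors, so the pivot sets are minimal among all
    sets of their size, although each pivot was only compared with single extensions.\<close>
  have le: "m (card I) \<le> v I" for I
  proof -
    have "pl f I / P (card I) \<noteq> 0" using quot(1)[of I] by (metis less_irrefl)
    from integral_hahn_iff[OF this] show ?thesis using h(1)[of I] unfolding quot(2) by linarith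
  qed
  \<comment> \<open>A positive integral series has nonnegative residue, and the residue is nonzero
    exactly at valuation zero.\<close>
  have nz_iff: "pl h I \<noteq> 0 \<longleftrightarrow> v I = m (card I)" and nonneg: "0 \<le> pl h I" for I
  proof -
    let ?q = "pl f I / P (card I)"
    have q: "?q \<noteq> 0" "0 < hahn_coeff ?q (hahn_val ?q)" using quot(1)[of I] by (auto simp: hahn_less_iff hahn_pos_def)
    have "residue ?q = 0" if "0 < hahn_val ?q" using hahn_coeff_less_val[OF q(1) that] .
    then show "pl h I \<noteq> 0 \<longleftrightarrow> v I = m (card I)" "0 \<le> pl h I"
      using q(2) le[of I] unfolding h(2) quot(2)[of I] by (cases "v I = m (card I)"; force)+
  qed
  have "set js = UNIV" using dist len by (metis card_subset_eq distinct_card finite subset_UNIV)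
  then have "v UNIV = m (CARD('n))" using len by (simp add: v_def m_def P_def)
  then have "tnn h" using nonneg nz_iff[of UNIV] by (simp add: tnn_def)
  moreover have "m (card I) \<le> w I \<and> (pl h I \<noteq> 0 \<longleftrightarrow> w I = m (card I))" if "I \<noteq> {}" for I
    using le[of I] nz_iff[of I] f(2)[OF that] by (simp add: v_def)
  ultimately show ?thesis by blast
qed

text \<open>Some element of \<open>supp h\<close> attains the least value in all levels
  simultaneously, so minimizing the sum is minimizing each level, which is membership in
  \<open>supp h\<close>.\<close>

theorem flag_sum_argmin_interval:
  fixes w :: "'n::{finite,linorder} set \<Rightarrow> real"
  assumes "tropical_positive w"
  shows "\<exists>v w'. bruhat_le v w' \<and> {\<sigma>. \<forall>\<tau>. flag_sum w \<sigma> \<le> flag_sum w \<tau>} = {z. bruhat_le v z \<and> bruhat_le z w'}"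
proof -
  obtain h m where h: "tnn h" "\<And>I. I \<noteq> {} \<Longrightarrow> m (card I) \<le> w I" "\<And>I. I \<noteq> {} \<Longrightarrow> pl h I \<noteq> 0 \<longleftrightarrow> w I = m (card I)"
    using ex_initial_flag[OF assms] by blast
  obtain v w' where vw: "bruhat_le v w'" "supp h = {z. bruhat_le v z \<and> bruhat_le z w'}"
    using tnn_supp_interval[OF h(1)] by blast
  have lev: "lev \<sigma> d \<noteq> {}" "card (lev \<sigma> d) = d" if "d \<in> {1..CARD('n)}" for \<sigma> :: "'n perm" and d
    using that card_lev[of d \<sigma>] by auto
  have le: "m d \<le> w (lev \<sigma> d)" if "d \<in> {1..CARD('n)}" for \<sigma> :: "'n perm" and d
    using h(2)[OF lev(1)[OF that]] lev(2)[OF that] by simp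
  have supp_iff: "\<sigma> \<in> supp h \<longleftrightarrow> (\<forall>d\<in>{1..CARD('n)}. w (lev \<sigma> d) = m d)" for \<sigma>
  proof -
    have "pl h (lev \<sigma> d) \<noteq> 0" if "d \<notin> {1..CARD('n)}" for d
      using that h(1) lev_card[of d \<sigma>] by (cases "d = 0") (auto simp: tnn_def)
    moreover have "pl h (lev \<sigma> d) \<noteq> 0 \<longleftrightarrow> w (lev \<sigma> d) = m d" if "d \<in> {1..CARD('n)}" for d
      using h(3)[OF lev(1)[OF that]] lev(2)[OF that] by simp
    ultimately show ?thesis unfolding supp_def by blast
  qed
  let ?m = "\<Sum>d=1..CARD('n). m d"
  have ge: "?m \<le> flag_sum w \<sigma>" for \<sigma> :: "'n perm" unfolding flag_sum_def by (intro sum_mono le)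
  have eq: "flag_sum w \<sigma> = ?m \<longleftrightarrow> \<sigma> \<in> supp h" for \<sigma>
  proof
    assume "flag_sum w \<sigma> = ?m"
    then have eq: "sum m {1..CARD('n)} = (\<Sum>d=1..CARD('n). w (lev \<sigma> d))" by (simp add: flag_sum_def)
    have "m d = w (lev \<sigma> d)" if "d \<in> {1..CARD('n)}" for d
      using sum_mono_inv[OF eq le that] by simp
    then show "\<sigma> \<in> supp h" unfolding supp_iff by simp
  next
    assume "\<sigma> \<in> supp h"
    then show "flag_sum w \<sigma> = ?m" unfolding supp_iff flag_sum_def by (intro sum.cong) auto
  qed
  have "v \<in> supp h" using vw by simp
  then have v: "flag_sum w v = ?m" using eq by blast
  have "(\<forall>\<tau>. flag_sum w \<sigma> \<le> flag_sum w \<tau>) \<longleftrightarrow> \<sigma> \<in> supp h" for \<sigma>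
  proof
    assume "\<forall>\<tau>. flag_sum w \<sigma> \<le> flag_sum w \<tau>"
    then have "flag_sum w \<sigma> \<le> ?m" unfolding v[symmetric] by (rule spec)
    then show "\<sigma> \<in> supp h" using ge[of \<sigma>] eq[of \<sigma>] by simp
  next
    assume "\<sigma> \<in> supp h"
    then have "flag_sum w \<sigma> = ?m" using eq by blast
    then show "\<forall>\<tau>. flag_sum w \<sigma> \<le> flag_sum w \<tau>" using ge by simp
  qed
  then have "{\<sigma>. \<forall>\<tau>. flag_sum w \<sigma> \<le> flag_sum w \<tau>} = supp h" by blast
  then show ?thesis using vw by blast
qed

no_notation Matrix.vec_index (infixl "$" 100)

section \<open>Realizations by linear spaces\<close>

lemma indicator_vec_nth: "indicator_vec Y $ i = (if i \<in> Y then 1 else 0)"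
  by (simp add: indicator_vec_def axis_def if_distrib cong: if_cong)

lemma perm_point_eq_sum:
  fixes \<sigma> :: "'n::{finite,linorder} perm"
  shows "perm_point \<sigma> = (\<Sum>d=1..CARD('n). indicator_vec (lev \<sigma> d))"
proof (rule Finite_Cartesian_Product.vec_eq_iff[THEN iffD2], rule allI)
  fix i
  let ?k = "idx (Perm.apply \<sigma> i)"
  have "{d \<in> {1..CARD('n)}. CARD('n) < ?k + d} = {Suc (CARD('n) - ?k)..CARD('n)}"
    using idx_le_card[of "Perm.apply \<sigma> i"] by auto
  then have "card {d \<in> {1..CARD('n)}. CARD('n) < ?k + d} = ?k"
    using idx_le_card[of "Perm.apply \<sigma> i"] by simp
  moreover have "(\<Sum>d=1..CARD('n). if CARD('n) < ?k + d then 1 else 0 :: real) = real (card {d \<in> {1..CARD('n)}. CARD('n) < ?k + d})"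
    by (simp add: sum.If_cases Int_def)
  ultimately show "perm_point \<sigma> $ i = (\<Sum>d=1..CARD('n). indicator_vec (lev \<sigma> d)) $ i"
    by (simp add: perm_point_def indicator_vec_nth lev_def)
qed

text \<open>Paired with the indicator vector of \<open>lev \<sigma> e\<close>, the summand of
  \<open>Y d\<close> contributes at most \<open>min d e\<close>. The vertex attains the total of
  these bounds, hence each single one, and \<open>d = e\<close> gives the claim.\<close>

lemma perm_point_decomposition_unique:
  fixes \<sigma> :: "'n::{finite,linorder} perm" and Y :: "nat \<Rightarrow> 'n set"
  assumes card: "\<And>d. d \<in> {1..CARD('n)} \<Longrightarrow> card (Y d) = d"
    and eq: "perm_point \<sigma> = (\<Sum>d=1..CARD('n). indicator_vec (Y d))"
    and e: "e \<in> {1..CARD('n)}"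
  shows "Y e = lev \<sigma> e"
proof -
  let ?F = "lev \<sigma> e"
  have cF: "card ?F = e" using e by (intro card_lev) auto
  have count: "(\<Sum>i\<in>?F. (\<Sum>d=1..CARD('n). indicator_vec (Z d)) $ i) = (\<Sum>d=1..CARD('n). real (card (Z d \<inter> ?F)))"
    for Z :: "nat \<Rightarrow> 'n set"
  proof -
    have "(\<Sum>i\<in>?F. (\<Sum>d=1..CARD('n). indicator_vec (Z d)) $ i) = (\<Sum>d=1..CARD('n). \<Sum>i\<in>?F. if i \<in> Z d then 1 else 0)"
      by (simp add: indicator_vec_nth sum.swap[of _ ?F])
    then show ?thesis by (simp add: sum.If_cases Int_commute)
  qed
  have "(\<Sum>d=1..CARD('n). real (card (Y d \<inter> ?F))) = (\<Sum>i\<in>?F. perm_point \<sigma> $ i)"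
    unfolding eq by (rule count[symmetric])
  also have "\<dots> = (\<Sum>d=1..CARD('n). real (card (lev \<sigma> d \<inter> ?F)))"
    unfolding perm_point_eq_sum by (rule count)
  also have "\<dots> = (\<Sum>d=1..CARD('n). real (min d e))"
  proof (intro sum.cong refl arg_cong[of _ _ real])
    fix d assume d: "d \<in> {1..CARD('n)}"
    have "lev \<sigma> d \<inter> ?F = lev \<sigma> (min d e)" by (auto simp: lev_def)
    then show "card (lev \<sigma> d \<inter> ?F) = min d e" using d e by (simp add: card_lev' min.absorb1 min.coboundedI1)
  qed
  finally have sum_eq: "(\<Sum>d=1..CARD('n). real (card (Y d \<inter> ?F))) = (\<Sum>d=1..CARD('n). real (min d e))" .
  have le: "real (card (Y d \<inter> ?F)) \<le> real (min d e)" if "d \<in> {1..CARD('n)}" for d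
    using card_mono[of "Y d" "Y d \<inter> ?F"] card_mono[of ?F "Y d \<inter> ?F"] card[OF that] cF by simp
  have "real (card (Y e \<inter> ?F)) = real (min e e)"
    by (rule sum_mono_inv[OF sum_eq le e]) auto
  then have "card (Y e \<inter> ?F) = e" by simp
  then have "Y e \<inter> ?F = ?F" by (intro card_subset_eq) (simp_all add: cF)
  then have "?F \<subseteq> Y e" by blast
  then show ?thesis using card_subset_eq[of "Y e" ?F] cF card[OF e] by simp
qed

lemma compression_perm_point:
  fixes \<sigma> :: "'n::{finite,linorder} perm"
  shows "compression W (perm_point \<sigma>) = (\<Sum>d=1..CARD('n). W d (lev \<sigma> d))"
proof -
  have "{\<Sum>d=1..CARD('n). W d (Y d) | Y. (\<forall>d\<in>{1..CARD('n)}. card (Y d) = d) \<and>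
      perm_point \<sigma> = (\<Sum>d=1..CARD('n). indicator_vec (Y d))} = {\<Sum>d=1..CARD('n). W d (lev \<sigma> d)}"
    (is "?A = {?s}")
  proof (intro equalityI subsetI)
    fix x assume "x \<in> ?A"
    then obtain Y where Y: "\<forall>d\<in>{1..CARD('n)}. card (Y d) = d" "perm_point \<sigma> = (\<Sum>d=1..CARD('n). indicator_vec (Y d))"
      "x = (\<Sum>d=1..CARD('n). W d (Y d))" by blast
    then have "Y d = lev \<sigma> d" if "d \<in> {1..CARD('n)}" for d
      using perm_point_decomposition_unique[of Y \<sigma> d] that by blast
    then show "x \<in> {?s}" unfolding Y(3) by simp
  next
    fix x assume "x \<in> {?s}"
    then show "x \<in> ?A" using perm_point_eq_sum[of \<sigma>] card_lev[of _ \<sigma>]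
      by (intro CollectI exI[of _ "lev \<sigma>"]) auto
  qed
  then show ?thesis unfolding compression_def by simp
qed

lemma minor_dependent_row:
  fixes h :: "nat \<Rightarrow> 'c \<Rightarrow> 'k::idom"
  assumes k: "k < length ys" and dep: "\<And>c. h k c = (\<Sum>l<k. u l * h l c)"
  shows "minor h ys = 0"
proof -
  define T where "T = (\<lambda>i l. if i = k then if l = k then 1 else - u l else if l = i then 1 else 0 :: 'k)"
  define g where "g = h(k := \<lambda>c. 0 * h 0 c + 0 * h 0 c)"
  have "minor g ys = (\<Prod>i<length ys. T i i) * minor h ys"
  proof (rule minor_triangular[where T = T])
    fix i c
    show "g i c = (\<Sum>l\<le>i. T i l * h l c)"
    proof (cases "i = k")
      case True
      have "(\<Sum>l\<le>k. T k l * h l c) = h k c + (\<Sum>l<k. T k l * h l c)"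
        by (simp add: lessThan_Suc_atMost[symmetric] T_def)
      also have "(\<Sum>l<k. T k l * h l c) = - (\<Sum>l<k. u l * h l c)"
        by (auto simp: T_def sum_negf[symmetric] intro!: sum.cong)
      finally show ?thesis using True dep[of c] by (simp add: g_def)
    next
      case False
      then show ?thesis by (simp add: g_def T_def if_distrib[of "\<lambda>y. y * _"] cong: if_cong)
    qed
  qed
  moreover have "(\<Prod>i<length ys. T i i) = 1" by (intro prod.neutral) (simp add: T_def)
  moreover have "minor g ys = 0" unfolding g_def by (subst minor_row_linear[OF k]) simp
  ultimately show ?thesis by simp
qed

definition row_vec :: "(nat \<Rightarrow> 'n \<Rightarrow> 'k) \<Rightarrow> nat \<Rightarrow> 'k ^ 'n" where
  "row_vec f l = (\<chi> c. f l c)"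

lemma span_rows_iff:
  fixes v :: "nat \<Rightarrow> 'k::field ^ 'n"
  assumes "inj_on v {..<d}"
  shows "x \<in> vec.span (v ` {..<d}) \<longleftrightarrow> (\<exists>u. x = (\<Sum>l<d. u l *s v l))"
proof -
  have "vec.span (v ` {..<d}) = range (\<lambda>u. \<Sum>y\<in>v ` {..<d}. u y *s y)" by (rule vec.span_finite) simp
  also have "\<dots> = range (\<lambda>u. \<Sum>l<d. u (v l) *s v l)" by (simp add: sum.reindex[OF assms])
  also have "\<dots> = range (\<lambda>u. \<Sum>l<d. u l *s v l)"
  proof (intro equalityI subsetI)
    fix y assume "y \<in> range (\<lambda>u. \<Sum>l<d. u l *s v l)"
    then obtain u where u: "y = (\<Sum>l<d. u l *s v l)" by blast
    have "y = (\<Sum>l<d. u (inv_into {..<d} v (v l)) *s v l)"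
      unfolding u by (intro sum.cong) (auto simp: inv_into_f_f[OF assms])
    then show "y \<in> range (\<lambda>u. \<Sum>l<d. u (v l) *s v l)" by (intro range_eqI[of _ _ "u \<circ> inv_into {..<d} v"]) simp
  qed auto
  finally show ?thesis by auto
qed

lemma independent_rows:
  fixes f :: "nat \<Rightarrow> 'n::{finite,linorder} \<Rightarrow> 'k::field"
  assumes nz: "pl f UNIV \<noteq> 0"
  shows "d \<le> CARD('n) \<Longrightarrow> inj_on (row_vec f) {..<d} \<and> vec.independent (row_vec f ` {..<d})"
proof (induction d)
  case (Suc d)
  then have ih: "inj_on (row_vec f) {..<d}" "vec.independent (row_vec f ` {..<d})" by auto
  have notin: "row_vec f d \<notin> vec.span (row_vec f ` {..<d})"
  proof
    assume "row_vec f d \<in> vec.span (row_vec f ` {..<d})"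
    then obtain u where u: "row_vec f d = (\<Sum>l<d. u l *s row_vec f l)" using span_rows_iff[OF ih(1)] by blast
    have "f d c = (\<Sum>l<d. u l * f l c)" for c
      using arg_cong[OF u, of "\<lambda>x. x $ c"] by (simp add: row_vec_def)
    moreover have "d < length (sorted_list_of_set (UNIV :: 'n set))" using Suc.prems by (simp add: Suc_le_eq)
    ultimately have "pl f UNIV = 0" unfolding pl_def by (intro minor_dependent_row)
    then show False using nz by simp
  qed
  then have "row_vec f d \<notin> row_vec f ` {..<d}" using vec.span_base[of "row_vec f d" "row_vec f ` {..<d}"] by blast
  then show ?case using ih vec.independent_insertI[OF notin ih(2)] unfolding lessThan_Suc image_insert inj_on_insert
    by simp
qed (simp add: vec.independent_empty)

lemma pl_mult_val:
  fixes f :: "nat \<Rightarrow> 'n::{finite,linorder} \<Rightarrow> hahn"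
  assumes f: "\<And>I. I \<noteq> {} \<Longrightarrow> 0 < pl f I \<and> hahn_val (pl f I) = w I"
    and xs: "distinct xs" "distinct ys" "xs \<noteq> []" "ys \<noteq> []"
  shows "minor f xs * minor f ys \<noteq> 0" "hahn_val (minor f xs * minor f ys) = w (set xs) + w (set ys)"
proof -
  have *: "minor f zs \<noteq> 0 \<and> hahn_val (minor f zs) = w (set zs)" if "distinct zs" "zs \<noteq> []" for zs
  proof -
    have "minor f zs = pl f (set zs) \<or> minor f zs = - pl f (set zs)"
      using minor_eq_sign_pl[OF that(1), where 'k=hahn] by auto
    then show ?thesis using f[of "set zs"] that(2) by (auto simp: hahn_val_uminus)
  qed
  show "minor f xs * minor f ys \<noteq> 0" "hahn_val (minor f xs * minor f ys) = w (set xs) + w (set ys)"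
    using *[of xs] *[of ys] xs by (auto simp: hahn_val_mult)
qed

text \<open>The exchange relation of one space with itself: repeated columns leave three nonzero
  products with signed sum zero, so the least valuation occurs twice.\<close>

lemma realizes_valuated_matroid:
  fixes f :: "nat \<Rightarrow> 'n::{finite,linorder} \<Rightarrow> hahn"
  assumes f: "\<And>I. I \<noteq> {} \<Longrightarrow> 0 < pl f I \<and> hahn_val (pl f I) = w I"
  shows "valuated_matroid d w"
  unfolding valuated_matroid_def
proof (intro allI impI, elim conjE)
  fix S :: "'n set" and i j k l
  assume dist: "distinct [i, j, k, l]" and S: "{i, j, k, l} \<inter> S = {}"
  let ?s = "sorted_list_of_set S"
  have nm: "distinct (?s @ [a, b])" "set (?s @ [a, b]) = S \<union> {a, b}" "?s @ [a, b] \<noteq> []"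
    if "a \<noteq> b" "a \<notin> S" "b \<notin> S" for a b using that by auto
  let ?ys = "?s @ [k, l]"
  have len: "length ?ys = Suc (Suc (card S))" by simp
  have "minor f ?ys * minor f ((?s @ [i, j])[card S := i])
    = (\<Sum>m<length ?ys. minor f (?ys[m := i]) * minor f ((?s @ [i, j])[card S := ?ys ! m]))"
    by (rule minor_exchange[where T = "\<lambda>l m. if l = m then 1 else 0"])
      (auto simp: if_distrib[of "\<lambda>y. y * _"] cong: if_cong)
  moreover have "minor f ((?s @ [i, j])[card S := ?ys ! m]) = 0" if "m < card S" for m
  proof (rule minor_not_distinct)
    have "?s ! m \<in> set ?s" using that by (intro nth_mem) simp
    then show "\<not> distinct ((?s @ [i, j])[card S := ?ys ! m])" using that by (simp add: nth_append list_update_append)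
  qed
  ultimately have "minor f (?s @ [k, l]) * minor f (?s @ [i, j])
    = minor f (?s @ [i, l]) * minor f (?s @ [k, j]) + minor f (?s @ [k, i]) * minor f (?s @ [l, j])"
    unfolding len by (simp add: nth_append list_update_append lessThan_Suc)
  then have zero: "minor f (?s @ [i, j]) * minor f (?s @ [k, l]) + - (minor f (?s @ [k, i]) * minor f (?s @ [l, j]))
      + - (minor f (?s @ [i, l]) * minor f (?s @ [k, j])) = 0" by (simp add: mult.commute)
  have *: "minor f (?s @ [a, b]) * minor f (?s @ [c, e]) \<noteq> 0"
    "hahn_val (minor f (?s @ [a, b]) * minor f (?s @ [c, e])) = w (S \<union> {a, b}) + w (S \<union> {c, e})"
    if "a \<noteq> b" "c \<noteq> e" "{a, b, c, e} \<inter> S = {}" for a b c e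
    using pl_mult_val[OF f, of "?s @ [a, b]" "?s @ [c, e]"] nm[of a b] nm[of c e] that by auto
  have "min_attained_twice (hahn_val (minor f (?s @ [i, j]) * minor f (?s @ [k, l])))
      (hahn_val (- (minor f (?s @ [k, i]) * minor f (?s @ [l, j]))))
      (hahn_val (- (minor f (?s @ [i, l]) * minor f (?s @ [k, j]))))"
    by (rule min_attained_twice_of_sum_zero[OF zero]; (unfold neg_equal_0_iff_equal)?; rule *; use dist S in auto)
  then show "min_attained_twice (w (S \<union> {i, j}) + w (S \<union> {k, l})) (w (S \<union> {i, k}) + w (S \<union> {j, l})) (w (S \<union> {i, l}) + w (S \<union> {j, k}))"
    using *(2)[of i j k l] *(2)[of k i l j] *(2)[of i l k j] dist S
    by (simp add: hahn_val_uminus insert_commute eq_commute[of k] eq_commute[of l j])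
qed

text \<open>The product of the two coordinates is a sum of exchanged products, so some nonzero
  summand has no larger valuation. Being nonzero it has no repeated column, which puts the exchanged
  element outside \<open>I\<close>.\<close>

lemma realizes_valuated_quotient:
  fixes f :: "nat \<Rightarrow> 'n::{finite,linorder} \<Rightarrow> hahn"
  assumes f: "\<And>I. I \<noteq> {} \<Longrightarrow> 0 < pl f I \<and> hahn_val (pl f I) = w I"
    and rs: "r < s"
  shows "valuated_quotient r s w w"
  unfolding valuated_quotient_def
proof (intro allI impI, elim conjE)
  fix I J :: "'n set" and i
  assume I: "card I = r" and J: "card J = s" and i: "i \<in> I - J"
  let ?xs = "sorted_list_of_set I" and ?ys = "sorted_list_of_set J"
  obtain p where p: "p < length ?xs" "?xs ! p = i" using i by (metis DiffD1 in_set_conv_nth finite set_sorted_list_of_set)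
  have xs_upd: "set (?xs[p := y]) = insert y (I - {i})" for y
    using p set_update_distinct[of ?xs p y] by simp
  have ys_upd: "set (?ys[j := i]) = insert i (J - {?ys ! j})" if "j < length ?ys" for j
    using that set_update_distinct[of ?ys j i] by simp
  have eq: "minor f ?ys * minor f (?xs[p := i])
    = (\<Sum>j<length ?ys. minor f (?ys[j := i]) * minor f (?xs[p := ?ys ! j]))"
    using I J rs p(1)
    by (intro minor_exchange[where T = "\<lambda>l m. if l = m then 1 else 0"])
      (auto simp: if_distrib[of "\<lambda>y. y * _"] cong: if_cong)
  have ne: "?xs \<noteq> []" "?ys \<noteq> []" using p(1) J rs by auto
  have upd: "?xs[p := i] = ?xs" using p by (metis list_update_id)
  have lhs: "minor f ?ys * minor f ?xs \<noteq> 0" "hahn_val (minor f ?ys * minor f ?xs) = w J + w I"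
    using pl_mult_val[OF f, of ?ys ?xs] ne by auto
  obtain j where j: "j < length ?ys" "minor f (?ys[j := i]) * minor f (?xs[p := ?ys ! j]) \<noteq> 0"
    "hahn_val (minor f (?ys[j := i]) * minor f (?xs[p := ?ys ! j])) \<le> w J + w I"
    using hahn_val_sum_ge[of "\<lambda>j. minor f (?ys[j := i]) * minor f (?xs[p := ?ys ! j])" "{..<length ?ys}"] lhs
    unfolding eq[unfolded upd, symmetric] by auto
  let ?y = "?ys ! j"
  have "distinct (?xs[p := ?y])" "distinct (?ys[j := i])" using j(2) minor_not_distinct by fastforce+
  then have "hahn_val (minor f (?ys[j := i]) * minor f (?xs[p := ?y])) = w (insert i (J - {?y})) + w (insert ?y (I - {i}))"
    using pl_mult_val(2)[OF f, of "?ys[j := i]" "?xs[p := ?y]"] ne xs_upd ys_upd[OF j(1)] by simp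
  moreover have yJ: "?y \<in> J" using j(1) nth_mem[of j ?ys] by simp
  have "?y \<notin> I"
  proof
    assume "?y \<in> I"
    moreover have "?y \<noteq> i" using yJ i by auto
    ultimately have "set (?xs[p := ?y]) = I - {i}" unfolding xs_upd by auto
    then have "card (set (?xs[p := ?y])) < card I" using card_Diff1_less[of I i] i by simp
    moreover have "card (set (?xs[p := ?y])) = card I"
      using distinct_card[OF \<open>distinct (?xs[p := ?y])\<close>] by simp
    ultimately show False by simp
  qed
  then have "(MIN j\<in>J - I. w (I - {i} \<union> {j}) + w (J - {j} \<union> {i})) \<le> w (I - {i} \<union> {?y}) + w (J - {?y} \<union> {i})"
    using yJ by (intro Min_le) auto
  ultimately show "(MIN j\<in>J - I. w (I - {i} \<union> {j}) + w (J - {j} \<union> {i})) \<le> w I + w J"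
    using j(3) by simp
qed

lemma minor_row_vec_of_pluecker:
  assumes "card B = d"
  shows "Determinant.det (Matrix.mat d d (\<lambda>(i, j). vec_nth (v i) (sorted_list_of_set B ! j))) = pl (\<lambda>l c. v l $ c) B"
  using assms by (simp add: pl_def minor_def minor_mat_def)

theorem tropical_positive_imp_realized:
  fixes w :: "'n::{finite,linorder} set \<Rightarrow> real"
  assumes w: "tropical_positive w"
  shows "full_valuated_flag_matroid (\<lambda>_. w)" "realized_by_totally_positive_flag (\<lambda>_. w)"
proof -
  obtain f :: "nat \<Rightarrow> 'n \<Rightarrow> hahn" where f: "\<And>I. I \<noteq> {} \<Longrightarrow> 0 < pl f I \<and> hahn_val (pl f I) = w I"
    using ex_totally_positive_lift[OF w] by blast
  show "full_valuated_flag_matroid (\<lambda>_. w)"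
    unfolding full_valuated_flag_matroid_def
    using realizes_valuated_matroid[OF f] realizes_valuated_quotient[OF f] by blast
  define L where "L = (\<lambda>d. vec.span (row_vec f ` {..<d}))"
  have nz: "pl f UNIV \<noteq> 0" using f[of UNIV] by auto
  note ind = independent_rows[OF nz]
  have dim: "vec.dim (L d) = d" if "d \<le> CARD('n)" for d
    using ind[OF that] by (simp add: L_def vec.dim_eq_card_independent card_image)
  show "realized_by_totally_positive_flag (\<lambda>_. w)"
    unfolding realized_by_totally_positive_flag_def
  proof (intro exI[of _ L] conjI ballI allI impI)
    show "vec.subspace (L d)" for d by (simp add: L_def)
    show "vec.dim (L d) = d" if "d \<in> {1..CARD('n)}" for d using dim that by simp
    show "L i \<subset> L j" if "1 \<le> i \<and> i < j \<and> j \<le> CARD('n)" for i j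
    proof -
      have "L i \<subseteq> L j" unfolding L_def using that by (intro vec.span_mono image_mono) auto
      moreover have "L i \<noteq> L j" using dim[of i] dim[of j] that by auto
      ultimately show ?thesis by blast
    qed
    show "L (CARD('n)) = UNIV"
      by (rule vec.subspace_dim_equal) (simp_all add: L_def[symmetric] dim vec_dim_card vec.dim_UNIV card_cart_basis, simp_all add: L_def)
    show "\<exists>p. pluecker_coordinates d (L d) p \<and> (\<forall>B. card B = d \<longrightarrow> 0 < p B \<and> hahn_val (p B) = w B)"
      if d: "d \<in> {1..CARD('n)}" for d
    proof (intro exI[of _ "pl f"] conjI allI impI)
      show "pluecker_coordinates d (L d) (pl f)"
        unfolding pluecker_coordinates_def
      proof (intro exI[of _ "row_vec f"] exI[of _ 1] conjI allI impI)
        show "inj_on (row_vec f) {..<d}" "vec.independent (row_vec f ` {..<d})" using ind[of d] d by auto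
        show "pl f B = 1 * Determinant.det (Matrix.mat d d (\<lambda>(i, j). row_vec f i $ (sorted_list_of_set B ! j)))"
          if "card B = d" for B :: "'n set"
        proof -
          have "(\<lambda>l c. row_vec f l $ c) = f" by (intro ext) (simp add: row_vec_def)
          then show ?thesis unfolding minor_row_vec_of_pluecker[OF that] by simp
        qed
      qed (simp_all add: L_def)
      fix B :: "'n set" assume "card B = d"
      then have "B \<noteq> {}" using d by auto
      then show "0 < pl f B" "hahn_val (pl f B) = w B" using f by auto
    qed
  qed
qed

text \<open>The bases of consecutive members need not be nested; it is enough to express one through
  the other by \<open>T\<close>. The scalings \<open>c\<close> and \<open>c'\<close> multiply all
  three products alike, and positivity turns the relation into a minimum of valuations.\<close>

theorem realized_imp_tropical_positive:
  fixes W :: "nat \<Rightarrow> 'n::{finite,linorder} set \<Rightarrow> real"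
  assumes W: "realized_by_totally_positive_flag W"
  shows "tropical_positive (\<lambda>I. W (card I) I)"
  unfolding tropical_positive_def
proof (intro allI impI, elim conjE)
  fix S :: "'n set" and i j k
  assume ijk: "i < j" "j < k" and S: "i \<notin> S" "j \<notin> S" "k \<notin> S"
  let ?d = "Suc (card S)" and ?e = "Suc (Suc (card S))"
  have "card (insert i (insert k S)) \<le> CARD('n)" by (intro card_mono) auto
  moreover have card: "card (insert a S) = ?d" "card (insert a (insert b S)) = ?e"
    if "a \<notin> S" "b \<notin> S" "a \<noteq> b" for a b using that by auto
  moreover have "i \<noteq> k" using ijk by auto
  ultimately have e: "?e \<le> CARD('n)" using S by metis
  obtain L where L_mono: "\<And>i j. 1 \<le> i \<and> i < j \<and> j \<le> CARD('n) \<Longrightarrow> L i \<subset> L j"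
    and pl: "\<And>d. d \<in> {1..CARD('n)} \<Longrightarrow> \<exists>p. pluecker_coordinates d (L d) p \<and> (\<forall>B. card B = d \<longrightarrow> 0 < p B \<and> hahn_val (p B) = W d B)"
    using W unfolding realized_by_totally_positive_flag_def by blast
  have L: "L ?d \<subset> L ?e" using e by (intro L_mono) auto
  obtain p where p: "pluecker_coordinates ?d (L ?d) p" "\<And>B. card B = ?d \<Longrightarrow> 0 < p B \<and> hahn_val (p B) = W ?d B"
    using pl[of ?d] e by auto
  obtain q where q: "pluecker_coordinates ?e (L ?e) q" "\<And>B. card B = ?e \<Longrightarrow> 0 < q B \<and> hahn_val (q B) = W ?e B"
    using pl[of ?e] e by auto
  obtain v c where v: "inj_on v {..<?d}" "vec.span (v ` {..<?d}) = L ?d"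
    "\<And>B. card B = ?d \<Longrightarrow> p B = c * pl (\<lambda>l x. v l $ x) B"
    using p(1) unfolding pluecker_coordinates_def by (metis minor_row_vec_of_pluecker)
  obtain v' c' where v': "inj_on v' {..<?e}" "vec.span (v' ` {..<?e}) = L ?e"
    "\<And>B. card B = ?e \<Longrightarrow> q B = c' * pl (\<lambda>l x. v' l $ x) B"
    using q(1) unfolding pluecker_coordinates_def by (metis minor_row_vec_of_pluecker)
  have "\<exists>u. v l = (\<Sum>m<?e. u m *s v' m)" if "l < ?d" for l
  proof -
    have "v l \<in> L ?d" unfolding v(2)[symmetric] using that by (intro vec.span_base) simp
    then have "v l \<in> vec.span (v' ` {..<?e})" using L v'(2) by blast
    then show ?thesis using span_rows_iff[OF v'(1)] by blast
  qed
  then obtain T where T: "\<And>l. l < ?d \<Longrightarrow> v l = (\<Sum>m<?e. T l m *s v' m)" by metis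
  have "pl (\<lambda>l x. v l $ x) (insert j S) * pl (\<lambda>l x. v' l $ x) (insert i (insert k S))
    = pl (\<lambda>l x. v l $ x) (insert i S) * pl (\<lambda>l x. v' l $ x) (insert j (insert k S))
    + pl (\<lambda>l x. v l $ x) (insert k S) * pl (\<lambda>l x. v' l $ x) (insert i (insert j S))"
    using S ijk by (intro pl_three_term[where T = T]) (auto simp: T)
  then have "(c * c') * (pl (\<lambda>l x. v l $ x) (insert j S) * pl (\<lambda>l x. v' l $ x) (insert i (insert k S)))
    = (c * c') * (pl (\<lambda>l x. v l $ x) (insert i S) * pl (\<lambda>l x. v' l $ x) (insert j (insert k S))
    + pl (\<lambda>l x. v l $ x) (insert k S) * pl (\<lambda>l x. v' l $ x) (insert i (insert j S)))" by simp
  then have rel: "p (insert j S) * q (insert i (insert k S))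
    = p (insert i S) * q (insert j (insert k S)) + p (insert k S) * q (insert i (insert j S))"
    using S ijk \<open>i \<noteq> k\<close> by (simp add: v(3) v'(3) algebra_simps)
  have pq: "0 < p (insert a S) * q (insert b (insert b' S))"
    "hahn_val (p (insert a S) * q (insert b (insert b' S))) = W ?d (insert a S) + W ?e (insert b (insert b' S))"
    if "a \<notin> S" "b \<notin> S" "b' \<notin> S" "b \<noteq> b'" for a b b'
  proof -
    have "0 < p (insert a S) \<and> hahn_val (p (insert a S)) = W ?d (insert a S)"
      "0 < q (insert b (insert b' S)) \<and> hahn_val (q (insert b (insert b' S))) = W ?e (insert b (insert b' S))"
      using that by (auto intro!: p(2) q(2))
    then show "0 < p (insert a S) * q (insert b (insert b' S))"
      "hahn_val (p (insert a S) * q (insert b (insert b' S))) = W ?d (insert a S) + W ?e (insert b (insert b' S))"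
      by (auto simp: hahn_val_mult)
  qed
  have "W ?d (insert j S) + W ?e (insert i (insert k S)) = hahn_val (p (insert j S) * q (insert i (insert k S)))"
    using S \<open>i \<noteq> k\<close> by (simp add: pq)
  also have "\<dots> = min (hahn_val (p (insert i S) * q (insert j (insert k S)))) (hahn_val (p (insert k S) * q (insert i (insert j S))))"
    unfolding rel using S ijk by (intro hahn_val_add pq) auto
  also have "\<dots> = min (W ?d (insert i S) + W ?e (insert j (insert k S))) (W ?d (insert k S) + W ?e (insert i (insert j S)))"
    using S ijk by (subst (1 2) pq) auto
  finally show "W (card (insert j S)) (insert j S) + W (card (insert i (insert k S))) (insert i (insert k S))
     = min (W (card (insert i S)) (insert i S) + W (card (insert j (insert k S))) (insert j (insert k S)))
         (W (card (insert k S)) (insert k S) + W (card (insert i (insert j S))) (insert i (insert j S)))"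
    using S ijk \<open>i \<noteq> k\<close> by simp
qed

theorem realizable_iff:
  fixes u :: "'n::{finite,linorder} perm \<Rightarrow> real"
  shows "(\<exists>W. full_valuated_flag_matroid W \<and> realized_by_totally_positive_flag W \<and>
      (\<forall>\<sigma>. u \<sigma> = compression W (perm_point \<sigma>)))
    \<longleftrightarrow> (\<exists>w. tropical_positive w \<and> (\<forall>\<sigma>. u \<sigma> = flag_sum w \<sigma>))"
proof
  assume "\<exists>W. full_valuated_flag_matroid W \<and> realized_by_totally_positive_flag W \<and>
      (\<forall>\<sigma>. u \<sigma> = compression W (perm_point \<sigma>))"
  then obtain W where W: "realized_by_totally_positive_flag W" "\<And>\<sigma>. u \<sigma> = compression W (perm_point \<sigma>)" by blast
  have "u \<sigma> = flag_sum (\<lambda>I. W (card I) I) \<sigma>" for \<sigma>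
    unfolding W(2) compression_perm_point flag_sum_def by (intro sum.cong) (auto simp: card_lev)
  then show "\<exists>w. tropical_positive w \<and> (\<forall>\<sigma>. u \<sigma> = flag_sum w \<sigma>)"
    using realized_imp_tropical_positive[OF W(1)] by blast
next
  assume "\<exists>w. tropical_positive w \<and> (\<forall>\<sigma>. u \<sigma> = flag_sum w \<sigma>)"
  then obtain w where w: "tropical_positive w" "\<And>\<sigma>. u \<sigma> = flag_sum w \<sigma>" by blast
  have "u \<sigma> = compression (\<lambda>_. w) (perm_point \<sigma>)" for \<sigma>
    unfolding w(2) compression_perm_point flag_sum_def ..
  then show "\<exists>W. full_valuated_flag_matroid W \<and> realized_by_totally_positive_flag W \<and>
      (\<forall>\<sigma>. u \<sigma> = compression W (perm_point \<sigma>))"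
    using tropical_positive_imp_realized[OF w(1)] by blast
qed

section \<open>Faces of the permutahedron\<close>

lemma perm_point_nth: "perm_point \<sigma> $ i = real (idx (Perm.apply \<sigma> i))"
  by (simp add: perm_point_def)

lemma perm_point_inj: "perm_point \<sigma> = perm_point \<tau> \<longleftrightarrow> \<sigma> = \<tau>"
  by (auto simp: Finite_Cartesian_Product.vec_eq_iff perm_point_nth idx_eq_iff perm_eq_iff)

lemma inj_perm_point: "inj perm_point"
  by (simp add: inj_def perm_point_inj)

definition step_vec :: "'n::{finite,linorder} perm \<Rightarrow> nat \<Rightarrow> real ^ 'n::{finite,linorder}" where
  "step_vec \<sigma> d = axis (pos \<sigma> (Suc d)) 1 - axis (pos \<sigma> d) 1"

lemma perm_point_adj:
  fixes \<sigma> :: "'n::{finite,linorder} perm"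
  assumes d: "Suc d < CARD('n)"
  shows "perm_point (adj d * \<sigma>) = perm_point \<sigma> + step_vec \<sigma> d"
proof (rule Finite_Cartesian_Product.vec_eq_iff[THEN iffD2], rule allI)
  fix i
  obtain e where e: "e < CARD('n)" "i = pos \<sigma> e" using ex_pos by blast
  have v: "idx (Perm.apply \<tau> (pos \<tau> k)) = CARD('n) - k" if "k < CARD('n)" for k and \<tau> :: "'n perm"
    using idx_apply_pos[OF that] .
  consider "e = d" | "e = Suc d" | "e \<noteq> d" "e \<noteq> Suc d" by blast
  then show "perm_point (adj d * \<sigma>) $ i = (perm_point \<sigma> + step_vec \<sigma> d) $ i"
  proof cases
    case 1
    then show ?thesis using e v[of d \<sigma>] v[of "Suc d" "adj d * \<sigma>"] d pos_inj[of d "Suc d" \<sigma>]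
      by (simp add: perm_point_nth step_vec_def axis_def pos_adj_simps of_nat_diff)
  next
    case 2
    then show ?thesis using e v[of "Suc d" \<sigma>] v[of d "adj d * \<sigma>"] d pos_inj[of d "Suc d" \<sigma>]
      by (simp add: perm_point_nth step_vec_def axis_def pos_adj_simps of_nat_diff)
  next
    case 3
    then show ?thesis using e v[of e \<sigma>] v[of e "adj d * \<sigma>"] d pos_inj[of e d \<sigma>] pos_inj[of e "Suc d" \<sigma>]
      by (simp add: perm_point_nth step_vec_def axis_def pos_adj_simps)
  qed
qed

lemma inner_step_vec: "a \<bullet> step_vec \<sigma> d = a $ pos \<sigma> (Suc d) - a $ pos \<sigma> d"
  by (simp add: step_vec_def inner_diff_right inner_axis)

lemma inner_perm_point_adj:
  fixes \<sigma> :: "'n::{finite,linorder} perm"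
  shows "Suc d < CARD('n) \<Longrightarrow> a \<bullet> perm_point (adj d * \<sigma>) = a \<bullet> perm_point \<sigma> + (a $ pos \<sigma> (Suc d) - a $ pos \<sigma> d)"
  by (simp add: perm_point_adj inner_add_right inner_step_vec)

definition maximizers :: "real ^ 'n::{finite,linorder} \<Rightarrow> 'n::{finite,linorder} perm set" where
  "maximizers a = {\<sigma>. \<forall>\<tau>. a \<bullet> perm_point \<tau> \<le> a \<bullet> perm_point \<sigma>}"

lemma finite_perms [simp]: "finite (A :: 'n::{finite,linorder} perm set)"
proof -
  have "inj (Perm.apply :: 'n perm \<Rightarrow> _)" by (metis injI perm_eqI)
  then have "finite (UNIV :: 'n perm set)" by (metis finite finite_imageD)
  then show ?thesis by (rule rev_finite_subset) simp
qed

lemma maximizers_antimono: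
  fixes \<sigma> :: "'n::{finite,linorder} perm"
  assumes "\<sigma> \<in> maximizers a" "Suc d < CARD('n)"
  shows "a $ pos \<sigma> (Suc d) \<le> a $ pos \<sigma> d"
  using assms(1)[unfolded maximizers_def] inner_perm_point_adj[OF assms(2), of a \<sigma>] by (smt (verit) mem_Collect_eq)

text \<open>A rearrangement argument by induction on \<open>\<tau> * inverse \<sigma>\<close>: each
  move towards \<sigma> weakly raises the functional, and equality forces a move between tied ranks.
  Any \<open>Y\<close> closed under tied moves then contains all maximizers, so one induction yields
  maximality, generation of the face and equality of the rank values.\<close>

lemma sorted_perm_maximal:
  fixes \<sigma> \<tau> :: "'n::{finite,linorder} perm"
  assumes sorted: "\<And>d. Suc d < CARD('n) \<Longrightarrow> a $ pos \<sigma> (Suc d) \<le> a $ pos \<sigma> d"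
    and Y: "\<sigma> \<in> Y" "\<And>\<tau> d. \<tau> \<in> Y \<Longrightarrow> Suc d < CARD('n) \<Longrightarrow> a $ pos \<sigma> (Suc d) = a $ pos \<sigma> d \<Longrightarrow> adj d * \<tau> \<in> Y"
  shows "a \<bullet> perm_point \<tau> \<le> a \<bullet> perm_point \<sigma> \<and>
    (a \<bullet> perm_point \<tau> = a \<bullet> perm_point \<sigma> \<longrightarrow> \<tau> \<in> Y \<and> (\<forall>d<CARD('n). a $ pos \<tau> d = a $ pos \<sigma> d))"
proof -
  have chain: "a $ pos \<sigma> e \<le> a $ pos \<sigma> d" if "d \<le> e" "e < CARD('n)" for d e
    using that
  proof (induction e rule: dec_induct)
    case (step e)
    then show ?case using sorted[of e] by force
  qed simp
  have pos: "pos \<rho> d = Perm.apply \<sigma> (pos (\<rho> * \<sigma>) d)" for \<rho> d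
    by (simp add: pos_def apply_times apply_inverse[symmetric])
  have mono: "a $ x \<le> a $ y" if lt: "Perm.apply \<sigma> x < Perm.apply \<sigma> y" for x y
  proof -
    obtain d e where de: "d < CARD('n)" "y = pos \<sigma> d" "e < CARD('n)" "x = pos \<sigma> e" using ex_pos by metis
    then have "idx (Perm.apply \<sigma> x) < idx (Perm.apply \<sigma> y)" using lt by (simp add: idx_less_iff)
    then have "d \<le> e" using de by (simp add: idx_apply_pos)
    then show ?thesis using chain de by simp
  qed
  have "a \<bullet> perm_point (\<rho> * \<sigma>) \<le> a \<bullet> perm_point \<sigma> \<and>
    (a \<bullet> perm_point (\<rho> * \<sigma>) = a \<bullet> perm_point \<sigma> \<longrightarrow> \<rho> * \<sigma> \<in> Y \<and> (\<forall>d<CARD('n). a $ pos (\<rho> * \<sigma>) d = a $ pos \<sigma> d))" for \<rho>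
  proof (induction \<rho> rule: perm_descent_induct)
    case one
    then show ?case using Y by simp
  next
    case (step \<rho> k)
    let ?\<tau> = "\<rho> * \<sigma>"
    have k: "Suc k < CARD('n)" by fact
    have le: "a $ pos ?\<tau> k \<le> a $ pos ?\<tau> (Suc k)" using step(2) unfolding pos[of \<rho>] by (rule mono)
    have eq: "a \<bullet> perm_point (adj k * ?\<tau>) = a \<bullet> perm_point ?\<tau> + (a $ pos ?\<tau> (Suc k) - a $ pos ?\<tau> k)"
      by (rule inner_perm_point_adj[OF k])
    note ih = step(3)[unfolded mult.assoc]
    show ?case
    proof (intro conjI impI allI)
      show "a \<bullet> perm_point ?\<tau> \<le> a \<bullet> perm_point \<sigma>" using ih le eq by simp
      assume *: "a \<bullet> perm_point ?\<tau> = a \<bullet> perm_point \<sigma>"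
      then have same: "a $ pos ?\<tau> k = a $ pos ?\<tau> (Suc k)" and ih': "adj k * ?\<tau> \<in> Y"
        "\<And>d. d < CARD('n) \<Longrightarrow> a $ pos (adj k * ?\<tau>) d = a $ pos \<sigma> d"
        using ih le eq by auto
      have "a $ pos \<sigma> (Suc k) = a $ pos \<sigma> k"
        using ih'(2)[of k] ih'(2)[of "Suc k"] same k by (simp add: pos_adj_simps)
      then show "?\<tau> \<in> Y" using Y(2)[OF ih'(1) k] by simp
      fix d assume d: "d < CARD('n)"
      consider "d = k" | "d = Suc k" | "d \<noteq> k" "d \<noteq> Suc k" by blast
      then show "a $ pos ?\<tau> d = a $ pos \<sigma> d"
        using ih'(2)[of k] ih'(2)[of "Suc k"] ih'(2)[of d] same k d by cases (simp_all add: pos_adj_simps)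
    qed
  qed
  from this[of "\<tau> * inverse \<sigma>"] show ?thesis by (simp add: mult.assoc)
qed

lemma maximizers_level:
  fixes \<sigma> \<tau> :: "'n::{finite,linorder} perm"
  assumes "\<sigma> \<in> maximizers a" "\<tau> \<in> maximizers a" "d < CARD('n)"
  shows "a $ pos \<tau> d = a $ pos \<sigma> d"
proof -
  have "a \<bullet> perm_point \<tau> = a \<bullet> perm_point \<sigma>" using assms by (auto simp: maximizers_def intro: order_antisym)
  then show ?thesis
    using sorted_perm_maximal[of a \<sigma> UNIV \<tau>] maximizers_antimono[OF assms(1)] assms(3) by auto
qed

lemma maximizers_subset:
  fixes \<sigma> :: "'n::{finite,linorder} perm"
  assumes "\<sigma> \<in> maximizers a" "\<sigma> \<in> Y"
    and "\<And>\<tau> d. \<tau> \<in> Y \<Longrightarrow> Suc d < CARD('n) \<Longrightarrow> a $ pos \<sigma> (Suc d) = a $ pos \<sigma> d \<Longrightarrow> adj d * \<tau> \<in> Y"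
  shows "maximizers a \<subseteq> Y"
proof
  fix \<tau> assume "\<tau> \<in> maximizers a"
  then have "a \<bullet> perm_point \<tau> = a \<bullet> perm_point \<sigma>" using assms(1) by (auto simp: maximizers_def intro: order_antisym)
  then show "\<tau> \<in> Y"
    using sorted_perm_maximal[of a \<sigma> Y \<tau>] maximizers_antimono[OF assms(1)] assms(2,3) by blast
qed

lemma maximizers_adj_iff:
  fixes \<tau> :: "'n::{finite,linorder} perm"
  assumes "\<tau> \<in> maximizers a" "Suc d < CARD('n)"
  shows "adj d * \<tau> \<in> maximizers a \<longleftrightarrow> a $ pos \<tau> (Suc d) = a $ pos \<tau> d"
  using assms(1) inner_perm_point_adj[OF assms(2), of a \<tau>] maximizers_antimono[OF assms]
  unfolding maximizers_def by (smt (verit) mem_Collect_eq)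

text \<open>The coefficients drop by one from each rank to the next, except across the ranks in
  \<open>K\<close>.\<close>

lemma ex_functional:
  fixes \<sigma> :: "'n::{finite,linorder} perm" and K :: "nat set"
  shows "\<exists>a. \<sigma> \<in> maximizers a \<and> (\<forall>d. Suc d < CARD('n) \<longrightarrow> (a $ pos \<sigma> (Suc d) = a $ pos \<sigma> d \<longleftrightarrow> d \<in> K))"
proof -
  define m where "m = (\<lambda>j. - real (card {i. i < j \<and> i \<notin> K}))"
  have m: "m (Suc j) = (if j \<in> K then m j else m j - 1)" for j
  proof -
    have "{i. i < Suc j \<and> i \<notin> K} = (if j \<in> K then {i. i < j \<and> i \<notin> K} else insert j {i. i < j \<and> i \<notin> K})"
      by (auto simp: less_Suc_eq)
    then show ?thesis by (simp add: m_def)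
  qed
  define a :: "real ^ 'n::{finite,linorder}" where "a = (\<chi> i. m (CARD('n) - idx (Perm.apply \<sigma> i)))"
  have a: "a $ pos \<sigma> d = m d" if "d < CARD('n)" for d
    using that by (simp add: a_def idx_apply_pos)
  have "\<sigma> \<in> maximizers a"
    unfolding maximizers_def using sorted_perm_maximal[of a \<sigma> UNIV] by (auto simp: a m)
  then show ?thesis using a m by (intro exI[of _ a]) auto
qed

lemma convex_hull_face:
  fixes S :: "'a::real_inner set"
  assumes S: "finite S" "\<And>s. s \<in> S \<Longrightarrow> a \<bullet> s \<le> b"
  shows "convex hull S \<inter> {x. a \<bullet> x = b} = convex hull {s \<in> S. a \<bullet> s = b}"
proof (intro equalityI subsetI)
  fix x assume x: "x \<in> convex hull S \<inter> {x. a \<bullet> x = b}"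
  then obtain u where u: "\<And>s. s \<in> S \<Longrightarrow> 0 \<le> u s" "sum u S = 1" "(\<Sum>s\<in>S. u s *\<^sub>R s) = x"
    unfolding convex_hull_finite[OF S(1)] by auto
  have "(\<Sum>s\<in>S. u s * (b - a \<bullet> s)) = b * sum u S - a \<bullet> (\<Sum>s\<in>S. u s *\<^sub>R s)"
    by (simp add: inner_sum_right algebra_simps sum_subtractf sum_distrib_left)
  also have "\<dots> = 0" using u x by simp
  finally have "u s * (b - a \<bullet> s) = 0" if "s \<in> S" for s
    using that u(1) S by (subst (asm) sum_nonneg_eq_0_iff) auto
  then have z: "u s = 0" if "s \<in> S" "a \<bullet> s \<noteq> b" for s using that by fastforce
  let ?T = "{s \<in> S. a \<bullet> s = b}"
  have "sum u ?T = sum u S" "(\<Sum>s\<in>?T. u s *\<^sub>R s) = (\<Sum>s\<in>S. u s *\<^sub>R s)"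
    using z S(1) by (intro sum.mono_neutral_left; force)+
  moreover have fT: "finite ?T" using S(1) by simp
  ultimately show "x \<in> convex hull ?T"
    unfolding convex_hull_finite[OF fT] using u by auto
next
  fix x assume x: "x \<in> convex hull {s \<in> S. a \<bullet> s = b}"
  have "convex hull {s \<in> S. a \<bullet> s = b} \<subseteq> {x. a \<bullet> x = b}"
    by (intro hull_minimal convex_hyperplane) auto
  moreover have "convex hull {s \<in> S. a \<bullet> s = b} \<subseteq> convex hull S" by (intro hull_mono) auto
  ultimately show "x \<in> convex hull S \<inter> {x. a \<bullet> x = b}" using x by blast
qed

lemma permutahedron_inner_le:
  assumes "\<sigma> \<in> maximizers a" "x \<in> permutahedron"
  shows "a \<bullet> x \<le> a \<bullet> perm_point \<sigma>"
proof -
  have "permutahedron \<subseteq> {x. a \<bullet> x \<le> a \<bullet> perm_point \<sigma>}"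
    unfolding permutahedron_def using assms(1)
    by (intro hull_minimal convex_halfspace_le) (auto simp: maximizers_def)
  then show ?thesis using assms(2) by blast
qed

lemma permutahedron_face_eq:
  fixes \<sigma> :: "'n::{finite,linorder} perm"
  assumes "\<sigma> \<in> maximizers a"
  shows "permutahedron \<inter> {x. a \<bullet> x = a \<bullet> perm_point \<sigma>} = convex hull (perm_point ` maximizers a)"
proof -
  have "{s \<in> range perm_point. a \<bullet> s = a \<bullet> perm_point \<sigma>} = perm_point ` maximizers a"
    using assms by (auto simp: maximizers_def) (metis order_antisym)
  then show ?thesis
    unfolding permutahedron_def using assms by (subst convex_hull_face) (auto simp: maximizers_def)
qed

lemma maximizers_nonempty: "maximizers a \<noteq> {}"
proof -
  let ?M = "range (\<lambda>\<tau>. a \<bullet> perm_point \<tau>)"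
  have fin: "finite ?M" by (intro finite_imageI finite_perms)
  then have "Max ?M \<in> ?M" by (intro Max_in) auto
  then obtain \<sigma> where "Max ?M = a \<bullet> perm_point \<sigma>" by blast
  then have "\<And>\<tau>. a \<bullet> perm_point \<tau> \<le> a \<bullet> perm_point \<sigma>" using Max_ge[OF fin] by (metis rangeI)
  then show ?thesis by (auto simp: maximizers_def)
qed

lemma maximizers_face: "convex hull (perm_point ` maximizers a) face_of permutahedron"
proof -
  obtain \<sigma> where \<sigma>: "\<sigma> \<in> maximizers a" using maximizers_nonempty by blast
  show ?thesis unfolding permutahedron_face_eq[OF \<sigma>, symmetric]
    by (rule face_of_Int_supporting_hyperplane_le) (use \<sigma> permutahedron_inner_le in \<open>auto simp: permutahedron_def\<close>)
qed

lemma face_eq_maximizers: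
  fixes F :: "(real ^ 'n::{finite,linorder}) set"
  assumes "F face_of permutahedron" "F \<noteq> {}"
  shows "\<exists>a. F = convex hull (perm_point ` maximizers a)"
proof -
  have "polyhedron (permutahedron :: (real ^ 'n::{finite,linorder}) set)"
    unfolding permutahedron_def by (intro polytope_imp_polyhedron polytope_convex_hull finite_imageI finite_perms)
  then have "F exposed_face_of permutahedron" using assms(1) exposed_face_of_polyhedron by blast
  then obtain a b where ab: "permutahedron \<subseteq> {x. a \<bullet> x \<le> b}" "F = permutahedron \<inter> {x. a \<bullet> x = b}"
    unfolding exposed_face_of_def by blast
  obtain \<sigma> where \<sigma>: "\<sigma> \<in> maximizers a" using maximizers_nonempty by blast
  obtain x where "x \<in> permutahedron" "a \<bullet> x = b" using assms(2) ab(2) by blast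
  then have "b \<le> a \<bullet> perm_point \<sigma>" using permutahedron_inner_le[OF \<sigma>] by blast
  moreover have "perm_point \<sigma> \<in> permutahedron" unfolding permutahedron_def by (intro hull_inc) simp
  then have "a \<bullet> perm_point \<sigma> \<le> b" using ab(1) by blast
  ultimately have "b = a \<bullet> perm_point \<sigma>" by simp
  then show ?thesis using ab(2) permutahedron_face_eq[OF \<sigma>] by blast
qed

lemma perm_point_extreme: "perm_point \<sigma> extreme_point_of permutahedron"
proof -
  obtain a where a: "\<sigma> \<in> maximizers a" "\<And>d. Suc d < CARD('a) \<Longrightarrow> a $ pos \<sigma> (Suc d) \<noteq> a $ pos \<sigma> d"
    using ex_functional[of \<sigma> "{}"] by auto
  have "maximizers a \<subseteq> {\<sigma>}" using a by (intro maximizers_subset[OF a(1)]) auto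
  then have "maximizers a = {\<sigma>}" using a(1) by blast
  then show ?thesis using maximizers_face[of a] by (simp add: face_of_singleton)
qed

lemma extreme_points_convex_hull: "{x. x extreme_point_of convex hull (perm_point ` V)} = perm_point ` V"
proof (intro equalityI subsetI)
  fix x assume "x \<in> {x. x extreme_point_of convex hull (perm_point ` V)}"
  then show "x \<in> perm_point ` V" using extreme_point_of_convex_hull by blast
next
  fix x assume "x \<in> perm_point ` V"
  then obtain \<sigma> where \<sigma>: "x = perm_point \<sigma>" "x \<in> convex hull (perm_point ` V)" by (auto intro: hull_inc)
  have "convex hull (perm_point ` V) \<subseteq> permutahedron" unfolding permutahedron_def by (intro hull_mono) auto
  then show "x \<in> {x. x extreme_point_of convex hull (perm_point ` V)}"
    using perm_point_extreme[of \<sigma>] \<sigma> unfolding extreme_point_of_def by blast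
qed

text \<open>Vertices of the permutahedron stay extreme in the hull of any subset, so faces, cells
  and interval polytopes can be compared through their sets of permutations.\<close>

lemma convex_hull_perm_point_inj:
  "convex hull (perm_point ` V) = convex hull (perm_point ` V') \<longleftrightarrow> V = V'"
  using extreme_points_convex_hull[of V] extreme_points_convex_hull[of V'] inj_image_eq_iff[OF inj_perm_point] by metis

text \<open>Up to sign, the levels of \<sigma> are dual to the edge directions at \<sigma>. This
  yields the independence of the directions and, later, functionals with prescribed slopes.\<close>

lemma inner_indicator_step_vec:
  fixes \<sigma> :: "'n::{finite,linorder} perm"
  assumes "Suc j < CARD('n)" "Suc k < CARD('n)"
  shows "indicator_vec (lev \<sigma> (Suc k)) \<bullet> step_vec \<sigma> j = (if j = k then - 1 else 0)"
proof -
  have "pos \<sigma> e \<in> lev \<sigma> (Suc k) \<longleftrightarrow> e \<le> k" if "e < CARD('n)" for e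
    using that assms by (auto simp: lev_def idx_apply_pos)
  then show ?thesis using assms by (auto simp: inner_step_vec indicator_vec_nth)
qed

lemma step_vec_independent:
  fixes \<sigma> :: "'n::{finite,linorder} perm"
  assumes K: "K \<subseteq> {d. Suc d < CARD('n)}"
  shows "inj_on (step_vec \<sigma>) K" "independent (step_vec \<sigma> ` K)"
proof -
  have dual: "indicator_vec (lev \<sigma> (Suc k)) \<bullet> step_vec \<sigma> j = (if j = k then - 1 else 0)" if "j \<in> K" "k \<in> K" for j k
    using that K by (intro inner_indicator_step_vec) auto
  show inj: "inj_on (step_vec \<sigma>) K"
  proof (rule inj_onI)
    fix j k assume jk: "j \<in> K" "k \<in> K" "step_vec \<sigma> j = step_vec \<sigma> k"
    then have "(if j = k then - 1 else 0 :: real) = - 1"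
      using dual[OF jk(1,2)] dual[OF jk(2,2)] by simp
    then show "j = k" by (simp split: if_splits)
  qed
  have fin: "finite K" using K by (rule finite_subset) (auto intro: finite_subset[of _ "{..<CARD('n)}"])
  show "independent (step_vec \<sigma> ` K)"
  proof
    assume "dependent (step_vec \<sigma> ` K)"
    then obtain u k where u: "k \<in> K" "u (step_vec \<sigma> k) \<noteq> 0" "(\<Sum>v\<in>step_vec \<sigma> ` K. u v *\<^sub>R v) = 0"
      using dependent_finite[of "step_vec \<sigma> ` K"] fin by auto
    have "0 = indicator_vec (lev \<sigma> (Suc k)) \<bullet> (\<Sum>j\<in>K. u (step_vec \<sigma> j) *\<^sub>R step_vec \<sigma> j)"
      using u(3) by (simp add: sum.reindex[OF inj])
    also have "\<dots> = (\<Sum>j\<in>K. if j = k then - u (step_vec \<sigma> k) else 0)"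
      unfolding inner_sum_right using u(1) by (intro sum.cong) (auto simp: dual)
    also have "\<dots> = - u (step_vec \<sigma> k)" using u(1) fin by simp
    finally show False using u(2) by simp
  qed
qed

lemma aff_dim_perm_points:
  assumes "\<sigma> \<in> V"
  shows "aff_dim (convex hull (perm_point ` V)) = int (dim ((\<lambda>\<tau>. perm_point \<tau> - perm_point \<sigma>) ` V))"
proof -
  have "aff_dim (perm_point ` V) = int (dim ((+) (- perm_point \<sigma>) ` perm_point ` V))"
    using assms by (intro aff_dim_eq_dim hull_inc) auto
  then show ?thesis by (simp add: image_image aff_dim_convex_hull)
qed

lemma edge_perm_points:
  fixes \<sigma> \<tau> :: "'n::{finite,linorder} perm"
  assumes "closed_segment (perm_point \<sigma>) (perm_point \<tau>) face_of permutahedron" "\<sigma> \<noteq> \<tau>"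
  shows "\<exists>d. Suc d < CARD('n) \<and> \<tau> = adj d * \<sigma>"
proof -
  have seg: "closed_segment (perm_point \<sigma>) (perm_point \<tau>) = convex hull (perm_point ` {\<sigma>, \<tau>})"
    by (simp add: segment_convex_hull)
  have "closed_segment (perm_point \<sigma>) (perm_point \<tau>) \<noteq> {}" by simp
  then obtain a where "closed_segment (perm_point \<sigma>) (perm_point \<tau>) = convex hull (perm_point ` maximizers a)"
    using face_eq_maximizers[OF assms(1)] by blast
  then have V: "maximizers a = {\<sigma>, \<tau>}" unfolding seg convex_hull_perm_point_inj by simp
  then have \<sigma>: "\<sigma> \<in> maximizers a" by simp
  have "\<exists>d. Suc d < CARD('n) \<and> a $ pos \<sigma> (Suc d) = a $ pos \<sigma> d"
  proof (rule ccontr)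
    assume "\<not> ?thesis"
    then have "maximizers a \<subseteq> {\<sigma>}" by (intro maximizers_subset[OF \<sigma>]) auto
    then show False using V assms(2) by auto
  qed
  then obtain d where d: "Suc d < CARD('n)" "a $ pos \<sigma> (Suc d) = a $ pos \<sigma> d" by blast
  then have "adj d * \<sigma> \<in> {\<sigma>, \<tau>}" using maximizers_adj_iff[OF \<sigma> d(1)] V by simp
  then show ?thesis using adj_neq[OF d(1), of \<sigma>] d(1) by auto
qed

lemma edge_adj:
  fixes \<sigma> :: "'n::{finite,linorder} perm"
  assumes d: "Suc d < CARD('n)"
  shows "closed_segment (perm_point \<sigma>) (perm_point (adj d * \<sigma>)) face_of permutahedron"
proof -
  obtain a where a: "\<sigma> \<in> maximizers a" "\<And>e. Suc e < CARD('n) \<Longrightarrow> a $ pos \<sigma> (Suc e) = a $ pos \<sigma> e \<longleftrightarrow> e = d"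
    using ex_functional[of \<sigma> "{d}"] by auto
  have "maximizers a \<subseteq> {\<sigma>, adj d * \<sigma>}" using a(2) by (intro maximizers_subset[OF a(1)]) auto
  moreover have "adj d * \<sigma> \<in> maximizers a" using maximizers_adj_iff[OF a(1) d] a(2)[OF d] by simp
  ultimately have "maximizers a = {\<sigma>, adj d * \<sigma>}" using a(1) by blast
  then show ?thesis using maximizers_face[of a] by (simp add: segment_convex_hull)
qed

lemma face_vertices_maximizers:
  fixes V :: "'n::{finite,linorder} perm set"
  assumes "F face_of permutahedron" "{x. x extreme_point_of F} = perm_point ` V" "V \<noteq> {}"
  shows "\<exists>a. F = convex hull (perm_point ` maximizers a) \<and> V = maximizers a"
proof -
  have "F \<noteq> {}" using assms(2,3) by (auto simp: extreme_point_of_def)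
  then obtain a where a: "F = convex hull (perm_point ` maximizers a)" using face_eq_maximizers assms(1) by blast
  then have "V = maximizers a"
    using assms(2) extreme_points_convex_hull[of "maximizers a"] inj_image_eq_iff[OF inj_perm_point] by metis
  then show ?thesis using a by blast
qed

text \<open>\<open>K\<close> collects the tied ranks of a functional defining the face. The
  corresponding edges at one vertex are independent, so the dimension bounds \<open>card K\<close>;
  ties occur at the same ranks at every vertex of the face, so all edges of the cycle have labels in
  \<open>K\<close>.\<close>

lemma face_cycleD:
  fixes vs :: "'n::{finite,linorder} perm list"
  assumes "face_cycle vs" "2 \<le> length vs"
  shows "\<exists>K. card K \<le> 2 \<and> finite K \<and> K \<subseteq> {d. Suc d < CARD('n)} \<and>
    (\<forall>k<length vs. \<exists>d\<in>K. vs ! (Suc k mod length vs) = adj d * vs ! k)"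
proof -
  obtain F where F: "distinct vs" "F face_of permutahedron" "aff_dim F = 2" "{x. x extreme_point_of F} = perm_point ` set vs"
    and edges: "\<And>k. k < length vs \<Longrightarrow> closed_segment (perm_point (vs ! k)) (perm_point (vs ! (Suc k mod length vs))) edge_of F"
    using assms(1) unfolding face_cycle_def by blast
  have "set vs \<noteq> {}" using assms(2) by auto
  then obtain a where a: "F = convex hull (perm_point ` maximizers a)" and V: "set vs = maximizers a"
    using face_vertices_maximizers[OF F(2,4)] by blast
  define \<sigma> where "\<sigma> = vs ! 0"
  have "\<sigma> \<in> set vs" unfolding \<sigma>_def using assms(2) by (intro nth_mem) linarith
  then have \<sigma>: "\<sigma> \<in> maximizers a" using V by simp
  define K where "K = {d. Suc d < CARD('n) \<and> a $ pos \<sigma> (Suc d) = a $ pos \<sigma> d}"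
  have K: "K \<subseteq> {d. Suc d < CARD('n)}" by (auto simp: K_def)
  have finK: "finite K" using K by (rule finite_subset) (auto intro: finite_subset[of _ "{..<CARD('n)}"])
  let ?D = "(\<lambda>\<tau>. perm_point \<tau> - perm_point \<sigma>) ` maximizers a"
  have "step_vec \<sigma> ` K \<subseteq> ?D"
  proof
    fix x assume "x \<in> step_vec \<sigma> ` K"
    then obtain d where d: "Suc d < CARD('n)" "a $ pos \<sigma> (Suc d) = a $ pos \<sigma> d" "x = step_vec \<sigma> d" by (auto simp: K_def)
    then have "adj d * \<sigma> \<in> maximizers a" using maximizers_adj_iff[OF \<sigma> d(1)] by simp
    moreover have "x = perm_point (adj d * \<sigma>) - perm_point \<sigma>" using d by (simp add: perm_point_adj)
    ultimately show "x \<in> ?D" by blast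
  qed
  then have "card (step_vec \<sigma> ` K) \<le> dim ?D"
    using step_vec_independent(2)[OF K] by (intro independent_card_le_dim)
  then have "card K \<le> 2"
    using card_image[OF step_vec_independent(1)[OF K, of \<sigma>]] aff_dim_perm_points[OF \<sigma>] F(3) a by simp
  moreover have "\<exists>d\<in>K. vs ! (Suc k mod length vs) = adj d * vs ! k" if k: "k < length vs" for k
  proof -
    let ?k' = "Suc k mod length vs"
    have k': "?k' < length vs" using assms(2) by (intro mod_less_divisor) linarith
    have "?k' \<noteq> k" using k assms(2) by (cases "Suc k = length vs") auto
    then have neq: "vs ! k \<noteq> vs ! ?k'" using F(1) k k' by (simp add: nth_eq_iff_index_eq)
    have "closed_segment (perm_point (vs ! k)) (perm_point (vs ! ?k')) face_of permutahedron"
      using edges[OF k] F(2) face_of_trans unfolding edge_of_def by blast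
    then obtain d where d: "Suc d < CARD('n)" "vs ! ?k' = adj d * vs ! k" using edge_perm_points neq by blast
    have m: "vs ! k \<in> maximizers a" "vs ! ?k' \<in> maximizers a" using V k k' nth_mem by blast+
    then have "a $ pos (vs ! k) (Suc d) = a $ pos (vs ! k) d" using maximizers_adj_iff[OF m(1) d(1)] d(2) by simp
    then have "d \<in> K" using maximizers_level[OF \<sigma> m(1)] d(1) by (simp add: K_def)
    then show ?thesis using d by blast
  qed
  ultimately show ?thesis using finK K by blast
qed

text \<open>\<open>closed\<close> and \<open>gen\<close> make \<open>set vs\<close> the orbit of
  \<sigma> under two moves, hence the maximizers of a functional tied exactly at \<open>k\<close>
  and \<open>l\<close>; \<open>span\<close> bounds the dimension from above.\<close>

lemma face_cycleI:
  fixes vs :: "'n::{finite,linorder} perm list" and \<sigma> :: "'n perm"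
  assumes dist: "distinct vs" and \<sigma>: "\<sigma> \<in> set vs"
    and kl: "k \<noteq> l" "Suc k < CARD('n)" "Suc l < CARD('n)"
    and edges: "\<And>i. i < length vs \<Longrightarrow> vs ! (Suc i mod length vs) = adj k * vs ! i \<or> vs ! (Suc i mod length vs) = adj l * vs ! i"
    and closed: "\<And>\<tau>. \<tau> \<in> set vs \<Longrightarrow> adj k * \<tau> \<in> set vs \<and> adj l * \<tau> \<in> set vs"
    and gen: "\<And>Z. \<sigma> \<in> Z \<Longrightarrow> (\<And>\<tau>. \<tau> \<in> Z \<Longrightarrow> adj k * \<tau> \<in> Z \<and> adj l * \<tau> \<in> Z) \<Longrightarrow> set vs \<subseteq> Z"
    and span: "\<And>\<tau>. \<tau> \<in> set vs \<Longrightarrow> perm_point \<tau> - perm_point \<sigma> \<in> span {step_vec \<sigma> k, step_vec \<sigma> l}"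
  shows "face_cycle vs"
proof -
  obtain a where a: "\<sigma> \<in> maximizers a" "\<And>d. Suc d < CARD('n) \<Longrightarrow> a $ pos \<sigma> (Suc d) = a $ pos \<sigma> d \<longleftrightarrow> d \<in> {k, l}"
    using ex_functional[of \<sigma> "{k, l}"] by blast
  have "maximizers a \<subseteq> set vs" using \<sigma> closed a(2) by (intro maximizers_subset[OF a(1)]) auto
  moreover have "set vs \<subseteq> maximizers a"
  proof (rule gen[OF a(1)])
    fix \<tau> assume \<tau>: "\<tau> \<in> maximizers a"
    have "a $ pos \<tau> (Suc d) = a $ pos \<tau> d" if "d \<in> {k, l}" for d
      using that kl a(2)[of d] maximizers_level[OF a(1) \<tau>, of d] maximizers_level[OF a(1) \<tau>, of "Suc d"] by auto
    then show "adj k * \<tau> \<in> maximizers a \<and> adj l * \<tau> \<in> maximizers a"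
      using maximizers_adj_iff[OF \<tau>] kl by simp
  qed
  ultimately have V: "set vs = maximizers a" by blast
  define F where "F = convex hull (perm_point ` set vs)"
  have face: "F face_of permutahedron" unfolding F_def V by (rule maximizers_face)
  let ?B = "{step_vec \<sigma> k, step_vec \<sigma> l}" and ?D = "(\<lambda>\<tau>. perm_point \<tau> - perm_point \<sigma>) ` set vs"
  have "dim ?D = 2"
  proof (rule dim_unique)
    show "?B \<subseteq> ?D"
      using closed[OF \<sigma>] perm_point_adj[OF kl(2), of \<sigma>] perm_point_adj[OF kl(3), of \<sigma>]
      by (auto simp: image_iff) (metis add_diff_cancel_left')+
    show "?D \<subseteq> span ?B" using span by auto
    show "independent ?B" using step_vec_independent(2)[of "{k, l}" \<sigma>] kl by simp
    show "card ?B = 2" using step_vec_independent(1)[of "{k, l}" \<sigma>] kl by (auto simp: inj_on_def)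
  qed
  then have "aff_dim F = 2" using aff_dim_perm_points[OF \<sigma>] by (simp add: F_def)
  moreover have "closed_segment (perm_point (vs ! i)) (perm_point (vs ! (Suc i mod length vs))) edge_of F"
    if i: "i < length vs" for i
  proof -
    let ?i' = "Suc i mod length vs"
    have i': "?i' < length vs" using i by (intro mod_less_divisor) linarith
    have "\<exists>d. Suc d < CARD('n) \<and> vs ! ?i' = adj d * vs ! i" using edges[OF i] kl by blast
    then obtain d where d: "Suc d < CARD('n)" "vs ! ?i' = adj d * vs ! i" by blast
    have "perm_point (vs ! i) \<in> F" "perm_point (vs ! ?i') \<in> F"
      unfolding F_def using i i' by (auto intro!: hull_inc)
    then have "closed_segment (perm_point (vs ! i)) (perm_point (vs ! ?i')) \<subseteq> F"
      by (intro closed_segment_subset) (auto simp: F_def)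
    then have "closed_segment (perm_point (vs ! i)) (perm_point (vs ! ?i')) face_of F"
      using face_of_subset[OF edge_adj[OF d(1), of "vs ! i"], of F] face_of_imp_subset[OF face] by (simp only: d(2))
    moreover have "perm_point (vs ! i) \<noteq> perm_point (vs ! ?i')"
      using adj_neq[OF d(1), of "vs ! i"] d(2) by (simp add: perm_point_inj)
    then have "aff_dim (closed_segment (perm_point (vs ! i)) (perm_point (vs ! ?i'))) = 1"
      unfolding segment_convex_hull aff_dim_convex_hull by (simp add: aff_dim_2)
    ultimately show ?thesis by (simp add: edge_of_def)
  qed
  ultimately show ?thesis
    unfolding face_cycle_def using dist face extreme_points_convex_hull[of "set vs"] by (auto simp: F_def)
qed

subsection \<open>Hexagons and squares\<close>

lemma card_le_2_cases: "card K \<le> 2 \<Longrightarrow> finite K \<Longrightarrow> j \<in> K \<Longrightarrow> k \<in> K \<Longrightarrow> l \<in> K \<Longrightarrow> j \<noteq> k \<Longrightarrow> l = j \<or> l = k"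
proof (rule ccontr)
  assume *: "card K \<le> 2" "finite K" "j \<in> K" "k \<in> K" "l \<in> K" "j \<noteq> k" "\<not> (l = j \<or> l = k)"
  then have "card {j, k, l} \<le> card K" by (intro card_mono) auto
  then show False using * by auto
qed

text \<open>Consecutive edges carry different labels, so two labels alternate. Commuting moves would
  close the cycle after four steps, so the labels are neighbours; which one is larger depends on the
  direction of the cycle.\<close>

lemma hexagonD:
  fixes a b c d e f :: "'n::{finite,linorder} perm"
  assumes "hexagon a b c d e f"
  obtains k l where "l = Suc k \<or> k = Suc l" "Suc k < CARD('n)" "Suc l < CARD('n)"
    "a = adj k * b" "c = adj l * b" "d = adj k * (adj l * b)" "e = adj l * (adj k * (adj l * b))" "f = adj l * (adj k * b)"
proof -
  have cyc: "face_cycle [a, b, c, d, e, f]" using assms by (simp add: hexagon_def)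
  then have dist: "distinct [a, b, c, d, e, f]" by (simp add: face_cycle_def)
  obtain K where K: "card K \<le> 2" "finite K" "K \<subseteq> {d. Suc d < CARD('n)}"
    "\<And>k. k < 6 \<Longrightarrow> \<exists>j\<in>K. [a, b, c, d, e, f] ! (Suc k mod 6) = adj j * [a, b, c, d, e, f] ! k"
    using face_cycleD[OF cyc] by auto
  obtain j1 where j1: "j1 \<in> K" "b = adj j1 * a" using K(4)[of 0] by auto
  obtain j2 where j2: "j2 \<in> K" "c = adj j2 * b" using K(4)[of 1] by auto
  obtain j3 where j3: "j3 \<in> K" "d = adj j3 * c" using K(4)[of 2] by auto
  obtain j4 where j4: "j4 \<in> K" "e = adj j4 * d" using K(4)[of 3] by auto
  obtain j5 where j5: "j5 \<in> K" "f = adj j5 * e" using K(4)[of 4] by auto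
  have n12: "j1 \<noteq> j2" using dist j1 j2 by auto
  have "j3 \<noteq> j2" using dist j2 j3 by auto
  then have e3: "j3 = j1" using card_le_2_cases[OF K(1,2) j1(1) j2(1) j3(1) n12] by auto
  have "j4 \<noteq> j3" using dist j3 j4 by auto
  then have e4: "j4 = j2" using card_le_2_cases[OF K(1,2) j1(1) j2(1) j4(1) n12] e3 by auto
  have "j5 \<noteq> j4" using dist j4 j5 by auto
  then have e5: "j5 = j1" using card_le_2_cases[OF K(1,2) j1(1) j2(1) j5(1) n12] e4 by auto
  have n: "Suc j1 < CARD('n)" "Suc j2 < CARD('n)" using K(3) j1 j2 by auto
  have a: "a = adj j1 * b" using j1 by simp
  have d: "d = adj j1 * (adj j2 * b)" using j3 j2 e3 by simp
  have e: "e = adj j2 * (adj j1 * (adj j2 * b))" using j4 d e4 by simp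
  have f: "f = adj j1 * (adj j2 * (adj j1 * (adj j2 * b)))" using j5 e e5 by simp
  have "\<not> Suc j1 < j2"
  proof
    assume "Suc j1 < j2"
    then have "e = a" unfolding e a using adj_commute[of j1 j2 b] n by simp
    then show False using dist by simp
  qed
  moreover have "\<not> Suc j2 < j1"
  proof
    assume "Suc j2 < j1"
    then have "e = a" unfolding e a using adj_commute[of j2 j1 b, symmetric] n by simp
    then show False using dist by simp
  qed
  ultimately have near: "j2 = Suc j1 \<or> j1 = Suc j2" using n12 by linarith
  then have "adj j1 * (adj j2 * (adj j1 * b)) = adj j2 * (adj j1 * (adj j2 * b))"
    using adj_braid[of j1 b] adj_braid[of j2 b] n by auto
  then have "f = adj j2 * (adj j1 * b)" unfolding f by (metis adj_adj(2))
  then show ?thesis using that near n a j2(2) d e by blast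
qed

text \<open>Alternating labels that close after four steps cannot be neighbours, by the braid
  relation.\<close>

lemma squareD:
  fixes a b c d :: "'n::{finite,linorder} perm"
  assumes "square a b c d"
  obtains k l where "Suc k < l \<or> Suc l < k" "Suc k < CARD('n)" "Suc l < CARD('n)"
    "a = adj k * b" "c = adj l * b" "d = adj k * (adj l * b)"
proof -
  have cyc: "face_cycle [a, b, c, d]" using assms by (simp add: square_def)
  then have dist: "distinct [a, b, c, d]" by (simp add: face_cycle_def)
  obtain K where K: "card K \<le> 2" "finite K" "K \<subseteq> {d. Suc d < CARD('n)}"
    "\<And>k. k < 4 \<Longrightarrow> \<exists>j\<in>K. [a, b, c, d] ! (Suc k mod 4) = adj j * [a, b, c, d] ! k"
    using face_cycleD[OF cyc] by auto
  obtain j1 where j1: "j1 \<in> K" "b = adj j1 * a" using K(4)[of 0] by auto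
  obtain j2 where j2: "j2 \<in> K" "c = adj j2 * b" using K(4)[of 1] by auto
  obtain j3 where j3: "j3 \<in> K" "d = adj j3 * c" using K(4)[of 2] by auto
  obtain j4 where j4: "j4 \<in> K" "a = adj j4 * d" using K(4)[of 3] by auto
  have n12: "j1 \<noteq> j2" using dist j1 j2 by auto
  have "j3 \<noteq> j2" using dist j2 j3 by auto
  then have e3: "j3 = j1" using card_le_2_cases[OF K(1,2) j1(1) j2(1) j3(1) n12] by auto
  have "j4 \<noteq> j3" using dist j3 j4 by auto
  then have e4: "j4 = j2" using card_le_2_cases[OF K(1,2) j1(1) j2(1) j4(1) n12] e3 by auto
  have n: "Suc j1 < CARD('n)" "Suc j2 < CARD('n)" using K(3) j1 j2 by auto
  have a: "a = adj j1 * b" using j1 by simp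
  have d: "d = adj j1 * (adj j2 * b)" using j3 j2 e3 by simp
  have loop: "adj j2 * (adj j1 * (adj j2 * b)) = adj j1 * b" using j4 d e4 a by simp
  have "\<not> (j2 = Suc j1 \<or> j1 = Suc j2)"
  proof
    assume "j2 = Suc j1 \<or> j1 = Suc j2"
    then have "adj j1 * (adj j2 * (adj j1 * b)) = adj j2 * (adj j1 * (adj j2 * b))"
      using adj_braid[of j1 b] adj_braid[of j2 b] n by auto
    then have "adj j2 * (adj j1 * b) = b" using loop by simp
    then have "adj j1 * b = adj j2 * b" by (metis adj_adj(2))
    then show False using a j2(2) dist by simp
  qed
  then have "Suc j1 < j2 \<or> Suc j2 < j1" using n12 by linarith
  then show ?thesis using that n a j2(2) d by blast
qed

lemma hexagon_distinct:
  fixes \<sigma> :: "'n::{finite,linorder} perm"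
  assumes d: "Suc (Suc d) < CARD('n)"
  shows "distinct [adj d * \<sigma>, \<sigma>, adj (Suc d) * \<sigma>, adj d * (adj (Suc d) * \<sigma>),
    adj d * (adj (Suc d) * (adj d * \<sigma>)), adj (Suc d) * (adj d * \<sigma>)]"
proof -
  let ?p = "\<lambda>\<tau> :: 'n perm. (pos \<tau> d, pos \<tau> (Suc d), pos \<tau> (Suc (Suc d)))"
  have neq: "pos \<sigma> d \<noteq> pos \<sigma> (Suc d)" "pos \<sigma> d \<noteq> pos \<sigma> (Suc (Suc d))" "pos \<sigma> (Suc d) \<noteq> pos \<sigma> (Suc (Suc d))"
    using d by (simp_all add: pos_inj)
  have "distinct (map ?p [adj d * \<sigma>, \<sigma>, adj (Suc d) * \<sigma>, adj d * (adj (Suc d) * \<sigma>),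
    adj d * (adj (Suc d) * (adj d * \<sigma>)), adj (Suc d) * (adj d * \<sigma>)])"
    using neq neq[symmetric] by (simp add: pos_adj_triple[OF d])
  then show ?thesis unfolding distinct_map by (rule conjunct1)
qed

lemma perm_point_hexagon:
  fixes \<sigma> :: "'n::{finite,linorder} perm"
  assumes d: "Suc (Suc d) < CARD('n)"
  defines "\<alpha> \<equiv> step_vec \<sigma> d" and "\<beta> \<equiv> step_vec \<sigma> (Suc d)"
  shows "perm_point (adj d * \<sigma>) = perm_point \<sigma> + \<alpha>"
    "perm_point (adj (Suc d) * \<sigma>) = perm_point \<sigma> + \<beta>"
    "perm_point (adj d * (adj (Suc d) * \<sigma>)) = perm_point \<sigma> + \<alpha> + 2 *\<^sub>R \<beta>"
    "perm_point (adj (Suc d) * (adj d * \<sigma>)) = perm_point \<sigma> + 2 *\<^sub>R \<alpha> + \<beta>"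
    "perm_point (adj d * (adj (Suc d) * (adj d * \<sigma>))) = perm_point \<sigma> + 2 *\<^sub>R \<alpha> + 2 *\<^sub>R \<beta>"
proof -
  have d': "Suc d < CARD('n)" using d by simp
  show "perm_point (adj d * \<sigma>) = perm_point \<sigma> + \<alpha>"
    "perm_point (adj (Suc d) * \<sigma>) = perm_point \<sigma> + \<beta>"
    "perm_point (adj d * (adj (Suc d) * \<sigma>)) = perm_point \<sigma> + \<alpha> + 2 *\<^sub>R \<beta>"
    "perm_point (adj (Suc d) * (adj d * \<sigma>)) = perm_point \<sigma> + 2 *\<^sub>R \<alpha> + \<beta>"
    "perm_point (adj d * (adj (Suc d) * (adj d * \<sigma>))) = perm_point \<sigma> + 2 *\<^sub>R \<alpha> + 2 *\<^sub>R \<beta>"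
    unfolding \<alpha>_def \<beta>_def perm_point_adj[OF d] perm_point_adj[OF d'] step_vec_def pos_adj_triple[OF d]
    by (simp_all add: algebra_simps scaleR_2)
qed

lemma hexagonI:
  fixes \<sigma> :: "'n::{finite,linorder} perm"
  assumes d: "Suc (Suc d) < CARD('n)"
  shows "hexagon (adj d * \<sigma>) \<sigma> (adj (Suc d) * \<sigma>) (adj d * (adj (Suc d) * \<sigma>))
    (adj d * (adj (Suc d) * (adj d * \<sigma>))) (adj (Suc d) * (adj d * \<sigma>))"
  unfolding hexagon_def
proof (rule face_cycleI[where \<sigma> = \<sigma> and k = d and l = "Suc d"])
  let ?vs = "[adj d * \<sigma>, \<sigma>, adj (Suc d) * \<sigma>, adj d * (adj (Suc d) * \<sigma>),
    adj d * (adj (Suc d) * (adj d * \<sigma>)), adj (Suc d) * (adj d * \<sigma>)]"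
  show "distinct ?vs" by (rule hexagon_distinct[OF d])
  note braid = adj_braid[OF d, of \<sigma>]
  have braid': "adj (Suc d) * (adj d * (adj (Suc d) * (adj d * \<sigma>))) = adj d * (adj (Suc d) * \<sigma>)"
    using adj_braid[OF d, of "adj d * \<sigma>"] by simp
  show "?vs ! (Suc i mod length ?vs) = adj d * ?vs ! i \<or> ?vs ! (Suc i mod length ?vs) = adj (Suc d) * ?vs ! i"
    if "i < length ?vs" for i
  proof -
    have "i < 6" using that by simp
    then consider "i = 0" | "i = 1" | "i = 2" | "i = 3" | "i = 4" | "i = 5" by linarith
    then show ?thesis using braid[symmetric] by cases simp_all
  qed
  show "adj d * \<tau> \<in> set ?vs \<and> adj (Suc d) * \<tau> \<in> set ?vs" if "\<tau> \<in> set ?vs" for \<tau>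
    using that by (auto simp: braid[symmetric] braid')
  show "set ?vs \<subseteq> Z" if "\<sigma> \<in> Z" "\<And>\<tau>. \<tau> \<in> Z \<Longrightarrow> adj d * \<tau> \<in> Z \<and> adj (Suc d) * \<tau> \<in> Z" for Z
    using that by auto
  have comb: "x *\<^sub>R step_vec \<sigma> d + y *\<^sub>R step_vec \<sigma> (Suc d) \<in> span {step_vec \<sigma> d, step_vec \<sigma> (Suc d)}" for x y
    by (intro span_add span_scale span_base) auto
  show "perm_point \<tau> - perm_point \<sigma> \<in> span {step_vec \<sigma> d, step_vec \<sigma> (Suc d)}" if "\<tau> \<in> set ?vs" for \<tau>
    using that comb[of 0 0] comb[of 1 0] comb[of 0 1] comb[of 1 2] comb[of 2 1] comb[of 2 2]
    by (auto simp: perm_point_hexagon[OF d, of \<sigma>] add.assoc)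
qed (use d in auto)

lemma perm_point_square:
  fixes \<sigma> :: "'n::{finite,linorder} perm"
  assumes de: "Suc d < e" "Suc e < CARD('n)"
  shows "perm_point (adj d * \<sigma>) = perm_point \<sigma> + step_vec \<sigma> d"
    "perm_point (adj e * \<sigma>) = perm_point \<sigma> + step_vec \<sigma> e"
    "perm_point (adj d * (adj e * \<sigma>)) = perm_point \<sigma> + step_vec \<sigma> d + step_vec \<sigma> e"
proof -
  have d: "Suc d < CARD('n)" using de by simp
  have "step_vec (adj e * \<sigma>) d = step_vec \<sigma> d" unfolding step_vec_def using de by (simp add: pos_adj_simps)
  then show "perm_point (adj d * \<sigma>) = perm_point \<sigma> + step_vec \<sigma> d"
    "perm_point (adj e * \<sigma>) = perm_point \<sigma> + step_vec \<sigma> e"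
    "perm_point (adj d * (adj e * \<sigma>)) = perm_point \<sigma> + step_vec \<sigma> d + step_vec \<sigma> e"
    by (simp_all add: perm_point_adj[OF d] perm_point_adj[OF de(2)])
qed

lemma square_distinct:
  fixes \<sigma> :: "'n::{finite,linorder} perm"
  assumes de: "Suc d < e" "Suc e < CARD('n)"
  shows "distinct [adj d * \<sigma>, \<sigma>, adj e * \<sigma>, adj d * (adj e * \<sigma>)]"
proof -
  have d: "Suc d < CARD('n)" using de by simp
  let ?p = "\<lambda>\<tau> :: 'n perm. (pos \<tau> d, pos \<tau> e)"
  have "distinct (map ?p [adj d * \<sigma>, \<sigma>, adj e * \<sigma>, adj d * (adj e * \<sigma>)])"
    using de d by (simp add: pos_adj_simps pos_inj)
  then show ?thesis unfolding distinct_map by (rule conjunct1)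
qed

lemma squareI:
  fixes \<sigma> :: "'n::{finite,linorder} perm"
  assumes de: "Suc d < e" "Suc e < CARD('n)"
  shows "square (adj d * \<sigma>) \<sigma> (adj e * \<sigma>) (adj d * (adj e * \<sigma>))"
  unfolding square_def
proof (rule face_cycleI[where \<sigma> = \<sigma> and k = d and l = e])
  let ?vs = "[adj d * \<sigma>, \<sigma>, adj e * \<sigma>, adj d * (adj e * \<sigma>)]"
  note comm = adj_commute[OF de, of \<sigma>]
  show "distinct ?vs" by (rule square_distinct[OF de])
  show "?vs ! (Suc i mod length ?vs) = adj d * ?vs ! i \<or> ?vs ! (Suc i mod length ?vs) = adj e * ?vs ! i"
    if "i < length ?vs" for i
  proof -
    have "i < 4" using that by simp
    then consider "i = 0" | "i = 1" | "i = 2" | "i = 3" by linarith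
    then show ?thesis using comm by cases simp_all
  qed
  have comm': "adj e * (adj d * (adj e * \<sigma>)) = adj d * \<sigma>" using comm by (metis adj_adj(2))
  show "adj d * \<tau> \<in> set ?vs \<and> adj e * \<tau> \<in> set ?vs" if "\<tau> \<in> set ?vs" for \<tau>
    using that by (auto simp: comm[symmetric] comm')
  show "set ?vs \<subseteq> Z" if "\<sigma> \<in> Z" "\<And>\<tau>. \<tau> \<in> Z \<Longrightarrow> adj d * \<tau> \<in> Z \<and> adj e * \<tau> \<in> Z" for Z
    using that by auto
  have comb: "x *\<^sub>R step_vec \<sigma> d + y *\<^sub>R step_vec \<sigma> e \<in> span {step_vec \<sigma> d, step_vec \<sigma> e}" for x y
    by (intro span_add span_scale span_base) auto
  show "perm_point \<tau> - perm_point \<sigma> \<in> span {step_vec \<sigma> d, step_vec \<sigma> e}" if "\<tau> \<in> set ?vs" for \<tau>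
    using that comb[of 0 0] comb[of 1 0] comb[of 0 1] comb[of 1 1]
    by (auto simp: perm_point_square[OF de, of \<sigma>] add.assoc)
qed (use de in auto)

section \<open>Local conditions on the faces\<close>

lemma bruhat_le_adj:
  fixes \<sigma> :: "'n::{finite,linorder} perm"
  assumes d: "Suc d < CARD('n)" and desc: "pos \<sigma> (Suc d) < pos \<sigma> d"
  shows "bruhat_le \<sigma> (adj d * \<sigma>)"
proof -
  have "lower d (adj d * \<sigma>) = \<sigma>" using d desc by (simp add: lower_def pos_adj_simps)
  then show ?thesis using flag_le_lower[OF d, of "adj d * \<sigma>"] by (simp add: bruhat_le_iff)
qed

lemma bruhat_le_trans: "bruhat_le x y \<Longrightarrow> bruhat_le y z \<Longrightarrow> bruhat_le x z" for x y z :: "'n::{finite,linorder} perm"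
  unfolding bruhat_le_iff by (rule flag_le_trans)

lemma hexagon_bruhat:
  fixes \<sigma> :: "'n::{finite,linorder} perm"
  assumes d: "Suc (Suc d) < CARD('n)"
    and desc: "pos \<sigma> (Suc d) < pos \<sigma> d" "pos \<sigma> (Suc (Suc d)) < pos \<sigma> (Suc d)"
  defines "a \<equiv> adj d * \<sigma>" and "c \<equiv> adj (Suc d) * \<sigma>" and "d' \<equiv> adj d * (adj (Suc d) * \<sigma>)"
    and "e \<equiv> adj d * (adj (Suc d) * (adj d * \<sigma>))" and "f \<equiv> adj (Suc d) * (adj d * \<sigma>)"
  shows "bruhat_le \<sigma> a" "bruhat_le \<sigma> c" "bruhat_le a d'" "bruhat_le a f" "bruhat_le c d'" "bruhat_le c f"
    "bruhat_le d' e" "bruhat_le f e"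
    "card (inversions a) = Suc (card (inversions \<sigma>))" "card (inversions c) = Suc (card (inversions \<sigma>))"
    "card (inversions d') = Suc (Suc (card (inversions \<sigma>)))" "card (inversions f) = Suc (Suc (card (inversions \<sigma>)))"
    "card (inversions e) = Suc (Suc (Suc (card (inversions \<sigma>))))"
proof -
  have d1: "Suc d < CARD('n)" using d by simp
  have desc2: "pos \<sigma> (Suc (Suc d)) < pos \<sigma> d" using desc by simp
  have e': "e = adj (Suc d) * d'" unfolding e_def d'_def by (rule adj_braid[OF d])
  have pa: "pos a (Suc (Suc d)) < pos a (Suc d)" using desc2 by (simp add: a_def pos_adj_triple[OF d])
  have pc: "pos c (Suc d) < pos c d" using desc2 by (simp add: c_def pos_adj_triple[OF d])
  have pf: "pos f (Suc d) < pos f d" using desc by (simp add: f_def pos_adj_triple[OF d])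
  have pd: "pos d' (Suc (Suc d)) < pos d' (Suc d)" using desc by (simp add: d'_def pos_adj_triple[OF d])
  show *: "bruhat_le \<sigma> a" "bruhat_le \<sigma> c" "bruhat_le a f" "bruhat_le c d'" "bruhat_le f e" "bruhat_le d' e"
    using bruhat_le_adj[OF d1 desc(1)] bruhat_le_adj[OF d desc(2)] bruhat_le_adj[OF d pa] bruhat_le_adj[OF d1 pc]
      bruhat_le_adj[OF d1 pf] bruhat_le_adj[OF d pd]
    by (simp_all add: a_def c_def d'_def e' f_def) (simp add: e_def[unfolded f_def[symmetric]] adj_braid[OF d])
  \<comment> \<open>The relation between \<open>a\<close> and \<open>d'\<close>, like that between
    \<open>c\<close> and \<open>f\<close> below, is not a left multiplication by a simple
    transposition; both come from the lifting property.\<close>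
  have "lower d a = \<sigma>" "lower d d' = c" "pos d' d < pos d' (Suc d)"
    using d1 desc(1) pc by (simp_all add: lower_def a_def d'_def c_def pos_adj_simps)
  then show "bruhat_le a d'" using flag_le_lower_iff[OF d1, of d' a] *(2) by (simp add: bruhat_le_iff)
  have "lower (Suc d) c = \<sigma>" "lower (Suc d) f = a" "pos f (Suc d) < pos f (Suc (Suc d))"
    using d desc(2) pa by (simp_all add: lower_def a_def f_def c_def pos_adj_simps)
  then show "bruhat_le c f" using flag_le_lower_iff[OF d, of f c] *(1) by (simp add: bruhat_le_iff)
  show card: "card (inversions a) = Suc (card (inversions \<sigma>))" "card (inversions c) = Suc (card (inversions \<sigma>))"
    unfolding a_def c_def by (rule card_inversions_adj; fact)+
  show card2: "card (inversions d') = Suc (Suc (card (inversions \<sigma>)))" "card (inversions f) = Suc (Suc (card (inversions \<sigma>)))"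
    using card_inversions_adj[OF d pa] card_inversions_adj[OF d1 pc] card by (simp_all add: a_def c_def d'_def f_def)
  show "card (inversions e) = Suc (Suc (Suc (card (inversions \<sigma>))))"
    using card_inversions_adj[OF d pd] card2 by (simp add: e')
qed

lemma bruhat_le_adj_desc:
  fixes \<sigma> :: "'n::{finite,linorder} perm"
  assumes "Suc d < CARD('n)" "bruhat_le \<sigma> (adj d * \<sigma>)"
  shows "pos \<sigma> (Suc d) < pos \<sigma> d"
  using pos_Suc_cases[OF assms(1), of \<sigma>] card_inversions_adj'[OF assms(1), of \<sigma>] bruhat_le_inversions(1)[OF assms(2)]
  by fastforce

lemma HXE_iff: "HXE u \<longleftrightarrow> hexagons_balanced (u :: 'n::{finite,linorder} perm \<Rightarrow> real)"
proof
  assume "HXE u"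
  then show "hexagons_balanced u"
    unfolding hexagons_balanced_def HXE_def using hexagonI by blast
next
  assume bal: "hexagons_balanced u"
  show "HXE u"
    unfolding HXE_def
  proof (intro allI impI)
    fix a b c d e f :: "'n perm"
    assume "hexagon a b c d e f"
    then obtain k l where kl: "l = Suc k \<or> k = Suc l" "Suc k < CARD('n)" "Suc l < CARD('n)"
      and eqs: "a = adj k * b" "c = adj l * b" "d = adj k * (adj l * b)" "e = adj l * (adj k * (adj l * b))" "f = adj l * (adj k * b)"
      by (rule hexagonD)
    from kl(1) show "u a + u c + u e = u b + u d + u f"
    proof
      assume l: "l = Suc k"
      then show ?thesis
        using bal[unfolded hexagons_balanced_def, rule_format, of k b] kl eqs adj_braid[of k b] by simp
    next
      assume "k = Suc l"
      then show ?thesis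
        using bal[unfolded hexagons_balanced_def, rule_format, of l b] kl eqs adj_braid[of l b] by simp
    qed
  qed
qed

lemma SQR_iff: "SQR u \<longleftrightarrow> squares_balanced (u :: 'n::{finite,linorder} perm \<Rightarrow> real)"
proof
  assume "SQR u"
  then show "squares_balanced u"
    unfolding squares_balanced_def SQR_def using squareI by blast
next
  assume bal: "squares_balanced u"
  show "SQR u"
    unfolding SQR_def
  proof (intro allI impI)
    fix a b c d :: "'n perm"
    assume "square a b c d"
    then obtain k l where kl: "Suc k < l \<or> Suc l < k" "Suc k < CARD('n)" "Suc l < CARD('n)"
      and eqs: "a = adj k * b" "c = adj l * b" "d = adj k * (adj l * b)"
      by (rule squareD)
    from kl(1) show "u a + u c = u b + u d"
    proof
      assume "Suc k < l"
      then show ?thesis using bal[unfolded squares_balanced_def, rule_format, of k l b] kl eqs by simp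
    next
      assume l: "Suc l < k"
      then show ?thesis
        using bal[unfolded squares_balanced_def, rule_format, of l k b] kl eqs adj_commute[OF l kl(2), of b] by simp
    qed
  qed
qed

lemma HXM_plus_iff: "HXM_plus u \<longleftrightarrow> hexagons_max (u :: 'n::{finite,linorder} perm \<Rightarrow> real)"
proof
  assume H: "HXM_plus u"
  show "hexagons_max u"
    unfolding hexagons_max_def
  proof (intro allI impI, elim conjE)
    fix \<sigma> :: "'n perm" and d
    assume d: "Suc (Suc d) < CARD('n)" and desc: "pos \<sigma> (Suc d) < pos \<sigma> d" "pos \<sigma> (Suc (Suc d)) < pos \<sigma> (Suc d)"
    note le = hexagon_bruhat[OF d desc]
    note up = bruhat_le_trans[OF le(1) le(4)] bruhat_le_trans[OF le(1) le(3)]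
    note up = up bruhat_le_trans[OF up(2) le(7)]
    show "u \<sigma> + u (adj d * (adj (Suc d) * (adj d * \<sigma>))) =
      max (u (adj d * \<sigma>) + u (adj d * (adj (Suc d) * \<sigma>))) (u (adj (Suc d) * \<sigma>) + u (adj (Suc d) * (adj d * \<sigma>)))"
      using H[unfolded HXM_plus_def, rule_format, OF conjI, OF hexagonI[OF d, of \<sigma>]] le(1,2) up by simp
  qed
next
  assume H: "hexagons_max u"
  show "HXM_plus u"
    unfolding HXM_plus_def
  proof (intro allI impI, elim conjE)
    fix a b c d e f :: "'n perm"
    assume low: "\<forall>x\<in>{a, b, c, d, e, f}. bruhat_le b x" and "hexagon a b c d e f"
    from this(2) obtain k l where kl: "l = Suc k \<or> k = Suc l" "Suc k < CARD('n)" "Suc l < CARD('n)"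
      and eqs: "a = adj k * b" "c = adj l * b" "d = adj k * (adj l * b)" "e = adj l * (adj k * (adj l * b))" "f = adj l * (adj k * b)"
      by (rule hexagonD)
    have desc: "pos b (Suc k) < pos b k" "pos b (Suc l) < pos b l"
      using bruhat_le_adj_desc kl low eqs by auto
    from kl(1) show "u b + u e = max (u a + u d) (u c + u f)"
    proof
      assume "l = Suc k"
      then show ?thesis
        using H[unfolded hexagons_max_def, rule_format, of k b] kl desc eqs adj_braid[of k b] by simp
    next
      assume "k = Suc l"
      then show ?thesis
        using H[unfolded hexagons_max_def, rule_format, of l b] kl desc eqs adj_braid[of l b]
        by (simp add: max.commute)
    qed
  qed
qed

section \<open>Cells of the regular subdivision\<close>

definition argmins :: "('n::{finite,linorder} perm \<Rightarrow> real) \<Rightarrow> real ^ 'n::{finite,linorder} \<Rightarrow> 'n::{finite,linorder} perm set" where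
  "argmins u c = {\<sigma>. \<forall>\<tau>. u \<sigma> + c \<bullet> perm_point \<sigma> \<le> u \<tau> + c \<bullet> perm_point \<tau>}"

definition bruhat_interval :: "'n::{finite,linorder} perm set \<Rightarrow> bool" where
  "bruhat_interval T \<longleftrightarrow> (\<exists>v w. bruhat_le v w \<and> T = {z. bruhat_le v z \<and> bruhat_le z w})"

lemma ex_minimizer: "\<exists>\<sigma> :: 'n::{finite,linorder} perm. \<forall>\<tau>. f \<sigma> \<le> (f \<tau> :: real)"
proof -
  have fin: "finite (range f)" by (intro finite_imageI finite_perms)
  then have "Min (range f) \<in> range f" by (intro Min_in) auto
  then obtain \<sigma> where "Min (range f) = f \<sigma>" by blast
  then show ?thesis using Min_le[OF fin] by (metis rangeI)
qed

lemma lower_face_lifted_permutahedron: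
  fixes u :: "'n::{finite,linorder} perm \<Rightarrow> real"
  shows "lower_face (lifted_permutahedron u) F \<longleftrightarrow>
    (\<exists>c. F = convex hull ((\<lambda>\<sigma>. (perm_point \<sigma>, u \<sigma>)) ` argmins u c))"
proof -
  let ?p = "\<lambda>\<sigma> :: 'n perm. (perm_point \<sigma>, u \<sigma>)" and ?g = "\<lambda>c (\<sigma> :: 'n perm). u \<sigma> + c \<bullet> perm_point \<sigma>"
  have face: "{(x, h) \<in> lifted_permutahedron u. c \<bullet> x + h = b} = convex hull (?p ` {\<sigma>. ?g c \<sigma> = b})"
    if "\<And>\<sigma>. b \<le> ?g c \<sigma>" for c b
  proof -
    have "convex hull range ?p \<inter> {x. (- c, - 1) \<bullet> x = - b} = convex hull {s \<in> range ?p. (- c, - 1) \<bullet> s = - b}"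
    proof (rule convex_hull_face)
      show "finite (range ?p)" by (intro finite_imageI finite_perms)
      show "(- c, - 1) \<bullet> s \<le> - b" if "s \<in> range ?p" for s
        using that \<open>\<And>\<sigma>. b \<le> ?g c \<sigma>\<close> by (auto simp: inner_Pair) (smt (verit))
    qed
    moreover have "{s \<in> range ?p. (- c, - 1) \<bullet> s = - b} = ?p ` {\<sigma>. ?g c \<sigma> = b}"
      by (auto simp: inner_Pair)
    moreover have "convex hull range ?p \<inter> {x. (- c, - 1) \<bullet> x = - b} = {(x, h) \<in> lifted_permutahedron u. c \<bullet> x + h = b}"
      by (auto simp: inner_Pair lifted_permutahedron_def)
    ultimately show ?thesis by simp
  qed
  show ?thesis
  proof
    assume "lower_face (lifted_permutahedron u) F"
    then obtain c b where ne: "F \<noteq> {}" and b: "\<And>x h. (x, h) \<in> lifted_permutahedron u \<Longrightarrow> b \<le> c \<bullet> x + h"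
      and F: "F = {(x, h) \<in> lifted_permutahedron u. c \<bullet> x + h = b}"
      unfolding lower_face_def by fast
    have ge: "b \<le> ?g c \<sigma>" for \<sigma>
      using b[of "perm_point \<sigma>" "u \<sigma>"] by (simp add: lifted_permutahedron_def hull_inc add.commute)
    obtain \<rho> where \<rho>: "?g c \<rho> = b" using ne unfolding F face[OF ge] by auto
    have "{\<sigma>. ?g c \<sigma> = b} = argmins u c"
      unfolding argmins_def using ge \<rho> by (auto intro: order_antisym)
    then show "\<exists>c. F = convex hull (?p ` argmins u c)" using F face[OF ge] by auto
  next
    assume "\<exists>c. F = convex hull (?p ` argmins u c)"
    then obtain c where F: "F = convex hull (?p ` argmins u c)" by blast
    obtain \<rho> where \<rho>: "\<And>\<tau>. ?g c \<rho> \<le> ?g c \<tau>" using ex_minimizer[of "?g c"] by blast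
    have eq: "{\<sigma>. ?g c \<sigma> = ?g c \<rho>} = argmins u c"
      unfolding argmins_def using \<rho> by (auto intro: order_antisym)
    have "lifted_permutahedron u \<subseteq> {x. (c, 1) \<bullet> x \<ge> ?g c \<rho>}"
      unfolding lifted_permutahedron_def using \<rho>
      by (intro hull_minimal convex_halfspace_ge) (auto simp: inner_Pair add.commute)
    then have "\<forall>(x, h)\<in>lifted_permutahedron u. ?g c \<rho> \<le> c \<bullet> x + h" by (auto simp: inner_Pair)
    moreover have "F = {(x, h) \<in> lifted_permutahedron u. c \<bullet> x + h = ?g c \<rho>}" using face[OF \<rho>] F eq by simp
    moreover have "\<rho> \<in> argmins u c" using \<rho> by (auto simp: argmins_def)
    then have "F \<noteq> {}" using F by auto
    ultimately show "lower_face (lifted_permutahedron u) F" unfolding lower_face_def by blast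
  qed
qed

lemma regular_subdivision_eq: "regular_subdivision u = range (\<lambda>c. convex hull (perm_point ` argmins u c))"
proof -
  have "fst ` (convex hull ((\<lambda>\<sigma>. (perm_point \<sigma>, u \<sigma>)) ` V)) = convex hull (perm_point ` V)" for V
    using convex_hull_linear_image[OF linear_fst, of "(\<lambda>\<sigma>. (perm_point \<sigma>, u \<sigma>)) ` V"] by (simp add: image_image)
  then show ?thesis unfolding regular_subdivision_def lower_face_lifted_permutahedron by auto
qed

lemma bruhat_subdivision_iff:
  "(\<forall>P\<in>regular_subdivision u. bruhat_interval_polytope P) \<longleftrightarrow> (\<forall>c. bruhat_interval (argmins u c))"
  unfolding regular_subdivision_eq bruhat_interval_polytope_def bruhat_interval_def
  by (simp add: convex_hull_perm_point_inj)

text \<open>A linear function added to \<open>u\<close> becomes a modular function added to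
  \<open>w\<close>. Each of the three terms of the relation uses \<open>i\<close>, \<open>j\<close>,
  \<open>k\<close> once and \<open>S\<close> twice, so all change by the same amount.\<close>

lemma tropical_positive_subdivision:
  fixes u :: "'n::{finite,linorder} perm \<Rightarrow> real"
  assumes w: "tropical_positive w" "\<And>\<sigma>. u \<sigma> = flag_sum w \<sigma>"
  shows "bruhat_interval (argmins u c)"
proof -
  define w' where "w' = (\<lambda>I. w I + (\<Sum>i\<in>I. c $ i))"
  have "tropical_positive w'"
    using w(1) unfolding tropical_positive_def w'_def by (auto simp: min_def)
  have "c \<bullet> indicator_vec I = (\<Sum>i\<in>I. c $ i)" for I :: "'n set"
    by (simp add: indicator_vec_def inner_sum_right inner_axis)
  then have "flag_sum w' \<sigma> = u \<sigma> + c \<bullet> perm_point \<sigma>" for \<sigma>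
    by (simp add: w w'_def flag_sum_def perm_point_eq_sum inner_sum_right sum.distrib)
  then show ?thesis
    using flag_sum_argmin_interval[OF \<open>tropical_positive w'\<close>] by (auto simp: argmins_def bruhat_interval_def)
qed

text \<open>\<open>N\<close> exceeds every ratio by which \<open>g\<close> could favour a point
  outside \<open>V\<close>; on \<open>V\<close> itself \<open>h\<close> is constant.\<close>

lemma argmin_concentrate:
  fixes g h :: "'a \<Rightarrow> real"
  assumes fin: "finite (UNIV :: 'a set)" and V: "V = {x. \<forall>y. h y \<le> h x}" "V \<noteq> {}"
  shows "\<exists>N. {x. \<forall>y. g x - N * h x \<le> g y - N * h y} = {x \<in> V. \<forall>y\<in>V. g x \<le> g y}"
proof -
  obtain v where v: "v \<in> V" using V(2) by blast
  let ?q = "\<lambda>(x, y). (g x - g y) / (h v - h y)"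
  have "finite (range ?q)" using finite_cartesian_product[OF fin fin] by simp
  define N where "N = Max (range ?q) + 1"
  have N: "?q z < N" for z
    using Max_ge[OF \<open>finite (range ?q)\<close>, of "?q z"] by (simp add: N_def)
  have hV: "h x = h v" if "x \<in> V" for x using that v V(1) by (auto intro: order_antisym)
  have gap: "g x - N * h x < g y - N * h y" if "x \<in> V" "y \<notin> V" for x y
  proof -
    have "h y < h v" using that v V(1) by (auto simp: not_le intro: less_le_trans)
    moreover have "(g x - g y) / (h v - h y) < N" using N[of "(x, y)"] by simp
    ultimately have "g x - g y < N * (h v - h y)" by (simp add: divide_less_eq)
    then show ?thesis using hV[OF that(1)] by (simp add: algebra_simps)
  qed
  have "{x. \<forall>y. g x - N * h x \<le> g y - N * h y} = {x \<in> V. \<forall>y\<in>V. g x \<le> g y}"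
  proof (intro Set.set_eqI iffI)
    fix x assume x: "x \<in> {x. \<forall>y. g x - N * h x \<le> g y - N * h y}"
    then have "x \<in> V" using gap[OF v, of x] by (auto simp: not_le[symmetric])
    moreover have "g x \<le> g y" if "y \<in> V" for y using x hV[OF that] hV[OF \<open>x \<in> V\<close>] by (simp, smt (verit))
    ultimately show "x \<in> {x \<in> V. \<forall>y\<in>V. g x \<le> g y}" by blast
  next
    fix x assume x: "x \<in> {x \<in> V. \<forall>y\<in>V. g x \<le> g y}"
    have "g x - N * h x \<le> g y - N * h y" for y
    proof (cases "y \<in> V")
      case True
      then show ?thesis using x hV[OF True] hV[of x] by simp
    next
      case False
      then show ?thesis using gap[of x y] x by simp
    qed
    then show "x \<in> {x. \<forall>y. g x - N * h x \<le> g y - N * h y}" by blast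
  qed
  then show ?thesis by blast
qed

lemma bruhat_interval_maximizers:
  fixes u :: "'n::{finite,linorder} perm \<Rightarrow> real"
  assumes "\<And>c. bruhat_interval (argmins u c)"
  shows "bruhat_interval {\<sigma> \<in> maximizers a. \<forall>\<tau>\<in>maximizers a. u \<sigma> + c \<bullet> perm_point \<sigma> \<le> u \<tau> + c \<bullet> perm_point \<tau>}"
proof -
  obtain N where "{x. \<forall>y. (u x + c \<bullet> perm_point x) - N * (a \<bullet> perm_point x) \<le> (u y + c \<bullet> perm_point y) - N * (a \<bullet> perm_point y)}
      = {\<sigma> \<in> maximizers a. \<forall>\<tau>\<in>maximizers a. u \<sigma> + c \<bullet> perm_point \<sigma> \<le> u \<tau> + c \<bullet> perm_point \<tau>}"
    using argmin_concentrate[OF finite_perms maximizers_def maximizers_nonempty, of "\<lambda>x. u x + c \<bullet> perm_point x"] by blast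
  then show ?thesis
    using assms[of "c - N *\<^sub>R a"] by (simp add: argmins_def inner_diff_left algebra_simps)
qed

lemma bruhat_interval_convex:
  "bruhat_interval T \<Longrightarrow> x \<in> T \<Longrightarrow> y \<in> T \<Longrightarrow> bruhat_le x z \<Longrightarrow> bruhat_le z y \<Longrightarrow> z \<in> T"
  unfolding bruhat_interval_def using bruhat_le_trans by blast

text \<open>Comparable distinct permutations differ in length, so neither of two distinct elements
  of equal length is the least or the greatest of the interval.\<close>

lemma bruhat_interval_bounds:
  assumes T: "bruhat_interval T" and xy: "x \<in> T" "y \<in> T" "x \<noteq> y" "card (inversions x) = card (inversions y)"
  shows "\<exists>p\<in>T. card (inversions p) < card (inversions x)" "\<exists>q\<in>T. card (inversions x) < card (inversions q)"
proof -
  obtain v w where vw: "bruhat_le v w" "T = {z. bruhat_le v z \<and> bruhat_le z w}"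
    using T unfolding bruhat_interval_def by blast
  have v: "v \<in> T" "bruhat_le v x" "bruhat_le v y" and w: "w \<in> T" "bruhat_le x w" "bruhat_le y w" using vw xy by auto
  have "card (inversions v) < card (inversions x)"
    using bruhat_le_inversions[OF v(2)] bruhat_le_inversions[OF v(3)] xy(3,4) by (metis le_neq_implies_less)
  then show "\<exists>p\<in>T. card (inversions p) < card (inversions x)" using v by blast
  have "card (inversions x) < card (inversions w)"
    using bruhat_le_inversions[OF w(2)] bruhat_le_inversions[OF w(3)] xy(3,4) by (metis le_neq_implies_less)
  then show "\<exists>q\<in>T. card (inversions x) < card (inversions q)" using w by blast
qed

text \<open>Only \<sigma> is shorter than \<open>a\<close> and \<open>c\<close>, and only
  \<open>e\<close> is longer than \<open>d'\<close> and \<open>f\<close>; this gives the first two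
  rules. The others are convexity.\<close>

lemma hexagon_interval_rules:
  fixes \<sigma> :: "'n::{finite,linorder} perm"
  assumes d: "Suc (Suc d) < CARD('n)"
    and desc: "pos \<sigma> (Suc d) < pos \<sigma> d" "pos \<sigma> (Suc (Suc d)) < pos \<sigma> (Suc d)"
  defines "a \<equiv> adj d * \<sigma>" and "c \<equiv> adj (Suc d) * \<sigma>" and "d' \<equiv> adj d * (adj (Suc d) * \<sigma>)"
    and "e \<equiv> adj d * (adj (Suc d) * (adj d * \<sigma>))" and "f \<equiv> adj (Suc d) * (adj d * \<sigma>)"
  assumes T: "bruhat_interval T" "T \<subseteq> {a, \<sigma>, c, d', e, f}"
  shows "a \<in> T \<Longrightarrow> c \<in> T \<Longrightarrow> \<sigma> \<in> T" "d' \<in> T \<Longrightarrow> f \<in> T \<Longrightarrow> e \<in> T"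
    "\<sigma> \<in> T \<Longrightarrow> d' \<in> T \<Longrightarrow> a \<in> T \<and> c \<in> T" "\<sigma> \<in> T \<Longrightarrow> f \<in> T \<Longrightarrow> a \<in> T \<and> c \<in> T"
    "a \<in> T \<Longrightarrow> e \<in> T \<Longrightarrow> d' \<in> T \<and> f \<in> T" "c \<in> T \<Longrightarrow> e \<in> T \<Longrightarrow> d' \<in> T \<and> f \<in> T"
    "\<sigma> \<in> T \<Longrightarrow> e \<in> T \<Longrightarrow> d' \<in> T \<and> f \<in> T"
proof -
  note B = hexagon_bruhat[OF d desc, folded a_def c_def d'_def e_def f_def]
  note conv = bruhat_interval_convex[OF T(1)]
  have dist: "a \<noteq> c" "d' \<noteq> f"
    using hexagon_distinct[OF d, of \<sigma>] unfolding a_def c_def d'_def e_def f_def by auto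
  show "a \<in> T \<Longrightarrow> c \<in> T \<Longrightarrow> \<sigma> \<in> T"
    using bruhat_interval_bounds(1)[OF T(1) _ _ dist(1)] T(2) B(9-13) by force
  show "d' \<in> T \<Longrightarrow> f \<in> T \<Longrightarrow> e \<in> T"
    using bruhat_interval_bounds(2)[OF T(1) _ _ dist(2)] T(2) B(9-13) by force
  show "\<sigma> \<in> T \<Longrightarrow> d' \<in> T \<Longrightarrow> a \<in> T \<and> c \<in> T" using conv[of \<sigma> d'] B by blast
  show "\<sigma> \<in> T \<Longrightarrow> f \<in> T \<Longrightarrow> a \<in> T \<and> c \<in> T" using conv[of \<sigma> f] B by blast
  show "a \<in> T \<Longrightarrow> e \<in> T \<Longrightarrow> d' \<in> T \<and> f \<in> T" using conv[of a e] B by blast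
  show "c \<in> T \<Longrightarrow> e \<in> T \<Longrightarrow> d' \<in> T \<and> f \<in> T" using conv[of c e] B by blast
  show "\<sigma> \<in> T \<Longrightarrow> e \<in> T \<Longrightarrow> d' \<in> T \<and> f \<in> T"
    using conv[of \<sigma> e] bruhat_le_trans[OF B(1,3)] bruhat_le_trans[OF B(1,4)] B by blast
qed

text \<open>The six numbers are the heights over a hexagon; \<open>A\<close> and \<open>B\<close> are the slopes of an added linear function along
  the two edges at the lowest vertex \<open>b\<close>. The case distinction is on which of the five balanced combinations
  \<open>(a + c + e) / 3\<close>, \<open>(b + d + f) / 3\<close>, \<open>(a + d) / 2\<close>, \<open>(b + e) / 2\<close>, \<open>(c + f) / 2\<close> of heights over the centre is least.\<close>

lemma hexagon_heights:
  fixes a b c d e f :: real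
  assumes rules: "\<And>A B m. m \<le> b \<Longrightarrow> m \<le> a + A \<Longrightarrow> m \<le> c + B \<Longrightarrow> m \<le> d + A + 2 * B \<Longrightarrow> m \<le> f + 2 * A + B \<Longrightarrow>
      m \<le> e + 2 * A + 2 * B \<Longrightarrow>
      (a + A = m \<and> c + B = m \<longrightarrow> b = m) \<and>
      (d + A + 2 * B = m \<and> f + 2 * A + B = m \<longrightarrow> e + 2 * A + 2 * B = m) \<and>
      (b = m \<and> d + A + 2 * B = m \<longrightarrow> a + A = m \<and> c + B = m) \<and>
      (b = m \<and> f + 2 * A + B = m \<longrightarrow> a + A = m \<and> c + B = m) \<and>
      (a + A = m \<and> e + 2 * A + 2 * B = m \<longrightarrow> d + A + 2 * B = m \<and> f + 2 * A + B = m) \<and>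
      (c + B = m \<and> e + 2 * A + 2 * B = m \<longrightarrow> d + A + 2 * B = m \<and> f + 2 * A + B = m) \<and>
      (b = m \<and> e + 2 * A + 2 * B = m \<longrightarrow> d + A + 2 * B = m \<and> f + 2 * A + B = m)"
  shows "a + c + e = b + d + f \<and> b + e = max (a + d) (c + f)"
proof -
  define P Q SA SB SC where "P = (a + c + e) / 3" and "Q = (b + d + f) / 3"
    and "SA = (a + d) / 2" and "SB = (b + e) / 2" and "SC = (c + f) / 2"
  note defs = P_def Q_def SA_def SB_def SC_def
  consider "P \<le> Q" "P \<le> SA" "P \<le> SB" "P \<le> SC" | "Q \<le> P" "Q \<le> SA" "Q \<le> SB" "Q \<le> SC"
    | "SA \<le> P" "SA \<le> Q" "SA \<le> SB" "SA \<le> SC" | "SB \<le> P" "SB \<le> Q" "SB \<le> SA" "SB \<le> SC"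
    | "SC \<le> P" "SC \<le> Q" "SC \<le> SA" "SC \<le> SB" by linarith
  then show ?thesis
  proof cases
    case 1
    \<comment> \<open>With the slopes \<open>m - a\<close> and \<open>m - c\<close> the heights at
      \<open>a\<close>, \<open>c\<close> and \<open>e\<close> all become \<open>m\<close>, the
      lowest over the hexagon; the rules bring the other three down to it.\<close>
    define m where "m = (2 * a + 2 * c - e) / 3"
    have "b = m \<and> d + (m - a) + 2 * (m - c) = m \<and> f + 2 * (m - a) + (m - c) = m"
      using rules[of m "m - a" "m - c"] 1 unfolding defs m_def by argo
    then show ?thesis unfolding m_def by argo
  next
    case 2
    \<comment> \<open>These slopes bring \<open>d\<close> and \<open>f\<close> to the height of
      \<open>b\<close>.\<close>
    define A B where "A = (b - 2 * f + d) / 3" and "B = (b - 2 * d + f) / 3"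
    have "a + A = b \<and> c + B = b \<and> e + 2 * A + 2 * B = b"
      using rules[of b A B] 2 unfolding defs A_def B_def by argo
    then show ?thesis unfolding A_def B_def by argo
  next
    case 3
    \<comment> \<open>This \<open>B\<close> levels the diagonal from \<open>a\<close> to
      \<open>d\<close>. Its height \<open>x = a + A\<close> remains free between \<open>n\<close>,
      where \<open>e\<close> or \<open>f\<close> meets it, and \<open>m\<close>, where
      \<open>b\<close> or \<open>c\<close> does; at each end the rules make both of them meet
      it.\<close>
    define B m n where "B = (a - d) / 2" and "m = min b (c + B)" and "n = max (2 * a - f - B) (2 * a - e - 2 * B)"
    have tight: "d + (x - a) + 2 * B = x" for x by (simp add: B_def field_simps)
    have "n \<le> m" using 3 unfolding defs B_def m_def n_def
      by (intro max.boundedI min.boundedI) (simp_all add: field_simps)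
    have ineqs: "x \<le> b" "x \<le> c + B" "x \<le> f + 2 * (x - a) + B" "x \<le> e + 2 * (x - a) + 2 * B" if "n \<le> x" "x \<le> m" for x
      using that unfolding m_def n_def by simp_all
    have edge: "a + (x - a) = x" for x by simp
    have rules': "x \<le> m \<Longrightarrow> n \<le> x \<Longrightarrow> (c + B = x \<longrightarrow> b = x) \<and> (b = x \<longrightarrow> c + B = x) \<and>
      (f + 2 * (x - a) + B = x \<longrightarrow> e + 2 * (x - a) + 2 * B = x) \<and>
      (e + 2 * (x - a) + 2 * B = x \<longrightarrow> f + 2 * (x - a) + B = x)" for x
      using rules[OF ineqs(1) eq_refl[OF edge[symmetric]] ineqs(2) eq_refl[OF tight[symmetric]] ineqs(3,4), of x]
        edge[of x] tight[of x] by blast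
    have "b = m \<or> c + B = m" by (simp add: m_def min_def)
    then have "b = m \<and> c + B = m" using rules'[of m] \<open>n \<le> m\<close> by blast
    moreover have "n = 2 * a - f - B \<or> n = 2 * a - e - 2 * B" by (simp add: n_def max_def)
    then have "f + 2 * (n - a) + B = n \<or> e + 2 * (n - a) + 2 * B = n" by argo
    then have "f + 2 * (n - a) + B = n \<and> e + 2 * (n - a) + 2 * B = n"
      using rules'[of n] \<open>n \<le> m\<close> by blast
    ultimately show ?thesis using 3 unfolding defs B_def by argo
  next
    case 4
    \<comment> \<open>Slopes with sum \<open>s\<close> level \<open>b\<close> and \<open>e\<close>,
      and \<open>A\<close> is the least one keeping \<open>a\<close> and \<open>f\<close> at or
      above them. By the rules \<open>b\<close> and \<open>e\<close> already force the other
      vertices, so one admissible tilt suffices.\<close>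
    define s A where "s = (b - e) / 2" and "A = max (b - a) (b - f - s)"
    have e: "e + 2 * A + 2 * (s - A) = b" by (simp add: s_def field_simps)
    have "b \<le> a + A" "b \<le> f + 2 * A + (s - A)" by (simp_all add: A_def)
    moreover have "b \<le> c + (s - A) \<and> b \<le> d + A + 2 * (s - A)"
    proof (cases "A = b - a")
      case True
      then show ?thesis using 4 unfolding defs s_def by (simp add: field_simps)
    next
      case False
      then have "A = b - f - s" by (simp add: A_def max_def split: if_splits)
      then show ?thesis using 4 unfolding defs s_def by (simp add: field_simps)
    qed
    ultimately have "a + A = b \<and> c + (s - A) = b \<and> d + A + 2 * (s - A) = b \<and> f + 2 * A + (s - A) = b"
      using rules[of b A "s - A"] e by simp
    then show ?thesis unfolding s_def by argo
  next
    case 5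
    \<comment> \<open>The mirror image of the diagonal from \<open>a\<close> to \<open>d\<close>:
      \<open>a\<close> is exchanged with \<open>c\<close>, \<open>d\<close> with \<open>f\<close>,
      and the slopes with each other.\<close>
    define A m n where "A = (c - f) / 2" and "m = min b (a + A)" and "n = max (2 * c - d - A) (2 * c - e - 2 * A)"
    have tight: "f + 2 * A + (x - c) = x" for x by (simp add: A_def field_simps)
    have "n \<le> m" using 5 unfolding defs A_def m_def n_def
      by (intro max.boundedI min.boundedI) (simp_all add: field_simps)
    have ineqs: "x \<le> b" "x \<le> a + A" "x \<le> d + A + 2 * (x - c)" "x \<le> e + 2 * A + 2 * (x - c)" if "n \<le> x" "x \<le> m" for x
      using that unfolding m_def n_def by simp_all
    have edge: "c + (x - c) = x" for x by simp
    have rules': "x \<le> m \<Longrightarrow> n \<le> x \<Longrightarrow> (a + A = x \<longrightarrow> b = x) \<and> (b = x \<longrightarrow> a + A = x) \<and>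
      (d + A + 2 * (x - c) = x \<longrightarrow> e + 2 * A + 2 * (x - c) = x) \<and>
      (e + 2 * A + 2 * (x - c) = x \<longrightarrow> d + A + 2 * (x - c) = x)" for x
      using rules[OF ineqs(1) ineqs(2) eq_refl[OF edge[symmetric]] ineqs(3) eq_refl[OF tight[symmetric]] ineqs(4), of x]
        edge[of x] tight[of x] by blast
    have "b = m \<or> a + A = m" by (simp add: m_def min_def)
    then have "b = m \<and> a + A = m" using rules'[of m] \<open>n \<le> m\<close> by blast
    moreover have "n = 2 * c - d - A \<or> n = 2 * c - e - 2 * A" by (simp add: n_def max_def)
    then have "d + A + 2 * (n - c) = n \<or> e + 2 * A + 2 * (n - c) = n" by argo
    then have "d + A + 2 * (n - c) = n \<and> e + 2 * A + 2 * (n - c) = n"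
      using rules'[of n] \<open>n \<le> m\<close> by blast
    ultimately show ?thesis using 5 unfolding defs A_def by argo
  qed
qed

text \<open>The first tilt levels \<open>a\<close>, \<open>c\<close>, \<open>d\<close> and is
  admissible if \<open>a + c \<le> b + d\<close>; the second levels \<open>a\<close>,
  \<open>b\<close>, \<open>d\<close> and is admissible if \<open>b + d \<le> a + c\<close>. Either
  way the fourth vertex is forced to the same height.\<close>

lemma square_heights:
  fixes a b c d :: real
  assumes rules: "\<And>A B m. m \<le> b \<Longrightarrow> m \<le> a + A \<Longrightarrow> m \<le> c + B \<Longrightarrow> m \<le> d + A + B \<Longrightarrow>
      (a + A = m \<and> c + B = m \<longrightarrow> b = m) \<and> (b = m \<and> d + A + B = m \<longrightarrow> a + A = m \<and> c + B = m)"
  shows "a + c = b + d"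
  using rules[of "a + c - d" "c - d" "a - d"] rules[of b "b - a" "a - d"] by argo

lemma ex_slopes:
  fixes \<sigma> :: "'n::{finite,linorder} perm"
  assumes "Suc d < CARD('n)" "Suc e < CARD('n)" "d \<noteq> e"
  shows "\<exists>c. c \<bullet> step_vec \<sigma> d = A \<and> c \<bullet> step_vec \<sigma> e = B"
  using assms
  by (intro exI[of _ "(- A) *\<^sub>R indicator_vec (lev \<sigma> (Suc d)) + (- B) *\<^sub>R indicator_vec (lev \<sigma> (Suc e))"])
    (simp add: inner_add_left inner_diff_left inner_indicator_step_vec)

lemma subdivision_face_interval:
  fixes u :: "'n::{finite,linorder} perm \<Rightarrow> real"
  assumes "\<And>c. bruhat_interval (argmins u c)" "face_cycle vs" "vs \<noteq> []"
  shows "bruhat_interval {\<sigma> \<in> set vs. \<forall>\<tau>\<in>set vs. u \<sigma> + c \<bullet> perm_point \<sigma> \<le> u \<tau> + c \<bullet> perm_point \<tau>}"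
proof -
  obtain F where "F face_of permutahedron" "{x. x extreme_point_of F} = perm_point ` set vs"
    using assms(2) unfolding face_cycle_def by blast
  then obtain a where "set vs = maximizers a" using face_vertices_maximizers[of F "set vs"] assms(3) by auto
  then show ?thesis using bruhat_interval_maximizers[OF assms(1)] by simp
qed

lemma subdivision_hexagon:
  fixes u :: "'n::{finite,linorder} perm \<Rightarrow> real" and \<sigma> :: "'n perm"
  assumes u: "\<And>c. bruhat_interval (argmins u c)" and d: "Suc (Suc d) < CARD('n)"
    and desc: "pos \<sigma> (Suc d) < pos \<sigma> d" "pos \<sigma> (Suc (Suc d)) < pos \<sigma> (Suc d)"
  shows "u (adj d * \<sigma>) + u (adj (Suc d) * \<sigma>) + u (adj d * (adj (Suc d) * (adj d * \<sigma>)))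
      = u \<sigma> + u (adj d * (adj (Suc d) * \<sigma>)) + u (adj (Suc d) * (adj d * \<sigma>)) \<and>
    u \<sigma> + u (adj d * (adj (Suc d) * (adj d * \<sigma>)))
      = max (u (adj d * \<sigma>) + u (adj d * (adj (Suc d) * \<sigma>))) (u (adj (Suc d) * \<sigma>) + u (adj (Suc d) * (adj d * \<sigma>)))"
proof (rule hexagon_heights)
  fix A B m
  let ?a = "adj d * \<sigma>" and ?c = "adj (Suc d) * \<sigma>" and ?d = "adj d * (adj (Suc d) * \<sigma>)"
    and ?e = "adj d * (adj (Suc d) * (adj d * \<sigma>))" and ?f = "adj (Suc d) * (adj d * \<sigma>)"
  let ?V = "{?a, \<sigma>, ?c, ?d, ?e, ?f}"
  assume ge: "m \<le> u \<sigma>" "m \<le> u ?a + A" "m \<le> u ?c + B" "m \<le> u ?d + A + 2 * B" "m \<le> u ?f + 2 * A + B"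
    "m \<le> u ?e + 2 * A + 2 * B"
  obtain c where c: "c \<bullet> step_vec \<sigma> d = A" "c \<bullet> step_vec \<sigma> (Suc d) = B" using ex_slopes[of d "Suc d" \<sigma> A B] d by auto
  define g where "g = (\<lambda>\<tau>. u \<tau> + c \<bullet> perm_point \<tau> - c \<bullet> perm_point \<sigma>)"
  have g: "g \<sigma> = u \<sigma>" "g ?a = u ?a + A" "g ?c = u ?c + B" "g ?d = u ?d + A + 2 * B" "g ?f = u ?f + 2 * A + B"
    "g ?e = u ?e + 2 * A + 2 * B"
    by (simp_all add: g_def perm_point_hexagon[OF d, of \<sigma>] inner_add_right c)
  define T where "T = {x \<in> ?V. \<forall>y\<in>?V. g x \<le> g y}"
  have T: "bruhat_interval T" "T \<subseteq> ?V"
    using subdivision_face_interval[OF u hexagonI[OF d, of \<sigma>, unfolded hexagon_def], of c]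
    by (simp_all add: T_def g_def) auto
  have mV: "m \<le> g x" if "x \<in> ?V" for x using that ge g by auto
  have inT: "x \<in> T" if "x \<in> ?V" "g x = m" for x using that mV by (auto simp: T_def)
  have Tm: "g y = m" if "x \<in> ?V" "g x = m" "y \<in> T" for x y using that mV[of y] by (auto simp: T_def intro: order_antisym)
  note R = hexagon_interval_rules[OF d desc T]
  have V: "?a \<in> ?V" "\<sigma> \<in> ?V" "?c \<in> ?V" "?d \<in> ?V" "?e \<in> ?V" "?f \<in> ?V" by auto
  show "(u ?a + A = m \<and> u ?c + B = m \<longrightarrow> u \<sigma> = m) \<and>
      (u ?d + A + 2 * B = m \<and> u ?f + 2 * A + B = m \<longrightarrow> u ?e + 2 * A + 2 * B = m) \<and>
      (u \<sigma> = m \<and> u ?d + A + 2 * B = m \<longrightarrow> u ?a + A = m \<and> u ?c + B = m) \<and>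
      (u \<sigma> = m \<and> u ?f + 2 * A + B = m \<longrightarrow> u ?a + A = m \<and> u ?c + B = m) \<and>
      (u ?a + A = m \<and> u ?e + 2 * A + 2 * B = m \<longrightarrow> u ?d + A + 2 * B = m \<and> u ?f + 2 * A + B = m) \<and>
      (u ?c + B = m \<and> u ?e + 2 * A + 2 * B = m \<longrightarrow> u ?d + A + 2 * B = m \<and> u ?f + 2 * A + B = m) \<and>
      (u \<sigma> = m \<and> u ?e + 2 * A + 2 * B = m \<longrightarrow> u ?d + A + 2 * B = m \<and> u ?f + 2 * A + B = m)"
  proof (cases "\<exists>x\<in>?V. g x = m")
    case True
    then obtain x where x: "x \<in> ?V" "g x = m" by blast
    have iff: "g y = m \<longleftrightarrow> y \<in> T" if "y \<in> ?V" for y using inT[OF that] Tm[OF x] by blast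
    show ?thesis unfolding g[symmetric] iff[OF V(1)] iff[OF V(2)] iff[OF V(3)] iff[OF V(4)] iff[OF V(5)] iff[OF V(6)] using R by blast
  next
    case False
    then have no: "g y \<noteq> m" if "y \<in> ?V" for y using that by blast
    show ?thesis unfolding g[symmetric] using no[OF V(1)] no[OF V(2)] no[OF V(3)] no[OF V(4)] no[OF V(5)] no[OF V(6)] by blast
  qed
qed

lemma subdivision_square:
  fixes u :: "'n::{finite,linorder} perm \<Rightarrow> real" and \<sigma> :: "'n perm"
  assumes u: "\<And>c. bruhat_interval (argmins u c)" and de: "Suc d < e" "Suc e < CARD('n)"
    and desc: "pos \<sigma> (Suc d) < pos \<sigma> d" "pos \<sigma> (Suc e) < pos \<sigma> e"
  shows "u (adj d * \<sigma>) + u (adj e * \<sigma>) = u \<sigma> + u (adj d * (adj e * \<sigma>))"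
proof (rule square_heights)
  fix A B m
  have d: "Suc d < CARD('n)" using de by simp
  let ?a = "adj d * \<sigma>" and ?c = "adj e * \<sigma>" and ?d = "adj d * (adj e * \<sigma>)"
  let ?V = "{?a, \<sigma>, ?c, ?d}"
  assume ge: "m \<le> u \<sigma>" "m \<le> u ?a + A" "m \<le> u ?c + B" "m \<le> u ?d + A + B"
  obtain c where c: "c \<bullet> step_vec \<sigma> d = A" "c \<bullet> step_vec \<sigma> e = B" using ex_slopes[of d e \<sigma> A B] de by auto
  define g where "g = (\<lambda>\<tau>. u \<tau> + c \<bullet> perm_point \<tau> - c \<bullet> perm_point \<sigma>)"
  have g: "g \<sigma> = u \<sigma>" "g ?a = u ?a + A" "g ?c = u ?c + B" "g ?d = u ?d + A + B"
    by (simp_all add: g_def perm_point_square[OF de, of \<sigma>] inner_add_right c)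
  define T where "T = {x \<in> ?V. \<forall>y\<in>?V. g x \<le> g y}"
  have T: "bruhat_interval T" "T \<subseteq> ?V"
    using subdivision_face_interval[OF u squareI[OF de, of \<sigma>, unfolded square_def], of c]
    by (simp_all add: T_def g_def) auto
  have mV: "m \<le> g x" if "x \<in> ?V" for x using that ge g by auto
  have inT: "x \<in> T" if "x \<in> ?V" "g x = m" for x using that mV by (auto simp: T_def)
  have Tm: "g y = m" if "x \<in> ?V" "g x = m" "y \<in> T" for x y using that mV[of y] by (auto simp: T_def intro: order_antisym)
  have ac: "bruhat_le \<sigma> ?a" "bruhat_le \<sigma> ?c" by (rule bruhat_le_adj; fact)+
  have pc: "pos ?c (Suc d) < pos ?c d" "pos ?a (Suc e) < pos ?a e" using desc de d by (simp_all add: pos_adj_simps)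
  have cd: "bruhat_le ?c ?d" "bruhat_le ?a ?d"
    using bruhat_le_adj[OF d pc(1)] bruhat_le_adj[OF de(2) pc(2)] by (simp_all add: adj_commute[OF de])
  have card: "card (inversions ?a) = Suc (card (inversions \<sigma>))" "card (inversions ?c) = Suc (card (inversions \<sigma>))"
    "card (inversions ?d) = Suc (card (inversions ?c))"
    using card_inversions_adj[OF d desc(1)] card_inversions_adj[OF de(2) desc(2)] card_inversions_adj[OF d pc(1)] by simp_all
  have "?a \<noteq> ?c" using square_distinct[OF de, of \<sigma>] by auto
  then have low: "?a \<in> T \<Longrightarrow> ?c \<in> T \<Longrightarrow> \<sigma> \<in> T"
    using bruhat_interval_bounds(1)[OF T(1), of ?a ?c] T(2) card by force
  have mid: "\<sigma> \<in> T \<Longrightarrow> ?d \<in> T \<Longrightarrow> ?a \<in> T \<and> ?c \<in> T"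
    using bruhat_interval_convex[OF T(1), of \<sigma> ?d] ac cd by blast
  have V: "?a \<in> ?V" "\<sigma> \<in> ?V" "?c \<in> ?V" "?d \<in> ?V" by auto
  show "(u ?a + A = m \<and> u ?c + B = m \<longrightarrow> u \<sigma> = m) \<and>
      (u \<sigma> = m \<and> u ?d + A + B = m \<longrightarrow> u ?a + A = m \<and> u ?c + B = m)"
  proof (cases "\<exists>x\<in>?V. g x = m")
    case True
    then obtain x where x: "x \<in> ?V" "g x = m" by blast
    have iff: "g y = m \<longleftrightarrow> y \<in> T" if "y \<in> ?V" for y using inT[OF that] Tm[OF x] by blast
    show ?thesis unfolding g[symmetric] iff[OF V(1)] iff[OF V(2)] iff[OF V(3)] iff[OF V(4)] using low mid by blast
  next
    case False
    then have no: "g y \<noteq> m" if "y \<in> ?V" for y using that by blast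
    show ?thesis unfolding g[symmetric] using no[OF V(1)] no[OF V(2)] no[OF V(3)] no[OF V(4)] by blast
  qed
qed

lemma subdivision_local_conditions:
  fixes u :: "'n::{finite,linorder} perm \<Rightarrow> real"
  assumes u: "\<And>c. bruhat_interval (argmins u c)"
  shows "hexagons_balanced u \<and> squares_balanced u \<and> hexagons_max u"
proof (intro conjI)
  show "hexagons_max u"
    unfolding hexagons_max_def using subdivision_hexagon[OF u] by blast
  \<comment> \<open>The balancing equation is the same from whichever vertex the hexagon is
    described, so descent in length moves \<sigma> to its lowest vertex. The squares below are
    treated alike.\<close>
  have "u (adj d * \<sigma>) + u (adj (Suc d) * \<sigma>) + u (adj d * (adj (Suc d) * (adj d * \<sigma>)))
     = u \<sigma> + u (adj d * (adj (Suc d) * \<sigma>)) + u (adj (Suc d) * (adj d * \<sigma>))" if d: "Suc (Suc d) < CARD('n)" for \<sigma> d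
  proof (induction "card (inversions \<sigma>)" arbitrary: \<sigma> rule: less_induct)
    case less
    have d1: "Suc d < CARD('n)" using d by simp
    consider "pos \<sigma> d < pos \<sigma> (Suc d)" | "pos \<sigma> (Suc d) < pos \<sigma> (Suc (Suc d))"
      | "pos \<sigma> (Suc d) < pos \<sigma> d" "pos \<sigma> (Suc (Suc d)) < pos \<sigma> (Suc d)"
      using pos_Suc_cases[OF d1, of \<sigma>] pos_Suc_cases[OF d, of \<sigma>] by blast
    then show ?case
    proof cases
      case 1
      then show ?thesis using less[of "adj d * \<sigma>"] card_inversions_adj'[OF d1, of \<sigma>] d1 by simp
    next
      case 2
      have "adj d * (adj (Suc d) * (adj d * (adj (Suc d) * \<sigma>))) = adj (Suc d) * (adj d * \<sigma>)"
        using adj_braid[OF d, of "adj (Suc d) * \<sigma>"] d by simp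
      then show ?thesis
        using 2 less[of "adj (Suc d) * \<sigma>"] card_inversions_adj'[OF d, of \<sigma>] d adj_braid[OF d, of \<sigma>] by simp
    next
      case 3
      then show ?thesis using subdivision_hexagon[OF u d] by blast
    qed
  qed
  then show "hexagons_balanced u" unfolding hexagons_balanced_def by blast
  have "u (adj d * \<sigma>) + u (adj e * \<sigma>) = u \<sigma> + u (adj d * (adj e * \<sigma>))" if de: "Suc d < e" "Suc e < CARD('n)" for \<sigma> d e
  proof (induction "card (inversions \<sigma>)" arbitrary: \<sigma> rule: less_induct)
    case less
    have d: "Suc d < CARD('n)" using de by simp
    consider "pos \<sigma> d < pos \<sigma> (Suc d)" | "pos \<sigma> e < pos \<sigma> (Suc e)"
      | "pos \<sigma> (Suc d) < pos \<sigma> d" "pos \<sigma> (Suc e) < pos \<sigma> e"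
      using pos_Suc_cases[OF d, of \<sigma>] pos_Suc_cases[OF de(2), of \<sigma>] by blast
    then show ?case
    proof cases
      case 1
      have "adj d * (adj e * (adj d * \<sigma>)) = adj e * \<sigma>" using adj_commute[OF de, of "adj d * \<sigma>"] adj_commute[OF de, of \<sigma>] d by simp
      then show ?thesis using 1 less[of "adj d * \<sigma>"] card_inversions_adj'[OF d, of \<sigma>] d adj_commute[OF de, of \<sigma>] by simp
    next
      case 2
      then show ?thesis using less[of "adj e * \<sigma>"] card_inversions_adj'[OF de(2), of \<sigma>] de by simp
    next
      case 3
      then show ?thesis using subdivision_square[OF u de] by blast
    qed
  qed
  then show "squares_balanced u" unfolding squares_balanced_def by blast
qed

theorem theorem20:
  fixes u :: "'n::{finite,linorder} perm \<Rightarrow> real"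
  shows "((\<exists>w. full_valuated_flag_matroid w \<and> realized_by_totally_positive_flag w \<and>
              (\<forall>\<sigma>. u \<sigma> = compression w (perm_point \<sigma>)))
          \<longleftrightarrow> (\<forall>P\<in>regular_subdivision u. bruhat_interval_polytope P))
       \<and> ((\<forall>P\<in>regular_subdivision u. bruhat_interval_polytope P)
          \<longleftrightarrow> HXE u \<and> SQR u \<and> HXM_plus u)"
proof -
  have "(\<exists>w. tropical_positive w \<and> (\<forall>\<sigma>. u \<sigma> = flag_sum w \<sigma>)) \<longleftrightarrow> (\<forall>c. bruhat_interval (argmins u c))"
    using tropical_positive_subdivision subdivision_local_conditions[of u] local_conditions_iff[of u] by blast
  then show ?thesis
    unfolding realizable_iff bruhat_subdivision_iff HXE_iff SQR_iff HXM_plus_iff local_conditions_iff by simp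
qed

end
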